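(* Let $(R,\mathfrak m)$ be a one-dimensional Noetherian Cohen-Macaulay local ring with $R/\mathfrak m$ infinite, having a canonical module $\omega_R$ that is a fractional ideal with $R\subseteq\omega_R\subseteq\overline R$. Let $I$ be an $\mathfrak m$-primary (proper) ideal of $R$, let $zR$ (with $z\in Q(R)$) be a minimal reduction of $(\omega_R:I)$, and let $a,b\in R$. Set $$K=\left\{\frac{x}{z}+\frac{y}{z}t \ \Big|\ x\in(\omega_R:I),\ y\in\omega_R\right\},$$ with $R(I)_{a,b}$-module structure given, for $r+it\in R(I)_{a,b}$, by $$(r+it)\left(\frac{x}{z}+\frac{y}{z}t\right)=\frac{rx}{z}-\frac{biy}{z}+\left(\frac{ry}{z}+\frac{ix}{z}-\frac{aiy}{z}\right)t .$$ Then the $R(I)_{a,b}$-module $K$ is a canonical ideal of $R(I)_{a,b}$ such that $R(I)_{a,b}\subseteq K\subseteq\overline{R(I)_{a,b}}$.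
   Context: All rings are commutative with unity. For a Noetherian ring $R$, a nonzero proper ideal $I$ and $a,b\in R$, the Rees algebra is the subring $\bigoplus_{n\ge 0} I^n t^n$ of $R[t]$, and $R(I)_{a,b}$ denotes the quotient of $\bigoplus_{n\ge 0} I^n t^n$ by the ideal $\big((t^2+at+b)R[t]\big)\cap \bigoplus_{n\ge 0} I^n t^n$. As an $R$-module $R(I)_{a,b}\cong R\oplus I$; its elements are written uniquely as $r+it$ with $r\in R$, $i\in I$, with product $(r+it)(s+jt)=rs-bij+(rj+is-aij)t$. $Q(R)$ is the total ring of fractions of $R$, $\overline R$ the integral closure of $R$ in $Q(R)$, and $(A:B)=\{q\in Q(R)\mid qB\subseteq A\}$. Since $I$ is regular, the total ring of fractions of $R(I)_{a,b}$ is that of $R[t]/(t^2+at+b)$, each of its elements having the form $\frac{r+it}{u}$ with $r\in R$, $i\in I$ and $u\in R$ regular; $K$ is regarded as a subset of it, and $\overline{R(I)_{a,b}}$ is the integral closure of $R(I)_{a,b}$ in it. If $H$ is a fractional ideal and $y\in R$ is regular with $yH\subseteq R$, then for a minimal reduction $xR$ of the ideal $yH$ one calls $xy^{-1}R$ a minimal reduction of $H$; the element $z$ is then invertible in $Q(R)$. "Canonical ideal" here means a fractional ideal of $R(I)_{a,b}$ that is isomorphic, as an $R(I)_{a,b}$-module, to the canonical module of $R(I)_{a,b}$. *)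

theory Defs
  imports
    "HOL-Algebra.Algebra"
    "HOL-Algebra.UnivPoly"
    "HOL-Library.Extended_Nat"
begin

section \<open>Modules\<close>

text \<open>The ring \<open>T\<close> as a module over the source of a ring homomorphism \<open>\<iota>\<close> into \<open>T\<close>.
  In particular \<open>scalar_module id R\<close> is \<open>R\<close> as a module over itself.\<close>

definition scalar_module :: "('s \<Rightarrow> 't) \<Rightarrow> ('t, 'n) ring_scheme \<Rightarrow> ('s, 't) module" where
  "scalar_module \<iota> T =
     \<lparr>carrier = carrier T, monoid.mult = monoid.mult T, monoid.one = monoid.one T, ring.zero = ring.zero T,
      ring.add = ring.add T,
      module.smult = (\<lambda>s x. \<iota> s \<otimes>\<^bsub>T\<^esub> x)\<rparr>"

definition mod_hom ::
    "('r, 'k) ring_scheme \<Rightarrow> ('r, 'a, 'm) module_scheme \<Rightarrow> ('r, 'b, 'n) module_scheme \<Rightarrow> ('a \<Rightarrow> 'b) set"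
  where
  "mod_hom R M N =
     {f \<in> carrier M \<rightarrow>\<^sub>E carrier N.
        (\<forall>x\<in>carrier M. \<forall>y\<in>carrier M. f (x \<oplus>\<^bsub>M\<^esub> y) = f x \<oplus>\<^bsub>N\<^esub> f y) \<and>
        (\<forall>r\<in>carrier R. \<forall>x\<in>carrier M. f (r \<odot>\<^bsub>M\<^esub> x) = r \<odot>\<^bsub>N\<^esub> f x)}"

definition mod_iso ::
    "('r, 'k) ring_scheme \<Rightarrow> ('r, 'a, 'm) module_scheme \<Rightarrow> ('r, 'b, 'n) module_scheme \<Rightarrow> bool" where
  "mod_iso R M N \<longleftrightarrow> (\<exists>f\<in>mod_hom R M N. bij_betw f (carrier M) (carrier N))"

text \<open>The records \<^typ>\<open>('r, 'a) module\<close> extend rings, so every module below needs some value for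
  the two ring fields \<open>mult\<close> and \<open>one\<close>; they play no role in the module structure.\<close>

definition hom_module ::
    "('r, 'k) ring_scheme \<Rightarrow> ('r, 'a, 'm) module_scheme \<Rightarrow> ('r, 'b, 'n) module_scheme
      \<Rightarrow> ('r, 'a \<Rightarrow> 'b) module" where
  "hom_module R M N =
     \<lparr>carrier = mod_hom R M N, monoid.mult = undefined, monoid.one = undefined,
      ring.zero = (\<lambda>x\<in>carrier M. \<zero>\<^bsub>N\<^esub>),
      ring.add = (\<lambda>f g. \<lambda>x\<in>carrier M. f x \<oplus>\<^bsub>N\<^esub> g x),
      module.smult = (\<lambda>r f. \<lambda>x\<in>carrier M. r \<odot>\<^bsub>N\<^esub> f x)\<rparr>"

definition quot_module :: "('r, 'a, 'm) module_scheme \<Rightarrow> 'a set \<Rightarrow> ('r, 'a set) module" where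
  "quot_module M N =
     \<lparr>carrier = a_rcosets\<^bsub>M\<^esub> N, monoid.mult = undefined, monoid.one = undefined,
      ring.zero = N, add = set_add M,
      module.smult = (\<lambda>r A. \<Union>x\<in>A. N +>\<^bsub>M\<^esub> (r \<odot>\<^bsub>M\<^esub> x))\<rparr>"

definition free_module :: "('r, 'k) ring_scheme \<Rightarrow> nat \<Rightarrow> ('r, nat \<Rightarrow> 'r) module" where
  "free_module R n =
     \<lparr>carrier = {..<n} \<rightarrow>\<^sub>E carrier R, monoid.mult = undefined, monoid.one = undefined,
      ring.zero = (\<lambda>j\<in>{..<n}. \<zero>\<^bsub>R\<^esub>),
      ring.add = (\<lambda>v w. \<lambda>j\<in>{..<n}. v j \<oplus>\<^bsub>R\<^esub> w j),
      module.smult = (\<lambda>r v. \<lambda>j\<in>{..<n}. r \<otimes>\<^bsub>R\<^esub> v j)\<rparr>"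

definition fin_gen_module :: "('r, 'k) ring_scheme \<Rightarrow> ('r, 'a, 'm) module_scheme \<Rightarrow> bool" where
  "fin_gen_module R M \<longleftrightarrow>
     (\<exists>n. \<exists>f\<in>mod_hom R (free_module R n) M. f ` carrier (free_module R n) = carrier M)"


section \<open>Ext\<close>

text \<open>An exact sequence \<open>\<dots> \<rightarrow> R\<^sup>n\<^sup>(\<^sup>1\<^sup>) \<rightarrow> R\<^sup>n\<^sup>(\<^sup>0\<^sup>) \<rightarrow> M \<rightarrow> 0\<close>, where
  \<open>d i\<close> maps \<open>R\<^sup>n\<^sup>(\<^sup>i\<^sup>+\<^sup>1\<^sup>)\<close> to \<open>R\<^sup>n\<^sup>(\<^sup>i\<^sup>)\<close> and \<open>\<epsilon>\<close> is the augmentation.\<close>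

definition free_resolution ::
    "('r, 'k) ring_scheme \<Rightarrow> ('r, 'a, 'm) module_scheme \<Rightarrow> (nat \<Rightarrow> nat)
      \<Rightarrow> (nat \<Rightarrow> (nat \<Rightarrow> 'r) \<Rightarrow> (nat \<Rightarrow> 'r)) \<Rightarrow> ((nat \<Rightarrow> 'r) \<Rightarrow> 'a) \<Rightarrow> bool" where
  "free_resolution R M n d \<epsilon> \<longleftrightarrow>
     \<epsilon> \<in> mod_hom R (free_module R (n 0)) M \<and>
     \<epsilon> ` carrier (free_module R (n 0)) = carrier M \<and>
     (\<forall>i. d i \<in> mod_hom R (free_module R (n (Suc i))) (free_module R (n i))) \<and>
     d 0 ` carrier (free_module R (n 1)) =
       {v \<in> carrier (free_module R (n 0)). \<epsilon> v = \<zero>\<^bsub>M\<^esub>} \<and>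
     (\<forall>i. d (Suc i) ` carrier (free_module R (n (Suc (Suc i)))) =
       {v \<in> carrier (free_module R (n (Suc i))). d i v = \<zero>\<^bsub>free_module R (n i)\<^esub>})"

definition ext_cocycles ::
    "('r, 'k) ring_scheme \<Rightarrow> (nat \<Rightarrow> nat) \<Rightarrow> (nat \<Rightarrow> (nat \<Rightarrow> 'r) \<Rightarrow> (nat \<Rightarrow> 'r))
      \<Rightarrow> ('r, 'c, 'm) module_scheme \<Rightarrow> nat \<Rightarrow> ((nat \<Rightarrow> 'r) \<Rightarrow> 'c) set" where
  "ext_cocycles R n d C i =
     {\<phi> \<in> mod_hom R (free_module R (n i)) C.
        \<forall>v\<in>carrier (free_module R (n (Suc i))). \<phi> (d i v) = \<zero>\<^bsub>C\<^esub>}"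

fun ext_coboundaries ::
    "('r, 'k) ring_scheme \<Rightarrow> (nat \<Rightarrow> nat) \<Rightarrow> (nat \<Rightarrow> (nat \<Rightarrow> 'r) \<Rightarrow> (nat \<Rightarrow> 'r))
      \<Rightarrow> ('r, 'c, 'm) module_scheme \<Rightarrow> nat \<Rightarrow> ((nat \<Rightarrow> 'r) \<Rightarrow> 'c) set" where
  "ext_coboundaries R n d C 0 = {\<lambda>v\<in>carrier (free_module R (n 0)). \<zero>\<^bsub>C\<^esub>}"
| "ext_coboundaries R n d C (Suc i) =
     (\<lambda>\<psi>. \<lambda>v\<in>carrier (free_module R (n (Suc i))). \<psi> (d i v)) ` mod_hom R (free_module R (n i)) C"

text \<open>The cohomology in degree \<open>i\<close> of the complex \<open>Hom\<^sub>R(R\<^sup>n\<^sup>(\<^sup>*\<^sup>), C)\<close>. If \<open>(n, d, \<epsilon>)\<close> is a free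
  resolution of \<open>M\<close>, this is \<open>Ext\<close> of \<open>(M, C)\<close> over \<open>R\<close> in degree \<open>i\<close>.\<close>

definition ext_module ::
    "('r, 'k) ring_scheme \<Rightarrow> (nat \<Rightarrow> nat) \<Rightarrow> (nat \<Rightarrow> (nat \<Rightarrow> 'r) \<Rightarrow> (nat \<Rightarrow> 'r))
      \<Rightarrow> ('r, 'c, 'm) module_scheme \<Rightarrow> nat \<Rightarrow> ('r, ((nat \<Rightarrow> 'r) \<Rightarrow> 'c) set) module" where
  "ext_module R n d C i =
     quot_module ((hom_module R (free_module R (n i)) C)\<lparr>carrier := ext_cocycles R n d C i\<rparr>)
       (ext_coboundaries R n d C i)"


section \<open>Cohen-Macaulay local rings and canonical modules\<close>

definition local_ring :: "('r, 'k) ring_scheme \<Rightarrow> 'r set \<Rightarrow> bool" where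
  "local_ring R \<mm> \<longleftrightarrow>
     cring R \<and> maximalideal \<mm> R \<and> (\<forall>J. maximalideal J R \<longrightarrow> J = \<mm>)"

definition krull_dim :: "('r, 'k) ring_scheme \<Rightarrow> enat" where
  "krull_dim R =
     (SUP n\<in>{n. \<exists>p. (\<forall>i\<le>n. primeideal (p i) R) \<and> (\<forall>i<n. p i \<subset> p (Suc i))}. enat n)"

text \<open>For sequences in the maximal ideal of a local ring the condition \<open>(xs) \<noteq> R\<close> is automatic.\<close>

definition regular_seq :: "('r, 'k) ring_scheme \<Rightarrow> 'r list \<Rightarrow> bool" where
  "regular_seq R xs \<longleftrightarrow>
     (\<forall>i<length xs. \<forall>y\<in>carrier R.
        xs ! i \<otimes>\<^bsub>R\<^esub> y \<in> Idl\<^bsub>R\<^esub> (set (take i xs)) \<longrightarrow> y \<in> Idl\<^bsub>R\<^esub> (set (take i xs)))"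

definition depth :: "('r, 'k) ring_scheme \<Rightarrow> 'r set \<Rightarrow> enat" where
  "depth R \<mm> = (SUP xs\<in>{xs. set xs \<subseteq> \<mm> \<and> regular_seq R xs}. enat (length xs))"

definition cm_local_ring :: "('r, 'k) ring_scheme \<Rightarrow> 'r set \<Rightarrow> bool" where
  "cm_local_ring R \<mm> \<longleftrightarrow>
     noetherian_ring R \<and> local_ring R \<mm> \<and> depth R \<mm> = krull_dim R"

text \<open>A canonical module of a Cohen-Macaulay local ring \<open>(R, \<mm>, k)\<close> of dimension \<open>e\<close> is a finitely
  generated module \<open>C\<close> such that the \<open>k\<close>-dimension of \<open>Ext\<close> of \<open>(k, C)\<close> in degree \<open>i\<close> is \<open>1\<close> for
  \<open>i = e\<close> and \<open>0\<close> otherwise, that is, a maximal Cohen-Macaulay module of type \<open>1\<close> and of finite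
  injective dimension (Bruns and Herzog, Section 3.3). The quantifier over resolutions of \<open>k\<close> is
  harmless: they exist because \<open>R\<close> is Noetherian, and \<open>Ext\<close> does not depend on the choice.\<close>

definition canonical_module ::
    "('r, 'k) ring_scheme \<Rightarrow> ('r, 'c, 'm) module_scheme \<Rightarrow> bool" where
  "canonical_module R C \<longleftrightarrow>
     (\<exists>\<mm>. cm_local_ring R \<mm> \<and> module R C \<and> fin_gen_module R C \<and>
        (\<forall>n d \<epsilon>. free_resolution R (quot_module (scalar_module id R) \<mm>) n d \<epsilon> \<longrightarrow>
          (\<forall>i. if enat i = krull_dim R
               then mod_iso R (ext_module R n d C i) (quot_module (scalar_module id R) \<mm>)
               else carrier (ext_module R n d C i) = {\<zero>\<^bsub>ext_module R n d C i\<^esub>})))"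


section \<open>Fractional ideals\<close>

definition regular_elt :: "('r, 'k) ring_scheme \<Rightarrow> 'r \<Rightarrow> bool" where
  "regular_elt R u \<longleftrightarrow> u \<in> carrier R \<and> (\<forall>x\<in>carrier R. u \<otimes>\<^bsub>R\<^esub> x = \<zero>\<^bsub>R\<^esub> \<longrightarrow> x = \<zero>\<^bsub>R\<^esub>)"

text \<open>\<open>T\<close> is the total ring of fractions of \<open>A\<close>, by means of the embedding \<open>\<iota>\<close>. With \<open>\<iota> = id\<close>,
  \<open>A\<close> is a subring of \<open>T\<close>.\<close>

definition total_fraction_ring ::
    "('r, 'k) ring_scheme \<Rightarrow> ('t, 'n) ring_scheme \<Rightarrow> ('r \<Rightarrow> 't) \<Rightarrow> bool" where
  "total_fraction_ring A T \<iota> \<longleftrightarrow>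
     cring A \<and> cring T \<and> \<iota> \<in> ring_hom A T \<and> inj_on \<iota> (carrier A) \<and>
     (\<forall>u. regular_elt A u \<longrightarrow> \<iota> u \<in> Units T) \<and>
     (\<forall>q\<in>carrier T. \<exists>r\<in>carrier A. \<exists>u. regular_elt A u \<and> q = \<iota> r \<otimes>\<^bsub>T\<^esub> inv\<^bsub>T\<^esub> (\<iota> u))"

definition fractional_ideal ::
    "('r, 'k) ring_scheme \<Rightarrow> ('t, 'n) ring_scheme \<Rightarrow> ('r \<Rightarrow> 't) \<Rightarrow> 't set \<Rightarrow> bool" where
  "fractional_ideal A T \<iota> H \<longleftrightarrow>
     submodule H A (scalar_module \<iota> T) \<and>
     (\<exists>y. regular_elt A y \<and> (\<forall>h\<in>H. \<iota> y \<otimes>\<^bsub>T\<^esub> h \<in> \<iota> ` carrier A))"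

definition canonical_ideal ::
    "('r, 'k) ring_scheme \<Rightarrow> ('t, 'n) ring_scheme \<Rightarrow> ('r \<Rightarrow> 't) \<Rightarrow> 't set \<Rightarrow> bool" where
  "canonical_ideal A T \<iota> H \<longleftrightarrow>
     fractional_ideal A T \<iota> H \<and> canonical_module A ((scalar_module \<iota> T)\<lparr>carrier := H\<rparr>)"

definition colon :: "('t, 'n) ring_scheme \<Rightarrow> 't set \<Rightarrow> 't set \<Rightarrow> 't set" where
  "colon T A B = {q \<in> carrier T. \<forall>b\<in>B. q \<otimes>\<^bsub>T\<^esub> b \<in> A}"

definition integral_closure :: "('t, 'n) ring_scheme \<Rightarrow> 't set \<Rightarrow> 't set" where
  "integral_closure T A =
     {w \<in> carrier T. \<exists>n. \<exists>c\<in>{..<n} \<rightarrow> A.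
        w [^]\<^bsub>T\<^esub> (n::nat) \<oplus>\<^bsub>T\<^esub> (\<Oplus>\<^bsub>T\<^esub>k\<in>{..<n}. c k \<otimes>\<^bsub>T\<^esub> w [^]\<^bsub>T\<^esub> k) = \<zero>\<^bsub>T\<^esub>}"

definition reduction :: "('r, 'k) ring_scheme \<Rightarrow> 'r set \<Rightarrow> 'r set \<Rightarrow> bool" where
  "reduction R J H \<longleftrightarrow>
     ideal J R \<and> ideal H R \<and> J \<subseteq> H \<and>
     (\<exists>n::nat. J \<cdot>\<^bsub>R\<^esub> (H [^]\<^bsub>ideals_set R\<^esub> n) = H [^]\<^bsub>ideals_set R\<^esub> Suc n)"

definition minimal_reduction :: "('r, 'k) ring_scheme \<Rightarrow> 'r set \<Rightarrow> 'r set \<Rightarrow> bool" where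
  "minimal_reduction R J H \<longleftrightarrow>
     reduction R J H \<and> (\<forall>J'. reduction R J' H \<and> J' \<subseteq> J \<longrightarrow> J' = J)"

text \<open>\<open>zR\<close> is a minimal reduction of the fractional ideal \<open>H\<close> of \<open>R \<subseteq> Q\<close>: it equals \<open>xy\<^sup>-\<^sup>1R\<close>
  for a regular \<open>y \<in> R\<close> with \<open>yH \<subseteq> R\<close> and a minimal reduction \<open>xR\<close> of the ideal \<open>yH\<close>.\<close>

definition frac_minimal_reduction ::
    "('r, 'k) ring_scheme \<Rightarrow> ('r, 'n) ring_scheme \<Rightarrow> 'r \<Rightarrow> 'r set \<Rightarrow> bool" where
  "frac_minimal_reduction R Q z H \<longleftrightarrow>
     fractional_ideal R Q id H \<and> z \<in> carrier Q \<and>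
     (\<exists>y x. regular_elt R y \<and> (\<lambda>h. y \<otimes>\<^bsub>Q\<^esub> h) ` H \<subseteq> carrier R \<and> x \<in> carrier R \<and>
        minimal_reduction R (PIdl\<^bsub>R\<^esub> x) ((\<lambda>h. y \<otimes>\<^bsub>Q\<^esub> h) ` H) \<and>
        (\<lambda>r. z \<otimes>\<^bsub>Q\<^esub> r) ` carrier R = (\<lambda>r. (x \<otimes>\<^bsub>Q\<^esub> inv\<^bsub>Q\<^esub> y) \<otimes>\<^bsub>Q\<^esub> r) ` carrier R)"

definition m_primary :: "('r, 'k) ring_scheme \<Rightarrow> 'r set \<Rightarrow> 'r set \<Rightarrow> bool" where
  "m_primary R \<mm> I \<longleftrightarrow>
     ideal I R \<and> I \<noteq> carrier R \<and>
     (\<forall>x\<in>carrier R. \<forall>y\<in>carrier R. x \<otimes>\<^bsub>R\<^esub> y \<in> I \<longrightarrow> x \<in> I \<or> (\<exists>n::nat. y [^]\<^bsub>R\<^esub> n \<in> I)) \<and>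
     {x \<in> carrier R. \<exists>n::nat. x [^]\<^bsub>R\<^esub> n \<in> I} = \<mm>"


section \<open>The quotients of the Rees algebra\<close>

definition rees_algebra :: "('r, 'k) ring_scheme \<Rightarrow> 'r set \<Rightarrow> ('r, nat \<Rightarrow> 'r) up_ring" where
  "rees_algebra R I =
     (UP R)\<lparr>carrier :=
       {p \<in> carrier (UP R). \<forall>n. coeff (UP R) p n \<in> I [^]\<^bsub>ideals_set R\<^esub> n}\<rparr>"

text \<open>The ideal \<open>(t\<^sup>2 + at + b) R[t]\<close> contracted to the Rees algebra.\<close>

definition rees_kernel ::
    "('r, 'k) ring_scheme \<Rightarrow> 'r set \<Rightarrow> 'r \<Rightarrow> 'r \<Rightarrow> (nat \<Rightarrow> 'r) set" where
  "rees_kernel R I a b =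
     (PIdl\<^bsub>UP R\<^esub> (monom (UP R) \<one>\<^bsub>R\<^esub> 2 \<oplus>\<^bsub>UP R\<^esub> monom (UP R) a 1 \<oplus>\<^bsub>UP R\<^esub> monom (UP R) b 0))
       \<inter> carrier (rees_algebra R I)"

definition rees_quotient ::
    "('r, 'k) ring_scheme \<Rightarrow> 'r set \<Rightarrow> 'r \<Rightarrow> 'r \<Rightarrow> (nat \<Rightarrow> 'r) set ring" where
  "rees_quotient R I a b = rees_algebra R I Quot rees_kernel R I a b"

text \<open>The class \<open>r + it\<close>.\<close>

definition rees_elt ::
    "('r, 'k) ring_scheme \<Rightarrow> 'r set \<Rightarrow> 'r \<Rightarrow> 'r \<Rightarrow> 'r \<Rightarrow> 'r \<Rightarrow> (nat \<Rightarrow> 'r) set" where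
  "rees_elt R I a b r i =
     rees_kernel R I a b +>\<^bsub>rees_algebra R I\<^esub> (monom (UP R) r 0 \<oplus>\<^bsub>UP R\<^esub> monom (UP R) i 1)"

text \<open>For \<open>p, q \<in> Q = Q(R)\<close>, the element \<open>p + qt\<close> of the total ring of fractions \<open>T\<close> of
  \<open>rees_quotient R I a b\<close>: it is \<open>(r + it)/u\<close> whenever \<open>p = r/u\<close> and \<open>q = i/u\<close> with \<open>r \<in> R\<close>,
  \<open>i \<in> I\<close> and \<open>u \<in> R\<close> regular. If \<open>I\<close> contains a regular element, such \<open>r\<close>, \<open>i\<close> and \<open>u\<close> exist,
  and the value does not depend on them.\<close>

definition rees_frac ::
    "('r, 'k) ring_scheme \<Rightarrow> ('r, 'l) ring_scheme \<Rightarrow> 'r set \<Rightarrow> 'r \<Rightarrow> 'r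
      \<Rightarrow> ('t, 'n) ring_scheme \<Rightarrow> ((nat \<Rightarrow> 'r) set \<Rightarrow> 't) \<Rightarrow> 'r \<Rightarrow> 'r \<Rightarrow> 't" where
  "rees_frac R Q I a b T \<iota> p q =
     (THE w. \<exists>r\<in>carrier R. \<exists>i\<in>I. \<exists>u. regular_elt R u \<and>
        p = r \<otimes>\<^bsub>Q\<^esub> inv\<^bsub>Q\<^esub> u \<and> q = i \<otimes>\<^bsub>Q\<^esub> inv\<^bsub>Q\<^esub> u \<and>
        w = \<iota> (rees_elt R I a b r i) \<otimes>\<^bsub>T\<^esub> inv\<^bsub>T\<^esub> (\<iota> (rees_elt R I a b u \<zero>\<^bsub>R\<^esub>)))"

text \<open>The set of all \<open>x/z + (y/z) t\<close> with \<open>x \<in> (\<omega> : I)\<close> and \<open>y \<in> \<omega>\<close>.\<close>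

definition rees_canonical ::
    "('r, 'k) ring_scheme \<Rightarrow> ('r, 'l) ring_scheme \<Rightarrow> 'r set \<Rightarrow> 'r \<Rightarrow> 'r
      \<Rightarrow> ('t, 'n) ring_scheme \<Rightarrow> ((nat \<Rightarrow> 'r) set \<Rightarrow> 't) \<Rightarrow> 'r set \<Rightarrow> 'r \<Rightarrow> 't set" where
  "rees_canonical R Q I a b T \<iota> \<omega> z =
     {rees_frac R Q I a b T \<iota> (x \<otimes>\<^bsub>Q\<^esub> inv\<^bsub>Q\<^esub> z) (y \<otimes>\<^bsub>Q\<^esub> inv\<^bsub>Q\<^esub> z) | x y. x \<in> colon Q \<omega> I \<and> y \<in> \<omega>}"

end

theory Submission
  imports Defs
begin

text \<open>Write \<open>A\<close> for the quotient \<open>R(I)_{a,b}\<close>, \<open>T\<close> for its total ring of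
  fractions, \<open>W\<close> for the fractional ideal \<open>z\<^sup>-\<^sup>1 \<omega>\<close> of \<open>R\<close>, and \<open>p + qt\<close> for the elements of \<open>T\<close>, where
  \<open>p\<close> and \<open>q\<close> range over \<open>Q(R)\<close>. Then \<open>K\<close> consists of the \<open>p + qt\<close> with \<open>q \<in> W\<close> and \<open>pI \<subseteq> W\<close>. It can
  also be described through the coefficient of \<open>t\<close>: an element \<open>w\<close> of \<open>T\<close> belongs to \<open>K\<close> if and only
  if the coefficient of \<open>t\<close> in every multiple \<open>xw\<close> with \<open>x \<in> A\<close> lies in \<open>W\<close> (\<open>canon_iff\<close>). This says
  that \<open>K\<close> is the module of \<open>R\<close>-linear maps from \<open>A\<close> to \<open>W\<close>, which is how canonical modules pass to
  finite extensions.

  The definition of a canonical module speaks about \<open>Ext\<close> of the residue field, computed from an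
  arbitrary free resolution. Over a one-dimensional Cohen-Macaulay local ring with maximal ideal
  \<open>n\<close>, it is equivalent, for a fractional ideal \<open>H\<close>, to two statements about the module \<open>T/H\<close>:
  every homomorphism from an ideal with a regular element to \<open>T/H\<close> is multiplication by an element
  (\<open>regular_injective\<close>), and the elements of \<open>T/H\<close> killed by \<open>n\<close> form a one-dimensional vector space
  (\<open>simple_socle\<close>). The equivalence rests on the sequence \<open>0 \<rightarrow> H \<rightarrow> T \<rightarrow> T/H \<rightarrow> 0\<close>. A regular
  element of \<open>n\<close> kills the residue field but acts bijectively on \<open>T\<close>, so no cohomology comes from
  \<open>T\<close>: all of \<open>Ext\<close> in degree \<open>1\<close> is the socle of \<open>T/H\<close>, and \<open>Ext\<close> in degree \<open>2\<close> is the
  obstruction to extending maps \<open>n \<rightarrow> T/H\<close> to the ring. Noetherian induction, based on the fact that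
  a proper ideal with a regular element has a residue class whose annihilator is \<open>n\<close>, passes from
  \<open>n\<close> to all ideals with a regular element. The two directions are
  \<open>canonical_ideal_imp_regular_injective_simple_socle\<close> and \<open>canonical_idealI\<close>.

  The two properties pass from \<open>\<omega>\<close> to \<open>W\<close> because \<open>z\<close> is a unit of \<open>Q(R)\<close>, and from \<open>W\<close> to \<open>K\<close>. For the
  socle this is a computation with \<open>p + qt\<close>. For the extension property, a map \<open>f\<close> from an ideal \<open>J\<close>
  of \<open>A\<close> to \<open>T/K\<close> is composed with the coefficient of \<open>t\<close>. The result is an \<open>R\<close>-linear map from \<open>J\<close>
  to \<open>Q(R)/W\<close>. Its restriction to the elements \<open>it\<close> of \<open>J\<close> is multiplication by some \<open>p\<close>, and what
  remains depends on the constant coefficients only and is multiplication by some \<open>q\<close>; from \<open>p\<close>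
  and \<open>q\<close> one reads off the element of \<open>T\<close> that represents \<open>f\<close> (\<open>canon_regular_injective\<close>).

  That \<open>A\<close> is a one-dimensional Cohen-Macaulay local ring is seen from the norm
  \<open>(r + it)(r - ai - it) = r\<^sup>2 - ari + bi\<^sup>2\<close>, an element of \<open>R\<close>. It decides units and regular elements,
  and shows that two comparable primes with the same contraction to \<open>R\<close> agree.

  Finally \<open>A \<subseteq> K\<close> because \<open>z\<close> itself lies in \<open>(\<omega> : I)\<close>. For the other inclusion, let \<open>xy\<^sup>-\<^sup>1R\<close> be the
  minimal reduction and \<open>G\<close> the power of \<open>y(\<omega> : I)\<close> at which the reduction becomes stable. Then
  multiplication by \<open>z\<^sup>-\<^sup>1(\<omega> : I)\<close> maps \<open>G\<close> to itself (\<open>principal_reduction\<close>), so \<open>K\<close> maps the set of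
  all \<open>g + ht\<close> with \<open>g, h \<in> G\<close> to itself. Hence the powers of an element of \<open>K\<close> have a common
  denominator in \<open>A\<close>, and since \<open>A\<close> is Noetherian, the element is integral over \<open>A\<close>
  (\<open>integral_if_common_denominator\<close>).\<close>

section \<open>Module homomorphisms and quotient modules\<close>

lemma scalar_module_simps [simp]:
  "carrier (scalar_module \<iota> T) = carrier T"
  "\<zero>\<^bsub>scalar_module \<iota> T\<^esub> = \<zero>\<^bsub>T\<^esub>"
  "x \<oplus>\<^bsub>scalar_module \<iota> T\<^esub> y = x \<oplus>\<^bsub>T\<^esub> y"
  "s \<odot>\<^bsub>scalar_module \<iota> T\<^esub> x = \<iota> s \<otimes>\<^bsub>T\<^esub> x"
  by (simp_all add: scalar_module_def)

lemma a_inv_scalar_module [simp]: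
  "\<ominus>\<^bsub>scalar_module \<iota> T\<^esub> x = \<ominus>\<^bsub>T\<^esub> x"
  by (simp add: a_inv_def m_inv_def scalar_module_def)

lemma a_minus_scalar_module [simp]:
  "x \<ominus>\<^bsub>scalar_module \<iota> T\<^esub> y = x \<ominus>\<^bsub>T\<^esub> y"
  by (simp add: a_minus_def)

lemma a_r_coset_scalar_module [simp]:
  "H +>\<^bsub>scalar_module \<iota> T\<^esub> x = H +>\<^bsub>T\<^esub> x"
  by (simp add: a_r_coset_def r_coset_def scalar_module_def)

lemma scalar_module_module:
  assumes "cring B" "cring T" "\<iota> \<in> ring_hom B T"
  shows "module B (scalar_module \<iota> T)"
proof -
  interpret B: cring B by fact
  interpret T: cring T by fact
  note h = ring_hom_closed[OF assms(3)] ring_hom_add[OF assms(3)] ring_hom_mult[OF assms(3)]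
    ring_hom_one[OF assms(3)]
  show ?thesis
    by (intro moduleI abelian_groupI assms)
       (auto simp: h T.l_distr T.r_distr T.m_assoc T.a_ac T.l_neg intro!: T.a_inv_closed)
qed

lemma mod_homI:
  assumes "f \<in> carrier M \<rightarrow>\<^sub>E carrier N"
    and "\<And>x y. x \<in> carrier M \<Longrightarrow> y \<in> carrier M \<Longrightarrow> f (x \<oplus>\<^bsub>M\<^esub> y) = f x \<oplus>\<^bsub>N\<^esub> f y"
    and "\<And>r x. r \<in> carrier R \<Longrightarrow> x \<in> carrier M \<Longrightarrow> f (r \<odot>\<^bsub>M\<^esub> x) = r \<odot>\<^bsub>N\<^esub> f x"
  shows "f \<in> mod_hom R M N"
  using assms by (auto simp: mod_hom_def)

lemma mod_hom_closed: "f \<in> mod_hom R M N \<Longrightarrow> x \<in> carrier M \<Longrightarrow> f x \<in> carrier N"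
  by (auto simp: mod_hom_def)

lemma mod_hom_add:
  "f \<in> mod_hom R M N \<Longrightarrow> x \<in> carrier M \<Longrightarrow> y \<in> carrier M \<Longrightarrow> f (x \<oplus>\<^bsub>M\<^esub> y) = f x \<oplus>\<^bsub>N\<^esub> f y"
  by (auto simp: mod_hom_def)

lemma mod_hom_smult:
  "f \<in> mod_hom R M N \<Longrightarrow> r \<in> carrier R \<Longrightarrow> x \<in> carrier M \<Longrightarrow> f (r \<odot>\<^bsub>M\<^esub> x) = r \<odot>\<^bsub>N\<^esub> f x"
  by (auto simp: mod_hom_def)

lemma mod_hom_eqI:
  "f \<in> mod_hom R M N \<Longrightarrow> g \<in> mod_hom R M N' \<Longrightarrow> (\<And>x. x \<in> carrier M \<Longrightarrow> f x = g x) \<Longrightarrow> f = g"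
  by (rule extensionalityI[of _ "carrier M"]) (auto simp: mod_hom_def PiE_def)

lemma mod_hom_zero:
  assumes "module R M" "module R N" "f \<in> mod_hom R M N"
  shows "f \<zero>\<^bsub>M\<^esub> = \<zero>\<^bsub>N\<^esub>"
proof -
  interpret M: module R M by fact
  interpret N: module R N by fact
  have "f \<zero>\<^bsub>M\<^esub> = f (\<zero>\<^bsub>R\<^esub> \<odot>\<^bsub>M\<^esub> \<zero>\<^bsub>M\<^esub>)" by simp
  also have "\<dots> = \<zero>\<^bsub>R\<^esub> \<odot>\<^bsub>N\<^esub> f \<zero>\<^bsub>M\<^esub>" by (rule mod_hom_smult[OF assms(3)]) auto
  also have "\<dots> = \<zero>\<^bsub>N\<^esub>" using mod_hom_closed[OF assms(3)] by simp
  finally show ?thesis .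
qed

lemma mod_hom_minus:
  assumes "module R M" "module R N" "f \<in> mod_hom R M N" "x \<in> carrier M" "y \<in> carrier M"
  shows "f (x \<ominus>\<^bsub>M\<^esub> y) = f x \<ominus>\<^bsub>N\<^esub> f y"
proof -
  interpret M: module R M by fact
  interpret N: module R N by fact
  have c: "f x \<in> carrier N" "f y \<in> carrier N" "f (\<ominus>\<^bsub>M\<^esub> y) \<in> carrier N"
    using assms mod_hom_closed[OF assms(3)] by auto
  have "f (\<ominus>\<^bsub>M\<^esub> y) \<oplus>\<^bsub>N\<^esub> f y = f (\<ominus>\<^bsub>M\<^esub> y \<oplus>\<^bsub>M\<^esub> y)"
    using assms by (simp add: mod_hom_add[OF assms(3)])
  also have "\<dots> = \<zero>\<^bsub>N\<^esub>" using assms mod_hom_zero[OF assms(1-3)] by (simp add: M.M.l_neg)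
  finally have "f (\<ominus>\<^bsub>M\<^esub> y) = \<ominus>\<^bsub>N\<^esub> f y" using c N.M.minus_equality by metis
  then show ?thesis using assms by (simp add: a_minus_def mod_hom_add[OF assms(3)])
qed

lemma mod_hom_comp:
  assumes "f \<in> mod_hom R L M" "g \<in> mod_hom R M N" "module R L"
  shows "(\<lambda>x\<in>carrier L. g (f x)) \<in> mod_hom R L N"
proof -
  interpret L: module R L by fact
  show ?thesis
    by (rule mod_homI)
       (auto simp: mod_hom_closed[OF assms(1)] mod_hom_closed[OF assms(2)] mod_hom_add[OF assms(1)]
          mod_hom_add[OF assms(2)] mod_hom_smult[OF assms(1)] mod_hom_smult[OF assms(2)])
qed

lemma mod_hom_factor:
  assumes "module R L" "p \<in> mod_hom R L M" "p ` carrier L = carrier M" "g \<in> mod_hom R L N"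
    and eq: "\<And>x y. x \<in> carrier L \<Longrightarrow> y \<in> carrier L \<Longrightarrow> p x = p y \<Longrightarrow> g x = g y"
  obtains f where "f \<in> mod_hom R M N" "\<And>x. x \<in> carrier L \<Longrightarrow> f (p x) = g x"
proof -
  interpret L: module R L by fact
  define f where "f = (\<lambda>y\<in>carrier M. g (inv_into (carrier L) p y))"
  have f: "f (p x) = g x" if x: "x \<in> carrier L" for x
  proof -
    have "inv_into (carrier L) p (p x) \<in> carrier L" "p (inv_into (carrier L) p (p x)) = p x"
      using inv_into_into[OF imageI[OF x]] f_inv_into_f[OF imageI[OF x]] .
    then have "g (inv_into (carrier L) p (p x)) = g x" using x by (intro eq)
    then show ?thesis using x mod_hom_closed[OF assms(2)] by (simp add: f_def)
  qed
  have "f \<in> mod_hom R M N"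
  proof (rule mod_homI)
    show "f \<in> carrier M \<rightarrow>\<^sub>E carrier N"
    proof
      fix y assume "y \<in> carrier M"
      then show "f y \<in> carrier N" using f mod_hom_closed[OF assms(4)] by (auto simp: assms(3)[symmetric])
    qed (auto simp: f_def)
  next
    fix x y assume "x \<in> carrier M" "y \<in> carrier M"
    then obtain x' y' where "x' \<in> carrier L" "x = p x'" "y' \<in> carrier L" "y = p y'"
      unfolding assms(3)[symmetric] by blast
    then show "f (x \<oplus>\<^bsub>M\<^esub> y) = f x \<oplus>\<^bsub>N\<^esub> f y"
      using f[of "x' \<oplus>\<^bsub>L\<^esub> y'"] by (simp add: f mod_hom_add[OF assms(2)] mod_hom_add[OF assms(4)])
  next
    fix r x assume r: "r \<in> carrier R" "x \<in> carrier M"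
    then obtain x' where "x' \<in> carrier L" "x = p x'" unfolding assms(3)[symmetric] by blast
    then show "f (r \<odot>\<^bsub>M\<^esub> x) = r \<odot>\<^bsub>N\<^esub> f x"
      using r f[of "r \<odot>\<^bsub>L\<^esub> x'"] by (simp add: f mod_hom_smult[OF assms(2)] mod_hom_smult[OF assms(4)])
  qed
  with f show ?thesis using that by blast
qed

lemma mod_hom_add_hom:
  assumes "module R M" "module R N" "f \<in> mod_hom R M N" "g \<in> mod_hom R M N"
  shows "(\<lambda>x\<in>carrier M. f x \<oplus>\<^bsub>N\<^esub> g x) \<in> mod_hom R M N"
proof -
  interpret M: module R M by fact
  interpret N: module R N by fact
  note h = assms(3,4)
  show ?thesis
    by (rule mod_homI)
       (auto simp: mod_hom_closed[OF assms(3)] mod_hom_closed[OF assms(4)] mod_hom_add[OF assms(3)]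
          mod_hom_add[OF assms(4)] mod_hom_smult[OF assms(3)] mod_hom_smult[OF assms(4)]
          N.M.a_ac N.smult_r_distr)
qed

lemma mod_hom_smult_hom:
  assumes "module R M" "module R N" "f \<in> mod_hom R M N" "r \<in> carrier R"
  shows "(\<lambda>x\<in>carrier M. r \<odot>\<^bsub>N\<^esub> f x) \<in> mod_hom R M N"
proof -
  interpret M: module R M by fact
  interpret N: module R N by fact
  show ?thesis
  proof (rule mod_homI)
    fix s x assume s: "s \<in> carrier R" "x \<in> carrier M"
    have "r \<odot>\<^bsub>N\<^esub> (s \<odot>\<^bsub>N\<^esub> f x) = (r \<otimes>\<^bsub>R\<^esub> s) \<odot>\<^bsub>N\<^esub> f x"
      using s assms mod_hom_closed[OF assms(3)] by (simp add: N.smult_assoc1)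
    also have "\<dots> = (s \<otimes>\<^bsub>R\<^esub> r) \<odot>\<^bsub>N\<^esub> f x"
      using s assms by (simp only: M.R.m_comm)
    also have "\<dots> = s \<odot>\<^bsub>N\<^esub> (r \<odot>\<^bsub>N\<^esub> f x)"
      using s assms mod_hom_closed[OF assms(3)] by (simp add: N.smult_assoc1)
    finally show "(\<lambda>x\<in>carrier M. r \<odot>\<^bsub>N\<^esub> f x) (s \<odot>\<^bsub>M\<^esub> x) = s \<odot>\<^bsub>N\<^esub> (\<lambda>x\<in>carrier M. r \<odot>\<^bsub>N\<^esub> f x) x"
      using s by (simp add: mod_hom_smult[OF assms(3)])
  qed (auto simp: mod_hom_closed[OF assms(3)] mod_hom_add[OF assms(3)] N.smult_r_distr assms(4))
qed

lemma mod_hom_diff_hom: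
  assumes "module R M" "module R N" "f \<in> mod_hom R M N" "g \<in> mod_hom R M N"
  shows "(\<lambda>x\<in>carrier M. f x \<ominus>\<^bsub>N\<^esub> g x) \<in> mod_hom R M N"
proof -
  interpret M: module R M by fact
  interpret N: module R N by fact
  have "(\<lambda>x\<in>carrier M. f x \<oplus>\<^bsub>N\<^esub> (\<lambda>x\<in>carrier M. (\<ominus>\<^bsub>R\<^esub> \<one>\<^bsub>R\<^esub>) \<odot>\<^bsub>N\<^esub> g x) x) \<in> mod_hom R M N"
    by (intro mod_hom_add_hom mod_hom_smult_hom assms) auto
  also have "(\<lambda>x\<in>carrier M. f x \<oplus>\<^bsub>N\<^esub> (\<lambda>x\<in>carrier M. (\<ominus>\<^bsub>R\<^esub> \<one>\<^bsub>R\<^esub>) \<odot>\<^bsub>N\<^esub> g x) x)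
      = (\<lambda>x\<in>carrier M. f x \<ominus>\<^bsub>N\<^esub> g x)"
    using mod_hom_closed[OF assms(4)]
    by (auto simp: a_minus_def N.smult_l_minus intro!: restrict_ext)
  finally show ?thesis .
qed

lemma submodule_abelian_subgroup:
  assumes "module R M" "submodule N R M"
  shows "abelian_subgroup N M"
proof -
  interpret M: module R M by fact
  interpret N: submodule N R M by fact
  show ?thesis
    by (intro abelian_subgroupI3 additive_subgroup.intro N.subgroup_axioms M.M.abelian_group_axioms)
qed

lemma coset_eq_iff:
  assumes "module R M" "submodule N R M" "x \<in> carrier M" "y \<in> carrier M"
  shows "N +>\<^bsub>M\<^esub> x = N +>\<^bsub>M\<^esub> y \<longleftrightarrow> x \<ominus>\<^bsub>M\<^esub> y \<in> N"
proof -
  interpret M: module R M by fact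
  interpret N: abelian_subgroup N M using submodule_abelian_subgroup[OF assms(1,2)] .
  show ?thesis
    using assms by (metis N.a_rcos_self N.a_repr_independence' N.a_rcos_module a_minus_def)
qed

lemma coset_zero_iff:
  assumes "module R M" "submodule N R M" "x \<in> carrier M"
  shows "N +>\<^bsub>M\<^esub> x = N \<longleftrightarrow> x \<in> N"
proof -
  interpret M: module R M by fact
  interpret N: abelian_subgroup N M using submodule_abelian_subgroup[OF assms(1,2)] .
  show ?thesis using assms N.a_rcos_self N.a_rcos_const by blast
qed

lemma quot_module_zero [simp]: "\<zero>\<^bsub>quot_module M N\<^esub> = N"
  by (simp add: quot_module_def)

lemma quot_module_carrier:
  "carrier (quot_module M N) = (\<lambda>x. N +>\<^bsub>M\<^esub> x) ` carrier M"
  by (auto simp: quot_module_def A_RCOSETS_def RCOSETS_def a_r_coset_def)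

lemma quot_module_add:
  assumes "module R M" "submodule N R M" "x \<in> carrier M" "y \<in> carrier M"
  shows "(N +>\<^bsub>M\<^esub> x) \<oplus>\<^bsub>quot_module M N\<^esub> (N +>\<^bsub>M\<^esub> y) = N +>\<^bsub>M\<^esub> (x \<oplus>\<^bsub>M\<^esub> y)"
proof -
  interpret N: abelian_subgroup N M using submodule_abelian_subgroup[OF assms(1,2)] .
  show ?thesis using assms N.a_rcos_sum by (simp add: quot_module_def)
qed

lemma quot_module_smult:
  assumes "module R M" "submodule N R M" "r \<in> carrier R" "x \<in> carrier M"
  shows "r \<odot>\<^bsub>quot_module M N\<^esub> (N +>\<^bsub>M\<^esub> x) = N +>\<^bsub>M\<^esub> (r \<odot>\<^bsub>M\<^esub> x)"
proof -
  interpret M: module R M by fact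
  interpret N: abelian_subgroup N M using submodule_abelian_subgroup[OF assms(1,2)] .
  interpret S: submodule N R M by fact
  have eq: "N +>\<^bsub>M\<^esub> (r \<odot>\<^bsub>M\<^esub> y) = N +>\<^bsub>M\<^esub> (r \<odot>\<^bsub>M\<^esub> x)" if y: "y \<in> N +>\<^bsub>M\<^esub> x" for y
  proof -
    have yc: "y \<in> carrier M" using y assms N.a_elemrcos_carrier by blast
    have "N +>\<^bsub>M\<^esub> y = N +>\<^bsub>M\<^esub> x" using N.a_repr_independence' y assms by metis
    then have "y \<ominus>\<^bsub>M\<^esub> x \<in> N" using coset_eq_iff[OF assms(1,2) yc assms(4)] by simp
    then have "r \<odot>\<^bsub>M\<^esub> (y \<ominus>\<^bsub>M\<^esub> x) \<in> N" using assms by auto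
    moreover have "r \<odot>\<^bsub>M\<^esub> (y \<ominus>\<^bsub>M\<^esub> x) = r \<odot>\<^bsub>M\<^esub> y \<ominus>\<^bsub>M\<^esub> r \<odot>\<^bsub>M\<^esub> x"
      using yc assms by (simp add: a_minus_def M.smult_r_distr M.smult_r_minus)
    ultimately show ?thesis using coset_eq_iff[OF assms(1,2)] yc assms by simp
  qed
  have "r \<odot>\<^bsub>quot_module M N\<^esub> (N +>\<^bsub>M\<^esub> x) = (\<Union>y\<in>N +>\<^bsub>M\<^esub> x. N +>\<^bsub>M\<^esub> (r \<odot>\<^bsub>M\<^esub> y))"
    by (simp add: quot_module_def)
  also have "\<dots> = (\<Union>y\<in>N +>\<^bsub>M\<^esub> x. N +>\<^bsub>M\<^esub> (r \<odot>\<^bsub>M\<^esub> x))"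
    by (intro SUP_cong refl eq)
  also have "\<dots> = N +>\<^bsub>M\<^esub> (r \<odot>\<^bsub>M\<^esub> x)"
    by (rule UN_constant_eq[OF N.a_rcos_self[OF assms(4)]]) simp
  finally show ?thesis .
qed

lemma quot_module_module:
  assumes "module R M" "submodule N R M"
  shows "module R (quot_module M N)"
proof -
  interpret M: module R M by fact
  interpret N: abelian_subgroup N M using submodule_abelian_subgroup[OF assms] .
  note simps = quot_module_add[OF assms] quot_module_smult[OF assms]
  have z: "\<zero>\<^bsub>quot_module M N\<^esub> = N +>\<^bsub>M\<^esub> \<zero>\<^bsub>M\<^esub>"
    using N.a_rcos_const[OF N.zero_closed] by simp
  have "abelian_group (quot_module M N)"
  proof (rule abelian_groupI)
    fix C assume "C \<in> carrier (quot_module M N)"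
    then obtain x where x: "x \<in> carrier M" "C = N +>\<^bsub>M\<^esub> x" unfolding quot_module_carrier by blast
    show "\<exists>D\<in>carrier (quot_module M N). D \<oplus>\<^bsub>quot_module M N\<^esub> C = \<zero>\<^bsub>quot_module M N\<^esub>"
      unfolding z by (rule bexI[of _ "N +>\<^bsub>M\<^esub> (\<ominus>\<^bsub>M\<^esub> x)"])
        (use x in \<open>auto simp: quot_module_carrier simps M.M.l_neg simp del: quot_module_zero\<close>)
  qed (auto simp: quot_module_carrier z simps M.M.a_ac simp del: quot_module_zero)
  then show ?thesis
    by (intro moduleI M.R.cring_axioms)
       (auto simp: quot_module_carrier simps M.smult_l_distr M.smult_r_distr M.smult_assoc1)
qed

lemma quot_proj_hom:
  assumes "module R M" "submodule N R M"
  shows "(\<lambda>x\<in>carrier M. N +>\<^bsub>M\<^esub> x) \<in> mod_hom R M (quot_module M N)"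
proof -
  interpret M: module R M by fact
  show ?thesis
    by (rule mod_homI)
       (auto simp: quot_module_carrier quot_module_add[OF assms] quot_module_smult[OF assms])
qed

lemma submodule_image:
  assumes "module R M" "module R N" "f \<in> mod_hom R M N" "submodule S R M"
  shows "submodule (f ` S) R N"
proof -
  interpret M: module R M by fact
  interpret N: module R N by fact
  note S = M.submoduleE[OF assms(4)]
  note c = subsetD[OF S(1)]
  have z: "\<zero>\<^bsub>M\<^esub> \<in> S" using S(2-5) by (metis M.M.r_neg all_not_in_conv c)
  show ?thesis
  proof (rule N.submoduleI)
    show "f ` S \<subseteq> carrier N" using c mod_hom_closed[OF assms(3)] by auto
    show "\<zero>\<^bsub>N\<^esub> \<in> f ` S" using mod_hom_zero[OF assms(1-3)] z by (metis imageI)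
    fix y assume "y \<in> f ` S"
    then obtain x where x: "x \<in> S" "y = f x" by blast
    have "f (\<zero>\<^bsub>M\<^esub> \<ominus>\<^bsub>M\<^esub> x) = \<ominus>\<^bsub>N\<^esub> f x"
      using c x mod_hom_closed[OF assms(3)]
      by (simp add: mod_hom_minus[OF assms(1-3)] mod_hom_zero[OF assms(1-3)] N.M.minus_eq)
    moreover have "\<zero>\<^bsub>M\<^esub> \<ominus>\<^bsub>M\<^esub> x \<in> S" using x S(3) c by (simp add: M.M.minus_eq)
    ultimately show "\<ominus>\<^bsub>N\<^esub> y \<in> f ` S" using x by (metis imageI)
  next
    fix a b assume "a \<in> f ` S" "b \<in> f ` S"
    then obtain x y where "x \<in> S" "a = f x" "y \<in> S" "b = f y" by blast
    then show "a \<oplus>\<^bsub>N\<^esub> b \<in> f ` S" using S(5)[of x y] c by (metis imageI mod_hom_add[OF assms(3)])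
  next
    fix r b assume r: "r \<in> carrier R" "b \<in> f ` S"
    then obtain y where "y \<in> S" "b = f y" by blast
    then show "r \<odot>\<^bsub>N\<^esub> b \<in> f ` S" using r S(4)[of r y] c by (metis imageI mod_hom_smult[OF assms(3)])
  qed
qed

lemma submodule_zero:
  assumes "module R M" "submodule S R M"
  shows "\<zero>\<^bsub>M\<^esub> \<in> S"
proof -
  interpret M: module R M by fact
  show ?thesis using M.submoduleE(2,3,5)[OF assms(2)] M.submoduleE(1)[OF assms(2)]
    by (metis M.M.r_neg all_not_in_conv subsetD)
qed

lemma submodule_minus:
  assumes "module R M" "submodule S R M" "x \<in> S" "y \<in> S"
  shows "x \<ominus>\<^bsub>M\<^esub> y \<in> S"
proof -
  interpret M: module R M by fact
  show ?thesis using M.submoduleE(3,5)[OF assms(2)] assms by (simp add: a_minus_def)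
qed

lemma submodule_vimage:
  assumes "module R M" "module R N" "f \<in> mod_hom R M N" "submodule S R N"
  shows "submodule {x \<in> carrier M. f x \<in> S} R M"
proof -
  interpret M: module R M by fact
  interpret N: module R N by fact
  note S = N.submoduleE[OF assms(4)]
  have m: "f (\<ominus>\<^bsub>M\<^esub> x) = \<ominus>\<^bsub>N\<^esub> f x" if "x \<in> carrier M" for x
    using that mod_hom_minus[OF assms(1-3), of "\<zero>\<^bsub>M\<^esub>" x] mod_hom_closed[OF assms(3), of x]
    by (simp add: mod_hom_zero[OF assms(1-3)] M.M.minus_eq N.M.minus_eq)
  show ?thesis
    by (rule M.submoduleI)
       (auto simp: S mod_hom_add[OF assms(3)] mod_hom_smult[OF assms(3)] m mod_hom_zero[OF assms(1-3)]
          submodule_zero[OF assms(2,4)])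
qed

lemma submodule_Int:
  assumes "module R M" "submodule S R M" "submodule S' R M"
  shows "submodule (S \<inter> S') R M"
proof -
  interpret M: module R M by fact
  note S = M.submoduleE[OF assms(2)] M.submoduleE[OF assms(3)]
  show ?thesis
    by (rule M.submoduleI) (use S submodule_zero[OF assms(1,2)] submodule_zero[OF assms(1,3)] in auto)
qed

lemma mod_hom_restrict:
  assumes "f \<in> mod_hom R M N" "submodule S R M" "module R M"
  shows "restrict f S \<in> mod_hom R (M\<lparr>carrier := S\<rparr>) N"
proof -
  interpret M: module R M by fact
  note S = M.submoduleE[OF assms(2)]
  note c = subsetD[OF S(1)]
  show ?thesis
    by (rule mod_homI)
       (use S c in \<open>auto simp: mod_hom_closed[OF assms(1)] mod_hom_add[OF assms(1)] mod_hom_smult[OF assms(1)]\<close>)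
qed

lemma mod_hom_codomain:
  assumes "f \<in> mod_hom R M N" "\<And>x. x \<in> carrier M \<Longrightarrow> f x \<in> S"
  shows "f \<in> mod_hom R M (N\<lparr>carrier := S\<rparr>)"
  using assms by (auto simp: mod_hom_def PiE_def)

lemma mod_hom_codomain_incl:
  assumes "f \<in> mod_hom R M (N\<lparr>carrier := S\<rparr>)" "S \<subseteq> carrier N"
  shows "f \<in> mod_hom R M N"
  using assms by (auto simp: mod_hom_def PiE_def Pi_def)

lemma mod_hom_smult_id:
  assumes "module R M" "r \<in> carrier R"
  shows "(\<lambda>x\<in>carrier M. r \<odot>\<^bsub>M\<^esub> x) \<in> mod_hom R M M"
proof -
  interpret M: module R M by fact
  have "(\<lambda>x\<in>carrier M. x) \<in> mod_hom R M M" by (rule mod_homI) auto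
  then have "(\<lambda>x\<in>carrier M. r \<odot>\<^bsub>M\<^esub> (\<lambda>x\<in>carrier M. x) x) \<in> mod_hom R M M"
    using mod_hom_smult_hom[OF assms(1) assms(1)] assms(2) by blast
  also have "(\<lambda>x\<in>carrier M. r \<odot>\<^bsub>M\<^esub> (\<lambda>x\<in>carrier M. x) x) = (\<lambda>x\<in>carrier M. r \<odot>\<^bsub>M\<^esub> x)"
    by (auto intro!: restrict_ext)
  finally show ?thesis .
qed

lemma quot_module_mod_iso:
  assumes "module R M" "submodule N R M" "module R P" "h \<in> mod_hom R M P"
    and surj: "h ` carrier M = carrier P"
    and ker: "\<And>x. x \<in> carrier M \<Longrightarrow> (h x = \<zero>\<^bsub>P\<^esub>) = (x \<in> N)"
  shows "mod_iso R (quot_module M N) P"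
proof -
  interpret M: module R M by fact
  interpret P: module R P by fact
  have eq: "(h x = h y) = (N +>\<^bsub>M\<^esub> x = N +>\<^bsub>M\<^esub> y)" if "x \<in> carrier M" "y \<in> carrier M" for x y
  proof -
    have "N +>\<^bsub>M\<^esub> x = N +>\<^bsub>M\<^esub> y \<longleftrightarrow> h (x \<ominus>\<^bsub>M\<^esub> y) = \<zero>\<^bsub>P\<^esub>"
      using that ker coset_eq_iff[OF assms(1,2)] by simp
    also have "\<dots> \<longleftrightarrow> h x \<ominus>\<^bsub>P\<^esub> h y = \<zero>\<^bsub>P\<^esub>" using that by (simp add: mod_hom_minus[OF assms(1,3,4)])
    also have "\<dots> \<longleftrightarrow> h x = h y" using that mod_hom_closed[OF assms(4)]
      by (metis P.M.minus_eq P.M.minus_equality P.M.minus_minus P.M.r_neg P.M.a_inv_closed)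
    finally show ?thesis by simp
  qed
  obtain f where f: "f \<in> mod_hom R (quot_module M N) P"
    and fx: "\<And>x. x \<in> carrier M \<Longrightarrow> f ((\<lambda>x\<in>carrier M. N +>\<^bsub>M\<^esub> x) x) = h x"
    by (rule mod_hom_factor[OF assms(1) quot_proj_hom[OF assms(1,2)] _ assms(4)])
      (use eq in \<open>auto simp: quot_module_carrier\<close>)
  have "bij_betw f (carrier (quot_module M N)) (carrier P)"
    unfolding bij_betw_def inj_on_def using fx eq surj by (auto simp: quot_module_carrier image_image)
  with f show ?thesis unfolding mod_iso_def by blast
qed

lemma hom_module_simps [simp]:
  "carrier (hom_module R M N) = mod_hom R M N"
  "\<zero>\<^bsub>hom_module R M N\<^esub> = (\<lambda>x\<in>carrier M. \<zero>\<^bsub>N\<^esub>)"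
  "f \<oplus>\<^bsub>hom_module R M N\<^esub> g = (\<lambda>x\<in>carrier M. f x \<oplus>\<^bsub>N\<^esub> g x)"
  "r \<odot>\<^bsub>hom_module R M N\<^esub> f = (\<lambda>x\<in>carrier M. r \<odot>\<^bsub>N\<^esub> f x)"
  by (simp_all add: hom_module_def)

lemma hom_module_module:
  assumes "module R M" "module R N"
  shows "module R (hom_module R M N)"
proof -
  interpret M: module R M by fact
  interpret N: module R N by fact
  note cl = mod_hom_closed[of _ R M N]
  have z: "(\<lambda>x\<in>carrier M. \<zero>\<^bsub>N\<^esub>) \<in> mod_hom R M N" by (rule mod_homI) auto
  have "abelian_group (hom_module R M N)"
  proof (rule abelian_groupI)
    fix f assume f: "f \<in> carrier (hom_module R M N)"
    show "\<exists>g\<in>carrier (hom_module R M N). g \<oplus>\<^bsub>hom_module R M N\<^esub> f = \<zero>\<^bsub>hom_module R M N\<^esub>"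
    proof
      show "(\<lambda>x\<in>carrier M. \<ominus>\<^bsub>R\<^esub> \<one>\<^bsub>R\<^esub> \<odot>\<^bsub>N\<^esub> f x) \<in> carrier (hom_module R M N)"
        using f mod_hom_smult_hom[OF assms] by simp
    qed (use f cl in \<open>auto simp: N.smult_l_minus N.M.l_neg intro!: restrict_ext\<close>)
    show "\<zero>\<^bsub>hom_module R M N\<^esub> \<oplus>\<^bsub>hom_module R M N\<^esub> f = f"
      unfolding hom_module_simps
      by (rule mod_hom_eqI[OF mod_hom_add_hom[OF assms z, of f]]) (use f cl in auto)
  qed (use cl z in \<open>auto simp: mod_hom_add_hom[OF assms] N.M.a_ac intro!: restrict_ext\<close>)
  moreover have "\<one>\<^bsub>R\<^esub> \<odot>\<^bsub>hom_module R M N\<^esub> f = f" if "f \<in> carrier (hom_module R M N)" for f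
    unfolding hom_module_simps
    by (rule mod_hom_eqI[OF mod_hom_smult_hom[OF assms, of f]]) (use that cl in auto)
  ultimately show ?thesis
    by (intro moduleI M.R.cring_axioms)
       (use cl in \<open>auto simp: mod_hom_smult_hom[OF assms] N.smult_l_distr N.smult_r_distr N.smult_assoc1
          intro!: restrict_ext\<close>)
qed

section \<open>Free modules\<close>

lemma free_module_simps [simp]:
  "carrier (free_module R n) = {..<n} \<rightarrow>\<^sub>E carrier R"
  "\<zero>\<^bsub>free_module R n\<^esub> = (\<lambda>j\<in>{..<n}. \<zero>\<^bsub>R\<^esub>)"
  "v \<oplus>\<^bsub>free_module R n\<^esub> w = (\<lambda>j\<in>{..<n}. v j \<oplus>\<^bsub>R\<^esub> w j)"
  "r \<odot>\<^bsub>free_module R n\<^esub> v = (\<lambda>j\<in>{..<n}. r \<otimes>\<^bsub>R\<^esub> v j)"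
  by (simp_all add: free_module_def)

lemma free_module_eqI:
  assumes "v \<in> carrier (free_module R n)" "w \<in> carrier (free_module R n)" "\<And>l. l < n \<Longrightarrow> v l = w l"
  shows "v = w"
  using assms by (auto intro: PiE_ext)

lemma free_module_coord:
  "v \<in> {..<n} \<rightarrow>\<^sub>E carrier R \<Longrightarrow> l < n \<Longrightarrow> v l \<in> carrier R"
  by auto

lemma free_module_zero_coord: "l < n \<Longrightarrow> \<zero>\<^bsub>free_module R n\<^esub> l = \<zero>\<^bsub>R\<^esub>"
  by simp

lemma free_module_add_coord: "l < n \<Longrightarrow> (x \<oplus>\<^bsub>free_module R n\<^esub> y) l = x l \<oplus>\<^bsub>R\<^esub> y l"
  by simp

lemma free_module_smult_coord: "l < n \<Longrightarrow> (r \<odot>\<^bsub>free_module R n\<^esub> x) l = r \<otimes>\<^bsub>R\<^esub> x l"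
  by simp

lemma free_module_coord_closed: "x \<in> carrier (free_module R n) \<Longrightarrow> l < n \<Longrightarrow> x l \<in> carrier R"
  by (simp add: free_module_coord)

lemma free_module_module:
  assumes "cring R"
  shows "module R (free_module R n)"
proof -
  interpret R: cring R by fact
  let ?F = "free_module R n"
  note coords = free_module_zero_coord free_module_add_coord free_module_smult_coord
  note cl = free_module_coord_closed[of _ R n]
  have z: "\<zero>\<^bsub>?F\<^esub> \<in> carrier ?F" by auto
  have add: "v \<oplus>\<^bsub>?F\<^esub> w \<in> carrier ?F" if "v \<in> carrier ?F" "w \<in> carrier ?F" for v w
    using cl[OF that(1)] cl[OF that(2)] by (simp add: PiE_iff)
  have smult: "r \<odot>\<^bsub>?F\<^esub> v \<in> carrier ?F" if "r \<in> carrier R" "v \<in> carrier ?F" for r v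
    using cl[OF that(2)] that(1) by (simp add: PiE_iff)
  note closed = z add smult
  note eqI = free_module_eqI[of _ R n]
  have "abelian_group ?F"
  proof (rule abelian_groupI)
    fix x assume x: "x \<in> carrier ?F"
    have m: "\<ominus>\<^bsub>R\<^esub> \<one>\<^bsub>R\<^esub> \<odot>\<^bsub>?F\<^esub> x \<in> carrier ?F" using x by (intro smult) auto
    moreover have "\<ominus>\<^bsub>R\<^esub> \<one>\<^bsub>R\<^esub> \<odot>\<^bsub>?F\<^esub> x \<oplus>\<^bsub>?F\<^esub> x = \<zero>\<^bsub>?F\<^esub>"
      by (rule eqI[OF add[OF m x] z])
        (use cl[OF x] in \<open>simp add: coords R.l_minus R.l_neg del: free_module_simps\<close>)
    ultimately show "\<exists>y\<in>carrier ?F. y \<oplus>\<^bsub>?F\<^esub> x = \<zero>\<^bsub>?F\<^esub>" by blast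
    show "\<zero>\<^bsub>?F\<^esub> \<oplus>\<^bsub>?F\<^esub> x = x"
      by (rule eqI[OF add[OF z x] x]) (use cl[OF x] in \<open>simp add: coords del: free_module_simps\<close>)
    fix y assume y: "y \<in> carrier ?F"
    show "x \<oplus>\<^bsub>?F\<^esub> y = y \<oplus>\<^bsub>?F\<^esub> x"
      by (rule eqI[OF add[OF x y] add[OF y x]])
        (use cl[OF x] cl[OF y] in \<open>simp add: coords R.a_comm del: free_module_simps\<close>)
    fix w assume w: "w \<in> carrier ?F"
    show "x \<oplus>\<^bsub>?F\<^esub> y \<oplus>\<^bsub>?F\<^esub> w = x \<oplus>\<^bsub>?F\<^esub> (y \<oplus>\<^bsub>?F\<^esub> w)"
      by (rule eqI[OF add[OF add[OF x y] w] add[OF x add[OF y w]]])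
        (use cl[OF x] cl[OF y] cl[OF w] in \<open>simp add: coords R.a_assoc del: free_module_simps\<close>)
  qed (fact z add)+
  then show ?thesis
  proof (rule moduleI[OF assms])
    fix x assume x: "x \<in> carrier ?F"
    show "\<one>\<^bsub>R\<^esub> \<odot>\<^bsub>?F\<^esub> x = x"
      by (rule eqI[OF smult[OF R.one_closed x] x]) (use cl[OF x] in \<open>simp add: coords del: free_module_simps\<close>)
  next
    fix r s x y assume r: "r \<in> carrier R" and x: "x \<in> carrier ?F"
    show "r \<odot>\<^bsub>?F\<^esub> x \<in> carrier ?F" by (rule smult[OF r x])
    show "r \<odot>\<^bsub>?F\<^esub> (x \<oplus>\<^bsub>?F\<^esub> y) = r \<odot>\<^bsub>?F\<^esub> x \<oplus>\<^bsub>?F\<^esub> r \<odot>\<^bsub>?F\<^esub> y" if y: "y \<in> carrier ?F"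
      by (rule eqI[OF smult[OF r add[OF x y]] add[OF smult[OF r x] smult[OF r y]]])
        (use r cl[OF x] cl[OF y] in \<open>simp add: coords R.r_distr del: free_module_simps\<close>)
    assume s: "s \<in> carrier R"
    show "(r \<oplus>\<^bsub>R\<^esub> s) \<odot>\<^bsub>?F\<^esub> x = r \<odot>\<^bsub>?F\<^esub> x \<oplus>\<^bsub>?F\<^esub> s \<odot>\<^bsub>?F\<^esub> x"
      by (rule eqI[OF smult[OF R.a_closed[OF r s] x] add[OF smult[OF r x] smult[OF s x]]])
        (use r s cl[OF x] in \<open>simp add: coords R.l_distr del: free_module_simps\<close>)
    show "r \<otimes>\<^bsub>R\<^esub> s \<odot>\<^bsub>?F\<^esub> x = r \<odot>\<^bsub>?F\<^esub> (s \<odot>\<^bsub>?F\<^esub> x)"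
      by (rule eqI[OF smult[OF R.m_closed[OF r s] x] smult[OF r smult[OF s x]]])
        (use r s cl[OF x] in \<open>simp add: coords R.m_assoc del: free_module_simps\<close>)
  qed
qed

definition free_basis :: "('r, 'k) ring_scheme \<Rightarrow> nat \<Rightarrow> nat \<Rightarrow> nat \<Rightarrow> 'r" where
  "free_basis R n l = (\<lambda>j\<in>{..<n}. if j = l then \<one>\<^bsub>R\<^esub> else \<zero>\<^bsub>R\<^esub>)"

lemma free_basis_closed [simp]:
  "cring R \<Longrightarrow> free_basis R n l \<in> carrier (free_module R n)"
proof -
  assume "cring R"
  then interpret R: cring R .
  show ?thesis by (auto simp: free_basis_def)
qed

lemma free_basis_induct [consumes 2, case_names zero add smult basis]:
  assumes "cring R" and v: "v \<in> carrier (free_module R n)"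
    and zero: "P \<zero>\<^bsub>free_module R n\<^esub>"
    and add: "\<And>x y. x \<in> carrier (free_module R n) \<Longrightarrow> y \<in> carrier (free_module R n) \<Longrightarrow>
      P x \<Longrightarrow> P y \<Longrightarrow> P (x \<oplus>\<^bsub>free_module R n\<^esub> y)"
    and smult: "\<And>r x. r \<in> carrier R \<Longrightarrow> x \<in> carrier (free_module R n) \<Longrightarrow> P x \<Longrightarrow>
      P (r \<odot>\<^bsub>free_module R n\<^esub> x)"
    and basis: "\<And>l. l < n \<Longrightarrow> P (free_basis R n l)"
  shows "P v"
proof -
  interpret R: cring R by fact
  have "P (\<lambda>j\<in>{..<n}. if j < k then v j else \<zero>\<^bsub>R\<^esub>)" if "k \<le> n" for k
    using that
  proof (induction k)
    case 0
    then show ?case using zero by (simp add: restrict_def)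
  next
    case (Suc k)
    let ?w = "\<lambda>j\<in>{..<n}. if j < k then v j else \<zero>\<^bsub>R\<^esub>"
    let ?u = "v k \<odot>\<^bsub>free_module R n\<^esub> free_basis R n k"
    have vk: "v l \<in> carrier R" if "l < n" for l using v that by auto
    have "P ?u" using Suc vk by (intro smult basis) (auto simp: free_basis_closed[OF assms(1), simplified])
    moreover have "P ?w" using Suc.IH Suc.prems by (simp only: Suc_leD)
    moreover have "?u \<in> carrier (free_module R n)" "?w \<in> carrier (free_module R n)"
      using vk Suc by (auto simp: free_basis_def)
    ultimately have "P (?w \<oplus>\<^bsub>free_module R n\<^esub> ?u)" using add by blast
    also have "?w \<oplus>\<^bsub>free_module R n\<^esub> ?u = (\<lambda>j\<in>{..<n}. if j < Suc k then v j else \<zero>\<^bsub>R\<^esub>)"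
      using vk Suc by (auto simp: free_basis_def less_Suc_eq intro!: restrict_ext)
    finally show ?case .
  qed
  from this[of n] have "P (\<lambda>j\<in>{..<n}. if j < n then v j else \<zero>\<^bsub>R\<^esub>)" by simp
  also have "(\<lambda>j\<in>{..<n}. if j < n then v j else \<zero>\<^bsub>R\<^esub>) = v"
    by (rule free_module_eqI[of _ R n]) (use v free_module_coord_closed[OF v] in \<open>auto simp: PiE_iff\<close>)
  finally show ?thesis .
qed

lemma free_hom_eqI:
  assumes "cring R" "module R N" "f \<in> mod_hom R (free_module R n) N" "g \<in> mod_hom R (free_module R n) N"
    and "\<And>l. l < n \<Longrightarrow> f (free_basis R n l) = g (free_basis R n l)"
  shows "f = g"
proof (rule mod_hom_eqI[OF assms(3,4)])
  fix v assume "v \<in> carrier (free_module R n)"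
  with assms(1) show "f v = g v"
  proof (induction rule: free_basis_induct)
    case zero
    then show ?case using mod_hom_zero[OF free_module_module[OF assms(1)] assms(2)] assms by metis
  next
    case (add x y)
    then show ?case by (simp only: mod_hom_add[OF assms(3)] mod_hom_add[OF assms(4)])
  next
    case (smult r x)
    then show ?case by (simp only: mod_hom_smult[OF assms(3)] mod_hom_smult[OF assms(4)])
  qed (fact assms(5))
qed

lemma free_hom_exists:
  assumes "cring R" "module R N" "\<And>l. l < n \<Longrightarrow> c l \<in> carrier N"
  obtains f where "f \<in> mod_hom R (free_module R n) N" "\<And>l. l < n \<Longrightarrow> f (free_basis R n l) = c l"
    and "\<And>v. v \<in> carrier (free_module R n) \<Longrightarrow> f v = (\<Oplus>\<^bsub>N\<^esub>l\<in>{..<n}. v l \<odot>\<^bsub>N\<^esub> c l)"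
proof -
  interpret R: cring R by fact
  interpret N: module R N by fact
  define f where "f = (\<lambda>v\<in>carrier (free_module R n). \<Oplus>\<^bsub>N\<^esub>l\<in>{..<n}. v l \<odot>\<^bsub>N\<^esub> c l)"
  have vc: "v l \<in> carrier R" if "v \<in> carrier (free_module R n)" "l < n" for v l
    using that by auto
  have f: "f \<in> mod_hom R (free_module R n) N"
  proof (rule mod_homI)
    show "f \<in> carrier (free_module R n) \<rightarrow>\<^sub>E carrier N"
      unfolding f_def by (auto intro!: N.M.finsum_closed N.smult_closed assms vc[simplified])
  next
    fix x y assume xy: "x \<in> carrier (free_module R n)" "y \<in> carrier (free_module R n)"
    interpret F: module R "free_module R n" using free_module_module[OF assms(1)] .
    have "f (x \<oplus>\<^bsub>free_module R n\<^esub> y) = (\<Oplus>\<^bsub>N\<^esub>l\<in>{..<n}. (x \<oplus>\<^bsub>free_module R n\<^esub> y) l \<odot>\<^bsub>N\<^esub> c l)"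
      using xy F.M.a_closed[OF xy] unfolding f_def by (simp only: restrict_apply' )
    also have "\<dots> = (\<Oplus>\<^bsub>N\<^esub>l\<in>{..<n}. x l \<odot>\<^bsub>N\<^esub> c l \<oplus>\<^bsub>N\<^esub> y l \<odot>\<^bsub>N\<^esub> c l)"
      using xy vc assms by (intro N.M.finsum_cong') (auto simp: N.smult_l_distr free_module_coord)
    also have "\<dots> = f x \<oplus>\<^bsub>N\<^esub> f y"
      using xy vc assms unfolding f_def by (subst N.M.finsum_addf) (auto simp: free_module_coord)
    finally show "f (x \<oplus>\<^bsub>free_module R n\<^esub> y) = f x \<oplus>\<^bsub>N\<^esub> f y" .
  next
    fix r x assume x: "r \<in> carrier R" "x \<in> carrier (free_module R n)"
    interpret F: module R "free_module R n" using free_module_module[OF assms(1)] .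
    have "f (r \<odot>\<^bsub>free_module R n\<^esub> x) = (\<Oplus>\<^bsub>N\<^esub>l\<in>{..<n}. (r \<odot>\<^bsub>free_module R n\<^esub> x) l \<odot>\<^bsub>N\<^esub> c l)"
      using x F.smult_closed[OF x] unfolding f_def by (simp only: restrict_apply')
    also have "\<dots> = (\<Oplus>\<^bsub>N\<^esub>l\<in>{..<n}. r \<odot>\<^bsub>N\<^esub> (x l \<odot>\<^bsub>N\<^esub> c l))"
      using x vc assms by (intro N.M.finsum_cong') (auto simp: N.smult_assoc1 free_module_coord)
    also have "\<dots> = r \<odot>\<^bsub>N\<^esub> (\<Oplus>\<^bsub>N\<^esub>l\<in>{..<n}. x l \<odot>\<^bsub>N\<^esub> c l)"
      using x vc assms by (intro N.finsum_smult_ldistr[symmetric]) (auto simp: free_module_coord)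
    also have "\<dots> = r \<odot>\<^bsub>N\<^esub> f x"
      using x unfolding f_def by (simp only: restrict_apply')
    finally show "f (r \<odot>\<^bsub>free_module R n\<^esub> x) = r \<odot>\<^bsub>N\<^esub> f x" .
  qed
  have "f (free_basis R n l) = c l" if "l < n" for l
  proof -
    have "f (free_basis R n l) = (\<Oplus>\<^bsub>N\<^esub>j\<in>{..<n}. free_basis R n l j \<odot>\<^bsub>N\<^esub> c j)"
      unfolding f_def using free_basis_closed[OF assms(1)] by (simp only: restrict_apply')
    also have "\<dots> = (\<Oplus>\<^bsub>N\<^esub>j\<in>{..<n}. if l = j then c j else \<zero>\<^bsub>N\<^esub>)"
      using assms(3) by (intro N.M.finsum_cong') (auto simp: free_basis_def)
    also have "\<dots> = c l"
      using that assms(3) by (intro N.M.finsum_singleton) auto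
    finally show ?thesis .
  qed
  then show ?thesis using f that[of f] by (simp add: f_def)
qed

declare free_module_simps [simp del]

lemma free_module_coord_hom:
  assumes "cring R" "l < n"
  shows "(\<lambda>v\<in>carrier (free_module R n). v l) \<in> mod_hom R (free_module R n) (scalar_module id R)"
proof -
  interpret R: cring R by fact
  interpret F: module R "free_module R n" using free_module_module[OF assms(1)] .
  show ?thesis
    by (rule mod_homI) (use assms(2) in \<open>auto simp: free_module_simps\<close>)
qed

lemma free_module_minus_coord:
  assumes "cring R" "l < n" "x \<in> carrier (free_module R n)" "y \<in> carrier (free_module R n)"
  shows "(x \<ominus>\<^bsub>free_module R n\<^esub> y) l = x l \<ominus>\<^bsub>R\<^esub> y l"
proof -
  interpret F: module R "free_module R n" using free_module_module[OF assms(1)] .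
  have "module R (scalar_module id R)" using assms(1) by (intro scalar_module_module) auto
  from mod_hom_minus[OF F.module_axioms this free_module_coord_hom[OF assms(1,2)] assms(3,4)]
  show ?thesis using assms by simp
qed

lemma (in abelian_group) minus_self [simp]: "x \<in> carrier G \<Longrightarrow> x \<ominus> x = \<zero>"
  by (simp add: minus_eq r_neg)

lemma (in abelian_group) minus_exchange:
  assumes "a \<in> carrier G" "b \<in> carrier G" "c \<in> carrier G" "d \<in> carrier G" "a \<ominus> b = c \<ominus> d"
  shows "c \<ominus> a = d \<ominus> b"
proof -
  have "c \<ominus> a = (c \<ominus> d) \<oplus> (d \<ominus> a)"
    using assms(1-4) by (simp add: minus_eq a_assoc r_neg2 r_neg1)
  also have "\<dots> = (a \<ominus> b) \<oplus> (d \<ominus> a)" by (simp only: assms(5))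
  also have "\<dots> = d \<ominus> b"
    using assms(1-4) by (simp add: minus_eq a_ac r_neg2 r_neg1)
  finally show ?thesis .
qed

lemma (in abelian_group) add_minus_cancel:
  assumes "a \<in> carrier G" "b \<in> carrier G"
  shows "a \<oplus> (b \<ominus> a) = b"
  using assms by (simp add: minus_eq a_lcomm[of a b] r_neg)

section \<open>Extension of homomorphisms from ideals with a regular element\<close>

text \<open>Baer's condition for injectivity, restricted to ideals that contain a regular element. These
  are the ideals for which the extension property can be read off from the residue field.\<close>

definition regular_injective ::
    "('r, 'k) ring_scheme \<Rightarrow> ('r, 'a, 'm) module_scheme \<Rightarrow> bool" where
  "regular_injective R E \<longleftrightarrow>
     (\<forall>J f. ideal J R \<and> (\<exists>u\<in>J. regular_elt R u) \<and> f \<in> mod_hom R ((scalar_module id R)\<lparr>carrier := J\<rparr>) E \<longrightarrow>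
        (\<exists>e\<in>carrier E. \<forall>x\<in>J. f x = x \<odot>\<^bsub>E\<^esub> e))"

lemma self_module: "cring R \<Longrightarrow> module R (scalar_module id R)"
  by (rule scalar_module_module) auto

lemma submodule_iff_ideal:
  assumes "cring R"
  shows "submodule J R (scalar_module id R) \<longleftrightarrow> ideal J R"
proof
  interpret R: cring R by fact
  interpret M: module R "scalar_module id R" using self_module[OF assms] .
  {
    assume J: "submodule J R (scalar_module id R)"
    note S = M.submoduleE[OF J] submodule_zero[OF M.module_axioms J]
    have "subgroup J (add_monoid R)"
      by (rule R.add.subgroupI) (use S in \<open>auto simp: a_inv_def[symmetric]\<close>)
    moreover have "a \<otimes>\<^bsub>R\<^esub> x \<in> J" if "a \<in> J" "x \<in> carrier R" for a x
      using S(4)[of x a] that R.m_comm[of x a] subsetD[OF S(1)] by auto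
    ultimately show "ideal J R"
      by (intro idealI R.ring_axioms) (use S in auto)
  next
    assume "ideal J R"
    then interpret J: ideal J R .
    show "submodule J R (scalar_module id R)"
      by (rule M.submoduleI) (auto simp: J.I_l_closed)
  }
qed

lemma free_module_a_inv_coord:
  assumes "cring R" "l < n" "x \<in> carrier (free_module R n)"
  shows "(\<ominus>\<^bsub>free_module R n\<^esub> x) l = \<ominus>\<^bsub>R\<^esub> x l"
proof -
  interpret R: cring R by fact
  interpret F: module R "free_module R n" using free_module_module[OF assms(1)] .
  have "(\<zero>\<^bsub>free_module R n\<^esub> \<ominus>\<^bsub>free_module R n\<^esub> x) l = \<zero>\<^bsub>R\<^esub> \<ominus>\<^bsub>R\<^esub> x l"
    using assms by (simp add: free_module_minus_coord free_module_zero_coord)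
  then show ?thesis using assms free_module_coord_closed[OF assms(3,2)] by (simp add: F.M.minus_eq R.minus_eq)
qed

text \<open>The condition for ideals implies the extension property for a submodule \<open>P\<close> of a free module
  that contains a regular multiple of it. The extension is built one coordinate at a time: the
  \<open>k\<close>-th coordinates of the elements of \<open>P\<close> whose later coordinates vanish form an ideal, and
  it contains \<open>u\<close>.\<close>

lemma regular_injective_extend:
  assumes "cring R" "module R E" "regular_injective R E" "submodule P R (free_module R n)"
    and u: "regular_elt R u" "\<And>x. x \<in> carrier (free_module R n) \<Longrightarrow> u \<odot>\<^bsub>free_module R n\<^esub> x \<in> P"
    and g: "g \<in> mod_hom R ((free_module R n)\<lparr>carrier := P\<rparr>) E"
  obtains h where "h \<in> mod_hom R (free_module R n) E" "\<And>x. x \<in> P \<Longrightarrow> h x = g x"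
proof -
  interpret R: cring R by fact
  interpret E: module R E by fact
  interpret SR: module R "scalar_module id R" using self_module[OF assms(1)] .
  let ?F = "free_module R n"
  interpret F: module R ?F using free_module_module[OF assms(1)] .
  have uc: "u \<in> carrier R" using u(1) by (simp add: regular_elt_def)
  note P = F.submoduleE[OF assms(4)] submodule_zero[OF F.module_axioms assms(4)]
    submodule_minus[OF F.module_axioms assms(4)]
  note Pc = subsetD[OF P(1)]
  have PM: "module R (?F\<lparr>carrier := P\<rparr>)" using submodule.submodule_is_module[OF assms(4) F.module_axioms] .
  note coord = free_module_coord_closed[of _ R n]
  have "\<exists>h\<in>mod_hom R ?F E. \<forall>x\<in>P. (\<forall>l. k \<le> l \<and> l < n \<longrightarrow> x l = \<zero>\<^bsub>R\<^esub>) \<longrightarrow> h x = g x" if "k \<le> n" for k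
    using that
  proof (induction k)
    case 0
    show ?case
    proof (intro bexI[of _ "\<lambda>x\<in>carrier ?F. \<zero>\<^bsub>E\<^esub>"] ballI impI)
      fix x assume x: "x \<in> P" "\<forall>l. 0 \<le> l \<and> l < n \<longrightarrow> x l = \<zero>\<^bsub>R\<^esub>"
      have "x = \<zero>\<^bsub>?F\<^esub>"
        by (rule free_module_eqI[OF Pc F.M.zero_closed]) (use x in \<open>auto simp: free_module_zero_coord\<close>)
      moreover have "g \<zero>\<^bsub>?F\<^esub> = \<zero>\<^bsub>E\<^esub>" using mod_hom_zero[OF PM assms(2) g] by simp
      ultimately show "(\<lambda>x\<in>carrier ?F. \<zero>\<^bsub>E\<^esub>) x = g x" by simp
    qed (auto intro!: mod_homI)
  next
    case (Suc k)
    then have k: "k < n" by simp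
    obtain h where h: "h \<in> mod_hom R ?F E"
      and hx: "\<And>x. x \<in> P \<Longrightarrow> (\<And>l. k \<le> l \<Longrightarrow> l < n \<Longrightarrow> x l = \<zero>\<^bsub>R\<^esub>) \<Longrightarrow> h x = g x"
      using Suc by auto
    define L where "L = {x \<in> P. \<forall>l. Suc k \<le> l \<and> l < n \<longrightarrow> x l = \<zero>\<^bsub>R\<^esub>}"
    have LP: "L \<subseteq> P" by (auto simp: L_def)
    have L: "submodule L R ?F"
      by (rule F.submoduleI)
        (use P Pc coord in \<open>auto simp: L_def free_module_zero_coord free_module_add_coord
          free_module_smult_coord free_module_a_inv_coord[OF assms(1)]\<close>)
    have LM: "module R (?F\<lparr>carrier := L\<rparr>)" using submodule.submodule_is_module[OF L F.module_axioms] .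
    let ?c = "\<lambda>v\<in>carrier ?F. v k"
    note c = free_module_coord_hom[OF assms(1) k]
    define J where "J = ?c ` L"
    have J: "ideal J R"
      unfolding J_def submodule_iff_ideal[OF assms(1), symmetric]
      by (rule submodule_image[OF F.module_axioms SR.module_axioms c L])
    have "u \<odot>\<^bsub>?F\<^esub> free_basis R n k \<in> L"
      using u(2)[OF free_basis_closed[OF assms(1)]] uc
      by (auto simp: L_def free_module_smult_coord free_basis_def)
    moreover have "?c (u \<odot>\<^bsub>?F\<^esub> free_basis R n k) = u"
      using uc k free_basis_closed[OF assms(1), of n k]
      by (simp add: free_module_smult_coord) (simp add: free_basis_def)
    ultimately have uJ: "u \<in> J" unfolding J_def by (metis imageI)
    define g' where "g' = (\<lambda>x\<in>L. g x \<ominus>\<^bsub>E\<^esub> h x)"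
    have gc: "g x \<in> carrier E" if "x \<in> P" for x using mod_hom_closed[OF g] that by simp
    have gL: "restrict g L \<in> mod_hom R (?F\<lparr>carrier := L\<rparr>) E"
      using LP by (intro mod_homI) (use mod_hom_add[OF g] mod_hom_smult[OF g] F.submoduleE[OF L] gc in \<open>auto simp: subset_iff\<close>)
    have hL: "restrict h L \<in> mod_hom R (?F\<lparr>carrier := L\<rparr>) E"
      by (rule mod_hom_restrict[OF h L F.module_axioms])
    have g'_hom: "g' \<in> mod_hom R (?F\<lparr>carrier := L\<rparr>) E"
      using mod_hom_diff_hom[OF LM assms(2) gL hL] unfolding g'_def
      by (rule back_subst[of "\<lambda>f. f \<in> _"]) (auto intro!: restrict_ext)
    have cL: "restrict ?c L \<in> mod_hom R (?F\<lparr>carrier := L\<rparr>) ((scalar_module id R)\<lparr>carrier := J\<rparr>)"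
      by (rule mod_hom_codomain[OF mod_hom_restrict[OF c L F.module_axioms]]) (auto simp: J_def)
    have eq: "g' x = g' y" if xy: "x \<in> L" "y \<in> L" "x k = y k" for x y
    proof -
      have xyc: "x \<in> P" "y \<in> P" "x \<in> carrier ?F" "y \<in> carrier ?F" using xy LP Pc by auto
      have "x \<ominus>\<^bsub>?F\<^esub> y \<in> P" using P(8) xyc by simp
      moreover have "(x \<ominus>\<^bsub>?F\<^esub> y) l = \<zero>\<^bsub>R\<^esub>" if "k \<le> l" "l < n" for l
        using that xy xyc coord[OF xyc(4)]
        by (cases "l = k") (auto simp: free_module_minus_coord[OF assms(1)] L_def R.minus_eq R.r_neg)
      ultimately have "h (x \<ominus>\<^bsub>?F\<^esub> y) = g (x \<ominus>\<^bsub>?F\<^esub> y)" using hx by blast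
      moreover have "g (x \<ominus>\<^bsub>?F\<^esub> y) = g x \<ominus>\<^bsub>E\<^esub> g y"
      proof -
        have "g x = g (x \<ominus>\<^bsub>?F\<^esub> y) \<oplus>\<^bsub>E\<^esub> g y"
          using mod_hom_add[OF g, of "x \<ominus>\<^bsub>?F\<^esub> y" y] xyc \<open>x \<ominus>\<^bsub>?F\<^esub> y \<in> P\<close>
          by (simp add: F.M.minus_eq F.M.a_assoc F.M.l_neg)
        then show ?thesis using gc xyc \<open>x \<ominus>\<^bsub>?F\<^esub> y \<in> P\<close>
          by (simp add: E.M.minus_eq E.M.a_assoc E.M.r_neg)
      qed
      ultimately have "h x \<ominus>\<^bsub>E\<^esub> h y = g x \<ominus>\<^bsub>E\<^esub> g y"
        using mod_hom_minus[OF F.module_axioms assms(2) h] xyc by simp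
      then show ?thesis
        using xy E.M.minus_exchange[OF mod_hom_closed[OF h xyc(3)] mod_hom_closed[OF h xyc(4)] gc[OF xyc(1)] gc[OF xyc(2)]]
        by (simp add: g'_def)
    qed
    have cx: "restrict ?c L x = x k" if "x \<in> L" for x using that Pc[OF subsetD[OF LP that]] by simp
    have im: "restrict ?c L ` L = J" unfolding J_def by (rule image_cong) simp_all
    obtain f where f: "f \<in> mod_hom R ((scalar_module id R)\<lparr>carrier := J\<rparr>) E"
      and fx': "\<And>x. x \<in> carrier (?F\<lparr>carrier := L\<rparr>) \<Longrightarrow> f (restrict ?c L x) = g' x"
    proof (rule mod_hom_factor[OF LM cL _ g'_hom])
      show "restrict ?c L ` carrier (?F\<lparr>carrier := L\<rparr>) = carrier ((scalar_module id R)\<lparr>carrier := J\<rparr>)"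
        using im by simp
      fix x y assume "x \<in> carrier (?F\<lparr>carrier := L\<rparr>)" "y \<in> carrier (?F\<lparr>carrier := L\<rparr>)"
        "restrict ?c L x = restrict ?c L y"
      then have "x \<in> L" "y \<in> L" "x k = y k" using cx by simp_all
      then show "g' x = g' y" by (rule eq)
    qed blast
    have fx: "f (x k) = g' x" if "x \<in> L" for x using fx'[of x] cx[OF that] that by simp
    obtain e where e: "e \<in> carrier E" "\<And>b. b \<in> J \<Longrightarrow> f b = b \<odot>\<^bsub>E\<^esub> e"
      using assms(3) J uJ u(1) f unfolding regular_injective_def by blast
    have eh: "(\<lambda>v\<in>carrier ?F. v k \<odot>\<^bsub>E\<^esub> e) \<in> mod_hom R ?F E"
      by (rule mod_homI) (use e k coord in \<open>auto simp: free_module_add_coord free_module_smult_coord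
        E.smult_l_distr E.smult_assoc1\<close>)
    show ?case
    proof (intro bexI[OF _ mod_hom_add_hom[OF F.module_axioms assms(2) h eh]] ballI impI)
      fix x assume x: "x \<in> P" "\<forall>l. Suc k \<le> l \<and> l < n \<longrightarrow> x l = \<zero>\<^bsub>R\<^esub>"
      then have xL: "x \<in> L" by (simp add: L_def)
      have "x k \<in> J" using xL Pc[OF x(1)] unfolding J_def by (metis (no_types, lifting) imageI restrict_apply')
      then have "x k \<odot>\<^bsub>E\<^esub> e = g x \<ominus>\<^bsub>E\<^esub> h x" using e fx[OF xL] xL by (simp add: g'_def)
      then show "(\<lambda>x\<in>carrier ?F. h x \<oplus>\<^bsub>E\<^esub> (\<lambda>v\<in>carrier ?F. v k \<odot>\<^bsub>E\<^esub> e) x) x = g x"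
        using Pc[OF x(1)] E.M.add_minus_cancel[OF mod_hom_closed[OF h Pc[OF x(1)]] gc[OF x(1)]] by simp
    qed
  qed
  from this[of n] obtain h where "h \<in> mod_hom R ?F E"
    "\<forall>x\<in>P. (\<forall>l. n \<le> l \<and> l < n \<longrightarrow> x l = \<zero>\<^bsub>R\<^esub>) \<longrightarrow> h x = g x" by auto
  then show ?thesis by (intro that[of h]) auto
qed

lemma free_hom_with_values:
  assumes "cring R" "module R N" "\<And>l. c l \<in> carrier N"
  shows "\<exists>f\<in>mod_hom R (free_module R n) N. \<forall>l<n. f (free_basis R n l) = c l"
  by (rule free_hom_exists[OF assms(1,2), of n c]) (use assms(3) in auto)

section \<open>Total rings of fractions\<close>

text \<open>\<open>B\<close> with its total ring of fractions \<open>T\<close>. The theory is developed for an embedding \<open>\<iota>\<close>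
  that need not be an inclusion, because it is applied both to \<open>R \<subseteq> Q(R)\<close> and to the
  quotient of the Rees algebra.\<close>

locale fraction_ring =
  fixes B :: "('b, 'k) ring_scheme" and T :: "('t, 'n) ring_scheme" and \<iota> :: "'b \<Rightarrow> 't"
  assumes tfr: "total_fraction_ring B T \<iota>"
begin

sublocale B: cring B using tfr by (simp add: total_fraction_ring_def)
sublocale T: cring T using tfr by (simp add: total_fraction_ring_def)
sublocale iota: ring_hom_cring B T \<iota>
  using tfr by unfold_locales (simp add: total_fraction_ring_def)

lemma iota_inj: "x \<in> carrier B \<Longrightarrow> y \<in> carrier B \<Longrightarrow> \<iota> x = \<iota> y \<longleftrightarrow> x = y"
  using tfr by (auto simp: total_fraction_ring_def inj_on_def)

lemma regular_unit: "regular_elt B u \<Longrightarrow> \<iota> u \<in> Units T"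
  using tfr by (auto simp: total_fraction_ring_def)

lemma regular_closed: "regular_elt B u \<Longrightarrow> u \<in> carrier B"
  by (simp add: regular_elt_def)

lemma fraction:
  assumes "q \<in> carrier T"
  obtains r u where "r \<in> carrier B" "regular_elt B u" "q = \<iota> r \<otimes>\<^bsub>T\<^esub> inv\<^bsub>T\<^esub> (\<iota> u)"
  using tfr assms by (auto simp: total_fraction_ring_def)

lemma regular_cancel:
  assumes "regular_elt B u" "x \<in> carrier T" "y \<in> carrier T" "\<iota> u \<otimes>\<^bsub>T\<^esub> x = \<iota> u \<otimes>\<^bsub>T\<^esub> y"
  shows "x = y"
  using assms regular_unit by (metis T.Units_l_cancel)

lemma regular_cancel_ring:
  assumes "regular_elt B u" "x \<in> carrier B" "y \<in> carrier B" "u \<otimes>\<^bsub>B\<^esub> x = u \<otimes>\<^bsub>B\<^esub> y"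
  shows "x = y"
  using assms regular_cancel[of u "\<iota> x" "\<iota> y"] regular_closed iota_inj by (metis iota.hom_closed iota.hom_mult)

lemma inv_cancel:
  assumes "regular_elt B u" "x \<in> carrier T"
  shows "inv\<^bsub>T\<^esub> (\<iota> u) \<otimes>\<^bsub>T\<^esub> (\<iota> u \<otimes>\<^bsub>T\<^esub> x) = x" "\<iota> u \<otimes>\<^bsub>T\<^esub> (inv\<^bsub>T\<^esub> (\<iota> u) \<otimes>\<^bsub>T\<^esub> x) = x"
  using assms regular_unit[OF assms(1)] T.Units_closed T.Units_inv_closed
  by (metis T.Units_l_inv T.m_assoc T.l_one, metis T.Units_r_inv T.m_assoc T.l_one)

lemma regular_free_cancel:
  assumes "regular_elt B u" "x \<in> carrier (free_module B n)" "y \<in> carrier (free_module B n)"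
    "u \<odot>\<^bsub>free_module B n\<^esub> x = u \<odot>\<^bsub>free_module B n\<^esub> y"
  shows "x = y"
proof (rule free_module_eqI[OF assms(2,3)])
  fix l assume l: "l < n"
  have "u \<otimes>\<^bsub>B\<^esub> x l = u \<otimes>\<^bsub>B\<^esub> y l" using assms(4) l by (metis free_module_smult_coord)
  then show "x l = y l" using regular_cancel_ring assms l free_module_coord_closed by metis
qed

abbreviation "TM \<equiv> scalar_module \<iota> T"

lemma TM_module: "module B TM"
  by (rule scalar_module_module) (use B.cring_axioms T.cring_axioms iota.homh in auto)

sublocale TM: module B TM by (rule TM_module)

lemma TM_scale_hom:
  assumes "module B M" "t \<in> carrier T" "f \<in> mod_hom B M TM"
  shows "(\<lambda>x\<in>carrier M. t \<otimes>\<^bsub>T\<^esub> f x) \<in> mod_hom B M TM"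
proof -
  interpret M: module B M by fact
  have cl: "f x \<in> carrier T" if "x \<in> carrier M" for x using mod_hom_closed[OF assms(3) that] by simp
  show ?thesis
    by (rule mod_homI) (use cl assms(2) in \<open>auto simp: mod_hom_add[OF assms(3)] mod_hom_smult[OF assms(3)]
      T.r_distr T.m_lcomm\<close>)
qed

end

section \<open>Free resolutions of the residue field\<close>

text \<open>A free resolution of the residue field, together with a regular element \<open>u\<close> of the maximal
  ideal. Cohomology is taken with coefficients in the fractional ideal \<open>H\<close>, and maps to \<open>H\<close>
  are compared with maps to \<open>T\<close>.\<close>

locale residue_resolution = fraction_ring B T \<iota>
  for B :: "('b, 'k) ring_scheme" and T :: "('t, 'n) ring_scheme" and \<iota> :: "'b \<Rightarrow> 't" +
  fixes H :: "'t set" and nn :: "'b set" and n :: "nat \<Rightarrow> nat" and d and \<epsilon> and u :: 'b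
  assumes H: "submodule H B (scalar_module \<iota> T)"
    and nn: "maximalideal nn B"
    and u: "u \<in> nn" "regular_elt B u"
    and res: "free_resolution B (quot_module (scalar_module id B) nn) n d \<epsilon>"
begin

abbreviation "F i \<equiv> free_module B (n i)"
abbreviation "HM \<equiv> TM\<lparr>carrier := H\<rparr>"
abbreviation "SB \<equiv> scalar_module id B"
abbreviation "k \<equiv> quot_module SB nn"

sublocale nn: maximalideal nn B by (rule nn)
sublocale SB: module B SB by (rule self_module[OF B.cring_axioms])

lemma F_module: "module B (F i)" by (rule free_module_module[OF B.cring_axioms])
sublocale F: module B "F i" for i by (rule F_module)

lemma nn_sub: "submodule nn B SB" using submodule_iff_ideal[OF B.cring_axioms] nn.ideal_axioms by blast

lemma HM_module: "module B HM" by (rule submodule.submodule_is_module[OF H TM_module])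
sublocale HM: module B HM by (rule HM_module)

lemma H_closed: "x \<in> H \<Longrightarrow> x \<in> carrier T" using TM.submoduleE(1)[OF H] by auto

lemmas H_smult = TM.submoduleE(4)[OF H, simplified]
lemmas H_add = TM.submoduleE(5)[OF H, simplified]
lemmas H_minus = submodule_minus[OF TM_module H, simplified]
lemmas H_zero = submodule_zero[OF TM_module H, simplified]

lemma k_module: "module B k" by (rule quot_module_module[OF SB.module_axioms nn_sub])

lemma uc: "u \<in> carrier B" using u(2) by (rule regular_closed)

lemma d_hom: "d i \<in> mod_hom B (F (Suc i)) (F i)" and eps_hom: "\<epsilon> \<in> mod_hom B (F 0) k"
  and eps_surj: "\<epsilon> ` carrier (F 0) = carrier k"
  using res unfolding free_resolution_def by auto

lemma exact_0: "v \<in> carrier (F 0) \<Longrightarrow> \<epsilon> v = nn \<Longrightarrow> \<exists>w\<in>carrier (F (Suc 0)). d 0 w = v"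
  and eps_d: "w \<in> carrier (F (Suc 0)) \<Longrightarrow> \<epsilon> (d 0 w) = nn"
proof -
  have "d 0 ` carrier (F (Suc 0)) = {v \<in> carrier (F 0). \<epsilon> v = nn}"
    using res unfolding free_resolution_def One_nat_def quot_module_zero by (elim conjE)
  from eqset_imp_iff[OF this] show "v \<in> carrier (F 0) \<Longrightarrow> \<epsilon> v = nn \<Longrightarrow> \<exists>w\<in>carrier (F (Suc 0)). d 0 w = v"
    and "w \<in> carrier (F (Suc 0)) \<Longrightarrow> \<epsilon> (d 0 w) = nn"
    unfolding image_iff by (metis (mono_tags, lifting) mem_Collect_eq)+
qed

lemma exact: "v \<in> carrier (F (Suc i)) \<Longrightarrow> d i v = \<zero>\<^bsub>F i\<^esub> \<Longrightarrow> \<exists>w\<in>carrier (F (Suc (Suc i))). d (Suc i) w = v"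
  and dd: "w \<in> carrier (F (Suc (Suc i))) \<Longrightarrow> d i (d (Suc i) w) = \<zero>\<^bsub>F i\<^esub>"
proof -
  have "d (Suc i) ` carrier (F (Suc (Suc i))) = {v \<in> carrier (F (Suc i)). d i v = \<zero>\<^bsub>F i\<^esub>}"
    using res unfolding free_resolution_def by blast
  from eqset_imp_iff[OF this] show "v \<in> carrier (F (Suc i)) \<Longrightarrow> d i v = \<zero>\<^bsub>F i\<^esub> \<Longrightarrow> \<exists>w\<in>carrier (F (Suc (Suc i))). d (Suc i) w = v"
    and "w \<in> carrier (F (Suc (Suc i))) \<Longrightarrow> d i (d (Suc i) w) = \<zero>\<^bsub>F i\<^esub>"
    unfolding image_iff by (metis (mono_tags, lifting) mem_Collect_eq)+
qed

lemmas d_closed = mod_hom_closed[OF d_hom]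
lemmas d_smult = mod_hom_smult[OF d_hom]
lemmas d_minus = mod_hom_minus[OF F_module F_module d_hom]

lemma eps_coset:
  assumes "x \<in> carrier (F 0)"
  obtains r where "r \<in> carrier B" "\<epsilon> x = nn +>\<^bsub>B\<^esub> r"
  using mod_hom_closed[OF eps_hom assms] by (auto simp: quot_module_carrier)

lemmas k_smult = quot_module_smult[OF SB.module_axioms nn_sub, simplified]
lemmas k_eq_iff = coset_eq_iff[OF SB.module_axioms nn_sub, simplified]
lemmas k_zero_iff = coset_zero_iff[OF SB.module_axioms nn_sub, simplified]

lemma eps_nn:
  assumes "x \<in> carrier (F 0)" "r \<in> nn"
  shows "\<epsilon> (r \<odot>\<^bsub>F 0\<^esub> x) = nn"
proof -
  obtain s where s: "s \<in> carrier B" "\<epsilon> x = nn +>\<^bsub>B\<^esub> s" using eps_coset[OF assms(1)] .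
  have r: "r \<in> carrier B" using assms(2) nn.Icarr by auto
  have "\<epsilon> (r \<odot>\<^bsub>F 0\<^esub> x) = nn +>\<^bsub>B\<^esub> (r \<otimes>\<^bsub>B\<^esub> s)"
    using s r assms by (simp add: mod_hom_smult[OF eps_hom] k_smult)
  also have "\<dots> = nn" using s r assms by (simp add: k_zero_iff nn.I_r_closed)
  finally show ?thesis .
qed

text \<open>As \<open>u\<close> annihilates the residue field, multiplication by \<open>u\<close> on the resolution is homotopic
  to zero. The consequence recorded here is that, on the image of \<open>d\<close>, the composite of the
  homotopy with \<open>d\<close> is multiplication by \<open>u\<close>. In degree zero it holds on the whole of \<open>F 0\<close>.\<close>

lemma homotopy:
  obtains s where "s \<in> mod_hom B (F j) (F (Suc j))"
    "\<And>v. v \<in> carrier (F (Suc j)) \<Longrightarrow> d j (s (d j v)) = u \<odot>\<^bsub>F j\<^esub> d j v"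
    "\<And>x. j = 0 \<Longrightarrow> x \<in> carrier (F 0) \<Longrightarrow> d 0 (s x) = u \<odot>\<^bsub>F 0\<^esub> x"
proof -
  have "\<exists>s\<in>mod_hom B (F j) (F (Suc j)).
    (\<forall>v\<in>carrier (F (Suc j)). d j (s (d j v)) = u \<odot>\<^bsub>F j\<^esub> d j v) \<and>
    (j = 0 \<longrightarrow> (\<forall>x\<in>carrier (F 0). d 0 (s x) = u \<odot>\<^bsub>F 0\<^esub> x))"
  proof (induction j)
    case 0
    have "\<exists>w\<in>carrier (F (Suc 0)). d 0 w = u \<odot>\<^bsub>F 0\<^esub> free_basis B (n 0) l" for l
      using free_basis_closed[OF B.cring_axioms] uc u by (intro exact_0 eps_nn) auto
    then obtain c where c: "\<And>l. c l \<in> carrier (F (Suc 0))" "\<And>l. d 0 (c l) = u \<odot>\<^bsub>F 0\<^esub> free_basis B (n 0) l"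
      by metis
    obtain s where s: "s \<in> mod_hom B (F 0) (F (Suc 0))" "\<And>l. l < n 0 \<Longrightarrow> s (free_basis B (n 0) l) = c l"
      using free_hom_with_values[of B "F (Suc 0)" c "n 0", OF B.cring_axioms F_module c(1)] by (elim bexE) simp
    have "(\<lambda>x\<in>carrier (F 0). d 0 (s x)) = (\<lambda>x\<in>carrier (F 0). u \<odot>\<^bsub>F 0\<^esub> x)"
      by (rule free_hom_eqI[OF B.cring_axioms F_module mod_hom_comp[OF s(1) d_hom F_module]
            mod_hom_smult_id[OF F_module uc]])
         (use s c free_basis_closed[OF B.cring_axioms] in simp)
    then have "d 0 (s x) = u \<odot>\<^bsub>F 0\<^esub> x" if "x \<in> carrier (F 0)" for x
      using that by (metis (no_types, lifting) restrict_apply')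
    then show ?case using s(1) d_closed by blast
  next
    case (Suc j)
    then obtain s where s: "s \<in> mod_hom B (F j) (F (Suc j))"
      "\<And>v. v \<in> carrier (F (Suc j)) \<Longrightarrow> d j (s (d j v)) = u \<odot>\<^bsub>F j\<^esub> d j v" by blast
    let ?y = "\<lambda>x\<in>carrier (F (Suc j)). (\<lambda>x\<in>carrier (F (Suc j)). u \<odot>\<^bsub>F (Suc j)\<^esub> x) x
       \<ominus>\<^bsub>F (Suc j)\<^esub> (\<lambda>x\<in>carrier (F (Suc j)). s (d j x)) x"
    have y: "?y \<in> mod_hom B (F (Suc j)) (F (Suc j))"
      by (rule mod_hom_diff_hom[OF F_module F_module mod_hom_smult_id[OF F_module uc]
            mod_hom_comp[OF d_hom s(1) F_module]])
    have "\<exists>w\<in>carrier (F (Suc (Suc j))). d (Suc j) w = ?y (free_basis B (n (Suc j)) l)" for l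
    proof (rule exact)
      let ?b = "free_basis B (n (Suc j)) l"
      have b: "?b \<in> carrier (F (Suc j))" by (rule free_basis_closed[OF B.cring_axioms])
      show "?y ?b \<in> carrier (F (Suc j))" using mod_hom_closed[OF y b] .
      have sb: "s (d j ?b) \<in> carrier (F (Suc j))" using b by (intro mod_hom_closed[OF s(1)] d_closed)
      then show "d j (?y ?b) = \<zero>\<^bsub>F j\<^esub>"
        using b s(2)[OF b] uc d_closed[OF b]
        by (simp add: d_minus d_smult F.smult_closed)
    qed
    then obtain c where c: "\<And>l. c l \<in> carrier (F (Suc (Suc j)))"
      "\<And>l. d (Suc j) (c l) = ?y (free_basis B (n (Suc j)) l)"
      by metis
    obtain s' where s': "s' \<in> mod_hom B (F (Suc j)) (F (Suc (Suc j)))"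
      "\<And>l. l < n (Suc j) \<Longrightarrow> s' (free_basis B (n (Suc j)) l) = c l"
      using free_hom_with_values[of B "F (Suc (Suc j))" c "n (Suc j)", OF B.cring_axioms F_module c(1)] by (elim bexE) simp
    have eq: "(\<lambda>x\<in>carrier (F (Suc j)). d (Suc j) (s' x)) = ?y"
      by (rule free_hom_eqI[OF B.cring_axioms F_module mod_hom_comp[OF s'(1) d_hom F_module] y])
         (use s' c free_basis_closed[OF B.cring_axioms] in \<open>simp only: restrict_apply'\<close>)
    have "d (Suc j) (s' (d (Suc j) v)) = u \<odot>\<^bsub>F (Suc j)\<^esub> d (Suc j) v"
      if v: "v \<in> carrier (F (Suc (Suc j)))" for v
    proof -
      have dv: "d (Suc j) v \<in> carrier (F (Suc j))" using d_closed[OF v] .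
      have "d (Suc j) (s' (d (Suc j) v)) = ?y (d (Suc j) v)"
        using fun_cong[OF eq, of "d (Suc j) v"] dv by (simp only: restrict_apply')
      then show ?thesis using dv uc
        by (simp add: dd[OF v] mod_hom_zero[OF F_module F_module s(1)] F.M.minus_eq F.smult_closed)
    qed
    then show ?case using s'(1) by blast
  qed
  then show ?thesis using that by blast
qed

text \<open>The cohomology with coefficients in \<open>T\<close> vanishes in positive degrees: the homotopy shows
  that \<open>u\<close> kills it, and \<open>u\<close> acts on it bijectively. Dividing the composite with the homotopy
  by \<open>u\<close> gives the lift.\<close>

lemma cocycle_lift:
  assumes "\<phi> \<in> mod_hom B (F (Suc i)) TM"
    and "\<And>v. v \<in> carrier (F (Suc (Suc i))) \<Longrightarrow> \<phi> (d (Suc i) v) = \<zero>\<^bsub>T\<^esub>"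
  obtains \<psi> where "\<psi> \<in> mod_hom B (F i) TM" "\<And>v. v \<in> carrier (F (Suc i)) \<Longrightarrow> \<psi> (d i v) = \<phi> v"
proof -
  obtain s where s: "s \<in> mod_hom B (F i) (F (Suc i))"
    "\<And>v. v \<in> carrier (F (Suc i)) \<Longrightarrow> d i (s (d i v)) = u \<odot>\<^bsub>F i\<^esub> d i v"
    using homotopy[of i] by metis
  let ?\<psi> = "\<lambda>x\<in>carrier (F i). inv\<^bsub>T\<^esub> (\<iota> u) \<otimes>\<^bsub>T\<^esub> (\<lambda>x\<in>carrier (F i). \<phi> (s x)) x"
  have h: "?\<psi> \<in> mod_hom B (F i) TM"
    by (rule TM_scale_hom[OF F_module _ mod_hom_comp[OF s(1) assms(1) F_module]])
      (use regular_unit[OF u(2)] in auto)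
  have "?\<psi> (d i v) = \<phi> v" if v: "v \<in> carrier (F (Suc i))" for v
  proof -
    have sv: "s (d i v) \<in> carrier (F (Suc i))" using v by (intro mod_hom_closed[OF s(1)] d_closed)
    have uv: "u \<odot>\<^bsub>F (Suc i)\<^esub> v \<in> carrier (F (Suc i))" using v uc by (simp add: F.smult_closed)
    let ?w = "s (d i v) \<ominus>\<^bsub>F (Suc i)\<^esub> u \<odot>\<^bsub>F (Suc i)\<^esub> v"
    have "d i ?w = \<zero>\<^bsub>F i\<^esub>"
      using sv uv v uc d_closed[OF v] s(2)[OF v]
      by (simp add: d_minus d_smult F.smult_closed)
    then obtain w where "w \<in> carrier (F (Suc (Suc i)))" "d (Suc i) w = ?w"
      using exact[of ?w i] sv uv by auto
    then have "\<phi> ?w = \<zero>\<^bsub>T\<^esub>" using assms(2) by metis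
    then have "\<phi> (s (d i v)) \<ominus>\<^bsub>T\<^esub> \<phi> (u \<odot>\<^bsub>F (Suc i)\<^esub> v) = \<zero>\<^bsub>T\<^esub>"
      using mod_hom_minus[OF F_module TM_module assms(1) sv uv] by simp
    then have "\<phi> (s (d i v)) = \<phi> (u \<odot>\<^bsub>F (Suc i)\<^esub> v)"
      using mod_hom_closed[OF assms(1)] sv uv by simp
    also have "\<dots> = \<iota> u \<otimes>\<^bsub>T\<^esub> \<phi> v" using v uc by (simp add: mod_hom_smult[OF assms(1)])
    finally show ?thesis using d_closed[OF v] mod_hom_closed[OF assms(1) v] u(2) by (simp add: inv_cancel)
  qed
  with h show ?thesis using that by blast
qed

text \<open>A map that is in \<open>H\<close> on the kernel of \<open>d j\<close> induces a map from the image of \<open>d j\<close> to \<open>T/H\<close>.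
  For \<open>j > 0\<close> the image need not contain a regular multiple of \<open>F j\<close>, so the map is first
  transported along \<open>d j\<close> composed with the homotopy, which is defined on all of \<open>F j\<close> and is
  multiplication by \<open>u\<close> on the image. The set \<open>P\<close> of elements on which the transported map
  makes sense contains \<open>u F j\<close>.\<close>

lemma extend_modulo:
  assumes inj: "regular_injective B (quot_module TM H)"
    and psi: "\<psi> \<in> mod_hom B (F (Suc j)) TM"
    and ker: "\<And>v. v \<in> carrier (F (Suc j)) \<Longrightarrow> d j v = \<zero>\<^bsub>F j\<^esub> \<Longrightarrow> \<psi> v \<in> H"
  obtains \<chi> where "\<chi> \<in> mod_hom B (F j) TM"
    "\<And>v. v \<in> carrier (F (Suc j)) \<Longrightarrow> \<psi> v \<ominus>\<^bsub>T\<^esub> \<chi> (d j v) \<in> H"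
proof -
  let ?E = "quot_module TM H"
  have E: "module B ?E" by (rule quot_module_module[OF TM_module H])
  interpret E: module B ?E by (rule E)
  let ?pi = "\<lambda>x\<in>carrier TM. H +>\<^bsub>TM\<^esub> x"
  have pi: "?pi \<in> mod_hom B TM ?E" by (rule quot_proj_hom[OF TM_module H])
  have pi_eq: "?pi x = ?pi y \<longleftrightarrow> x \<ominus>\<^bsub>T\<^esub> y \<in> H" if "x \<in> carrier T" "y \<in> carrier T" for x y
    using that coset_eq_iff[OF TM_module H, of x y] by simp
  obtain s where s: "s \<in> mod_hom B (F j) (F (Suc j))"
    "\<And>v. v \<in> carrier (F (Suc j)) \<Longrightarrow> d j (s (d j v)) = u \<odot>\<^bsub>F j\<^esub> d j v"
    using homotopy[of j] by metis
  let ?p = "\<lambda>v\<in>carrier (F (Suc j)). u \<odot>\<^bsub>F j\<^esub> d j v"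
  have p: "?p \<in> mod_hom B (F (Suc j)) (F j)" by (rule mod_hom_smult_hom[OF F_module F_module d_hom uc])
  define S where "S = ?p ` carrier (F (Suc j))"
  have S: "submodule S B (F j)"
    unfolding S_def by (rule submodule_image[OF F_module F_module p F.carrier_is_submodule])
  have p': "?p \<in> mod_hom B (F (Suc j)) ((F j)\<lparr>carrier := S\<rparr>)"
    by (rule mod_hom_codomain[OF p]) (auto simp: S_def)
  note pipsi = mod_hom_comp[OF psi pi F_module]
  have eq: "?pi (\<psi> v) = ?pi (\<psi> w)"
    if v: "v \<in> carrier (F (Suc j))" "w \<in> carrier (F (Suc j))" "?p v = ?p w" for v w
  proof -
    have "d j v = d j w"
      by (rule regular_free_cancel[OF u(2) d_closed[OF v(1)] d_closed[OF v(2)]]) (use v in simp)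
    then have "d j (v \<ominus>\<^bsub>F (Suc j)\<^esub> w) = \<zero>\<^bsub>F j\<^esub>"
      using v d_closed by (simp add: d_minus)
    then have "\<psi> (v \<ominus>\<^bsub>F (Suc j)\<^esub> w) \<in> H" using v by (intro ker) auto
    then show ?thesis
      using v mod_hom_closed[OF psi] mod_hom_minus[OF F_module TM_module psi] pi_eq[of "\<psi> v" "\<psi> w"] by simp
  qed
  obtain g0 where g0: "g0 \<in> mod_hom B ((F j)\<lparr>carrier := S\<rparr>) ?E"
    and g0p': "\<And>v. v \<in> carrier (F (Suc j)) \<Longrightarrow> g0 (?p v) = (\<lambda>v\<in>carrier (F (Suc j)). ?pi (\<psi> v)) v"
  proof (rule mod_hom_factor[OF F_module p' _ pipsi])
    show "?p ` carrier (F (Suc j)) = carrier ((F j)\<lparr>carrier := S\<rparr>)" by (simp only: S_def, simp)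
    fix v w assume v: "v \<in> carrier (F (Suc j))" "w \<in> carrier (F (Suc j))" "?p v = ?p w"
    show "(\<lambda>v\<in>carrier (F (Suc j)). ?pi (\<psi> v)) v = (\<lambda>v\<in>carrier (F (Suc j)). ?pi (\<psi> v)) w"
      using eq[OF v] v(1,2) by (simp only: restrict_apply')
  qed blast
  have g0p: "g0 (?p v) = ?pi (\<psi> v)" if "v \<in> carrier (F (Suc j))" for v
    using g0p'[OF that] that by (simp only: restrict_apply')
  note ds = mod_hom_comp[OF s(1) d_hom F_module]
  define P where "P = {x \<in> carrier (F j). d j (s x) \<in> S}"
  have P: "submodule P B (F j)"
    using submodule_vimage[OF F_module F_module ds S]
    by (rule back_subst[of "\<lambda>A. submodule A B (F j)"]) (auto simp: P_def)
  have PM: "module B ((F j)\<lparr>carrier := P\<rparr>)" using submodule.submodule_is_module[OF P F_module] .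
  have dsP: "restrict (\<lambda>x. d j (s x)) P \<in> mod_hom B ((F j)\<lparr>carrier := P\<rparr>) ((F j)\<lparr>carrier := S\<rparr>)"
  proof (rule mod_hom_codomain)
    show "restrict (\<lambda>x. d j (s x)) P \<in> mod_hom B ((F j)\<lparr>carrier := P\<rparr>) (F j)"
      using mod_hom_restrict[OF ds P F_module]
      by (rule back_subst[of "\<lambda>f. f \<in> _"]) (auto simp: P_def intro!: restrict_ext)
  qed (auto simp: P_def)
  note g = mod_hom_comp[OF dsP g0 PM]
  have uP: "u \<odot>\<^bsub>F j\<^esub> x \<in> P" if x: "x \<in> carrier (F j)" for x
  proof -
    have sx: "s x \<in> carrier (F (Suc j))" using mod_hom_closed[OF s(1) x] .
    have "d j (s (u \<odot>\<^bsub>F j\<^esub> x)) = ?p (s x)"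
      using x uc sx by (simp add: mod_hom_smult[OF s(1)] d_smult)
    then show ?thesis using x uc sx by (auto simp: P_def S_def F.smult_closed)
  qed
  obtain h where h: "h \<in> mod_hom B (F j) ?E"
    and hP: "\<And>x. x \<in> P \<Longrightarrow> h x = (\<lambda>x\<in>carrier ((F j)\<lparr>carrier := P\<rparr>). g0 (restrict (\<lambda>x. d j (s x)) P x)) x"
    using regular_injective_extend[OF B.cring_axioms E inj P u(2) uP g] by metis
  have "\<exists>c\<in>carrier T. h (free_basis B (n j) l) = ?pi c" for l
    using mod_hom_closed[OF h free_basis_closed[OF B.cring_axioms, of "n j" l]] by (auto simp: quot_module_carrier)
  then obtain c where c: "\<And>l. c l \<in> carrier TM" "\<And>l. h (free_basis B (n j) l) = ?pi (c l)"
    unfolding scalar_module_simps by metis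
  obtain \<chi> where chi: "\<chi> \<in> mod_hom B (F j) TM" "\<And>l. l < n j \<Longrightarrow> \<chi> (free_basis B (n j) l) = c l"
    using free_hom_with_values[of B TM c "n j", OF B.cring_axioms TM_module c(1)] by (elim bexE) simp
  have hchi: "(\<lambda>x\<in>carrier (F j). ?pi (\<chi> x)) = h"
    by (rule free_hom_eqI[OF B.cring_axioms E mod_hom_comp[OF chi(1) pi F_module] h])
       (use chi c free_basis_closed[OF B.cring_axioms] in \<open>simp only: restrict_apply'\<close>)
  have "\<psi> v \<ominus>\<^bsub>T\<^esub> \<chi> (d j v) \<in> H" if v: "v \<in> carrier (F (Suc j))" for v
  proof -
    have dv: "d j v \<in> carrier (F j)" by (rule d_closed[OF v])
    have sdv: "d j (s (d j v)) = ?p v" using s(2)[OF v] v by simp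
    then have dP: "d j v \<in> P" using dv v by (auto simp: P_def S_def)
    have "?pi (\<chi> (d j v)) = h (d j v)" using fun_cong[OF hchi, of "d j v"] dv by (simp only: restrict_apply')
    also have "\<dots> = g0 (d j (s (d j v)))" using hP[OF dP] dP by simp
    also have "\<dots> = ?pi (\<psi> v)" using g0p[OF v] sdv by simp
    finally show ?thesis
      using pi_eq[of "\<psi> v" "\<chi> (d j v)"] mod_hom_closed[OF psi v] mod_hom_closed[OF chi(1) dv] by simp
  qed
  with chi(1) show ?thesis using that by blast
qed

text \<open>The dimension shift for
  \<open>0 \<rightarrow> H \<rightarrow> T \<rightarrow> T/H \<rightarrow> 0\<close> in terms of cochains:
  lift the cocycle to a map into \<open>T\<close>, extend this map modulo \<open>H\<close> by \<open>extend_modulo\<close>, and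
  subtract the extension.\<close>

lemma cocycle_is_coboundary:
  assumes inj: "regular_injective B (quot_module TM H)"
    and phi: "\<phi> \<in> mod_hom B (F (Suc (Suc j))) HM"
    and coc: "\<And>v. v \<in> carrier (F (Suc (Suc (Suc j)))) \<Longrightarrow> \<phi> (d (Suc (Suc j)) v) = \<zero>\<^bsub>T\<^esub>"
  obtains \<Phi> where "\<Phi> \<in> mod_hom B (F (Suc j)) HM"
    "\<And>v. v \<in> carrier (F (Suc (Suc j))) \<Longrightarrow> \<Phi> (d (Suc j) v) = \<phi> v"
proof -
  have phiT: "\<phi> \<in> mod_hom B (F (Suc (Suc j))) TM"
    by (rule mod_hom_codomain_incl[OF phi]) (use H_closed in auto)
  obtain \<psi> where psi: "\<psi> \<in> mod_hom B (F (Suc j)) TM"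
    "\<And>v. v \<in> carrier (F (Suc (Suc j))) \<Longrightarrow> \<psi> (d (Suc j) v) = \<phi> v"
    using cocycle_lift[OF phiT coc] by blast
  have "\<psi> v \<in> H" if "v \<in> carrier (F (Suc j))" "d j v = \<zero>\<^bsub>F j\<^esub>" for v
    using exact[OF that] psi(2) mod_hom_closed[OF phi] by auto
  then obtain \<chi> where chi: "\<chi> \<in> mod_hom B (F j) TM"
    "\<And>v. v \<in> carrier (F (Suc j)) \<Longrightarrow> \<psi> v \<ominus>\<^bsub>T\<^esub> \<chi> (d j v) \<in> H"
    using extend_modulo[OF inj psi(1)] by blast
  let ?c = "\<lambda>v\<in>carrier (F (Suc j)). \<chi> (d j v)"
  have c: "?c \<in> mod_hom B (F (Suc j)) TM" by (rule mod_hom_comp[OF d_hom chi(1) F_module])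
  let ?Phi = "\<lambda>v\<in>carrier (F (Suc j)). \<psi> v \<ominus>\<^bsub>TM\<^esub> ?c v"
  have "?Phi \<in> mod_hom B (F (Suc j)) HM"
    by (rule mod_hom_codomain[OF mod_hom_diff_hom[OF F_module TM_module psi(1) c]]) (use chi(2) in simp)
  moreover have "?Phi (d (Suc j) v) = \<phi> v" if v: "v \<in> carrier (F (Suc (Suc j)))" for v
    using d_closed[OF v] mod_hom_closed[OF phiT v]
    by (simp add: psi(2)[OF v] dd[OF v] mod_hom_zero[OF F_module TM_module chi(1)] T.minus_eq)
  ultimately show ?thesis using that by blast
qed

end

lemma (in module) submoduleI_linear:
  assumes "H \<subseteq> carrier M" "\<zero>\<^bsub>M\<^esub> \<in> H"
    and "\<And>x y. x \<in> H \<Longrightarrow> y \<in> H \<Longrightarrow> x \<oplus>\<^bsub>M\<^esub> y \<in> H"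
    and smult: "\<And>r x. r \<in> carrier R \<Longrightarrow> x \<in> H \<Longrightarrow> r \<odot>\<^bsub>M\<^esub> x \<in> H"
  shows "submodule H R M"
proof (rule submoduleI)
  fix x assume x: "x \<in> H"
  then have "\<ominus> \<one> \<odot>\<^bsub>M\<^esub> x \<in> H" by (intro smult) auto
  then show "\<ominus>\<^bsub>M\<^esub> x \<in> H" using x assms(1) by (simp add: smult_l_minus subsetD)
qed (use assms in auto)

section \<open>Ext of the residue field\<close>

context residue_resolution
begin

abbreviation "cocycles i \<equiv> ext_cocycles B n d HM i"
abbreviation "coboundaries i \<equiv> ext_coboundaries B n d HM i"
abbreviation "Z i \<equiv> (hom_module B (F i) HM)\<lparr>carrier := cocycles i\<rparr>"

lemma cocycle_iff:
  "\<phi> \<in> cocycles i \<longleftrightarrow> \<phi> \<in> mod_hom B (F i) HM \<and> (\<forall>v\<in>carrier (F (Suc i)). \<phi> (d i v) = \<zero>\<^bsub>T\<^esub>)"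
  by (simp add: ext_cocycles_def)

lemma HM_hom: "\<phi> \<in> mod_hom B (F i) HM \<Longrightarrow> \<phi> \<in> mod_hom B (F i) TM"
  by (rule mod_hom_codomain_incl) (use H_closed in auto)

lemma HM_closed: "\<phi> \<in> mod_hom B (F i) HM \<Longrightarrow> v \<in> carrier (F i) \<Longrightarrow> \<phi> v \<in> H"
  using mod_hom_closed[of \<phi> B "F i" HM v] by simp

lemma zero_hom: "(\<lambda>v\<in>carrier (F i). \<zero>\<^bsub>T\<^esub>) \<in> mod_hom B (F i) HM"
  by (rule mod_homI) (use H_zero in auto)

lemma hom_HM_module: "module B (hom_module B (F i) HM)"
  by (rule hom_module_module[OF F_module HM_module])

lemma cocycles_submodule: "submodule (cocycles i) B (hom_module B (F i) HM)"
proof -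
  interpret M: module B "hom_module B (F i) HM" by (rule hom_HM_module)
  show ?thesis
  proof (rule M.submoduleI_linear)
    show "cocycles i \<subseteq> carrier (hom_module B (F i) HM)" by (auto simp: cocycle_iff)
    show "\<zero>\<^bsub>hom_module B (F i) HM\<^esub> \<in> cocycles i"
      using zero_hom d_closed by (simp add: cocycle_iff)
  next
    fix x y assume xy: "x \<in> cocycles i" "y \<in> cocycles i"
    then show "x \<oplus>\<^bsub>hom_module B (F i) HM\<^esub> y \<in> cocycles i"
      using mod_hom_add_hom[OF F_module HM_module, of x i y] d_closed by (simp add: cocycle_iff)
  next
    fix r x assume rx: "r \<in> carrier B" "x \<in> cocycles i"
    then show "r \<odot>\<^bsub>hom_module B (F i) HM\<^esub> x \<in> cocycles i"
      using mod_hom_smult_hom[OF F_module HM_module, of x i r] d_closed by (simp add: cocycle_iff)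
  qed
qed

lemma Z_module: "module B (Z i)"
  by (rule submodule.submodule_is_module[OF cocycles_submodule hom_HM_module])

lemma coboundaries_submodule: "submodule (coboundaries i) B (Z i)"
proof (cases i)
  case 0
  interpret M: module B "Z 0" by (rule Z_module)
  have "(\<lambda>v\<in>carrier (F 0). \<zero>\<^bsub>T\<^esub>) \<in> cocycles 0"
    using zero_hom d_closed by (simp add: cocycle_iff)
  then show ?thesis unfolding 0
    by (intro M.submoduleI_linear) (auto intro!: restrict_ext)
next
  case (Suc j)
  interpret M: module B "Z (Suc j)" by (rule Z_module)
  let ?c = "\<lambda>\<psi>. \<lambda>v\<in>carrier (F (Suc j)). \<psi> (d j v)"
  have cob: "coboundaries i = ?c ` mod_hom B (F j) HM" by (simp add: Suc)
  have c: "?c \<psi> \<in> cocycles (Suc j)" if psi: "\<psi> \<in> mod_hom B (F j) HM" for \<psi>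
    unfolding cocycle_iff
    using mod_hom_comp[OF d_hom psi F_module] d_closed dd mod_hom_zero[OF F_module HM_module psi]
    by simp
  show ?thesis unfolding cob unfolding Suc
  proof (rule M.submoduleI_linear)
    show "?c ` mod_hom B (F j) HM \<subseteq> carrier (Z (Suc j))" using c by auto
    have "\<zero>\<^bsub>Z (Suc j)\<^esub> = ?c (\<lambda>v\<in>carrier (F j). \<zero>\<^bsub>T\<^esub>)"
      using d_closed by (auto intro!: restrict_ext)
    then show "\<zero>\<^bsub>Z (Suc j)\<^esub> \<in> ?c ` mod_hom B (F j) HM" using zero_hom by blast
  next
    fix x y assume "x \<in> ?c ` mod_hom B (F j) HM" "y \<in> ?c ` mod_hom B (F j) HM"
    then obtain f g where fg: "f \<in> mod_hom B (F j) HM" "x = ?c f" "g \<in> mod_hom B (F j) HM" "y = ?c g" by blast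
    have "x \<oplus>\<^bsub>Z (Suc j)\<^esub> y = ?c (\<lambda>v\<in>carrier (F j). f v \<oplus>\<^bsub>HM\<^esub> g v)"
      unfolding fg using d_closed by (auto intro!: restrict_ext)
    then show "x \<oplus>\<^bsub>Z (Suc j)\<^esub> y \<in> ?c ` mod_hom B (F j) HM"
      using mod_hom_add_hom[OF F_module HM_module fg(1,3)] by blast
  next
    fix r x assume r: "r \<in> carrier B" "x \<in> ?c ` mod_hom B (F j) HM"
    then obtain f where f: "f \<in> mod_hom B (F j) HM" "x = ?c f" by blast
    have "r \<odot>\<^bsub>Z (Suc j)\<^esub> x = ?c (\<lambda>v\<in>carrier (F j). r \<odot>\<^bsub>HM\<^esub> f v)"
      unfolding f using d_closed by (auto intro!: restrict_ext)
    then show "r \<odot>\<^bsub>Z (Suc j)\<^esub> x \<in> ?c ` mod_hom B (F j) HM"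
      using mod_hom_smult_hom[OF F_module HM_module f(1) r(1)] by blast
  qed
qed

lemma ext_trivial_iff:
  "carrier (ext_module B n d HM i) = {\<zero>\<^bsub>ext_module B n d HM i\<^esub>} \<longleftrightarrow> cocycles i \<subseteq> coboundaries i"
proof -
  note z = coset_zero_iff[OF Z_module coboundaries_submodule]
  have "\<zero>\<^bsub>Z i\<^esub> \<in> cocycles i" using submodule_zero[OF hom_HM_module cocycles_submodule] by simp
  then have "carrier (ext_module B n d HM i) = {coboundaries i} \<longleftrightarrow>
      (\<forall>x\<in>cocycles i. coboundaries i +>\<^bsub>Z i\<^esub> x = coboundaries i)"
    unfolding ext_module_def quot_module_carrier by auto
  also have "\<dots> \<longleftrightarrow> cocycles i \<subseteq> coboundaries i" using z[of _ i] by auto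
  finally show ?thesis by (simp add: ext_module_def)
qed

text \<open>A homomorphism from the residue field to \<open>H\<close> is zero, because \<open>u\<close> kills its values and is a
  unit in \<open>T\<close>.\<close>

lemma ext_0: "carrier (ext_module B n d HM 0) = {\<zero>\<^bsub>ext_module B n d HM 0\<^esub>}"
  unfolding ext_trivial_iff
proof
  fix \<phi> assume "\<phi> \<in> cocycles 0"
  then have phi: "\<phi> \<in> mod_hom B (F 0) TM" and c: "\<And>v. v \<in> carrier (F (Suc 0)) \<Longrightarrow> \<phi> (d 0 v) = \<zero>\<^bsub>T\<^esub>"
    using HM_hom by (auto simp: cocycle_iff)
  have "\<phi> x = \<zero>\<^bsub>T\<^esub>" if x: "x \<in> carrier (F 0)" for x
  proof -
    have ux: "u \<odot>\<^bsub>F 0\<^esub> x \<in> carrier (F 0)" using x uc by (rule F.smult_closed[rotated])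
    obtain w where "w \<in> carrier (F (Suc 0))" "d 0 w = u \<odot>\<^bsub>F 0\<^esub> x"
      using exact_0[OF ux eps_nn[OF x u(1)]] by blast
    then have "\<iota> u \<otimes>\<^bsub>T\<^esub> \<phi> x = \<zero>\<^bsub>T\<^esub>" using c mod_hom_smult[OF phi uc x] by fastforce
    then show ?thesis using regular_cancel[OF u(2), of "\<phi> x" "\<zero>\<^bsub>T\<^esub>"] mod_hom_closed[OF phi x] uc by simp
  qed
  then have "\<phi> = (\<lambda>v\<in>carrier (F 0). \<zero>\<^bsub>T\<^esub>)"
    by (intro mod_hom_eqI[OF phi zero_hom]) simp
  then show "\<phi> \<in> coboundaries 0" by simp
qed

lemma ext_ge_2:
  assumes "regular_injective B (quot_module TM H)"
  shows "carrier (ext_module B n d HM (Suc (Suc j))) = {\<zero>\<^bsub>ext_module B n d HM (Suc (Suc j))\<^esub>}"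
  unfolding ext_trivial_iff
proof
  fix \<phi> assume phi: "\<phi> \<in> cocycles (Suc (Suc j))"
  obtain \<Phi> where Phi: "\<Phi> \<in> mod_hom B (F (Suc j)) HM"
    "\<And>v. v \<in> carrier (F (Suc (Suc j))) \<Longrightarrow> \<Phi> (d (Suc j) v) = \<phi> v"
    using cocycle_is_coboundary[OF assms, of \<phi> j] phi unfolding cocycle_iff by blast
  have "\<phi> = (\<lambda>v\<in>carrier (F (Suc (Suc j))). \<Phi> (d (Suc j) v))"
    by (rule mod_hom_eqI[OF _ mod_hom_comp[OF d_hom Phi(1) F_module], of _ HM])
      (use phi Phi(2) in \<open>simp_all add: cocycle_iff\<close>)
  then show "\<phi> \<in> coboundaries (Suc (Suc j))" using Phi(1) by simp
qed

text \<open>The elements of \<open>T\<close> whose classes form the socle of \<open>T/H\<close>.\<close>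

definition "colon_nn = {q \<in> carrier T. \<forall>r\<in>nn. \<iota> r \<otimes>\<^bsub>T\<^esub> q \<in> H}"

text \<open>A lift of the augmentation to the ring, available as \<open>F 0\<close> is free.\<close>

lemma eps_lift:
  obtains \<rho> where "\<rho> \<in> mod_hom B (F 0) SB" "\<And>x. x \<in> carrier (F 0) \<Longrightarrow> \<epsilon> x = nn +>\<^bsub>B\<^esub> \<rho> x"
proof -
  let ?pi = "\<lambda>x\<in>carrier SB. nn +>\<^bsub>SB\<^esub> x"
  have pi: "?pi \<in> mod_hom B SB k" by (rule quot_proj_hom[OF SB.module_axioms nn_sub])
  have "\<exists>c\<in>carrier B. \<epsilon> (free_basis B (n 0) l) = nn +>\<^bsub>B\<^esub> c" for l
    using eps_coset[OF free_basis_closed[OF B.cring_axioms]] by metis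
  then obtain c where c: "\<And>l. c l \<in> carrier SB" "\<And>l. \<epsilon> (free_basis B (n 0) l) = nn +>\<^bsub>B\<^esub> c l"
    unfolding scalar_module_simps by metis
  obtain \<rho> where rho: "\<rho> \<in> mod_hom B (F 0) SB" "\<And>l. l < n 0 \<Longrightarrow> \<rho> (free_basis B (n 0) l) = c l"
    using free_hom_with_values[of B SB c "n 0", OF B.cring_axioms SB.module_axioms c(1)] by (elim bexE) simp
  have eq: "\<epsilon> = (\<lambda>x\<in>carrier (F 0). ?pi (\<rho> x))"
    by (rule free_hom_eqI[OF B.cring_axioms k_module eps_hom mod_hom_comp[OF rho(1) pi F_module]])
      (use rho c free_basis_closed[OF B.cring_axioms] in simp)
  have "\<epsilon> x = nn +>\<^bsub>B\<^esub> \<rho> x" if "x \<in> carrier (F 0)" for x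
    using fun_cong[OF eq, of x] that mod_hom_closed[OF rho(1) that] by simp
  with rho(1) show ?thesis using that by blast
qed

lemma unit_vector:
  obtains e where "e \<in> carrier (F 0)" "\<epsilon> e = nn +>\<^bsub>B\<^esub> \<one>\<^bsub>B\<^esub>"
proof -
  have "nn +>\<^bsub>B\<^esub> \<one>\<^bsub>B\<^esub> \<in> carrier k" by (auto simp: quot_module_carrier)
  then show ?thesis using that eps_surj by (metis imageE)
qed

lemma unit_vector_pair:
  obtains e w where "e \<in> carrier (F 0)" "\<epsilon> e = nn +>\<^bsub>B\<^esub> \<one>\<^bsub>B\<^esub>"
    "w \<in> carrier (F (Suc 0))" "d 0 w = u \<odot>\<^bsub>F 0\<^esub> e"
proof -
  obtain e where e: "e \<in> carrier (F 0)" "\<epsilon> e = nn +>\<^bsub>B\<^esub> \<one>\<^bsub>B\<^esub>" using unit_vector .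
  show ?thesis using that[OF e] exact_0[OF F.smult_closed[OF uc e(1)] eps_nn[OF e(1) u(1)]] by blast
qed

end

text \<open>A vector \<open>e\<close> of \<open>F 0\<close> over the unit of the residue field, and a witness \<open>w\<close> for the fact
  that \<open>ue\<close> is a boundary.\<close>

locale residue_resolution_unit = residue_resolution B T \<iota> H nn n d \<epsilon> u
  for B :: "('b, 'k) ring_scheme" and T :: "('t, 'n) ring_scheme" and \<iota> :: "'b \<Rightarrow> 't"
    and H nn n d \<epsilon> u +
  fixes e :: "nat \<Rightarrow> 'b" and w :: "nat \<Rightarrow> 'b"
  assumes e: "e \<in> carrier (F 0)" "\<epsilon> e = nn +>\<^bsub>B\<^esub> \<one>\<^bsub>B\<^esub>"
    and w: "w \<in> carrier (F (Suc 0))" "d 0 w = u \<odot>\<^bsub>F 0\<^esub> e"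
begin

text \<open>A cocycle of degree one is the restriction of a unique map \<open>\<psi>\<close> from \<open>F 0\<close> to \<open>T\<close>, and
  its class is determined by the value of \<open>\<psi>\<close> at \<open>e\<close>, which is the element below
  (\<open>socle_value_lift\<close>).\<close>

definition "socle_value \<phi> = inv\<^bsub>T\<^esub> (\<iota> u) \<otimes>\<^bsub>T\<^esub> \<phi> w"

lemma socle_value_lift:
  assumes "\<psi> \<in> mod_hom B (F 0) TM" "\<And>v. v \<in> carrier (F (Suc 0)) \<Longrightarrow> \<psi> (d 0 v) = \<phi> v"
  shows "socle_value \<phi> = \<psi> e"
proof -
  have "\<phi> w = \<iota> u \<otimes>\<^bsub>T\<^esub> \<psi> e"
    using assms(2)[OF w(1)] mod_hom_smult[OF assms(1) uc e(1)] by (simp add: w(2))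
  then show ?thesis using mod_hom_closed[OF assms(1) e(1)] u(2) by (simp add: socle_value_def inv_cancel)
qed

lemma nn_e:
  assumes "r \<in> nn"
  obtains v where "v \<in> carrier (F (Suc 0))" "d 0 v = r \<odot>\<^bsub>F 0\<^esub> e"
  using exact_0[OF F.smult_closed[OF nn.Icarr[OF assms] e(1)] eps_nn[OF e(1) assms]] by blast

lemma decompose:
  assumes "x \<in> carrier (F 0)"
  obtains r v where "r \<in> carrier B" "v \<in> carrier (F (Suc 0))" "x = r \<odot>\<^bsub>F 0\<^esub> e \<oplus>\<^bsub>F 0\<^esub> d 0 v"
proof -
  obtain r where r: "r \<in> carrier B" "\<epsilon> x = nn +>\<^bsub>B\<^esub> r" using eps_coset[OF assms] .
  have re: "r \<odot>\<^bsub>F 0\<^esub> e \<in> carrier (F 0)" by (rule F.smult_closed[OF r(1) e(1)])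
  interpret k: module B k by (rule k_module)
  have "\<epsilon> (r \<odot>\<^bsub>F 0\<^esub> e) = nn +>\<^bsub>B\<^esub> r" using r(1) by (simp add: mod_hom_smult[OF eps_hom r(1) e(1)] e(2) k_smult)
  then have "\<epsilon> (x \<ominus>\<^bsub>F 0\<^esub> r \<odot>\<^bsub>F 0\<^esub> e) = nn"
    using mod_hom_minus[OF F_module k_module eps_hom assms re] r mod_hom_closed[OF eps_hom assms] k.M.minus_self by simp
  then obtain v where v: "v \<in> carrier (F (Suc 0))" "d 0 v = x \<ominus>\<^bsub>F 0\<^esub> r \<odot>\<^bsub>F 0\<^esub> e"
    using exact_0[of "x \<ominus>\<^bsub>F 0\<^esub> r \<odot>\<^bsub>F 0\<^esub> e"] assms re by auto
  then have "x = r \<odot>\<^bsub>F 0\<^esub> e \<oplus>\<^bsub>F 0\<^esub> d 0 v" using F.M.add_minus_cancel[OF re assms] by simp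
  with r v show ?thesis using that by blast
qed

lemma lift_1:
  assumes "\<phi> \<in> cocycles (Suc 0)"
  shows "\<exists>\<psi>\<in>mod_hom B (F 0) TM. (\<forall>v\<in>carrier (F (Suc 0)). \<psi> (d 0 v) = \<phi> v) \<and> \<psi> e = socle_value \<phi>"
proof -
  have "\<phi> \<in> mod_hom B (F (Suc 0)) TM" using assms HM_hom by (auto simp: cocycle_iff)
  then obtain \<psi> where psi: "\<psi> \<in> mod_hom B (F 0) TM" "\<And>v. v \<in> carrier (F (Suc 0)) \<Longrightarrow> \<psi> (d 0 v) = \<phi> v"
    using cocycle_lift[of \<phi> 0] assms unfolding cocycle_iff by blast
  with socle_value_lift[OF psi] show ?thesis by (intro bexI[of _ \<psi>]) simp_all
qed

lemma socle_value_colon: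
  assumes "\<phi> \<in> cocycles (Suc 0)"
  shows "socle_value \<phi> \<in> colon_nn"
proof -
  obtain \<psi> where psi: "\<psi> \<in> mod_hom B (F 0) TM" "\<And>v. v \<in> carrier (F (Suc 0)) \<Longrightarrow> \<psi> (d 0 v) = \<phi> v"
    "\<psi> e = socle_value \<phi>" using lift_1[OF assms] by (elim bexE conjE) simp
  have "\<iota> r \<otimes>\<^bsub>T\<^esub> \<psi> e \<in> H" if r: "r \<in> nn" for r
  proof -
    obtain v where v: "v \<in> carrier (F (Suc 0))" "d 0 v = r \<odot>\<^bsub>F 0\<^esub> e" using nn_e[OF r] .
    have "\<iota> r \<otimes>\<^bsub>T\<^esub> \<psi> e = \<psi> (d 0 v)" using mod_hom_smult[OF psi(1) nn.Icarr[OF r] e(1)] v by simp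
    then show ?thesis using psi(2)[OF v(1)] HM_closed v(1) assms by (auto simp: cocycle_iff)
  qed
  then show ?thesis using psi(3) mod_hom_closed[OF psi(1) e(1)] by (simp add: colon_nn_def)
qed

lemma socle_value_coboundary:
  assumes "\<phi> \<in> cocycles (Suc 0)"
  shows "socle_value \<phi> \<in> H \<longleftrightarrow> \<phi> \<in> coboundaries (Suc 0)"
proof
  assume c: "socle_value \<phi> \<in> H"
  obtain \<psi> where psi: "\<psi> \<in> mod_hom B (F 0) TM" "\<And>v. v \<in> carrier (F (Suc 0)) \<Longrightarrow> \<psi> (d 0 v) = \<phi> v"
    "\<psi> e = socle_value \<phi>" using lift_1[OF assms] by (elim bexE conjE) simp
  have "\<psi> x \<in> H" if x: "x \<in> carrier (F 0)" for x
  proof -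
    obtain r v where rv: "r \<in> carrier B" "v \<in> carrier (F (Suc 0))" "x = r \<odot>\<^bsub>F 0\<^esub> e \<oplus>\<^bsub>F 0\<^esub> d 0 v"
      using decompose[OF x] .
    have "\<psi> x = \<iota> r \<otimes>\<^bsub>T\<^esub> \<psi> e \<oplus>\<^bsub>T\<^esub> \<phi> v"
      unfolding rv(3) using mod_hom_add[OF psi(1) F.smult_closed[OF rv(1) e(1)] d_closed[OF rv(2)]]
        mod_hom_smult[OF psi(1) rv(1) e(1)] psi(2)[OF rv(2)] by simp
    moreover have "\<phi> v \<in> H" using assms rv(2) HM_closed by (auto simp: cocycle_iff)
    ultimately show ?thesis using c rv(1) psi(3) by (simp add: H_add H_smult)
  qed
  then have psiH: "\<psi> \<in> mod_hom B (F 0) HM" by (rule mod_hom_codomain[OF psi(1)])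
  have "\<phi> = (\<lambda>v\<in>carrier (F (Suc 0)). \<psi> (d 0 v))"
    by (rule mod_hom_eqI[OF _ mod_hom_comp[OF d_hom psi(1) F_module], of _ HM])
      (use assms psi(2) in \<open>simp_all add: cocycle_iff\<close>)
  then show "\<phi> \<in> coboundaries (Suc 0)" using psiH by simp
next
  assume "\<phi> \<in> coboundaries (Suc 0)"
  then obtain \<psi> where psi: "\<psi> \<in> mod_hom B (F 0) HM" "\<phi> = (\<lambda>v\<in>carrier (F (Suc 0)). \<psi> (d 0 v))" by auto
  have "socle_value \<phi> = \<psi> e" by (rule socle_value_lift[OF HM_hom[OF psi(1)]]) (simp add: psi(2))
  then show "socle_value \<phi> \<in> H" using HM_closed[OF psi(1) e(1)] by simp
qed

text \<open>The cocycle comes from multiplying a lift \<open>\<rho>\<close> of the augmentation by \<open>q\<close>: on boundaries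
  \<open>\<rho>\<close> takes values in the maximal ideal, so the products lie in \<open>H\<close>.\<close>

lemma socle_value_surj:
  assumes "q \<in> colon_nn"
  obtains \<phi> where "\<phi> \<in> cocycles (Suc 0)" "socle_value \<phi> \<ominus>\<^bsub>T\<^esub> q \<in> H"
proof -
  have q: "q \<in> carrier T" "\<And>r. r \<in> nn \<Longrightarrow> \<iota> r \<otimes>\<^bsub>T\<^esub> q \<in> H" using assms by (auto simp: colon_nn_def)
  obtain \<rho> where rho: "\<rho> \<in> mod_hom B (F 0) SB" "\<And>x. x \<in> carrier (F 0) \<Longrightarrow> \<epsilon> x = nn +>\<^bsub>B\<^esub> \<rho> x"
    using eps_lift by blast
  have rc: "\<rho> x \<in> carrier B" if "x \<in> carrier (F 0)" for x using mod_hom_closed[OF rho(1) that] by simp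
  let ?psi = "\<lambda>x\<in>carrier (F 0). \<iota> (\<rho> x) \<otimes>\<^bsub>T\<^esub> q"
  have psi: "?psi \<in> mod_hom B (F 0) TM"
    by (rule mod_homI)
      (use q(1) rc in \<open>auto simp: mod_hom_add[OF rho(1)] mod_hom_smult[OF rho(1)] T.l_distr T.m_assoc\<close>)
  let ?phi = "\<lambda>v\<in>carrier (F (Suc 0)). ?psi (d 0 v)"
  have phi: "?phi \<in> mod_hom B (F (Suc 0)) TM" by (rule mod_hom_comp[OF d_hom psi F_module])
  have "\<rho> (d 0 v) \<in> nn" if v: "v \<in> carrier (F (Suc 0))" for v
    using rho(2)[OF d_closed[OF v]] eps_d[OF v] k_zero_iff[OF rc[OF d_closed[OF v]]] by metis
  then have phiH: "?phi \<in> mod_hom B (F (Suc 0)) HM"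
    by (intro mod_hom_codomain[OF phi]) (use q(2) d_closed in simp)
  have "?phi \<in> cocycles (Suc 0)"
    unfolding cocycle_iff using phiH dd d_closed mod_hom_zero[OF F_module TM_module psi] by simp
  moreover have "socle_value ?phi = ?psi e" by (rule socle_value_lift[OF psi]) simp
  moreover have "?psi e \<ominus>\<^bsub>T\<^esub> q \<in> H"
  proof -
    have "\<rho> e \<ominus>\<^bsub>B\<^esub> \<one>\<^bsub>B\<^esub> \<in> nn" using rho(2)[OF e(1)] e(2) k_eq_iff[OF rc[OF e(1)] B.one_closed] by metis
    then have "\<iota> (\<rho> e \<ominus>\<^bsub>B\<^esub> \<one>\<^bsub>B\<^esub>) \<otimes>\<^bsub>T\<^esub> q \<in> H" by (rule q(2))
    moreover have "\<iota> (\<rho> e \<ominus>\<^bsub>B\<^esub> \<one>\<^bsub>B\<^esub>) \<otimes>\<^bsub>T\<^esub> q = ?psi e \<ominus>\<^bsub>T\<^esub> q"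
      using q(1) rc[OF e(1)] e(1) by (simp add: B.minus_eq T.minus_eq T.l_distr T.l_minus)
    ultimately show ?thesis by simp
  qed
  ultimately show ?thesis using that by metis
qed

lemma socle_value_hom: "(\<lambda>\<phi>\<in>cocycles (Suc 0). socle_value \<phi>) \<in> mod_hom B (Z (Suc 0)) TM"
proof -
  have cl: "\<phi> w \<in> carrier T" if "\<phi> \<in> cocycles (Suc 0)" for \<phi>
    using that w(1) HM_closed H_closed by (auto simp: cocycle_iff)
  interpret Z: module B "Z (Suc 0)" by (rule Z_module)
  have i: "inv\<^bsub>T\<^esub> (\<iota> u) \<in> carrier T" using regular_unit[OF u(2)] by simp
  show ?thesis
  proof (rule mod_homI)
    fix x y assume xy: "x \<in> carrier (Z (Suc 0))" "y \<in> carrier (Z (Suc 0))"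
    then have "x \<oplus>\<^bsub>Z (Suc 0)\<^esub> y \<in> cocycles (Suc 0)" using Z.M.a_closed[OF xy] by simp
    then show "(\<lambda>\<phi>\<in>cocycles (Suc 0). socle_value \<phi>) (x \<oplus>\<^bsub>Z (Suc 0)\<^esub> y) =
      (\<lambda>\<phi>\<in>cocycles (Suc 0). socle_value \<phi>) x \<oplus>\<^bsub>TM\<^esub> (\<lambda>\<phi>\<in>cocycles (Suc 0). socle_value \<phi>) y"
      using xy w(1) cl i by (simp add: socle_value_def T.r_distr)
  next
    fix r x assume rx: "r \<in> carrier B" "x \<in> carrier (Z (Suc 0))"
    then have "r \<odot>\<^bsub>Z (Suc 0)\<^esub> x \<in> cocycles (Suc 0)" using Z.smult_closed[OF rx] by simp
    then show "(\<lambda>\<phi>\<in>cocycles (Suc 0). socle_value \<phi>) (r \<odot>\<^bsub>Z (Suc 0)\<^esub> x) =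
      r \<odot>\<^bsub>TM\<^esub> (\<lambda>\<phi>\<in>cocycles (Suc 0). socle_value \<phi>) x"
      using rx w(1) cl i by (simp add: socle_value_def T.m_lcomm)
  qed (use cl i in \<open>auto simp: socle_value_def\<close>)
qed

end

context residue_resolution_unit
begin

text \<open>By \<open>socle_value\<close>, \<open>Ext\<close> in degree one is the socle of \<open>T/H\<close>. If \<open>\<sigma>\<close> generates the
  socle and is not in \<open>H\<close>, the annihilator of its class is the maximal ideal, so the socle is
  a copy of the residue field.\<close>

lemma ext_1_iso:
  assumes sigma: "\<sigma> \<in> colon_nn" "\<sigma> \<notin> H"
    and gen: "\<And>q. q \<in> colon_nn \<Longrightarrow> \<exists>r\<in>carrier B. q \<ominus>\<^bsub>T\<^esub> \<iota> r \<otimes>\<^bsub>T\<^esub> \<sigma> \<in> H"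
  shows "mod_iso B (ext_module B n d HM (Suc 0)) k"
proof -
  have sT: "\<sigma> \<in> carrier T" using sigma(1) by (simp add: colon_nn_def)
  have mem: "\<iota> r \<otimes>\<^bsub>T\<^esub> \<sigma> \<in> H \<longleftrightarrow> r \<in> nn" if r: "r \<in> carrier B" for r
  proof
    assume "r \<in> nn" then show "\<iota> r \<otimes>\<^bsub>T\<^esub> \<sigma> \<in> H" using sigma(1) by (simp add: colon_nn_def)
  next
    assume rs: "\<iota> r \<otimes>\<^bsub>T\<^esub> \<sigma> \<in> H"
    define J where "J = {s \<in> carrier SB. (\<lambda>s\<in>carrier SB. \<iota> s \<otimes>\<^bsub>T\<^esub> \<sigma>) s \<in> H}"
    have mem: "s \<in> J \<longleftrightarrow> s \<in> carrier B \<and> \<iota> s \<otimes>\<^bsub>T\<^esub> \<sigma> \<in> H" for s by (auto simp: J_def)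
    have hom: "(\<lambda>s\<in>carrier SB. \<iota> s \<otimes>\<^bsub>T\<^esub> \<sigma>) \<in> mod_hom B SB TM"
      by (rule mod_homI) (use sT in \<open>auto simp: T.l_distr T.m_assoc\<close>)
    have J: "ideal J B"
      unfolding submodule_iff_ideal[OF B.cring_axioms, symmetric] J_def
      by (rule submodule_vimage[OF SB.module_axioms TM_module hom H])
    have "nn \<subseteq> J" using sigma(1) nn.Icarr mem by (simp add: colon_nn_def subset_iff)
    moreover have "J \<subseteq> carrier B" using mem by blast
    ultimately have "J = nn \<or> J = carrier B" by (rule nn.I_maximal[OF J])
    moreover have "\<one>\<^bsub>B\<^esub> \<notin> J" using sigma(2) sT mem by simp
    ultimately have "J = nn" using B.one_closed by metis
    then show "r \<in> nn" using r rs mem by metis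
  qed
  let ?E = "quot_module TM H"
  have E: "module B ?E" by (rule quot_module_module[OF TM_module H])
  let ?pi = "\<lambda>x\<in>carrier TM. H +>\<^bsub>TM\<^esub> x"
  have pi: "?pi \<in> mod_hom B TM ?E" by (rule quot_proj_hom[OF TM_module H])
  have pi_eq: "?pi x = ?pi y \<longleftrightarrow> x \<ominus>\<^bsub>T\<^esub> y \<in> H" if "x \<in> carrier T" "y \<in> carrier T" for x y
    using that coset_eq_iff[OF TM_module H, of x y] by simp
  let ?p = "\<lambda>r\<in>carrier SB. ?pi (\<iota> r \<otimes>\<^bsub>T\<^esub> \<sigma>)"
  have ms: "(\<lambda>s\<in>carrier SB. \<iota> s \<otimes>\<^bsub>T\<^esub> \<sigma>) \<in> mod_hom B SB TM"
    by (rule mod_homI) (use sT in \<open>auto simp: T.l_distr T.m_assoc\<close>)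
  have p: "?p \<in> mod_hom B SB ?E"
    using mod_hom_comp[OF ms pi SB.module_axioms]
    by (rule back_subst[of "\<lambda>f. f \<in> _"]) (auto intro!: restrict_ext)
  let ?M = "?p ` carrier SB"
  have p': "?p \<in> mod_hom B SB (?E\<lparr>carrier := ?M\<rparr>)"
    by (rule mod_hom_codomain[OF p]) blast
  have proj: "(\<lambda>x\<in>carrier SB. nn +>\<^bsub>SB\<^esub> x) \<in> mod_hom B SB k" by (rule quot_proj_hom[OF SB.module_axioms nn_sub])
  obtain f where f: "f \<in> mod_hom B (?E\<lparr>carrier := ?M\<rparr>) k"
    and fp: "\<And>r. r \<in> carrier SB \<Longrightarrow> f (?p r) = (\<lambda>x\<in>carrier SB. nn +>\<^bsub>SB\<^esub> x) r"
  proof (rule mod_hom_factor[OF SB.module_axioms p' _ proj])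
    show "?p ` carrier SB = carrier (?E\<lparr>carrier := ?M\<rparr>)" by simp
    fix r s assume rs: "r \<in> carrier SB" "s \<in> carrier SB" "?p r = ?p s"
    have "\<iota> (r \<ominus>\<^bsub>B\<^esub> s) \<otimes>\<^bsub>T\<^esub> \<sigma> = \<iota> r \<otimes>\<^bsub>T\<^esub> \<sigma> \<ominus>\<^bsub>T\<^esub> \<iota> s \<otimes>\<^bsub>T\<^esub> \<sigma>"
      using rs sT by (simp add: B.minus_eq T.minus_eq T.l_distr T.l_minus)
    also have "\<dots> \<in> H" using rs sT pi_eq[of "\<iota> r \<otimes>\<^bsub>T\<^esub> \<sigma>" "\<iota> s \<otimes>\<^bsub>T\<^esub> \<sigma>"] by simp
    finally have h: "\<iota> (r \<ominus>\<^bsub>B\<^esub> s) \<otimes>\<^bsub>T\<^esub> \<sigma> \<in> H" .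
    have "r \<ominus>\<^bsub>B\<^esub> s \<in> carrier B" using rs(1,2) by simp
    then have "r \<ominus>\<^bsub>B\<^esub> s \<in> nn" using mem h by blast
    then show "(\<lambda>x\<in>carrier SB. nn +>\<^bsub>SB\<^esub> x) r = (\<lambda>x\<in>carrier SB. nn +>\<^bsub>SB\<^esub> x) s"
      using rs k_eq_iff by simp
  qed blast
  let ?sv = "\<lambda>\<phi>\<in>cocycles (Suc 0). socle_value \<phi>"
  have piM: "\<exists>r\<in>carrier B. socle_value \<phi> \<ominus>\<^bsub>T\<^esub> \<iota> r \<otimes>\<^bsub>T\<^esub> \<sigma> \<in> H \<and> ?pi (socle_value \<phi>) = ?p r \<and>
      f (?pi (socle_value \<phi>)) = nn +>\<^bsub>B\<^esub> r" if phi: "\<phi> \<in> cocycles (Suc 0)" for \<phi>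
  proof -
    have c: "socle_value \<phi> \<in> colon_nn" by (rule socle_value_colon[OF phi])
    obtain r where r: "r \<in> carrier B" "socle_value \<phi> \<ominus>\<^bsub>T\<^esub> \<iota> r \<otimes>\<^bsub>T\<^esub> \<sigma> \<in> H" using gen[OF c] by blast
    then have "?pi (socle_value \<phi>) = ?p r"
      using pi_eq[of "socle_value \<phi>" "\<iota> r \<otimes>\<^bsub>T\<^esub> \<sigma>"] c sT by (simp add: colon_nn_def)
    then show ?thesis using r fp[of r] by auto
  qed
  have "(\<lambda>\<phi>\<in>carrier (Z (Suc 0)). ?pi (?sv \<phi>)) \<in> mod_hom B (Z (Suc 0)) (?E\<lparr>carrier := ?M\<rparr>)"
  proof (rule mod_hom_codomain[OF mod_hom_comp[OF socle_value_hom pi Z_module]])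
    fix \<phi> assume "\<phi> \<in> carrier (Z (Suc 0))"
    then show "(\<lambda>\<phi>\<in>carrier (Z (Suc 0)). ?pi (?sv \<phi>)) \<phi> \<in> ?M" using piM[of \<phi>] by auto
  qed
  note Theta = mod_hom_comp[OF this f Z_module]
  let ?Theta = "\<lambda>\<phi>\<in>carrier (Z (Suc 0)). f ((\<lambda>\<phi>\<in>carrier (Z (Suc 0)). ?pi (?sv \<phi>)) \<phi>)"
  have Theta_eq: "?Theta \<phi> = f (?pi (socle_value \<phi>))" if "\<phi> \<in> cocycles (Suc 0)" for \<phi>
    using that by simp
  show ?thesis unfolding ext_module_def
  proof (rule quot_module_mod_iso[OF Z_module coboundaries_submodule k_module Theta])
    show "?Theta ` carrier (Z (Suc 0)) = carrier k"
    proof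
      show "?Theta ` carrier (Z (Suc 0)) \<subseteq> carrier k" using mod_hom_closed[OF Theta] by blast
      show "carrier k \<subseteq> ?Theta ` carrier (Z (Suc 0))"
      proof
        fix C assume "C \<in> carrier k"
        then obtain r where r: "r \<in> carrier B" "C = nn +>\<^bsub>B\<^esub> r" by (auto simp: quot_module_carrier)
        have "\<iota> s \<otimes>\<^bsub>T\<^esub> (\<iota> r \<otimes>\<^bsub>T\<^esub> \<sigma>) \<in> H" if s: "s \<in> nn" for s
        proof -
          have "\<iota> s \<otimes>\<^bsub>T\<^esub> (\<iota> r \<otimes>\<^bsub>T\<^esub> \<sigma>) = \<iota> r \<otimes>\<^bsub>T\<^esub> (\<iota> s \<otimes>\<^bsub>T\<^esub> \<sigma>)"
            using nn.Icarr[OF s] r(1) sT by (intro T.m_lcomm) auto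
          then show ?thesis using H_smult[OF r(1)] sigma(1) s by (simp add: colon_nn_def)
        qed
        then have "\<iota> r \<otimes>\<^bsub>T\<^esub> \<sigma> \<in> colon_nn" using r(1) sT by (simp add: colon_nn_def)
        then obtain \<phi> where phi: "\<phi> \<in> cocycles (Suc 0)" "socle_value \<phi> \<ominus>\<^bsub>T\<^esub> \<iota> r \<otimes>\<^bsub>T\<^esub> \<sigma> \<in> H"
          using socle_value_surj by blast
        then have "?pi (socle_value \<phi>) = ?p r"
          using pi_eq[of "socle_value \<phi>" "\<iota> r \<otimes>\<^bsub>T\<^esub> \<sigma>"] r sT socle_value_colon[OF phi(1)] by (simp add: colon_nn_def)
        then have "?Theta \<phi> = C" using Theta_eq[OF phi(1)] fp[of r] r by simp
        then show "C \<in> ?Theta ` carrier (Z (Suc 0))" using phi(1) by force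
      qed
    qed
    fix \<phi> assume "\<phi> \<in> carrier (Z (Suc 0))"
    then have phi: "\<phi> \<in> cocycles (Suc 0)" by simp
    obtain r where r: "r \<in> carrier B" "socle_value \<phi> \<ominus>\<^bsub>T\<^esub> \<iota> r \<otimes>\<^bsub>T\<^esub> \<sigma> \<in> H"
      "f (?pi (socle_value \<phi>)) = nn +>\<^bsub>B\<^esub> r" using piM[OF phi] by blast
    have svT: "socle_value \<phi> \<in> carrier T" using socle_value_colon[OF phi] by (simp add: colon_nn_def)
    have "?Theta \<phi> = \<zero>\<^bsub>k\<^esub> \<longleftrightarrow> r \<in> nn" using Theta_eq[OF phi] r(1,3) k_zero_iff by simp
    also have "\<dots> \<longleftrightarrow> \<iota> r \<otimes>\<^bsub>T\<^esub> \<sigma> \<in> H" using mem[OF r(1)] by simp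
    also have "\<dots> \<longleftrightarrow> socle_value \<phi> \<in> H"
    proof
      assume a: "\<iota> r \<otimes>\<^bsub>T\<^esub> \<sigma> \<in> H"
      have "\<iota> r \<otimes>\<^bsub>T\<^esub> \<sigma> \<oplus>\<^bsub>T\<^esub> (socle_value \<phi> \<ominus>\<^bsub>T\<^esub> \<iota> r \<otimes>\<^bsub>T\<^esub> \<sigma>) \<in> H" by (rule H_add[OF a r(2)])
      then show "socle_value \<phi> \<in> H" using T.add_minus_cancel svT r(1) sT by simp
    next
      assume a: "socle_value \<phi> \<in> H"
      have "socle_value \<phi> \<ominus>\<^bsub>T\<^esub> (socle_value \<phi> \<ominus>\<^bsub>T\<^esub> \<iota> r \<otimes>\<^bsub>T\<^esub> \<sigma>) \<in> H" by (rule H_minus[OF a r(2)])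
      moreover have "socle_value \<phi> \<ominus>\<^bsub>T\<^esub> (socle_value \<phi> \<ominus>\<^bsub>T\<^esub> \<iota> r \<otimes>\<^bsub>T\<^esub> \<sigma>) = \<iota> r \<otimes>\<^bsub>T\<^esub> \<sigma>"
        using svT r(1) sT by (simp add: T.minus_eq T.minus_add T.r_neg1 T.r_neg2)
      ultimately show "\<iota> r \<otimes>\<^bsub>T\<^esub> \<sigma> \<in> H" by simp
    qed
    also have "\<dots> \<longleftrightarrow> \<phi> \<in> coboundaries (Suc 0)" by (rule socle_value_coboundary[OF phi])
    finally show "(?Theta \<phi> = \<zero>\<^bsub>k\<^esub>) = (\<phi> \<in> coboundaries (Suc 0))" .
  qed
qed

lemma ext_1_iso_imp_simple_socle:
  assumes "mod_iso B (ext_module B n d HM (Suc 0)) k"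
  shows "\<exists>\<sigma>\<in>colon_nn. \<sigma> \<notin> H \<and> (\<forall>q\<in>colon_nn. \<exists>r\<in>carrier B. q \<ominus>\<^bsub>T\<^esub> \<iota> r \<otimes>\<^bsub>T\<^esub> \<sigma> \<in> H)"
proof -
  let ?N = "coboundaries (Suc 0)" and ?Z = "Z (Suc 0)"
  note N = coboundaries_submodule[of "Suc 0"]
  interpret Z: module B ?Z by (rule Z_module)
  obtain f where f: "f \<in> mod_hom B (quot_module ?Z ?N) k"
    and bij: "bij_betw f (carrier (quot_module ?Z ?N)) (carrier k)"
    using assms unfolding mod_iso_def ext_module_def by blast
  have coset: "?N +>\<^bsub>?Z\<^esub> \<phi> \<in> carrier (quot_module ?Z ?N)" if "\<phi> \<in> cocycles (Suc 0)" for \<phi>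
    using that by (auto simp: quot_module_carrier)
  have E: "module B (quot_module ?Z ?N)" by (rule quot_module_module[OF Z_module N])
  have "nn +>\<^bsub>B\<^esub> \<one>\<^bsub>B\<^esub> \<in> carrier k" by (auto simp: quot_module_carrier)
  then have "nn +>\<^bsub>B\<^esub> \<one>\<^bsub>B\<^esub> \<in> f ` carrier (quot_module ?Z ?N)"
    using bij by (simp only: bij_betw_imp_surj_on)
  then obtain C where C: "C \<in> carrier (quot_module ?Z ?N)" "nn +>\<^bsub>B\<^esub> \<one>\<^bsub>B\<^esub> = f C"
    by (elim imageE)
  then obtain \<phi>1 where "\<phi>1 \<in> carrier ?Z" "C = ?N +>\<^bsub>?Z\<^esub> \<phi>1"
    unfolding quot_module_carrier by (elim imageE)
  then have phi1: "\<phi>1 \<in> cocycles (Suc 0)" "f (?N +>\<^bsub>?Z\<^esub> \<phi>1) = nn +>\<^bsub>B\<^esub> \<one>\<^bsub>B\<^esub>"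
    using C by simp_all
  let ?s = "socle_value \<phi>1"
  have sT: "?s \<in> carrier T" using socle_value_colon[OF phi1(1)] by (simp add: colon_nn_def)
  have "?s \<notin> H"
  proof
    assume "?s \<in> H"
    then have "\<phi>1 \<in> ?N" using socle_value_coboundary[OF phi1(1)] by simp
    then have "?N +>\<^bsub>?Z\<^esub> \<phi>1 = ?N" using coset_zero_iff[OF Z_module N, of \<phi>1] phi1(1) by simp
    then have "nn +>\<^bsub>B\<^esub> \<one>\<^bsub>B\<^esub> = nn"
      using phi1(2) mod_hom_zero[OF E k_module f] by simp
    then show False using k_zero_iff[of "\<one>\<^bsub>B\<^esub>"] nn.I_notcarr nn.one_imp_carrier by auto
  qed
  moreover have "\<exists>r\<in>carrier B. q \<ominus>\<^bsub>T\<^esub> \<iota> r \<otimes>\<^bsub>T\<^esub> ?s \<in> H" if q: "q \<in> colon_nn" for q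
  proof -
    obtain \<phi> where phi: "\<phi> \<in> cocycles (Suc 0)" "socle_value \<phi> \<ominus>\<^bsub>T\<^esub> q \<in> H" using socle_value_surj[OF q] .
    have svT: "socle_value \<phi> \<in> carrier T" using socle_value_colon[OF phi(1)] by (simp add: colon_nn_def)
    have "f (?N +>\<^bsub>?Z\<^esub> \<phi>) \<in> carrier k" using mod_hom_closed[OF f coset[OF phi(1)]] .
    then obtain r where "r \<in> carrier SB" "f (?N +>\<^bsub>?Z\<^esub> \<phi>) = nn +>\<^bsub>SB\<^esub> r"
      unfolding quot_module_carrier[of SB] by (elim imageE)
    then have r: "r \<in> carrier B" "f (?N +>\<^bsub>?Z\<^esub> \<phi>) = nn +>\<^bsub>B\<^esub> r" by simp_all
    have r1: "r \<odot>\<^bsub>?Z\<^esub> \<phi>1 \<in> carrier ?Z" using Z.smult_closed[OF r(1), of \<phi>1] phi1(1) by simp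
    have "f (?N +>\<^bsub>?Z\<^esub> (r \<odot>\<^bsub>?Z\<^esub> \<phi>1)) = f (r \<odot>\<^bsub>quot_module ?Z ?N\<^esub> (?N +>\<^bsub>?Z\<^esub> \<phi>1))"
      using quot_module_smult[OF Z_module N r(1), of \<phi>1] phi1(1) by simp
    also have "\<dots> = r \<odot>\<^bsub>k\<^esub> (nn +>\<^bsub>B\<^esub> \<one>\<^bsub>B\<^esub>)"
      using mod_hom_smult[OF f r(1) coset[OF phi1(1)]] phi1(2) by simp
    also have "\<dots> = f (?N +>\<^bsub>?Z\<^esub> \<phi>)" using r by (simp add: k_smult)
    finally have "?N +>\<^bsub>?Z\<^esub> (r \<odot>\<^bsub>?Z\<^esub> \<phi>1) = ?N +>\<^bsub>?Z\<^esub> \<phi>"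
      using bij coset[OF phi(1)] coset[of "r \<odot>\<^bsub>?Z\<^esub> \<phi>1"] r1 unfolding bij_betw_def inj_on_def by simp
    then have m: "\<phi> \<ominus>\<^bsub>?Z\<^esub> r \<odot>\<^bsub>?Z\<^esub> \<phi>1 \<in> ?N"
      using coset_eq_iff[OF Z_module N _ r1, of \<phi>] phi(1) by simp
    have mc: "\<phi> \<ominus>\<^bsub>?Z\<^esub> r \<odot>\<^bsub>?Z\<^esub> \<phi>1 \<in> cocycles (Suc 0)" using phi(1) r1 Z.M.minus_closed[of \<phi> "r \<odot>\<^bsub>?Z\<^esub> \<phi>1"] by simp
    let ?sv = "\<lambda>\<phi>\<in>cocycles (Suc 0). socle_value \<phi>"
    have "socle_value (\<phi> \<ominus>\<^bsub>?Z\<^esub> r \<odot>\<^bsub>?Z\<^esub> \<phi>1) = ?sv (\<phi> \<ominus>\<^bsub>?Z\<^esub> r \<odot>\<^bsub>?Z\<^esub> \<phi>1)" using mc by (simp only: restrict_apply')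
    also have "\<dots> = ?sv \<phi> \<ominus>\<^bsub>TM\<^esub> ?sv (r \<odot>\<^bsub>?Z\<^esub> \<phi>1)"
      by (rule mod_hom_minus[OF Z_module TM_module socle_value_hom _ r1]) (use phi(1) in simp)
    also have "?sv (r \<odot>\<^bsub>?Z\<^esub> \<phi>1) = r \<odot>\<^bsub>TM\<^esub> ?sv \<phi>1"
      by (rule mod_hom_smult[OF socle_value_hom r(1)]) (use phi1(1) in simp)
    also have "?sv \<phi> \<ominus>\<^bsub>TM\<^esub> r \<odot>\<^bsub>TM\<^esub> ?sv \<phi>1 = socle_value \<phi> \<ominus>\<^bsub>T\<^esub> \<iota> r \<otimes>\<^bsub>T\<^esub> ?s"
      using phi(1) phi1(1) by simp
    finally have sv: "socle_value (\<phi> \<ominus>\<^bsub>?Z\<^esub> r \<odot>\<^bsub>?Z\<^esub> \<phi>1) = socle_value \<phi> \<ominus>\<^bsub>T\<^esub> \<iota> r \<otimes>\<^bsub>T\<^esub> ?s" .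
    have "socle_value \<phi> \<ominus>\<^bsub>T\<^esub> \<iota> r \<otimes>\<^bsub>T\<^esub> ?s \<in> H"
      unfolding sv[symmetric] by (rule iffD2[OF socle_value_coboundary[OF mc] m])
    from H_minus[OF this phi(2)] have "(socle_value \<phi> \<ominus>\<^bsub>T\<^esub> \<iota> r \<otimes>\<^bsub>T\<^esub> ?s) \<ominus>\<^bsub>T\<^esub> (socle_value \<phi> \<ominus>\<^bsub>T\<^esub> q) \<in> H" .
    moreover have "(socle_value \<phi> \<ominus>\<^bsub>T\<^esub> \<iota> r \<otimes>\<^bsub>T\<^esub> ?s) \<ominus>\<^bsub>T\<^esub> (socle_value \<phi> \<ominus>\<^bsub>T\<^esub> q) = q \<ominus>\<^bsub>T\<^esub> \<iota> r \<otimes>\<^bsub>T\<^esub> ?s"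
      using svT r(1) sT q by (simp add: colon_nn_def T.minus_eq T.minus_add T.a_ac T.r_neg1 T.r_neg2)
    ultimately show ?thesis using r(1) by auto
  qed
  ultimately show ?thesis using socle_value_colon[OF phi1(1)] by blast
qed

text \<open>The connecting map in terms of cochains. Composing \<open>f\<close> with a lift \<open>\<rho>\<close> of the
  augmentation yields a map from \<open>F 1\<close> to \<open>T/H\<close>, which lifts to \<open>T\<close> as \<open>F 1\<close> is free. The
  coboundary of the lift is a cocycle with values in \<open>H\<close>. As \<open>Ext\<close> vanishes in degree two it
  is the coboundary of a map to \<open>H\<close>; after subtracting that map, \<open>cocycle_lift\<close> extends the
  lift to \<open>F 0\<close>, and its value at the unit vector represents \<open>f\<close>.\<close>

lemma hom_from_maximal_ideal:
  assumes ext2: "carrier (ext_module B n d HM (Suc (Suc 0))) = {\<zero>\<^bsub>ext_module B n d HM (Suc (Suc 0))\<^esub>}"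
    and f: "f \<in> mod_hom B (SB\<lparr>carrier := nn\<rparr>) (quot_module TM H)"
  shows "\<exists>t\<in>carrier (quot_module TM H). \<forall>r\<in>nn. f r = r \<odot>\<^bsub>quot_module TM H\<^esub> t"
proof -
  let ?E = "quot_module TM H"
  have E: "module B ?E" by (rule quot_module_module[OF TM_module H])
  interpret E: module B ?E by (rule E)
  let ?pi = "\<lambda>x\<in>carrier TM. H +>\<^bsub>TM\<^esub> x"
  have pi: "?pi \<in> mod_hom B TM ?E" by (rule quot_proj_hom[OF TM_module H])
  have pi_zero: "?pi x = H \<longleftrightarrow> x \<in> H" if "x \<in> carrier T" for x
    using that coset_zero_iff[OF TM_module H, of x] by simp
  have nnM: "module B (SB\<lparr>carrier := nn\<rparr>)" by (rule submodule.submodule_is_module[OF nn_sub SB.module_axioms])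
  have fc: "f r \<in> carrier ?E" if "r \<in> nn" for r using mod_hom_closed[OF f] that by simp
  obtain \<rho> where rho: "\<rho> \<in> mod_hom B (F 0) SB" "\<And>x. x \<in> carrier (F 0) \<Longrightarrow> \<epsilon> x = nn +>\<^bsub>B\<^esub> \<rho> x"
    using eps_lift by blast
  have rc: "\<rho> x \<in> carrier B" if "x \<in> carrier (F 0)" for x using mod_hom_closed[OF rho(1) that] by simp
  have rnn: "\<rho> (d 0 v) \<in> nn" if v: "v \<in> carrier (F (Suc 0))" for v
    using rho(2)[OF d_closed[OF v]] eps_d[OF v] k_zero_iff[OF rc[OF d_closed[OF v]]] by metis
  let ?r = "\<lambda>v\<in>carrier (F (Suc 0)). \<rho> (d 0 v)"
  have "?r \<in> mod_hom B (F (Suc 0)) (SB\<lparr>carrier := nn\<rparr>)"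
    by (rule mod_hom_codomain[OF mod_hom_comp[OF d_hom rho(1) F_module]]) (use rnn in simp)
  note fr = mod_hom_comp[OF this f F_module]
  let ?fr = "\<lambda>v\<in>carrier (F (Suc 0)). f (?r v)"
  have "\<exists>c\<in>carrier T. ?fr (free_basis B (n (Suc 0)) l) = ?pi c" for l
  proof -
    have "?fr (free_basis B (n (Suc 0)) l) \<in> carrier ?E"
      by (rule mod_hom_closed[OF fr free_basis_closed[OF B.cring_axioms]])
    then obtain c where "c \<in> carrier TM" "?fr (free_basis B (n (Suc 0)) l) = H +>\<^bsub>TM\<^esub> c"
      unfolding quot_module_carrier by (elim imageE)
    then show ?thesis by (intro bexI[of _ c]) simp_all
  qed
  then obtain c where c: "\<And>l. c l \<in> carrier TM" "\<And>l. ?fr (free_basis B (n (Suc 0)) l) = ?pi (c l)"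
    unfolding scalar_module_simps by metis
  obtain \<phi> where phi: "\<phi> \<in> mod_hom B (F (Suc 0)) TM" "\<And>l. l < n (Suc 0) \<Longrightarrow> \<phi> (free_basis B (n (Suc 0)) l) = c l"
    using free_hom_with_values[of B TM c "n (Suc 0)", OF B.cring_axioms TM_module c(1)] by (elim bexE) simp
  have pphi: "(\<lambda>x\<in>carrier (F (Suc 0)). ?pi (\<phi> x)) = ?fr"
    by (rule free_hom_eqI[OF B.cring_axioms E mod_hom_comp[OF phi(1) pi F_module] fr])
       (use phi c free_basis_closed[OF B.cring_axioms] in \<open>simp only: restrict_apply'\<close>)
  have pphi': "?pi (\<phi> v) = f (\<rho> (d 0 v))" if v: "v \<in> carrier (F (Suc 0))" for v
    using fun_cong[OF pphi, of v] v by (simp only: restrict_apply')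
  let ?q = "\<lambda>v\<in>carrier (F (Suc (Suc 0))). \<phi> (d (Suc 0) v)"
  have q: "?q \<in> mod_hom B (F (Suc (Suc 0))) TM" by (rule mod_hom_comp[OF d_hom phi(1) F_module])
  have "\<phi> (d (Suc 0) v) \<in> H" if v: "v \<in> carrier (F (Suc (Suc 0)))" for v
  proof -
    have "?pi (\<phi> (d (Suc 0) v)) = f \<zero>\<^bsub>B\<^esub>"
      using pphi'[OF d_closed[OF v]] dd[OF v] mod_hom_zero[OF F_module SB.module_axioms rho(1)] by simp
    also have "\<dots> = H" using mod_hom_zero[OF nnM E f] by simp
    finally show ?thesis using pi_zero[of "\<phi> (d (Suc 0) v)"] mod_hom_closed[OF phi(1) d_closed[OF v]] by simp
  qed
  then have "?q \<in> mod_hom B (F (Suc (Suc 0))) HM" by (intro mod_hom_codomain[OF q]) simp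
  then have "?q \<in> cocycles (Suc (Suc 0))"
    unfolding cocycle_iff using dd d_closed mod_hom_zero[OF F_module TM_module phi(1)] by simp
  then have "?q \<in> coboundaries (Suc (Suc 0))" using ext2 unfolding ext_trivial_iff by blast
  then obtain h where h: "h \<in> mod_hom B (F (Suc 0)) HM"
    "?q = (\<lambda>v\<in>carrier (F (Suc (Suc 0))). h (d (Suc 0) v))" by auto
  have hq: "h (d (Suc 0) v) = \<phi> (d (Suc 0) v)" if "v \<in> carrier (F (Suc (Suc 0)))" for v
    using fun_cong[OF h(2), of v] that by simp
  let ?th = "\<lambda>v\<in>carrier (F (Suc 0)). \<phi> v \<ominus>\<^bsub>TM\<^esub> h v"
  have th: "?th \<in> mod_hom B (F (Suc 0)) TM" by (rule mod_hom_diff_hom[OF F_module TM_module phi(1) HM_hom[OF h(1)]])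
  have "?th (d (Suc 0) v) = \<zero>\<^bsub>T\<^esub>" if v: "v \<in> carrier (F (Suc (Suc 0)))" for v
    using hq[OF v] d_closed[OF v] mod_hom_closed[OF phi(1) d_closed[OF v]] T.minus_self by simp
  then obtain \<psi> where psi: "\<psi> \<in> mod_hom B (F 0) TM" "\<And>v. v \<in> carrier (F (Suc 0)) \<Longrightarrow> \<psi> (d 0 v) = ?th v"
    using cocycle_lift[OF th] by blast
  have pc: "\<psi> e \<in> carrier T" using mod_hom_closed[OF psi(1) e(1)] by simp
  let ?t = "?pi (\<psi> e)"
  have tc: "?t \<in> carrier ?E" using mod_hom_closed[OF pi, of "\<psi> e"] pc by simp
  have re: "\<rho> e \<in> carrier B" by (rule rc[OF e(1)])
  have main: "f (r \<otimes>\<^bsub>B\<^esub> \<rho> e) = r \<odot>\<^bsub>?E\<^esub> ?t" if r: "r \<in> nn" for r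
  proof -
    have rB: "r \<in> carrier B" by (rule nn.Icarr[OF r])
    obtain v where v: "v \<in> carrier (F (Suc 0))" "d 0 v = r \<odot>\<^bsub>F 0\<^esub> e" using nn_e[OF r] .
    have hv: "h v \<in> H" by (rule HM_closed[OF h(1) v(1)])
    have pv: "\<phi> v \<in> carrier T" using mod_hom_closed[OF phi(1) v(1)] by simp
    have "r \<odot>\<^bsub>?E\<^esub> ?t = ?pi (\<psi> (d 0 v))"
      using mod_hom_smult[OF pi rB, of "\<psi> e"] mod_hom_smult[OF psi(1) rB e(1)] pc by (simp add: v(2))
    also have "\<psi> (d 0 v) = \<phi> v \<ominus>\<^bsub>T\<^esub> h v" using psi(2)[OF v(1)] v(1) by simp
    also have "?pi (\<phi> v \<ominus>\<^bsub>T\<^esub> h v) = ?pi (\<phi> v) \<ominus>\<^bsub>?E\<^esub> ?pi (h v)"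
      using mod_hom_minus[OF TM_module E pi, of "\<phi> v" "h v"] pv H_closed[OF hv] by simp
    also have "?pi (h v) = \<zero>\<^bsub>?E\<^esub>" using pi_zero[OF H_closed[OF hv]] hv by simp
    also have "?pi (\<phi> v) \<ominus>\<^bsub>?E\<^esub> \<zero>\<^bsub>?E\<^esub> = ?pi (\<phi> v)"
      using mod_hom_closed[OF pi, of "\<phi> v"] pv by (simp add: E.M.minus_eq del: quot_module_zero)
    also have "\<dots> = f (r \<otimes>\<^bsub>B\<^esub> \<rho> e)"
      using pphi'[OF v(1)] mod_hom_smult[OF rho(1) rB e(1)] by (simp add: v(2))
    finally show ?thesis by simp
  qed
  let ?s = "\<rho> e \<ominus>\<^bsub>B\<^esub> \<one>\<^bsub>B\<^esub>"
  have s: "?s \<in> nn" using rho(2)[OF e(1)] e(2) k_eq_iff[OF re B.one_closed] by metis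
  have "f r = r \<odot>\<^bsub>?E\<^esub> (?t \<ominus>\<^bsub>?E\<^esub> f ?s)" if r: "r \<in> nn" for r
  proof -
    have rB: "r \<in> carrier B" by (rule nn.Icarr[OF r])
    have rs: "r \<otimes>\<^bsub>B\<^esub> ?s \<in> nn" by (rule nn.I_l_closed[OF s rB])
    have "r \<otimes>\<^bsub>B\<^esub> \<rho> e = r \<oplus>\<^bsub>B\<^esub> r \<otimes>\<^bsub>B\<^esub> ?s"
      using rB re by (simp add: B.minus_eq B.r_distr B.r_minus B.a_lcomm[of r] B.r_neg)
    then have "r \<odot>\<^bsub>?E\<^esub> ?t = f r \<oplus>\<^bsub>?E\<^esub> r \<odot>\<^bsub>?E\<^esub> f ?s"
      using main[OF r] mod_hom_add[OF f, of r "r \<otimes>\<^bsub>B\<^esub> ?s"] mod_hom_smult[OF f rB, of ?s] r rs s by simp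
    then show ?thesis
      using tc fc[OF r] fc[OF s] rB
      by (simp add: E.M.minus_eq E.smult_r_distr E.smult_r_minus E.M.a_assoc E.M.r_neg del: quot_module_zero)
  qed
  moreover have "?t \<ominus>\<^bsub>?E\<^esub> f ?s \<in> carrier ?E" using tc fc[OF s] by simp
  ultimately show ?thesis by blast
qed

end

section \<open>Noetherian rings\<close>

text \<open>The filtration of a submodule of a free module by the number of coordinates that may be
  nonzero. Its steps are measured by ideals of the ring.\<close>

lemma free_initial_submodule:
  assumes "cring R" "submodule P R (free_module R n)"
  shows "submodule {x \<in> P. \<forall>l. k \<le> l \<and> l < n \<longrightarrow> x l = \<zero>\<^bsub>R\<^esub>} R (free_module R n)"
proof -
  interpret R: cring R by fact
  let ?F = "free_module R n"
  interpret F: module R ?F using free_module_module[OF assms(1)] .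
  note P = F.submoduleE[OF assms(2)] submodule_zero[OF F.module_axioms assms(2)]
  note Pc = subsetD[OF P(1)]
  show ?thesis
    by (rule F.submoduleI)
      (use P Pc free_module_coord_closed[of _ R n] in \<open>auto simp: free_module_zero_coord
        free_module_add_coord free_module_smult_coord free_module_a_inv_coord[OF assms(1)]\<close>)
qed

text \<open>Finite generation of a submodule, phrased without linear combinations: every submodule that
  contains \<open>G\<close> contains \<open>P\<close>.\<close>

definition finitely_spanned ::
    "('r, 'k) ring_scheme \<Rightarrow> ('r, 'a, 'm) module_scheme \<Rightarrow> 'a set \<Rightarrow> bool" where
  "finitely_spanned R M P \<longleftrightarrow> (\<exists>G. finite G \<and> G \<subseteq> P \<and> (\<forall>S. submodule S R M \<and> G \<subseteq> S \<longrightarrow> P \<subseteq> S))"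

text \<open>Induction on the filtration by the number of nonzero coordinates: the last coordinates form
  an ideal, which is finitely generated.\<close>

lemma noetherian_free_submodule_fg:
  assumes "cring R" "noetherian_ring R" "submodule P R (free_module R n)"
  shows "finitely_spanned R (free_module R n) P"
proof -
  interpret R: cring R by fact
  interpret N: noetherian_ring R by fact
  interpret SR: module R "scalar_module id R" using self_module[OF assms(1)] .
  let ?F = "free_module R n"
  interpret F: module R ?F using free_module_module[OF assms(1)] .
  define L where "L k = {x \<in> P. \<forall>l. k \<le> l \<and> l < n \<longrightarrow> x l = \<zero>\<^bsub>R\<^esub>}" for k
  have L: "submodule (L k) R ?F" for k
    unfolding L_def by (rule free_initial_submodule[OF assms(1,3)])
  note P = F.submoduleE[OF assms(3)] submodule_minus[OF F.module_axioms assms(3)]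
  note Pc = subsetD[OF P(1)]
  have "finitely_spanned R ?F (L k)" if "k \<le> n" for k
    using that
  proof (induction k)
    case 0
    have "x = \<zero>\<^bsub>?F\<^esub>" if "x \<in> L 0" for x
      using that by (intro free_module_eqI[OF Pc F.M.zero_closed]) (auto simp: L_def free_module_zero_coord)
    then have "L 0 \<subseteq> {\<zero>\<^bsub>?F\<^esub>}" by blast
    then show ?case
      unfolding finitely_spanned_def
      by (intro exI[of _ "{}"]) (use submodule_zero[OF F.module_axioms] in blast)
  next
    case (Suc k)
    then have k: "k < n" by simp
    obtain G where G: "finite G" "G \<subseteq> L k" "\<And>S. submodule S R ?F \<Longrightarrow> G \<subseteq> S \<Longrightarrow> L k \<subseteq> S"
      using Suc unfolding finitely_spanned_def by auto
    let ?c = "\<lambda>v\<in>carrier ?F. v k"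
    note c = free_module_coord_hom[OF assms(1) k]
    have image_ideal: "ideal (?c ` S) R" if "submodule S R ?F" for S
      unfolding submodule_iff_ideal[OF assms(1), symmetric]
      by (rule submodule_image[OF F.module_axioms SR.module_axioms c that])
    obtain A where A: "A \<subseteq> carrier R" "finite A" "?c ` L (Suc k) = Idl\<^bsub>R\<^esub> A"
      using N.finetely_gen[OF image_ideal[OF L[of "Suc k"]]] by (elim exE conjE)
    have AJ: "A \<subseteq> ?c ` L (Suc k)" unfolding A(3) by (rule R.genideal_self[OF A(1)])
    define g where "g = inv_into (L (Suc k)) ?c"
    have g: "g a \<in> L (Suc k)" "?c (g a) = a" if "a \<in> A" for a
      unfolding g_def by (rule inv_into_into[OF subsetD[OF AJ that]], rule f_inv_into_f[OF subsetD[OF AJ that]])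
    show ?case unfolding finitely_spanned_def
    proof (intro exI conjI allI impI)
      show "finite (G \<union> g ` A)" using G(1) A(2) by simp
      have "L k \<subseteq> L (Suc k)" by (auto simp: L_def)
      then show "G \<union> g ` A \<subseteq> L (Suc k)" using G(2) g(1) by blast
      fix S assume S: "submodule S R ?F \<and> G \<union> g ` A \<subseteq> S"
      then have LS: "L k \<subseteq> S" using G(3) by blast
      note Ss = F.submoduleE[OF conjunct1[OF S]]
      have "ideal (?c ` (S \<inter> L (Suc k))) R"
        using S by (intro image_ideal submodule_Int F.module_axioms L) simp
      moreover have "A \<subseteq> ?c ` (S \<inter> L (Suc k))"
      proof
        fix a assume a: "a \<in> A"
        then have "g a \<in> S \<inter> L (Suc k)" using g(1) S by blast
        then show "a \<in> ?c ` (S \<inter> L (Suc k))" using g(2)[OF a] by (metis imageI)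
      qed
      ultimately have sub: "?c ` L (Suc k) \<subseteq> ?c ` (S \<inter> L (Suc k))"
        unfolding A(3) by (rule R.genideal_minimal)
      show "L (Suc k) \<subseteq> S"
      proof
        fix x assume x: "x \<in> L (Suc k)"
        then obtain s where s: "s \<in> S" "s \<in> L (Suc k)" "?c x = ?c s" using sub by blast
        have xs: "x \<in> P" "s \<in> P" "x \<in> carrier ?F" "s \<in> carrier ?F" using x s Pc by (auto simp: L_def)
        have "x k = s k" using s(3) xs by simp
        then have "(x \<ominus>\<^bsub>?F\<^esub> s) l = \<zero>\<^bsub>R\<^esub>" if "k \<le> l" "l < n" for l
          using that x s(2) xs free_module_coord_closed[OF xs(4)]
          by (cases "l = k") (auto simp: free_module_minus_coord[OF assms(1)] L_def)
        then have "x \<ominus>\<^bsub>?F\<^esub> s \<in> L k" using P(7) xs by (simp add: L_def)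
        then have "s \<oplus>\<^bsub>?F\<^esub> (x \<ominus>\<^bsub>?F\<^esub> s) \<in> S" using LS s(1) by (intro Ss(5)) auto
        then show "x \<in> S" using F.M.add_minus_cancel[OF xs(4,3)] by simp
      qed
    qed
  qed
  moreover have "L n = P" by (auto simp: L_def)
  ultimately show ?thesis by (metis order_refl)
qed

lemma spanned_free_image:
  assumes "cring R" "module R M" "submodule P R M" "finitely_spanned R M P"
  shows "\<exists>m. \<exists>f\<in>mod_hom R (free_module R m) M. f ` carrier (free_module R m) = P"
proof -
  interpret R: cring R by fact
  interpret M: module R M by fact
  obtain G where G: "finite G" "G \<subseteq> P" "\<And>S. submodule S R M \<Longrightarrow> G \<subseteq> S \<Longrightarrow> P \<subseteq> S"
    using assms(4) unfolding finitely_spanned_def by auto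
  note P = M.submoduleE[OF assms(3)]
  obtain h where h: "bij_betw h {..<card G} G"
    using ex_bij_betw_nat_finite[OF G(1)] by (auto simp: atLeast0LessThan)
  let ?m = "card G" and ?F = "free_module R (card G)"
  define c where "c l = (if l < ?m then h l else \<zero>\<^bsub>M\<^esub>)" for l
  have cP: "c l \<in> P" for l
    using h G(2) submodule_zero[OF assms(2,3)] by (auto simp: c_def bij_betw_def)
  obtain f where f: "f \<in> mod_hom R ?F M" "\<And>l. l < ?m \<Longrightarrow> f (free_basis R ?m l) = c l"
    using free_hom_with_values[of R M c ?m, OF assms(1,2)] cP P(1) by blast
  have F: "module R ?F" by (rule free_module_module[OF assms(1)])
  have "f v \<in> P" if "v \<in> carrier ?F" for v
    using assms(1) that
  proof (induction rule: free_basis_induct)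
    case zero
    then show ?case using mod_hom_zero[OF F assms(2) f(1)] submodule_zero[OF assms(2,3)] by simp
  next
    case (add x y)
    then show ?case using P(5) mod_hom_add[OF f(1) add(1,2)] by simp
  next
    case (smult r x)
    then show ?case using P(4) mod_hom_smult[OF f(1) smult(1,2)] by simp
  next
    case (basis l)
    then show ?case using f(2) cP by simp
  qed
  moreover have "G \<subseteq> f ` carrier ?F"
  proof
    fix x assume "x \<in> G"
    then have "x \<in> h ` {..<?m}" using h by (simp only: bij_betw_imp_surj_on)
    then obtain l where "l < ?m" "x = h l" by (elim imageE) simp
    then have "x = f (free_basis R ?m l)" using f(2) by (simp add: c_def)
    then show "x \<in> f ` carrier ?F" using free_basis_closed[OF assms(1)] by blast
  qed
  moreover have "submodule (f ` carrier ?F) R M"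
    by (rule submodule_image[OF F assms(2) f(1) module.carrier_is_submodule[OF F]])
  ultimately have "f ` carrier ?F = P" using G(3) by blast
  then show ?thesis using f(1) by blast
qed

text \<open>Needed because the defining condition of a canonical module quantifies over all resolutions,
  and to use it one resolution has to be exhibited. Each kernel is a submodule of a free
  module, hence finitely generated.\<close>

lemma free_resolution_exists:
  assumes "cring R" "noetherian_ring R" "ideal \<aa> R"
  shows "\<exists>n d \<epsilon>. free_resolution R (quot_module (scalar_module id R) \<aa>) n d \<epsilon>"
proof -
  interpret R: cring R by fact
  interpret SR: module R "scalar_module id R" using self_module[OF assms(1)] .
  let ?S = "scalar_module id R"
  let ?k = "quot_module ?S \<aa>"
  have sub: "submodule \<aa> R ?S" using submodule_iff_ideal[OF assms(1)] assms(3) by blast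
  have k: "module R ?k" by (rule quot_module_module[OF SR.module_axioms sub])
  have F: "module R (free_module R m)" for m by (rule free_module_module[OF assms(1)])
  have cover: "\<exists>m. \<exists>D\<in>mod_hom R (free_module R m) (free_module R q).
      D ` carrier (free_module R m) = {v \<in> carrier (free_module R q). f v = \<zero>\<^bsub>N\<^esub>}"
    if f: "f \<in> mod_hom R (free_module R q) N" "module R N" for f q and N :: "('a, 'z, 'w) module_scheme"
  proof -
    interpret N: module R N by fact
    have z: "submodule {\<zero>\<^bsub>N\<^esub>} R N" by (rule N.submoduleI) auto
    have "submodule {v \<in> carrier (free_module R q). f v = \<zero>\<^bsub>N\<^esub>} R (free_module R q)"
      using submodule_vimage[OF F f(2,1) z] by simp
    then show ?thesis
      by (intro spanned_free_image[OF assms(1) F] noetherian_free_submodule_fg[OF assms(1,2)])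
  qed
  have one: "\<aa> +>\<^bsub>?S\<^esub> \<one>\<^bsub>R\<^esub> \<in> carrier ?k" unfolding quot_module_carrier by simp
  obtain \<epsilon> where eps: "\<epsilon> \<in> mod_hom R (free_module R 1) ?k" "\<epsilon> (free_basis R 1 0) = \<aa> +>\<^bsub>?S\<^esub> \<one>\<^bsub>R\<^esub>"
    using free_hom_with_values[of R ?k "\<lambda>_. \<aa> +>\<^bsub>?S\<^esub> \<one>\<^bsub>R\<^esub>" 1, OF assms(1) k one] by auto
  have surj: "\<epsilon> ` carrier (free_module R 1) = carrier ?k"
  proof
    show "\<epsilon> ` carrier (free_module R 1) \<subseteq> carrier ?k" using mod_hom_closed[OF eps(1)] by blast
    show "carrier ?k \<subseteq> \<epsilon> ` carrier (free_module R 1)"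
    proof
      fix C assume "C \<in> carrier ?k"
      then obtain r where r: "r \<in> carrier ?S" "C = \<aa> +>\<^bsub>?S\<^esub> r" unfolding quot_module_carrier by (elim imageE)
      have "\<epsilon> (r \<odot>\<^bsub>free_module R 1\<^esub> free_basis R 1 0) = C"
        using mod_hom_smult[OF eps(1) _ free_basis_closed[OF assms(1)], of r 0] r eps(2)
          quot_module_smult[OF SR.module_axioms sub, of r "\<one>\<^bsub>R\<^esub>"] by simp
      moreover have "r \<odot>\<^bsub>free_module R 1\<^esub> free_basis R 1 0 \<in> carrier (free_module R 1)"
        using r by (intro module.smult_closed[OF F] free_basis_closed[OF assms(1)]) simp
      ultimately show "C \<in> \<epsilon> ` carrier (free_module R 1)" by blast
    qed
  qed
  obtain m0 D0 where D0: "D0 \<in> mod_hom R (free_module R m0) (free_module R 1)"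
    "D0 ` carrier (free_module R m0) = {v \<in> carrier (free_module R 1). \<epsilon> v = \<zero>\<^bsub>?k\<^esub>}"
    using cover[OF eps(1) k] by blast
  let ?good = "\<lambda>(q, m, D). D \<in> mod_hom R (free_module R m) (free_module R q)"
  let ?Q = "\<lambda>i (q, m, D) (q', m', D'). q' = m \<and>
      D' ` carrier (free_module R m') = {v \<in> carrier (free_module R m). D v = \<zero>\<^bsub>free_module R q\<^esub>}"
  have "\<exists>s. \<forall>i. (?good (s i) \<and> (i = (0::nat) \<longrightarrow> s i = (1, m0, D0))) \<and> ?Q i (s i) (s (Suc i))"
  proof (rule dependent_nat_choice)
    show "\<exists>x. ?good x \<and> ((0::nat) = 0 \<longrightarrow> x = (1, m0, D0))" using D0 by auto
  next
    fix x :: "nat \<times> nat \<times> ((nat \<Rightarrow> 'a) \<Rightarrow> nat \<Rightarrow> 'a)" and i :: nat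
    assume x: "?good x \<and> (i = 0 \<longrightarrow> x = (1, m0, D0))"
    obtain q m D where qmD: "x = (q, m, D)" by (cases x)
    then have "D \<in> mod_hom R (free_module R m) (free_module R q)" using x by simp
    from cover[OF this F] obtain m' D' where "D' \<in> mod_hom R (free_module R m') (free_module R m)"
      "D' ` carrier (free_module R m') = {v \<in> carrier (free_module R m). D v = \<zero>\<^bsub>free_module R q\<^esub>}"
      by blast
    then show "\<exists>y. (?good y \<and> (Suc i = 0 \<longrightarrow> y = (1, m0, D0))) \<and> ?Q i x y"
      unfolding qmD by (intro exI[of _ "(m, m', D')"]) simp
  qed
  then obtain s where "\<forall>i. (?good (s i) \<and> (i = (0::nat) \<longrightarrow> s i = (1, m0, D0))) \<and> ?Q i (s i) (s (Suc i))" by (elim exE)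
  note s' = this[rule_format]
  have s: "?good (s i)" "s 0 = (1, m0, D0)" "?Q i (s i) (s (Suc i))" for i
    by (rule conjunct1[OF conjunct1[OF s'[of i]]], rule mp[OF conjunct2[OF conjunct1[OF s'[of 0]]] refl],
      rule conjunct2[OF s'[of i]])
  define n where "n i = fst (s i)" for i
  define d where "d i = snd (snd (s i))" for i
  have m: "fst (snd (s i)) = n (Suc i)" for i
    using s(3)[of i] by (simp add: n_def split_beta)
  have n0: "n 0 = 1" "n (Suc 0) = m0" "d 0 = D0" using s(2) m[of 0] by (simp_all add: n_def d_def)
  have "free_resolution R ?k n d \<epsilon>"
    unfolding free_resolution_def
  proof (intro conjI allI)
    show "\<epsilon> \<in> mod_hom R (free_module R (n 0)) ?k" "\<epsilon> ` carrier (free_module R (n 0)) = carrier ?k"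
      using eps(1) surj n0 by simp_all
    show "d i \<in> mod_hom R (free_module R (n (Suc i))) (free_module R (n i))" for i
      using s(1)[of i] by (simp add: split_beta m) (simp add: n_def d_def)
    show "d 0 ` carrier (free_module R (n 1)) = {v \<in> carrier (free_module R (n 0)). \<epsilon> v = \<zero>\<^bsub>?k\<^esub>}"
      using D0(2) n0 by simp
    show "d (Suc i) ` carrier (free_module R (n (Suc (Suc i)))) =
       {v \<in> carrier (free_module R (n (Suc i))). d i v = \<zero>\<^bsub>free_module R (n i)\<^esub>}" for i
      using conjunct2[OF s(3)[of i, unfolded split_beta]] by (simp add: m) (simp add: n_def d_def)
  qed
  then show ?thesis by blast
qed

lemma noetherian_maximal_element:
  assumes "noetherian_ring R" "\<A> \<noteq> {}" "\<And>J. J \<in> \<A> \<Longrightarrow> ideal J R"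
  obtains M where "M \<in> \<A>" "\<And>J. J \<in> \<A> \<Longrightarrow> M \<subseteq> J \<Longrightarrow> J = M"
proof -
  interpret N: noetherian_ring R by fact
  have "\<exists>M\<in>\<A>. \<forall>J\<in>\<A>. M \<subseteq> J \<longrightarrow> J = M"
  proof (rule subset_Zorn)
    fix C assume C: "subset.chain \<A> C"
    show "\<exists>U\<in>\<A>. \<forall>J\<in>C. J \<subseteq> U"
    proof (cases "C = {}")
      case True
      then show ?thesis using assms(2) by blast
    next
      case False
      have "subset.chain {J. ideal J R} C"
        using C assms(3) unfolding pred_on.chain_def by blast
      then have "\<Union>C \<in> C" using N.ideal_chain_is_trivial[OF False] by blast
      moreover have "C \<subseteq> \<A>" using C unfolding pred_on.chain_def by (elim conjE)
      ultimately have "\<Union>C \<in> \<A>" by (rule rev_subsetD)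
      then show ?thesis by (rule bexI[rotated]) (intro ballI Union_upper)
    qed
  qed
  then show ?thesis using that by blast
qed

text \<open>An ideal that is maximal among those that contain \<open>J\<close> and are disjoint from \<open>S\<close> is prime.\<close>

lemma prime_avoiding_multiplicative_set:
  assumes "cring R" "noetherian_ring R" "ideal J R" "J \<inter> S = {}" "\<one>\<^bsub>R\<^esub> \<in> S"
    and mult: "\<And>s t. s \<in> S \<Longrightarrow> t \<in> S \<Longrightarrow> s \<otimes>\<^bsub>R\<^esub> t \<in> S"
  obtains P where "primeideal P R" "J \<subseteq> P" "P \<inter> S = {}"
proof -
  interpret R: cring R by fact
  let ?A = "{K. ideal K R \<and> J \<subseteq> K \<and> K \<inter> S = {}}"
  have ne: "?A \<noteq> {}" using assms(3,4) by blast
  obtain M where M: "M \<in> ?A" and max: "\<And>K. K \<in> ?A \<Longrightarrow> M \<subseteq> K \<Longrightarrow> K = M"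
    by (rule noetherian_maximal_element[OF assms(2) ne]) auto
  then interpret M: ideal M R by simp
  have meets: "\<exists>m\<in>M. \<exists>r\<in>carrier R. m \<oplus>\<^bsub>R\<^esub> r \<otimes>\<^bsub>R\<^esub> a \<in> S" if a: "a \<in> carrier R" "a \<notin> M" for a
  proof (rule ccontr)
    assume n: "\<not> ?thesis"
    let ?K = "M <+>\<^bsub>R\<^esub> PIdl\<^bsub>R\<^esub> a"
    have K: "ideal ?K R" by (rule R.add_ideals[OF M.ideal_axioms R.cgenideal_ideal[OF a(1)]])
    have mem: "x \<in> ?K \<longleftrightarrow> (\<exists>m\<in>M. \<exists>r\<in>carrier R. x = m \<oplus>\<^bsub>R\<^esub> r \<otimes>\<^bsub>R\<^esub> a)" for x
      by (auto simp: set_add_def' cgenideal_def)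
    have "M \<subseteq> ?K"
    proof
      fix x assume "x \<in> M"
      then show "x \<in> ?K" unfolding mem using a(1) by (intro bexI[of _ x] bexI[of _ "\<zero>\<^bsub>R\<^esub>"]) auto
    qed
    moreover have "x \<notin> S" if "x \<in> ?K" for x using n that unfolding mem by blast
    then have "?K \<inter> S = {}" unfolding disjoint_iff by iprover
    ultimately have "?K = M" using K M by (intro max) auto
    moreover have "a \<in> ?K" unfolding mem using a(1)
      by (intro bexI[of _ "\<zero>\<^bsub>R\<^esub>"] bexI[of _ "\<one>\<^bsub>R\<^esub>"]) auto
    ultimately show False using a(2) by simp
  qed
  have "primeideal M R"
  proof (rule primeidealI[OF M.ideal_axioms assms(1)])
    show "carrier R \<noteq> M" using M assms(5) by auto
    fix a b assume ab: "a \<in> carrier R" "b \<in> carrier R" "a \<otimes>\<^bsub>R\<^esub> b \<in> M"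
    show "a \<in> M \<or> b \<in> M"
    proof (rule ccontr)
      assume "\<not> (a \<in> M \<or> b \<in> M)"
      then obtain m r m' r' where mr: "m \<in> M" "r \<in> carrier R" "m \<oplus>\<^bsub>R\<^esub> r \<otimes>\<^bsub>R\<^esub> a \<in> S"
        "m' \<in> M" "r' \<in> carrier R" "m' \<oplus>\<^bsub>R\<^esub> r' \<otimes>\<^bsub>R\<^esub> b \<in> S"
        using meets[OF ab(1)] meets[OF ab(2)] by blast
      note c = M.a_Hcarr[OF mr(1)] M.a_Hcarr[OF mr(4)]
      have "(m \<oplus>\<^bsub>R\<^esub> r \<otimes>\<^bsub>R\<^esub> a) \<otimes>\<^bsub>R\<^esub> (m' \<oplus>\<^bsub>R\<^esub> r' \<otimes>\<^bsub>R\<^esub> b) =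
          m \<otimes>\<^bsub>R\<^esub> (m' \<oplus>\<^bsub>R\<^esub> r' \<otimes>\<^bsub>R\<^esub> b) \<oplus>\<^bsub>R\<^esub> ((r \<otimes>\<^bsub>R\<^esub> a) \<otimes>\<^bsub>R\<^esub> m' \<oplus>\<^bsub>R\<^esub> (r \<otimes>\<^bsub>R\<^esub> r') \<otimes>\<^bsub>R\<^esub> (a \<otimes>\<^bsub>R\<^esub> b))"
        using c mr(2,5) ab(1,2) by (simp add: R.l_distr R.r_distr R.m_ac)
      also have "\<dots> \<in> M"
        using M.I_r_closed[OF mr(1), of "m' \<oplus>\<^bsub>R\<^esub> r' \<otimes>\<^bsub>R\<^esub> b"] M.I_l_closed[OF mr(4), of "r \<otimes>\<^bsub>R\<^esub> a"]
          M.I_l_closed[OF ab(3), of "r \<otimes>\<^bsub>R\<^esub> r'"] c mr(2,5) ab(1,2) by simp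
      finally show False using mult[OF mr(3,6)] M by blast
    qed
  qed
  then show ?thesis using M that by blast
qed

lemma noetherian_in_maximal:
  assumes "cring R" "noetherian_ring R" "ideal J R" "J \<noteq> carrier R"
  obtains M where "maximalideal M R" "J \<subseteq> M"
proof -
  interpret R: cring R by fact
  let ?A = "{K. ideal K R \<and> J \<subseteq> K \<and> K \<noteq> carrier R}"
  have ne: "?A \<noteq> {}" using assms by blast
  obtain M where M: "M \<in> ?A" and max: "\<And>K. K \<in> ?A \<Longrightarrow> M \<subseteq> K \<Longrightarrow> K = M"
    by (rule noetherian_maximal_element[OF assms(2) ne]) auto
  have "maximalideal M R"
    by (rule maximalidealI) (use M max in blast)+
  then show ?thesis using M that by blast
qed

lemma local_ringD:
  assumes "local_ring R \<mm>"
  shows "cring R" "maximalideal \<mm> R" "maximalideal J R \<Longrightarrow> J = \<mm>"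
  using assms unfolding local_ring_def by iprover+

lemma local_ideal_subset:
  assumes "noetherian_ring R" "local_ring R \<mm>" "ideal J R" "J \<noteq> carrier R"
  shows "J \<subseteq> \<mm>"
  by (rule noetherian_in_maximal[OF local_ringD(1)[OF assms(2)] assms(1,3,4)])
    (use local_ringD(3)[OF assms(2)] in blast)

lemma krull_dim_ge:
  assumes "\<And>i. i \<le> n \<Longrightarrow> primeideal (p i) R" "\<And>i. i < n \<Longrightarrow> p i \<subset> p (Suc i)"
  shows "enat n \<le> krull_dim R"
  unfolding krull_dim_def by (rule SUP_upper) (use assms in auto)

text \<open>A regular element is not contained in a minimal prime. Concretely, if \<open>p\<close> is a prime and
  \<open>u \<in> p\<close> is regular, then the multiplicative set of all \<open>u\<^sup>n s\<close> with \<open>s \<notin> p\<close>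
  does not contain zero, and a prime that avoids it lies strictly below \<open>p\<close>. If \<open>p\<close> were not
  maximal, this would give a chain of length two.\<close>

lemma dim_one_regular_prime:
  assumes "noetherian_ring R" "local_ring R \<mm>" "krull_dim R \<le> 1"
    and p: "primeideal p R" and u: "u \<in> p" "regular_elt R u"
  shows "p = \<mm>"
proof (rule ccontr)
  assume ne: "p \<noteq> \<mm>"
  note cr = local_ringD(1)[OF assms(2)] and max = local_ringD(2)[OF assms(2)]
  interpret R: cring R by (rule cr)
  interpret p: primeideal p R by (rule p)
  define S where "S = {u [^]\<^bsub>R\<^esub> (n::nat) \<otimes>\<^bsub>R\<^esub> s | n s. s \<in> carrier R \<and> s \<notin> p}"
  have uc: "u \<in> carrier R" using u(2) by (simp add: regular_elt_def)
  have one: "\<one>\<^bsub>R\<^esub> \<notin> p" using p.I_notcarr p.one_imp_carrier by blast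
  have "\<one>\<^bsub>R\<^esub> \<in> S" unfolding S_def using one by (intro CollectI exI[of _ 0] exI[of _ "\<one>\<^bsub>R\<^esub>"]) simp
  moreover have "x \<otimes>\<^bsub>R\<^esub> y \<in> S" if "x \<in> S" "y \<in> S" for x y
  proof -
    obtain n s m t where xy: "x = u [^]\<^bsub>R\<^esub> (n::nat) \<otimes>\<^bsub>R\<^esub> s" "s \<in> carrier R" "s \<notin> p"
      "y = u [^]\<^bsub>R\<^esub> (m::nat) \<otimes>\<^bsub>R\<^esub> t" "t \<in> carrier R" "t \<notin> p" using \<open>x \<in> S\<close> \<open>y \<in> S\<close> by (auto simp: S_def)
    have "x \<otimes>\<^bsub>R\<^esub> y = u [^]\<^bsub>R\<^esub> (n + m) \<otimes>\<^bsub>R\<^esub> (s \<otimes>\<^bsub>R\<^esub> t)"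
      unfolding xy using xy(2,5) uc by (simp add: R.nat_pow_mult[symmetric] R.m_ac)
    moreover have "s \<otimes>\<^bsub>R\<^esub> t \<notin> p" using p.I_prime xy by blast
    ultimately show ?thesis unfolding S_def using xy by blast
  qed
  moreover have "\<zero>\<^bsub>R\<^esub> \<notin> S"
  proof
    assume "\<zero>\<^bsub>R\<^esub> \<in> S"
    then obtain n s where s: "u [^]\<^bsub>R\<^esub> (n::nat) \<otimes>\<^bsub>R\<^esub> s = \<zero>\<^bsub>R\<^esub>" "s \<in> carrier R" "s \<notin> p" by (auto simp: S_def)
    have "u [^]\<^bsub>R\<^esub> (n::nat) \<otimes>\<^bsub>R\<^esub> s = \<zero>\<^bsub>R\<^esub> \<Longrightarrow> s = \<zero>\<^bsub>R\<^esub>"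
    proof (induction n)
      case (Suc n)
      have c: "u [^]\<^bsub>R\<^esub> n \<otimes>\<^bsub>R\<^esub> s \<in> carrier R" using s(2) uc by simp
      have "u \<otimes>\<^bsub>R\<^esub> (u [^]\<^bsub>R\<^esub> n \<otimes>\<^bsub>R\<^esub> s) = u [^]\<^bsub>R\<^esub> Suc n \<otimes>\<^bsub>R\<^esub> s"
        using s(2) uc by (simp add: R.m_ac)
      also have "\<dots> = \<zero>\<^bsub>R\<^esub>" by (rule Suc.prems)
      finally have "u [^]\<^bsub>R\<^esub> n \<otimes>\<^bsub>R\<^esub> s = \<zero>\<^bsub>R\<^esub>" using u(2) c unfolding regular_elt_def by blast
      then show ?case by (rule Suc.IH)
    qed (use s in simp)
    then show False using s p.zero_closed by auto
  qed
  then have "{\<zero>\<^bsub>R\<^esub>} \<inter> S = {}" by simp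
  ultimately obtain q where q: "primeideal q R" "q \<inter> S = {}"
    using prime_avoiding_multiplicative_set[OF cr assms(1) R.zeroideal, of S] by metis
  interpret q: primeideal q R by (rule q(1))
  have "q \<subseteq> p"
  proof
    fix s assume s: "s \<in> q"
    then have "s \<in> carrier R" by (rule q.Icarr)
    moreover from this have "s \<notin> p \<Longrightarrow> s \<in> S"
      unfolding S_def by (intro CollectI exI[of _ 0] exI[of _ s]) simp
    ultimately show "s \<in> p" using q(2) s by blast
  qed
  moreover have "u \<in> S" unfolding S_def using one uc
    by (intro CollectI exI[of _ 1] exI[of _ "\<one>\<^bsub>R\<^esub>"]) simp
  then have "u \<notin> q" using q(2) by blast
  ultimately have qp: "q \<subset> p" using u(1) by blast
  have "p \<subseteq> \<mm>" using local_ideal_subset[OF assms(1,2) p.ideal_axioms] p.I_notcarr by metis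
  then have pm: "p \<subset> \<mm>" using ne by blast
  define c where "c i = (if i = 0 then q else if i = 1 then p else \<mm>)" for i :: nat
  have "enat 2 \<le> krull_dim R"
  proof (rule krull_dim_ge[of 2 c])
    fix i :: nat assume "i < 2" then show "c i \<subset> c (Suc i)" using qp pm by (auto simp: c_def less_2_cases_iff)
  qed (use q(1) p R.maximalideal_prime[OF max] in \<open>auto simp: c_def\<close>)
  also have "\<dots> \<le> enat 1" using assms(3) by (simp add: one_enat_def)
  finally show False by simp
qed

text \<open>The ring modulo \<open>J\<close> has an associated prime, the largest annihilator of a nonzero residue
  class. This prime contains the regular element \<open>u\<close>, so it is maximal in dimension one.\<close>

lemma regular_ideal_associated_maximal:
  assumes "noetherian_ring R" "local_ring R \<mm>" "krull_dim R \<le> 1"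
    and J: "ideal J R" "J \<noteq> carrier R" and u: "u \<in> J" "regular_elt R u"
  obtains x where "x \<in> carrier R" "x \<notin> J" "\<And>r. r \<in> \<mm> \<Longrightarrow> r \<otimes>\<^bsub>R\<^esub> x \<in> J"
proof -
  note cr = local_ringD(1)[OF assms(2)]
  interpret R: cring R by (rule cr)
  interpret J: ideal J R by (rule J(1))
  define ann where "ann x = {r \<in> carrier R. r \<otimes>\<^bsub>R\<^esub> x \<in> J}" for x
  have ann: "ideal (ann x) R" if x: "x \<in> carrier R" for x
  proof (rule idealI[OF R.ring_axioms])
    show "subgroup (ann x) (add_monoid R)"
      by (rule R.add.subgroupI)
        (use x in \<open>auto simp: ann_def R.l_distr R.l_minus a_inv_def[symmetric] intro!: exI[of _ "\<zero>\<^bsub>R\<^esub>"]\<close>)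
    fix a r assume "a \<in> ann x" "r \<in> carrier R"
    then have ar: "a \<in> carrier R" "r \<in> carrier R" "a \<otimes>\<^bsub>R\<^esub> x \<in> J" by (auto simp: ann_def)
    have "(r \<otimes>\<^bsub>R\<^esub> a) \<otimes>\<^bsub>R\<^esub> x = r \<otimes>\<^bsub>R\<^esub> (a \<otimes>\<^bsub>R\<^esub> x)" using ar x by (simp add: R.m_assoc)
    then show "r \<otimes>\<^bsub>R\<^esub> a \<in> ann x" using ar J.I_l_closed by (simp add: ann_def)
    then show "a \<otimes>\<^bsub>R\<^esub> r \<in> ann x" using ar by (simp add: R.m_comm)
  qed
  have "\<one>\<^bsub>R\<^esub> \<notin> J" using J(2) J.one_imp_carrier by blast
  then have ne: "{ann x | x. x \<in> carrier R \<and> x \<notin> J} \<noteq> {}" by blast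
  obtain P where P: "P \<in> {ann x | x. x \<in> carrier R \<and> x \<notin> J}"
    and max: "\<And>K. K \<in> {ann x | x. x \<in> carrier R \<and> x \<notin> J} \<Longrightarrow> P \<subseteq> K \<Longrightarrow> K = P"
    by (rule noetherian_maximal_element[OF assms(1) ne]) (use ann in blast)+
  obtain x where x: "P = ann x" "x \<in> carrier R" "x \<notin> J" using P by blast
  have "primeideal P R"
  proof (rule primeidealI[OF _ cr])
    show "ideal P R" using ann x by simp
    have "\<one>\<^bsub>R\<^esub> \<notin> P" using x by (simp add: ann_def)
    then show "carrier R \<noteq> P" by blast
    fix a b assume ab: "a \<in> carrier R" "b \<in> carrier R" "a \<otimes>\<^bsub>R\<^esub> b \<in> P"
    show "a \<in> P \<or> b \<in> P"
    proof (rule disjCI)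
      assume b: "b \<notin> P"
      then have bx: "b \<otimes>\<^bsub>R\<^esub> x \<in> carrier R" "b \<otimes>\<^bsub>R\<^esub> x \<notin> J" using ab x by (auto simp: ann_def)
      have "P \<subseteq> ann (b \<otimes>\<^bsub>R\<^esub> x)"
      proof
        fix r assume "r \<in> P"
        then have r: "r \<in> carrier R" "r \<otimes>\<^bsub>R\<^esub> x \<in> J" using x by (auto simp: ann_def)
        have "r \<otimes>\<^bsub>R\<^esub> (b \<otimes>\<^bsub>R\<^esub> x) = b \<otimes>\<^bsub>R\<^esub> (r \<otimes>\<^bsub>R\<^esub> x)" using r ab x by (simp add: R.m_lcomm)
        then show "r \<in> ann (b \<otimes>\<^bsub>R\<^esub> x)" using r ab J.I_l_closed by (simp add: ann_def)
      qed
      then have "ann (b \<otimes>\<^bsub>R\<^esub> x) = P" using bx by (intro max) auto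
      moreover have "a \<in> ann (b \<otimes>\<^bsub>R\<^esub> x)" using ab x by (simp add: ann_def R.m_assoc)
      ultimately show "a \<in> P" by simp
    qed
  qed
  moreover have "u \<in> P" using u x J.I_r_closed J.Icarr by (simp add: ann_def)
  ultimately have "P = \<mm>" using dim_one_regular_prime[OF assms(1-3)] u(2) by blast
  then show ?thesis using that[of x] x by (auto simp: ann_def)
qed

section \<open>Canonical ideals in dimension one\<close>

lemma colon_ideal:
  assumes "cring R" "ideal J R" "x \<in> carrier R"
  shows "ideal {r \<in> carrier R. r \<otimes>\<^bsub>R\<^esub> x \<in> J} R"
proof -
  interpret R: cring R by fact
  interpret SR: module R "scalar_module id R" using self_module[OF assms(1)] .
  have sub: "submodule J R (scalar_module id R)" using submodule_iff_ideal[OF assms(1)] assms(2) by blast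
  have hom: "(\<lambda>r\<in>carrier R. r \<otimes>\<^bsub>R\<^esub> x) \<in> mod_hom R (scalar_module id R) (scalar_module id R)"
    by (rule mod_homI) (use assms(3) in \<open>auto simp: R.l_distr R.m_assoc\<close>)
  have "{r \<in> carrier R. (\<lambda>r\<in>carrier R. r \<otimes>\<^bsub>R\<^esub> x) r \<in> J} = {r \<in> carrier R. r \<otimes>\<^bsub>R\<^esub> x \<in> J}"
    by (rule Collect_cong) simp
  then show ?thesis
    using submodule_vimage[OF SR.module_axioms SR.module_axioms hom sub] submodule_iff_ideal[OF assms(1)] by simp
qed

text \<open>It suffices to extend homomorphisms from the maximal ideal. Among the extensions of a given
  map to larger ideals, take one with the largest domain \<open>J\<close>. If \<open>J\<close> is proper, some
  \<open>x \<notin> J\<close> is multiplied into \<open>J\<close> by the maximal ideal, and the assumption on maps from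
  the maximal ideal gives an extension to \<open>J + Rx\<close>.\<close>

lemma regular_injectiveI:
  fixes R :: "('r, 'k) ring_scheme" and E :: "('r, 'a, 'm) module_scheme"
  assumes R: "noetherian_ring R" "local_ring R \<mm>" and E: "module R E"
    and ass: "\<And>J u. ideal J R \<Longrightarrow> J \<noteq> carrier R \<Longrightarrow> u \<in> J \<Longrightarrow> regular_elt R u \<Longrightarrow>
      \<exists>x\<in>carrier R. x \<notin> J \<and> (\<forall>r\<in>\<mm>. r \<otimes>\<^bsub>R\<^esub> x \<in> J)"
    and hom: "\<And>f. f \<in> mod_hom R ((scalar_module id R)\<lparr>carrier := \<mm>\<rparr>) E \<Longrightarrow>
      \<exists>t\<in>carrier E. \<forall>r\<in>\<mm>. f r = r \<odot>\<^bsub>E\<^esub> t"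
  shows "regular_injective R E"
  unfolding regular_injective_def
proof (intro allI impI, elim conjE)
  fix J0 f0 assume J0: "ideal J0 R" and reg: "\<exists>u\<in>J0. regular_elt R u"
    and f0: "f0 \<in> mod_hom R ((scalar_module id R)\<lparr>carrier := J0\<rparr>) E"
  let ?S = "scalar_module id R"
  note cr = local_ringD(1)[OF R(2)]
  interpret R: cring R by (rule cr)
  interpret SR: module R ?S using self_module[OF cr] .
  interpret E: module R E by (rule E)
  interpret mm: maximalideal \<mm> R by (rule local_ringD(2)[OF R(2)])
  obtain u where u: "u \<in> J0" "regular_elt R u" using reg by blast
  let ?A = "{J. ideal J R \<and> J0 \<subseteq> J \<and> (\<exists>g\<in>mod_hom R (?S\<lparr>carrier := J\<rparr>) E. \<forall>x\<in>J0. g x = f0 x)}"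
  have "J0 \<in> ?A" using J0 f0 by blast
  then have ne: "?A \<noteq> {}" by blast
  obtain J where J: "J \<in> ?A" and max: "\<And>K. K \<in> ?A \<Longrightarrow> J \<subseteq> K \<Longrightarrow> K = J"
    by (rule noetherian_maximal_element[OF R(1) ne]) (rule conjunct1, simp, blast)
  then have Ji: "ideal J R" and JJ: "J0 \<subseteq> J" by simp_all
  obtain g where g: "g \<in> mod_hom R (?S\<lparr>carrier := J\<rparr>) E" "\<And>x. x \<in> J0 \<Longrightarrow> g x = f0 x" using J by blast
  interpret J: ideal J R by (rule Ji)
  have gadd: "g (x \<oplus>\<^bsub>R\<^esub> y) = g x \<oplus>\<^bsub>E\<^esub> g y" if "x \<in> J" "y \<in> J" for x y
    using mod_hom_add[OF g(1), of x y] that by simp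
  have gsm: "g (r \<otimes>\<^bsub>R\<^esub> x) = r \<odot>\<^bsub>E\<^esub> g x" if "r \<in> carrier R" "x \<in> J" for r x
    using mod_hom_smult[OF g(1), of r x] that by simp
  have gc: "g x \<in> carrier E" if "x \<in> J" for x using mod_hom_closed[OF g(1), of x] that by simp
  have "J = carrier R"
  proof (rule ccontr)
    assume nJ: "J \<noteq> carrier R"
    obtain x where x: "x \<in> carrier R" "x \<notin> J" "\<forall>r\<in>\<mm>. r \<otimes>\<^bsub>R\<^esub> x \<in> J"
      using ass[OF Ji nJ subsetD[OF JJ u(1)] u(2)] by blast
    have ann: "r \<in> \<mm>" if r: "r \<in> carrier R" "r \<otimes>\<^bsub>R\<^esub> x \<in> J" for r
    proof -
      let ?K = "{r \<in> carrier R. r \<otimes>\<^bsub>R\<^esub> x \<in> J}"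
      have K: "ideal ?K R" by (rule colon_ideal[OF cr Ji x(1)])
      have "\<one>\<^bsub>R\<^esub> \<notin> ?K" using x by simp
      then have "?K \<noteq> carrier R" using R.one_closed by (metis (no_types, lifting))
      then have "?K \<subseteq> \<mm>" by (rule local_ideal_subset[OF R K])
      then show ?thesis using r by blast
    qed
    have "(\<lambda>r\<in>\<mm>. g (r \<otimes>\<^bsub>R\<^esub> x)) \<in> mod_hom R (?S\<lparr>carrier := \<mm>\<rparr>) E"
      by (rule mod_homI)
        (use x gc mm.Icarr in \<open>auto simp: R.l_distr gadd R.m_assoc gsm mm.I_l_closed\<close>)
    from hom[OF this] obtain t where t: "t \<in> carrier E" "\<And>r. r \<in> \<mm> \<Longrightarrow> g (r \<otimes>\<^bsub>R\<^esub> x) = r \<odot>\<^bsub>E\<^esub> t"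
      by auto
    let ?F = "free_module R 2"
    have F: "module R ?F" by (rule free_module_module[OF cr])
    interpret F: module R ?F by (rule F)
    let ?c = "\<lambda>v\<in>carrier ?F. v 0"
    have c: "?c \<in> mod_hom R ?F ?S" by (rule free_module_coord_hom[OF cr]) simp
    have Js: "submodule J R ?S" using submodule_iff_ideal[OF cr] Ji by blast
    define L where "L = {v \<in> carrier ?F. v 0 \<in> J}"
    have L: "submodule L R ?F"
      using submodule_vimage[OF F SR.module_axioms c Js]
      by (rule back_subst[of "\<lambda>A. submodule A R ?F"]) (auto simp: L_def)
    note LM = submodule.submodule_is_module[OF L F]
    have vc: "v 0 \<in> J" "v 1 \<in> carrier R" "v 0 \<in> carrier R" "v \<in> carrier ?F" if "v \<in> L" for v
      using that free_module_coord_closed[of v R 2] by (auto simp: L_def)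
    let ?p = "\<lambda>v\<in>L. v 0 \<oplus>\<^bsub>R\<^esub> v 1 \<otimes>\<^bsub>R\<^esub> x"
    let ?g = "\<lambda>v\<in>L. g (v 0) \<oplus>\<^bsub>E\<^esub> v 1 \<odot>\<^bsub>E\<^esub> t"
    have Ladd: "v \<oplus>\<^bsub>?F\<^esub> w \<in> L" if "v \<in> L" "w \<in> L" for v w using F.submoduleE(5)[OF L] that by blast
    have Lsm: "r \<odot>\<^bsub>?F\<^esub> v \<in> L" if "r \<in> carrier R" "v \<in> L" for r v using F.submoduleE(4)[OF L] that by blast
    note co = free_module_add_coord[of _ 2 R] free_module_smult_coord[of _ 2 R]
    have p: "?p \<in> mod_hom R (?F\<lparr>carrier := L\<rparr>) ?S"
      by (rule mod_homI)
        (use x(1) vc Ladd Lsm in \<open>simp_all add: co R.l_distr R.r_distr R.m_assoc R.a_ac restrict_PiE_iff\<close>)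
    have gL: "?g \<in> mod_hom R (?F\<lparr>carrier := L\<rparr>) E"
      by (rule mod_homI)
        (use t(1) vc gc Ladd Lsm in \<open>simp_all add: co gadd gsm E.smult_l_distr E.smult_r_distr E.smult_assoc1
          E.M.a_ac restrict_PiE_iff\<close>)
    define K where "K = ?p ` L"
    have Ki: "ideal K R"
      unfolding submodule_iff_ideal[OF cr, symmetric] K_def
      using submodule_image[OF LM SR.module_axioms p module.carrier_is_submodule[OF LM]] by simp
    have p': "?p \<in> mod_hom R (?F\<lparr>carrier := L\<rparr>) (?S\<lparr>carrier := K\<rparr>)"
      by (rule mod_hom_codomain[OF p]) (simp add: K_def)
    obtain h where h: "h \<in> mod_hom R (?S\<lparr>carrier := K\<rparr>) E"
      and hp': "\<And>v. v \<in> carrier (?F\<lparr>carrier := L\<rparr>) \<Longrightarrow> h (?p v) = ?g v"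
    proof (rule mod_hom_factor[OF LM p' _ gL])
      show "?p ` carrier (?F\<lparr>carrier := L\<rparr>) = carrier (?S\<lparr>carrier := K\<rparr>)" by (simp add: K_def)
      fix v w assume "v \<in> carrier (?F\<lparr>carrier := L\<rparr>)" "w \<in> carrier (?F\<lparr>carrier := L\<rparr>)" and eq: "?p v = ?p w"
      then have vw: "v \<in> L" "w \<in> L" by simp_all
      note v = vc[OF vw(1)] and w = vc[OF vw(2)]
      have eq': "v 0 \<oplus>\<^bsub>R\<^esub> v 1 \<otimes>\<^bsub>R\<^esub> x = w 0 \<oplus>\<^bsub>R\<^esub> w 1 \<otimes>\<^bsub>R\<^esub> x" using eq vw by simp
      let ?r = "w 1 \<ominus>\<^bsub>R\<^esub> v 1"
      have rR: "?r \<in> carrier R" using v w by simp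
      have v0: "v 0 = w 0 \<oplus>\<^bsub>R\<^esub> ?r \<otimes>\<^bsub>R\<^esub> x"
      proof -
        have "v 0 = (v 0 \<oplus>\<^bsub>R\<^esub> v 1 \<otimes>\<^bsub>R\<^esub> x) \<ominus>\<^bsub>R\<^esub> v 1 \<otimes>\<^bsub>R\<^esub> x"
          using v(2,3) x(1) by (simp add: R.minus_eq R.a_assoc R.r_neg)
        also have "\<dots> = (w 0 \<oplus>\<^bsub>R\<^esub> w 1 \<otimes>\<^bsub>R\<^esub> x) \<ominus>\<^bsub>R\<^esub> v 1 \<otimes>\<^bsub>R\<^esub> x" by (simp only: eq')
        also have "\<dots> = w 0 \<oplus>\<^bsub>R\<^esub> ?r \<otimes>\<^bsub>R\<^esub> x"
          using v(2,3) w(2,3) x(1) by (simp add: R.minus_eq R.a_assoc R.l_distr R.l_minus)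
        finally show ?thesis .
      qed
      have rx: "?r \<otimes>\<^bsub>R\<^esub> x = v 0 \<ominus>\<^bsub>R\<^esub> w 0"
        using v0 rR x(1) w(3) by (simp add: R.minus_eq R.a_comm[of "w 0"] R.a_assoc R.r_neg)
      have rxJ: "?r \<otimes>\<^bsub>R\<^esub> x \<in> J" unfolding rx using v(1) w(1) by (simp add: R.minus_eq)
      then have rm: "?r \<in> \<mm>" using ann[OF rR] by blast
      have gv: "g (v 0) = g (w 0) \<oplus>\<^bsub>E\<^esub> ?r \<odot>\<^bsub>E\<^esub> t"
        by (subst v0, subst gadd[OF w(1) rxJ], subst t(2)[OF rm], rule refl)
      have "g (v 0) \<oplus>\<^bsub>E\<^esub> v 1 \<odot>\<^bsub>E\<^esub> t = g (w 0) \<oplus>\<^bsub>E\<^esub> (?r \<oplus>\<^bsub>R\<^esub> v 1) \<odot>\<^bsub>E\<^esub> t"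
        unfolding gv using gc[OF w(1)] t(1) rR v(2) by (simp add: E.smult_l_distr E.M.a_assoc)
      also have "?r \<oplus>\<^bsub>R\<^esub> v 1 = w 1" using v(2) w(2) by (simp add: R.minus_eq R.a_assoc R.l_neg)
      finally show "?g v = ?g w" using vw by simp
    qed blast
    have hp: "h (v 0 \<oplus>\<^bsub>R\<^esub> v 1 \<otimes>\<^bsub>R\<^esub> x) = g (v 0) \<oplus>\<^bsub>E\<^esub> v 1 \<odot>\<^bsub>E\<^esub> t"
      and pK: "v 0 \<oplus>\<^bsub>R\<^esub> v 1 \<otimes>\<^bsub>R\<^esub> x \<in> K" if "v \<in> L" for v
      using hp'[of v] that by (auto simp: K_def intro!: image_eqI[of _ _ v])
    have pair: "(\<lambda>l\<in>{..<2}. if l = 0 then j else r) \<in> L" if "j \<in> J" "r \<in> carrier R" for j r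
      using that by (auto simp: L_def free_module_simps)
    have hJ: "j \<in> K" "h j = g j" if j: "j \<in> J" for j
      using hp[OF pair[OF j R.zero_closed]] pK[OF pair[OF j R.zero_closed]] j x(1) t(1) gc[OF j] J.Icarr[OF j] by simp_all
    have xK: "x \<in> K" using pK[OF pair[OF J.zero_closed R.one_closed]] x(1) by simp
    have "K \<in> ?A" using Ki JJ hJ g(2) h by (auto intro!: bexI[of _ h])
    moreover have "J \<subseteq> K" using hJ by blast
    ultimately have "K = J" by (rule max)
    then show False using xK x(2) by simp
  qed
  then have one: "\<one>\<^bsub>R\<^esub> \<in> J" by simp
  show "\<exists>e\<in>carrier E. \<forall>x\<in>J0. f0 x = x \<odot>\<^bsub>E\<^esub> e"
  proof (intro bexI[OF _ gc[OF one]] ballI)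
    fix y assume y: "y \<in> J0"
    then have "y \<in> carrier R" using JJ J.Icarr by blast
    then show "f0 y = y \<odot>\<^bsub>E\<^esub> g \<one>\<^bsub>R\<^esub>" using gsm[OF _ one, of y] g(2)[OF y] by simp
  qed
qed

context fraction_ring
begin

text \<open>The socle of \<open>T/H\<close> is one-dimensional over the residue field, generated by the class of
  \<open>\<sigma>\<close>.\<close>

definition simple_socle :: "'b set \<Rightarrow> 't set \<Rightarrow> bool" where
  "simple_socle \<nn> H \<longleftrightarrow>
     (\<exists>\<sigma>\<in>carrier T. (\<forall>r\<in>\<nn>. \<iota> r \<otimes>\<^bsub>T\<^esub> \<sigma> \<in> H) \<and> \<sigma> \<notin> H \<and>
        (\<forall>q\<in>carrier T. (\<forall>r\<in>\<nn>. \<iota> r \<otimes>\<^bsub>T\<^esub> q \<in> H) \<longrightarrow>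
           (\<exists>r\<in>carrier B. q \<ominus>\<^bsub>T\<^esub> \<iota> r \<otimes>\<^bsub>T\<^esub> \<sigma> \<in> H)))"

text \<open>Multiplication by a common denominator identifies \<open>H\<close> with an ideal.\<close>

lemma fractional_ideal_fg:
  assumes "noetherian_ring B" "fractional_ideal B T \<iota> H"
  shows "fin_gen_module B (TM\<lparr>carrier := H\<rparr>)"
proof -
  interpret N: noetherian_ring B by fact
  let ?S = "scalar_module id B"
  note cr = B.cring_axioms
  have S: "module B ?S" by (rule self_module[OF cr])
  have H: "submodule H B TM" using assms(2) by (simp add: fractional_ideal_def)
  obtain y where y: "regular_elt B y" "\<And>h. h \<in> H \<Longrightarrow> \<iota> y \<otimes>\<^bsub>T\<^esub> h \<in> \<iota> ` carrier B"
    using assms(2) by (auto simp: fractional_ideal_def)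
  have yT: "\<iota> y \<in> carrier T" "inv\<^bsub>T\<^esub> (\<iota> y) \<in> carrier T" using regular_unit[OF y(1)] T.Units_closed by simp_all
  note Hs = TM.submoduleE[OF H]
  have i: "(\<lambda>b\<in>carrier ?S. \<iota> b) \<in> mod_hom B ?S TM" by (rule mod_homI) auto
  let ?q = "\<lambda>b\<in>carrier ?S. inv\<^bsub>T\<^esub> (\<iota> y) \<otimes>\<^bsub>T\<^esub> (\<lambda>b\<in>carrier ?S. \<iota> b) b"
  have q: "?q \<in> mod_hom B ?S TM" by (rule TM_scale_hom[OF S yT(2) i])
  have vim: "ideal {b \<in> carrier ?S. ?q b \<in> P} B" if "submodule P B TM" for P
    using submodule_vimage[OF S TM_module q that] submodule_iff_ideal[OF cr] by blast
  define J where "J = {b \<in> carrier ?S. ?q b \<in> H}"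
  have J: "ideal J B" unfolding J_def by (rule vim[OF H])
  obtain A where A: "A \<subseteq> carrier B" "finite A" "J = Idl\<^bsub>B\<^esub> A" using N.finetely_gen[OF J] by (elim exE conjE)
  have AJ: "A \<subseteq> J" unfolding A(3) by (rule B.genideal_self[OF A(1)])
  have "finitely_spanned B TM H"
    unfolding finitely_spanned_def
  proof (intro exI conjI allI impI)
    show "finite (?q ` A)" using A(2) by simp
    show "?q ` A \<subseteq> H"
    proof
      fix x assume "x \<in> ?q ` A"
      then obtain a where "a \<in> A" "x = ?q a" by (elim imageE)
      then show "x \<in> H" using subsetD[OF AJ, of a] by (simp only: J_def mem_Collect_eq)
    qed
    fix P assume P: "submodule P B TM \<and> ?q ` A \<subseteq> P"
    have "A \<subseteq> {b \<in> carrier ?S. ?q b \<in> P}"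
    proof
      fix a assume a: "a \<in> A"
      then have "?q a \<in> P" using P by (meson imageI subsetD)
      then show "a \<in> {b \<in> carrier ?S. ?q b \<in> P}" using a A(1) by (simp only: mem_Collect_eq scalar_module_simps subsetD)
    qed
    with vim[OF conjunct1[OF P]] have JP: "J \<subseteq> {b \<in> carrier ?S. ?q b \<in> P}"
      unfolding A(3) by (rule B.genideal_minimal)
    show "H \<subseteq> P"
    proof
      fix h assume h: "h \<in> H"
      obtain b where b: "b \<in> carrier B" "\<iota> y \<otimes>\<^bsub>T\<^esub> h = \<iota> b" using y(2)[OF h] by (elim imageE)
      have hT: "h \<in> carrier T" using Hs(1) h by auto
      have qb: "?q b = h" using b inv_cancel(1)[OF y(1) hT] by simp
      then have "b \<in> J" using b(1) h unfolding J_def by (simp only: mem_Collect_eq scalar_module_simps simp_thms)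
      then have "?q b \<in> P" using JP by blast
      then show "h \<in> P" using qb by simp
    qed
  qed
  from spanned_free_image[OF cr TM_module H this] obtain m f where
    f: "f \<in> mod_hom B (free_module B m) TM" "f ` carrier (free_module B m) = H" by blast
  have "f \<in> mod_hom B (free_module B m) (TM\<lparr>carrier := H\<rparr>)"
    by (rule mod_hom_codomain[OF f(1)]) (use f(2) in blast)
  then show ?thesis unfolding fin_gen_module_def using f(2) by (intro exI[of _ m] bexI[of _ f]) simp_all
qed

text \<open>The vanishing of \<open>Ext\<close> in degree two gives the extension of maps from the maximal ideal
  (\<open>hom_from_maximal_ideal\<close>), and \<open>regular_injectiveI\<close> does the rest; \<open>Ext\<close> in degree one is
  the socle.\<close>

lemma canonical_ideal_imp_regular_injective_simple_socle:
  assumes cm: "cm_local_ring B \<nn>" and dim: "krull_dim B = 1" and H: "canonical_ideal B T \<iota> H"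
    and u: "u \<in> \<nn>" "regular_elt B u"
  shows "regular_injective B (quot_module TM H)" "simple_socle \<nn> H"
proof -
  have N: "noetherian_ring B" and loc: "local_ring B \<nn>" using cm by (simp_all only: cm_local_ring_def)
  have sub: "submodule H B TM" using H by (simp add: canonical_ideal_def fractional_ideal_def)
  have max: "maximalideal \<nn> B" by (rule local_ringD(2)[OF loc])
  have E: "module B (quot_module TM H)" by (rule quot_module_module[OF TM_module sub])
  let ?k = "quot_module (scalar_module id B) \<nn>"
  obtain n d \<epsilon> where res: "free_resolution B ?k n d \<epsilon>"
    using free_resolution_exists[OF B.cring_axioms N maximalideal.axioms(1)[OF max]] by blast
  interpret res: residue_resolution B T \<iota> H \<nn> n d \<epsilon> u
    by (intro residue_resolution.intro residue_resolution_axioms.intro fraction_ring_axioms sub max u res)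
  obtain e w where ew: "e \<in> carrier (res.F 0)" "\<epsilon> e = \<nn> +>\<^bsub>B\<^esub> \<one>\<^bsub>B\<^esub>"
    "w \<in> carrier (res.F (Suc 0))" "d 0 w = u \<odot>\<^bsub>res.F 0\<^esub> e" by (rule res.unit_vector_pair)
  interpret resu: residue_resolution_unit B T \<iota> H \<nn> n d \<epsilon> u e w
    by (intro residue_resolution_unit.intro residue_resolution_unit_axioms.intro res.residue_resolution_axioms ew)
  obtain \<nn>' where nn': "cm_local_ring B \<nn>'" and ext: "\<forall>n d \<epsilon>.
      free_resolution B (quot_module (scalar_module id B) \<nn>') n d \<epsilon> \<longrightarrow>
      (\<forall>i. if enat i = krull_dim B
         then mod_iso B (ext_module B n d (TM\<lparr>carrier := H\<rparr>) i) (quot_module (scalar_module id B) \<nn>')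
         else carrier (ext_module B n d (TM\<lparr>carrier := H\<rparr>) i) = {\<zero>\<^bsub>ext_module B n d (TM\<lparr>carrier := H\<rparr>) i\<^esub>})"
    using H unfolding canonical_ideal_def canonical_module_def by (elim conjE exE)
  have "\<nn>' = \<nn>"
    using local_ringD(3)[OF loc] local_ringD(2)[of B \<nn>'] nn' by (simp only: cm_local_ring_def)
  note ext' = ext[unfolded this, rule_format, OF res]
  have "enat 2 \<noteq> krull_dim B" "enat 1 = krull_dim B" using dim by (simp_all add: one_enat_def)
  then have e2: "carrier (ext_module B n d (TM\<lparr>carrier := H\<rparr>) 2) = {\<zero>\<^bsub>ext_module B n d (TM\<lparr>carrier := H\<rparr>) 2\<^esub>}"
    and e1: "mod_iso B (ext_module B n d (TM\<lparr>carrier := H\<rparr>) 1) ?k"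
    using ext'[of 2] ext'[of 1] by (simp_all only: if_True if_False)
  show "regular_injective B (quot_module TM H)"
  proof (rule regular_injectiveI[OF N loc E])
    fix f assume "f \<in> mod_hom B ((scalar_module id B)\<lparr>carrier := \<nn>\<rparr>) (quot_module TM H)"
    then show "\<exists>t\<in>carrier (quot_module TM H). \<forall>r\<in>\<nn>. f r = r \<odot>\<^bsub>quot_module TM H\<^esub> t"
      using resu.hom_from_maximal_ideal e2 by (simp only: numeral_2_eq_2)
  next
    fix J u assume "ideal J B" "J \<noteq> carrier B" "u \<in> J" "regular_elt B u"
    then show "\<exists>x\<in>carrier B. x \<notin> J \<and> (\<forall>r\<in>\<nn>. r \<otimes>\<^bsub>B\<^esub> x \<in> J)"
      using regular_ideal_associated_maximal[OF N loc, of J u] dim by (metis order_refl)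
  qed
  show "simple_socle \<nn> H"
    using resu.ext_1_iso_imp_simple_socle e1
    unfolding simple_socle_def res.colon_nn_def One_nat_def by blast
qed

text \<open>The converse: \<open>Ext\<close> vanishes in degree zero always, in degrees at least two by the extension
  property, and in degree one it is the socle of \<open>T/H\<close>.\<close>

lemma canonical_idealI:
  assumes cm: "cm_local_ring B \<nn>" and dim: "krull_dim B = 1" and H: "fractional_ideal B T \<iota> H"
    and u: "u \<in> \<nn>" "regular_elt B u"
    and inj: "regular_injective B (quot_module TM H)" and socle: "simple_socle \<nn> H"
  shows "canonical_ideal B T \<iota> H"
proof -
  have N: "noetherian_ring B" and loc: "local_ring B \<nn>" using cm by (simp_all only: cm_local_ring_def)
  have sub: "submodule H B TM" using H by (simp add: fractional_ideal_def)
  have max: "maximalideal \<nn> B" by (rule local_ringD(2)[OF loc])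
  let ?k = "quot_module (scalar_module id B) \<nn>"
  let ?H = "TM\<lparr>carrier := H\<rparr>"
  have "if enat i = krull_dim B then mod_iso B (ext_module B n d ?H i) ?k
      else carrier (ext_module B n d ?H i) = {\<zero>\<^bsub>ext_module B n d ?H i\<^esub>}"
    if res: "free_resolution B ?k n d \<epsilon>" for n d \<epsilon> i
  proof -
    interpret res: residue_resolution B T \<iota> H \<nn> n d \<epsilon> u
      by (intro residue_resolution.intro residue_resolution_axioms.intro fraction_ring_axioms sub max u res)
    obtain e w where ew: "e \<in> carrier (res.F 0)" "\<epsilon> e = \<nn> +>\<^bsub>B\<^esub> \<one>\<^bsub>B\<^esub>"
      "w \<in> carrier (res.F (Suc 0))" "d 0 w = u \<odot>\<^bsub>res.F 0\<^esub> e" by (rule res.unit_vector_pair)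
    interpret resu: residue_resolution_unit B T \<iota> H \<nn> n d \<epsilon> u e w
      by (intro residue_resolution_unit.intro residue_resolution_unit_axioms.intro res.residue_resolution_axioms ew)
    consider "i = 0" | "i = Suc 0" | j where "i = Suc (Suc j)" by (metis not0_implies_Suc)
    then show ?thesis
    proof cases
      case 1
      then show ?thesis using res.ext_0 dim by (simp add: one_enat_def)
    next
      case 2
      obtain \<sigma> where s: "\<sigma> \<in> res.colon_nn" "\<sigma> \<notin> H"
        "\<And>q. q \<in> res.colon_nn \<Longrightarrow> \<exists>r\<in>carrier B. q \<ominus>\<^bsub>T\<^esub> \<iota> r \<otimes>\<^bsub>T\<^esub> \<sigma> \<in> H"
        using socle unfolding simple_socle_def res.colon_nn_def by blast
      have d1: "enat (Suc 0) = krull_dim B" using dim by (simp add: one_enat_def)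
      show ?thesis unfolding 2 if_P[OF d1] by (rule resu.ext_1_iso[OF s])
    next
      case 3
      then show ?thesis using res.ext_ge_2[OF inj, of j] dim by (simp add: one_enat_def)
    qed
  qed
  then have "canonical_module B ?H"
    unfolding canonical_module_def
    using cm submodule.submodule_is_module[OF sub TM_module] fractional_ideal_fg[OF N H] by blast
  with H show ?thesis by (simp add: canonical_ideal_def)
qed

end

section \<open>The ring structure of the quotients of the Rees algebra\<close>

text \<open>The ring \<open>R[t]/(t\<^sup>2 + at + b)\<close> with the basis \<open>1, t\<close>. It is used to compute in the
  quotient of the Rees algebra, which it contains as the pairs with second component in \<open>I\<close>.\<close>

definition quadratic_ring :: "('r, 'k) ring_scheme \<Rightarrow> 'r \<Rightarrow> 'r \<Rightarrow> ('r \<times> 'r) ring" where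
  "quadratic_ring R a b =
     \<lparr>carrier = carrier R \<times> carrier R,
      monoid.mult = (\<lambda>(r, i) (s, j). (r \<otimes>\<^bsub>R\<^esub> s \<ominus>\<^bsub>R\<^esub> b \<otimes>\<^bsub>R\<^esub> (i \<otimes>\<^bsub>R\<^esub> j),
        (r \<otimes>\<^bsub>R\<^esub> j \<oplus>\<^bsub>R\<^esub> i \<otimes>\<^bsub>R\<^esub> s) \<ominus>\<^bsub>R\<^esub> a \<otimes>\<^bsub>R\<^esub> (i \<otimes>\<^bsub>R\<^esub> j))),
      monoid.one = (\<one>\<^bsub>R\<^esub>, \<zero>\<^bsub>R\<^esub>), ring.zero = (\<zero>\<^bsub>R\<^esub>, \<zero>\<^bsub>R\<^esub>),
      ring.add = (\<lambda>(r, i) (s, j). (r \<oplus>\<^bsub>R\<^esub> s, i \<oplus>\<^bsub>R\<^esub> j))\<rparr>"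

lemma quadratic_ring_simps [simp]:
  "carrier (quadratic_ring R a b) = carrier R \<times> carrier R"
  "(r, i) \<otimes>\<^bsub>quadratic_ring R a b\<^esub> (s, j) = (r \<otimes>\<^bsub>R\<^esub> s \<ominus>\<^bsub>R\<^esub> b \<otimes>\<^bsub>R\<^esub> (i \<otimes>\<^bsub>R\<^esub> j),
        (r \<otimes>\<^bsub>R\<^esub> j \<oplus>\<^bsub>R\<^esub> i \<otimes>\<^bsub>R\<^esub> s) \<ominus>\<^bsub>R\<^esub> a \<otimes>\<^bsub>R\<^esub> (i \<otimes>\<^bsub>R\<^esub> j))"
  "\<one>\<^bsub>quadratic_ring R a b\<^esub> = (\<one>\<^bsub>R\<^esub>, \<zero>\<^bsub>R\<^esub>)"
  "\<zero>\<^bsub>quadratic_ring R a b\<^esub> = (\<zero>\<^bsub>R\<^esub>, \<zero>\<^bsub>R\<^esub>)"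
  "(r, i) \<oplus>\<^bsub>quadratic_ring R a b\<^esub> (s, j) = (r \<oplus>\<^bsub>R\<^esub> s, i \<oplus>\<^bsub>R\<^esub> j)"
  by (simp_all add: quadratic_ring_def)

lemma (in cring) quadratic_assoc_fst:
  assumes "a \<in> carrier R" "b \<in> carrier R" "r \<in> carrier R" "i \<in> carrier R" "s \<in> carrier R" "j \<in> carrier R"
    "p \<in> carrier R" "l \<in> carrier R"
  shows "(r \<otimes> s \<ominus> b \<otimes> (i \<otimes> j)) \<otimes> p \<ominus> b \<otimes> ((r \<otimes> j \<oplus> i \<otimes> s \<ominus> a \<otimes> (i \<otimes> j)) \<otimes> l) =
    r \<otimes> (s \<otimes> p \<ominus> b \<otimes> (j \<otimes> l)) \<ominus> b \<otimes> (i \<otimes> (s \<otimes> l \<oplus> j \<otimes> p \<ominus> a \<otimes> (j \<otimes> l)))"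
  using assms by algebra

lemma (in cring) quadratic_assoc_snd:
  assumes "a \<in> carrier R" "b \<in> carrier R" "r \<in> carrier R" "i \<in> carrier R" "s \<in> carrier R" "j \<in> carrier R"
    "p \<in> carrier R" "l \<in> carrier R"
  shows "(r \<otimes> s \<ominus> b \<otimes> (i \<otimes> j)) \<otimes> l \<oplus> (r \<otimes> j \<oplus> i \<otimes> s \<ominus> a \<otimes> (i \<otimes> j)) \<otimes> p
        \<ominus> a \<otimes> ((r \<otimes> j \<oplus> i \<otimes> s \<ominus> a \<otimes> (i \<otimes> j)) \<otimes> l) =
    r \<otimes> (s \<otimes> l \<oplus> j \<otimes> p \<ominus> a \<otimes> (j \<otimes> l)) \<oplus> i \<otimes> (s \<otimes> p \<ominus> b \<otimes> (j \<otimes> l))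
        \<ominus> a \<otimes> (i \<otimes> (s \<otimes> l \<oplus> j \<otimes> p \<ominus> a \<otimes> (j \<otimes> l)))"
  using assms by algebra

lemma quadratic_ring_cring:
  assumes "cring R" "a \<in> carrier R" "b \<in> carrier R"
  shows "cring (quadratic_ring R a b)"
proof -
  interpret R: cring R by fact
  note ab = assms(2,3)
  show ?thesis
  proof (intro cringI abelian_groupI comm_monoidI)
    fix x assume "x \<in> carrier (quadratic_ring R a b)"
    then show "\<exists>y\<in>carrier (quadratic_ring R a b). y \<oplus>\<^bsub>quadratic_ring R a b\<^esub> x = \<zero>\<^bsub>quadratic_ring R a b\<^esub>"
      by (intro bexI[of _ "(\<ominus>\<^bsub>R\<^esub> fst x, \<ominus>\<^bsub>R\<^esub> snd x)"]) (auto simp: R.l_neg)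
  next
    fix x y z
    assume "x \<in> carrier (quadratic_ring R a b)" "y \<in> carrier (quadratic_ring R a b)" "z \<in> carrier (quadratic_ring R a b)"
    then obtain r i s j p l where c: "x = (r, i)" "y = (s, j)" "z = (p, l)" "r \<in> carrier R" "i \<in> carrier R"
      "s \<in> carrier R" "j \<in> carrier R" "p \<in> carrier R" "l \<in> carrier R" by auto
    show "x \<otimes>\<^bsub>quadratic_ring R a b\<^esub> y \<otimes>\<^bsub>quadratic_ring R a b\<^esub> z
        = x \<otimes>\<^bsub>quadratic_ring R a b\<^esub> (y \<otimes>\<^bsub>quadratic_ring R a b\<^esub> z)"
      unfolding c quadratic_ring_simps prod.inject
      using R.quadratic_assoc_fst[OF ab c(4-9)] R.quadratic_assoc_snd[OF ab c(4-9)] by blast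
    have "(r \<oplus>\<^bsub>R\<^esub> s) \<otimes>\<^bsub>R\<^esub> p \<ominus>\<^bsub>R\<^esub> b \<otimes>\<^bsub>R\<^esub> ((i \<oplus>\<^bsub>R\<^esub> j) \<otimes>\<^bsub>R\<^esub> l) =
        r \<otimes>\<^bsub>R\<^esub> p \<ominus>\<^bsub>R\<^esub> b \<otimes>\<^bsub>R\<^esub> (i \<otimes>\<^bsub>R\<^esub> l) \<oplus>\<^bsub>R\<^esub> (s \<otimes>\<^bsub>R\<^esub> p \<ominus>\<^bsub>R\<^esub> b \<otimes>\<^bsub>R\<^esub> (j \<otimes>\<^bsub>R\<^esub> l))"
      "(r \<oplus>\<^bsub>R\<^esub> s) \<otimes>\<^bsub>R\<^esub> l \<oplus>\<^bsub>R\<^esub> (i \<oplus>\<^bsub>R\<^esub> j) \<otimes>\<^bsub>R\<^esub> p \<ominus>\<^bsub>R\<^esub> a \<otimes>\<^bsub>R\<^esub> ((i \<oplus>\<^bsub>R\<^esub> j) \<otimes>\<^bsub>R\<^esub> l) =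
        r \<otimes>\<^bsub>R\<^esub> l \<oplus>\<^bsub>R\<^esub> i \<otimes>\<^bsub>R\<^esub> p \<ominus>\<^bsub>R\<^esub> a \<otimes>\<^bsub>R\<^esub> (i \<otimes>\<^bsub>R\<^esub> l) \<oplus>\<^bsub>R\<^esub>
        (s \<otimes>\<^bsub>R\<^esub> l \<oplus>\<^bsub>R\<^esub> j \<otimes>\<^bsub>R\<^esub> p \<ominus>\<^bsub>R\<^esub> a \<otimes>\<^bsub>R\<^esub> (j \<otimes>\<^bsub>R\<^esub> l))"
      using ab c(4-9) by algebra+
    then show "(x \<oplus>\<^bsub>quadratic_ring R a b\<^esub> y) \<otimes>\<^bsub>quadratic_ring R a b\<^esub> z
      = x \<otimes>\<^bsub>quadratic_ring R a b\<^esub> z \<oplus>\<^bsub>quadratic_ring R a b\<^esub> y \<otimes>\<^bsub>quadratic_ring R a b\<^esub> z"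
      unfolding c quadratic_ring_simps prod.inject by blast
  next
    fix x y
    assume "x \<in> carrier (quadratic_ring R a b)" "y \<in> carrier (quadratic_ring R a b)"
    then show "x \<otimes>\<^bsub>quadratic_ring R a b\<^esub> y = y \<otimes>\<^bsub>quadratic_ring R a b\<^esub> x"
      by (auto simp: R.m_comm R.a_comm)
  qed (use ab in \<open>auto simp: R.a_ac R.minus_eq\<close>)
qed

lemma (in abelian_monoid) finsum_in_submonoid:
  assumes "finite A" "\<And>i. i \<in> A \<Longrightarrow> f i \<in> W" "W \<subseteq> carrier G" "\<zero> \<in> W"
    "\<And>x y. x \<in> W \<Longrightarrow> y \<in> W \<Longrightarrow> x \<oplus> y \<in> W"
  shows "finsum G f A \<in> W"
  using assms(1,2)
proof (induction A rule: finite_induct)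
  case (insert x A)
  then have "f x \<in> W" "finsum G f A \<in> W" "f \<in> A \<rightarrow> carrier G" "f x \<in> carrier G" using assms(3) by auto
  then show ?case using insert(1,2) assms(5) by (simp add: finsum_insert)
qed (use assms(4) in simp)

text \<open>The quotient of the Rees algebra is identified with \<open>R + It\<close> inside \<open>quadratic_ring\<close> through
  the evaluation \<open>Psi\<close> of polynomials at \<open>t\<close>.\<close>

locale rees = R: cring R + I: ideal I R
  for R :: "('a, 'k) ring_scheme" (structure) and I :: "'a set" +
  fixes a b :: 'a
  assumes ab: "a \<in> carrier R" "b \<in> carrier R"
begin

abbreviation "P \<equiv> UP R"
abbreviation "S \<equiv> quadratic_ring R a b"
abbreviation "g \<equiv> monom P \<one> 2 \<oplus>\<^bsub>P\<^esub> monom P a 1 \<oplus>\<^bsub>P\<^esub> monom P b 0"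
abbreviation "A \<equiv> rees_quotient R I a b"
abbreviation "elt \<equiv> rees_elt R I a b"
abbreviation "Rees \<equiv> rees_algebra R I"

sublocale UP: UP_cring R P by unfold_locales simp
sublocale S: cring S by (rule quadratic_ring_cring[OF R.cring_axioms ab])

lemma const_hom: "(\<lambda>r. (r, \<zero>)) \<in> ring_hom R S"
  by (rule ring_hom_memI) (use ab in \<open>auto simp: R.minus_eq\<close>)

lemma pre_univ_prop: "UP_pre_univ_prop R S (\<lambda>r. (r, \<zero>))"
  using const_hom R.cring_axioms S.cring_axioms
  by (intro UP_pre_univ_prop.intro ring_hom_cring.intro ring_hom_cring_axioms.intro UP.UP_cring_axioms) simp_all

definition "Psi = eval R S (\<lambda>r. (r, \<zero>)) (\<zero>, \<one>)"

lemma t_closed: "(\<zero>, \<one>) \<in> carrier S" by simp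

lemma Psi_hom: "Psi \<in> ring_hom P S"
  unfolding Psi_def by (rule UP_pre_univ_prop.eval_ring_hom[OF pre_univ_prop t_closed])

lemma Psi_monom: "c \<in> carrier R \<Longrightarrow> Psi (monom P c n) = (c, \<zero>) \<otimes>\<^bsub>S\<^esub> (\<zero>, \<one>) [^]\<^bsub>S\<^esub> n"
  unfolding Psi_def by (rule UP_pre_univ_prop.eval_monom[OF pre_univ_prop _ t_closed])

lemmas Psi_add = ring_hom_add[OF Psi_hom]
lemmas Psi_mult = ring_hom_mult[OF Psi_hom]

definition "lin r i = monom P r 0 \<oplus>\<^bsub>P\<^esub> monom P i 1"

lemma lin_closed: "r \<in> carrier R \<Longrightarrow> i \<in> carrier R \<Longrightarrow> lin r i \<in> carrier P"
  by (simp add: lin_def)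

lemma Psi_lin: "r \<in> carrier R \<Longrightarrow> i \<in> carrier R \<Longrightarrow> Psi (lin r i) = (r, i)"
  using ab by (simp add: lin_def Psi_add Psi_monom R.minus_eq S.nat_pow_Suc)

lemma g_closed: "g \<in> carrier P" using ab by simp

lemma Psi_g: "Psi g = \<zero>\<^bsub>S\<^esub>"
proof -
  have "Psi g = (\<one>, \<zero>) \<otimes>\<^bsub>S\<^esub> (\<zero>, \<one>) [^]\<^bsub>S\<^esub> (2::nat) \<oplus>\<^bsub>S\<^esub> (a, \<zero>) \<otimes>\<^bsub>S\<^esub> (\<zero>, \<one>) [^]\<^bsub>S\<^esub> (1::nat)
      \<oplus>\<^bsub>S\<^esub> (b, \<zero>) \<otimes>\<^bsub>S\<^esub> (\<zero>, \<one>) [^]\<^bsub>S\<^esub> (0::nat)"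
    using ab by (simp only: Psi_add Psi_monom UP.monom_closed UP.UP_a_closed R.one_closed)
  also have "(\<zero>, \<one>) [^]\<^bsub>S\<^esub> (2::nat) = (\<zero>, \<one>) \<otimes>\<^bsub>S\<^esub> (\<zero>, \<one>)"
    using S.nat_pow_Suc[of "(\<zero>, \<one>)" 1] S.nat_pow_eone[OF t_closed] by (simp only: Suc_1)
  also have "(\<zero>, \<one>) [^]\<^bsub>S\<^esub> (1::nat) = (\<zero>, \<one>)" by (rule S.nat_pow_eone[OF t_closed])
  also have "(\<zero>, \<one>) [^]\<^bsub>S\<^esub> (0::nat) = (\<one>, \<zero>)" by (simp only: S.nat_pow_0 quadratic_ring_simps)
  also have "(\<one>, \<zero>) \<otimes>\<^bsub>S\<^esub> ((\<zero>, \<one>) \<otimes>\<^bsub>S\<^esub> (\<zero>, \<one>)) \<oplus>\<^bsub>S\<^esub> (a, \<zero>) \<otimes>\<^bsub>S\<^esub> (\<zero>, \<one>)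
      \<oplus>\<^bsub>S\<^esub> (b, \<zero>) \<otimes>\<^bsub>S\<^esub> (\<one>, \<zero>) = \<zero>\<^bsub>S\<^esub>"
    using ab by (simp add: R.minus_eq R.l_neg)
  finally show ?thesis .
qed

text \<open>Division with remainder by a monic quadratic polynomial. The polynomials that admit it form
  an additive group that is stable under multiplication by the variable, so it contains all
  monomials.\<close>

lemma division:
  assumes "f \<in> carrier P"
  shows "\<exists>r\<in>carrier R. \<exists>i\<in>carrier R. \<exists>q\<in>carrier P. f = lin r i \<oplus>\<^bsub>P\<^esub> g \<otimes>\<^bsub>P\<^esub> q"
proof -
  define V where "V = {x. \<exists>r\<in>carrier R. \<exists>i\<in>carrier R. \<exists>q\<in>carrier P. x = lin r i \<oplus>\<^bsub>P\<^esub> g \<otimes>\<^bsub>P\<^esub> q}"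
  have VE: "\<exists>r\<in>carrier R. \<exists>i\<in>carrier R. \<exists>q\<in>carrier P. x = lin r i \<oplus>\<^bsub>P\<^esub> g \<otimes>\<^bsub>P\<^esub> q" if "x \<in> V" for x
    using that by (simp only: V_def mem_Collect_eq)
  have VI: "lin r i \<oplus>\<^bsub>P\<^esub> g \<otimes>\<^bsub>P\<^esub> q \<in> V" if "r \<in> carrier R" "i \<in> carrier R" "q \<in> carrier P" for r i q
    unfolding V_def mem_Collect_eq by (intro bexI[OF _ that(1)] bexI[OF _ that(2)] bexI[OF _ that(3)] refl)
  have V: "V \<subseteq> carrier P"
  proof
    fix x assume "x \<in> V"
    from VE[OF this] obtain r i q where c: "r \<in> carrier R" "i \<in> carrier R" "q \<in> carrier P"
      "x = lin r i \<oplus>\<^bsub>P\<^esub> g \<otimes>\<^bsub>P\<^esub> q" by (elim bexE)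
    show "x \<in> carrier P"
      unfolding c(4) by (intro UP.P.a_closed UP.P.m_closed lin_closed[OF c(1,2)] g_closed c(3))
  qed
  have add: "x \<oplus>\<^bsub>P\<^esub> y \<in> V" if "x \<in> V" "y \<in> V" for x y
  proof -
    from VE[OF that(1)] VE[OF that(2)] obtain r i q s j p where c: "r \<in> carrier R" "i \<in> carrier R" "q \<in> carrier P"
      "s \<in> carrier R" "j \<in> carrier R" "p \<in> carrier P"
      "x = lin r i \<oplus>\<^bsub>P\<^esub> g \<otimes>\<^bsub>P\<^esub> q" "y = lin s j \<oplus>\<^bsub>P\<^esub> g \<otimes>\<^bsub>P\<^esub> p" by (elim bexE)
    have l: "lin (r \<oplus> s) (i \<oplus> j) = lin r i \<oplus>\<^bsub>P\<^esub> lin s j"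
    proof -
      have "(A \<oplus>\<^bsub>P\<^esub> B) \<oplus>\<^bsub>P\<^esub> (C \<oplus>\<^bsub>P\<^esub> D) = (A \<oplus>\<^bsub>P\<^esub> C) \<oplus>\<^bsub>P\<^esub> (B \<oplus>\<^bsub>P\<^esub> D)"
        if "A \<in> carrier P" "B \<in> carrier P" "C \<in> carrier P" "D \<in> carrier P" for A B C D
        using that by algebra
      from this[of "monom P r 0" "monom P s 0" "monom P i 1" "monom P j 1"] show ?thesis
        unfolding lin_def using c by (simp only: UP.monom_add UP.monom_closed)
    qed
    have key: "(L \<oplus>\<^bsub>P\<^esub> G \<otimes>\<^bsub>P\<^esub> q) \<oplus>\<^bsub>P\<^esub> (L' \<oplus>\<^bsub>P\<^esub> G \<otimes>\<^bsub>P\<^esub> p) = (L \<oplus>\<^bsub>P\<^esub> L') \<oplus>\<^bsub>P\<^esub> G \<otimes>\<^bsub>P\<^esub> (q \<oplus>\<^bsub>P\<^esub> p)"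
      if "L \<in> carrier P" "L' \<in> carrier P" "G \<in> carrier P" "q \<in> carrier P" "p \<in> carrier P" for L L' G q p
      using that by algebra
    have "x \<oplus>\<^bsub>P\<^esub> y = lin (r \<oplus> s) (i \<oplus> j) \<oplus>\<^bsub>P\<^esub> g \<otimes>\<^bsub>P\<^esub> (q \<oplus>\<^bsub>P\<^esub> p)"
      unfolding l c(7,8) by (rule key[OF lin_closed[OF c(1,2)] lin_closed[OF c(4,5)] g_closed c(3,6)])
    also have "\<dots> \<in> V" using c by (intro VI) auto
    finally show ?thesis .
  qed
  have shift: "monom P \<one> 1 \<otimes>\<^bsub>P\<^esub> x \<in> V" if "x \<in> V" for x
  proof -
    from VE[OF that] obtain r i q where c: "r \<in> carrier R" "i \<in> carrier R" "q \<in> carrier P"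
      "x = lin r i \<oplus>\<^bsub>P\<^esub> g \<otimes>\<^bsub>P\<^esub> q" by (elim bexE)
    let ?X = "monom P \<one> 1" and ?c = "\<lambda>r. monom P r 0"
    have m1: "monom P s 1 = ?c s \<otimes>\<^bsub>P\<^esub> ?X" if "s \<in> carrier R" for s
      using UP.monom_mult[of s \<one> 0 1] that by simp
    have g: "g = ?X \<otimes>\<^bsub>P\<^esub> ?X \<oplus>\<^bsub>P\<^esub> ?c a \<otimes>\<^bsub>P\<^esub> ?X \<oplus>\<^bsub>P\<^esub> ?c b"
      using UP.monom_mult[of \<one> \<one> 1 1] m1[OF ab(1)] by (simp add: numeral_2_eq_2)
    have key: "Y \<otimes>\<^bsub>P\<^esub> ((A \<oplus>\<^bsub>P\<^esub> B \<otimes>\<^bsub>P\<^esub> Y) \<oplus>\<^bsub>P\<^esub> (Y \<otimes>\<^bsub>P\<^esub> Y \<oplus>\<^bsub>P\<^esub> M \<otimes>\<^bsub>P\<^esub> Y \<oplus>\<^bsub>P\<^esub> N) \<otimes>\<^bsub>P\<^esub> q) =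
       ((\<ominus>\<^bsub>P\<^esub> (N \<otimes>\<^bsub>P\<^esub> B)) \<oplus>\<^bsub>P\<^esub> (A \<ominus>\<^bsub>P\<^esub> M \<otimes>\<^bsub>P\<^esub> B) \<otimes>\<^bsub>P\<^esub> Y)
         \<oplus>\<^bsub>P\<^esub> (Y \<otimes>\<^bsub>P\<^esub> Y \<oplus>\<^bsub>P\<^esub> M \<otimes>\<^bsub>P\<^esub> Y \<oplus>\<^bsub>P\<^esub> N) \<otimes>\<^bsub>P\<^esub> (Y \<otimes>\<^bsub>P\<^esub> q \<oplus>\<^bsub>P\<^esub> B)"
      if "Y \<in> carrier P" "A \<in> carrier P" "B \<in> carrier P" "M \<in> carrier P" "N \<in> carrier P" "q \<in> carrier P" for Y A B M N q
      using that by algebra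
    have l1: "lin r i = ?c r \<oplus>\<^bsub>P\<^esub> ?c i \<otimes>\<^bsub>P\<^esub> ?X" unfolding lin_def m1[OF c(2)] ..
    have mm: "?c (s \<otimes> t) = ?c s \<otimes>\<^bsub>P\<^esub> ?c t" if "s \<in> carrier R" "t \<in> carrier R" for s t
      using UP.monom_mult[of s t 0 0] that by simp
    have l2: "lin (\<ominus> (b \<otimes> i)) (r \<ominus> a \<otimes> i) =
        (\<ominus>\<^bsub>P\<^esub> (?c b \<otimes>\<^bsub>P\<^esub> ?c i)) \<oplus>\<^bsub>P\<^esub> (?c r \<ominus>\<^bsub>P\<^esub> ?c a \<otimes>\<^bsub>P\<^esub> ?c i) \<otimes>\<^bsub>P\<^esub> ?X"
    proof -
      have "?c (r \<ominus> a \<otimes> i) = ?c r \<ominus>\<^bsub>P\<^esub> ?c a \<otimes>\<^bsub>P\<^esub> ?c i"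
        using c ab by (simp add: R.minus_eq UP.P.minus_eq mm del: UP.monom_mult)
      moreover have "?c (\<ominus> (b \<otimes> i)) = \<ominus>\<^bsub>P\<^esub> (?c b \<otimes>\<^bsub>P\<^esub> ?c i)"
        using c ab by (simp add: mm del: UP.monom_mult)
      ultimately show ?thesis unfolding lin_def using c ab by (subst m1) auto
    qed
    have "?X \<otimes>\<^bsub>P\<^esub> x = lin (\<ominus> (b \<otimes> i)) (r \<ominus> a \<otimes> i) \<oplus>\<^bsub>P\<^esub> g \<otimes>\<^bsub>P\<^esub> (?X \<otimes>\<^bsub>P\<^esub> q \<oplus>\<^bsub>P\<^esub> ?c i)"
      unfolding c(4) l1 l2 g by (rule key) (use c ab in auto)
    also have "\<dots> \<in> V" using c ab by (intro VI) auto
    finally show ?thesis .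
  qed
  have V0: "lin r \<zero> \<in> V" if "r \<in> carrier R" for r
    using VI[OF that R.zero_closed UP.P.zero_closed] g_closed lin_closed[OF that R.zero_closed] by simp
  have mono: "monom P c n \<in> V" if c: "c \<in> carrier R" for c n
  proof (induction n)
    case 0
    show ?case using V0[OF c] c by (simp add: lin_def)
  next
    case (Suc n)
    have "monom P c (Suc n) = monom P \<one> 1 \<otimes>\<^bsub>P\<^esub> monom P c n"
      using UP.monom_mult[of \<one> c 1 n] c by simp
    then show ?case using shift[OF Suc] by simp
  qed
  have "(\<Oplus>\<^bsub>P\<^esub> i \<in> {..deg R f}. monom P (coeff P f i) i) \<in> V"
  proof (rule UP.P.finsum_in_submonoid)
    have "lin \<zero> \<zero> = \<zero>\<^bsub>P\<^esub>" by (simp add: lin_def)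
    then show "\<zero>\<^bsub>P\<^esub> \<in> V" using V0[OF R.zero_closed] by (simp only:)
    show "monom P (coeff P f i) i \<in> V" for i by (rule mono[OF UP.coeff_closed[OF assms]])
  qed (fact V add finite_atMost)+
  then have "f \<in> V" by (simp only: UP.up_repr[OF assms])
  then show ?thesis by (rule VE)
qed

lemma Psi_zero_iff:
  assumes "f \<in> carrier P"
  shows "Psi f = \<zero>\<^bsub>S\<^esub> \<longleftrightarrow> f \<in> PIdl\<^bsub>P\<^esub> g"
proof
  assume "f \<in> PIdl\<^bsub>P\<^esub> g"
  then obtain q where "q \<in> carrier P" "f = q \<otimes>\<^bsub>P\<^esub> g" by (auto simp: cgenideal_def)
  then show "Psi f = \<zero>\<^bsub>S\<^esub>"
    using Psi_mult[of q g] g_closed Psi_g ring_hom_closed[OF Psi_hom, of q] S.r_null by metis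
next
  assume z: "Psi f = \<zero>\<^bsub>S\<^esub>"
  obtain r i q where c: "r \<in> carrier R" "i \<in> carrier R" "q \<in> carrier P" "f = lin r i \<oplus>\<^bsub>P\<^esub> g \<otimes>\<^bsub>P\<^esub> q"
    using division[OF assms] by blast
  have "Psi (g \<otimes>\<^bsub>P\<^esub> q) = \<zero>\<^bsub>S\<^esub>"
    using Psi_mult[OF g_closed c(3)] Psi_g ring_hom_closed[OF Psi_hom c(3)] S.l_null by metis
  then have "Psi f = (r, i)"
    unfolding c(4) using Psi_add[of "lin r i" "g \<otimes>\<^bsub>P\<^esub> q"] lin_closed[OF c(1,2)] g_closed c Psi_lin[OF c(1,2)] by simp
  then have "(r, i) = (\<zero>, \<zero>)" using z by (simp only: quadratic_ring_simps)
  then have "r = \<zero>" "i = \<zero>" by simp_all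
  then have "f = q \<otimes>\<^bsub>P\<^esub> g" using c(3) g_closed unfolding c(4) by (simp add: lin_def UP.P.m_comm)
  then show "f \<in> PIdl\<^bsub>P\<^esub> g" using c(3) by (auto simp: cgenideal_def)
qed

abbreviation "Ipow n \<equiv> I [^]\<^bsub>ideals_set R\<^esub> (n::nat)"

lemma Ipow_0: "Ipow 0 = carrier R" by (simp add: ideals_set_def)

sublocale IS: comm_monoid "ideals_set R" by (rule R.ideals_set_is_comm_monoid)

lemma I_in: "I \<in> carrier (ideals_set R)" using I.ideal_axioms by (simp add: ideals_set_def)

lemma Ipow_ideal: "ideal (Ipow n) R"
  using IS.nat_pow_closed[OF I_in, of n] by (simp add: ideals_set_def)

lemma Ipow_1: "Ipow 1 = I" using IS.nat_pow_eone[OF I_in] by simp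

lemma Ipow_mult: "x \<in> Ipow n \<Longrightarrow> y \<in> Ipow m \<Longrightarrow> x \<otimes> y \<in> Ipow (n + m)"
proof -
  assume "x \<in> Ipow n" "y \<in> Ipow m"
  then have "x \<otimes> y \<in> Ipow n \<cdot> Ipow m" by (rule ideal_prod.prod)
  also have "Ipow n \<cdot> Ipow m = Ipow (n + m)"
    using IS.nat_pow_mult[OF I_in, of n m] by (simp add: ideals_set_def)
  finally show ?thesis .
qed

lemma Ipow_Suc_subset: "Ipow (Suc n) \<subseteq> I"
proof -
  have "Ipow (Suc n) = Ipow n \<cdot> I" by (simp add: ideals_set_def)
  then show ?thesis using R.ideal_prod_inter[OF Ipow_ideal I.ideal_axioms] by auto
qed

lemma Rees_carrier: "p \<in> carrier Rees \<longleftrightarrow> p \<in> carrier P \<and> (\<forall>n. coeff P p n \<in> Ipow n)"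
  by (simp add: rees_algebra_def)

lemma Rees_subring: "subring (carrier Rees) P"
proof (rule UP.P.subringI)
  show "carrier Rees \<subseteq> carrier P" by (auto simp: Rees_carrier)
  show "\<one>\<^bsub>P\<^esub> \<in> carrier Rees"
    using additive_subgroup.zero_closed[OF ideal.axioms(1)[OF Ipow_ideal]]
    by (auto simp: Rees_carrier Ipow_0[simplified])
next
  fix h assume h: "h \<in> carrier Rees"
  then show "\<ominus>\<^bsub>P\<^esub> h \<in> carrier Rees"
    using additive_subgroup.a_inv_closed[OF ideal.axioms(1)[OF Ipow_ideal]] by (auto simp: Rees_carrier)
next
  fix p q assume h: "p \<in> carrier Rees" "q \<in> carrier Rees"
  then show "p \<oplus>\<^bsub>P\<^esub> q \<in> carrier Rees"
    using additive_subgroup.a_closed[OF ideal.axioms(1)[OF Ipow_ideal]] by (auto simp: Rees_carrier)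
  have "coeff P (p \<otimes>\<^bsub>P\<^esub> q) n \<in> Ipow n" for n
  proof -
    interpret J: ideal "Ipow n" R by (rule Ipow_ideal)
    have "(\<Oplus>i \<in> {..n}. coeff P p i \<otimes> coeff P q (n - i)) \<in> Ipow n"
    proof (rule R.finsum_in_submonoid)
      fix i assume "i \<in> {..n}"
      then show "coeff P p i \<otimes> coeff P q (n - i) \<in> Ipow n"
        using Ipow_mult[of "coeff P p i" i "coeff P q (n - i)" "n - i"] h by (simp add: Rees_carrier)
    qed (use J.Icarr in auto)
    then show ?thesis using h by (simp add: Rees_carrier)
  qed
  then show "p \<otimes>\<^bsub>P\<^esub> q \<in> carrier Rees" using h by (simp add: Rees_carrier)
qed

lemma Rees_eq: "P\<lparr>carrier := carrier Rees\<rparr> = Rees"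
  by (simp add: rees_algebra_def)

lemma Rees_cring: "cring Rees"
  using UP.P.subcring_iff[OF subringE(1)[OF Rees_subring]] UP.P.subcringI'[OF Rees_subring] Rees_eq by simp

sublocale Rees: cring Rees by (rule Rees_cring)

lemma Rees_simps [simp]:
  "x \<otimes>\<^bsub>Rees\<^esub> y = x \<otimes>\<^bsub>P\<^esub> y" "x \<oplus>\<^bsub>Rees\<^esub> y = x \<oplus>\<^bsub>P\<^esub> y" "\<one>\<^bsub>Rees\<^esub> = \<one>\<^bsub>P\<^esub>" "\<zero>\<^bsub>Rees\<^esub> = \<zero>\<^bsub>P\<^esub>"
  by (simp_all add: rees_algebra_def)

lemma Rees_Psi: "ring_hom_ring Rees S Psi"
proof (rule ring_hom_ringI[OF Rees.ring_axioms S.ring_axioms])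
  fix x y assume xy: "x \<in> carrier Rees" "y \<in> carrier Rees"
  then have "x \<in> carrier P" "y \<in> carrier P" by (simp_all add: Rees_carrier)
  then show "Psi x \<in> carrier S" "Psi (x \<otimes>\<^bsub>Rees\<^esub> y) = Psi x \<otimes>\<^bsub>S\<^esub> Psi y" "Psi (x \<oplus>\<^bsub>Rees\<^esub> y) = Psi x \<oplus>\<^bsub>S\<^esub> Psi y"
    using ring_hom_closed[OF Psi_hom] Psi_mult Psi_add by simp_all
qed (use ring_hom_one[OF Psi_hom] in simp)

lemma lin_Rees:
  assumes "r \<in> carrier R" "i \<in> I"
  shows "lin r i \<in> carrier Rees"
proof -
  have i: "i \<in> carrier R" by (rule I.Icarr[OF assms(2)])
  have "coeff P (lin r i) n \<in> Ipow n" for n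
  proof -
    interpret J: ideal "Ipow n" R by (rule Ipow_ideal)
    consider "n = 0" | "n = 1" | "n \<noteq> 0 \<and> n \<noteq> 1" by blast
    then show ?thesis
    proof cases
      case 2
      then show ?thesis using Ipow_1 assms i by (simp add: lin_def)
    qed (use assms i Ipow_0 in \<open>auto simp: lin_def\<close>)
  qed
  then show ?thesis using lin_closed[OF assms(1) i] by (simp add: Rees_carrier)
qed

text \<open>The image contains no more than \<open>R + It\<close> because the coefficient of \<open>t\<^sup>n\<close> of a member
  of the Rees algebra lies in \<open>I\<close> for every positive \<open>n\<close>.\<close>

lemma Psi_Rees: "Psi ` carrier Rees = carrier R \<times> I"
proof
  show "carrier R \<times> I \<subseteq> Psi ` carrier Rees"
  proof
    fix x assume "x \<in> carrier R \<times> I"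
    then obtain r i where "x = (r, i)" "r \<in> carrier R" "i \<in> I" by blast
    then show "x \<in> Psi ` carrier Rees"
      using lin_Rees[of r i] Psi_lin[of r i] I.Icarr by (metis imageI)
  qed
  show "Psi ` carrier Rees \<subseteq> carrier R \<times> I"
  proof
    fix x assume "x \<in> Psi ` carrier Rees"
    then obtain p where p: "p \<in> carrier P" "\<And>n. coeff P p n \<in> Ipow n" "x = Psi p" by (auto simp: Rees_carrier)
    have "x = (\<Oplus>\<^bsub>S\<^esub>n\<in>{..deg R p}. (coeff P p n, \<zero>) \<otimes>\<^bsub>S\<^esub> (\<zero>, \<one>) [^]\<^bsub>S\<^esub> n)"
      unfolding p(3) Psi_def by (rule UP.eval_on_carrier[OF p(1)])
    also have "\<dots> \<in> carrier R \<times> I"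
    proof (rule S.finsum_in_submonoid)
      fix n :: nat
      have tn: "(\<zero>, \<one>) [^]\<^bsub>S\<^esub> n \<in> carrier S" by (rule S.nat_pow_closed[OF t_closed])
      have c: "coeff P p n \<in> carrier R" using p(1) by simp
      show "(coeff P p n, \<zero>) \<otimes>\<^bsub>S\<^esub> (\<zero>, \<one>) [^]\<^bsub>S\<^esub> n \<in> carrier R \<times> I"
      proof (cases n)
        case 0
        then show ?thesis using c ab by (simp add: R.minus_eq)
      next
        case (Suc m)
        then have cI: "coeff P p n \<in> I" using p(2)[of n] Ipow_Suc_subset by blast
        obtain u v where uv: "(\<zero>, \<one>) [^]\<^bsub>S\<^esub> n = (u, v)" "u \<in> carrier R" "v \<in> carrier R" using tn by auto
        show ?thesis unfolding uv(1) using uv(2,3) c ab cI I.I_r_closed by (simp add: R.minus_eq)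
      qed
    qed (use I.Icarr in auto)
    finally show "x \<in> carrier R \<times> I" .
  qed
qed

sublocale Psi: ring_hom_ring Rees S Psi by (rule Rees_Psi)

lemma kernel_eq: "rees_kernel R I a b = a_kernel Rees S Psi"
  unfolding rees_kernel_def a_kernel_def' using Psi_zero_iff by (auto simp: Rees_carrier)

definition "Phi C = the_elem (Psi ` C)"

lemma Phi_iso: "Phi \<in> ring_iso A (S\<lparr>carrier := carrier R \<times> I\<rparr>)"
  using Psi.FactRing_iso_set_aux unfolding Psi_Rees Phi_def rees_quotient_def kernel_eq by simp

lemma A_cring: "cring A"
  unfolding rees_quotient_def kernel_eq
  by (rule ideal.quotient_is_cring[OF Psi.kernel_is_ideal Rees_cring])

sublocale A: cring A by (rule A_cring)

lemma elt_eq: "elt r i = a_kernel Rees S Psi +>\<^bsub>Rees\<^esub> lin r i"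
  by (simp add: rees_elt_def kernel_eq lin_def)

lemma Phi_elt: "r \<in> carrier R \<Longrightarrow> i \<in> I \<Longrightarrow> Phi (elt r i) = (r, i)"
  unfolding elt_eq Phi_def using Psi.the_elem_simp[OF lin_Rees] Psi_lin I.Icarr by simp

lemma elt_closed: "r \<in> carrier R \<Longrightarrow> i \<in> I \<Longrightarrow> elt r i \<in> carrier A"
  unfolding elt_eq rees_quotient_def kernel_eq FactRing_def A_RCOSETS_def'
  using lin_Rees by auto

lemma Phi_inj: "x \<in> carrier A \<Longrightarrow> y \<in> carrier A \<Longrightarrow> Phi x = Phi y \<Longrightarrow> x = y"
  using Phi_iso unfolding ring_iso_def bij_betw_def inj_on_def by blast

lemma Phi_ops:
  assumes "x \<in> carrier A" "y \<in> carrier A"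
  shows "Phi x \<in> carrier R \<times> I" "Phi (x \<oplus>\<^bsub>A\<^esub> y) = Phi x \<oplus>\<^bsub>S\<^esub> Phi y" "Phi (x \<otimes>\<^bsub>A\<^esub> y) = Phi x \<otimes>\<^bsub>S\<^esub> Phi y"
  using ring_iso_memE(1-3)[OF Phi_iso] assms by auto

lemma elt_cases:
  assumes "x \<in> carrier A"
  obtains r i where "r \<in> carrier R" "i \<in> I" "x = elt r i"
proof -
  from Phi_ops(1)[OF assms assms] obtain r i where ri: "r \<in> carrier R" "i \<in> I" "Phi x = (r, i)"
    by (elim SigmaE)
  have "Phi x = Phi (elt r i)" unfolding ri(3) Phi_elt[OF ri(1,2)] ..
  then have "x = elt r i" by (rule Phi_inj[OF assms elt_closed[OF ri(1,2)]])
  with ri(1,2) show ?thesis by (rule that)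
qed

lemma elt_eq_iff:
  assumes "r \<in> carrier R" "i \<in> I" "s \<in> carrier R" "j \<in> I"
  shows "elt r i = elt s j \<longleftrightarrow> r = s \<and> i = j"
  using Phi_elt[OF assms(1,2)] Phi_elt[OF assms(3,4)] by (metis prod.inject)

lemma elt_add:
  assumes "r \<in> carrier R" "i \<in> I" "s \<in> carrier R" "j \<in> I"
  shows "elt r i \<oplus>\<^bsub>A\<^esub> elt s j = elt (r \<oplus> s) (i \<oplus> j)"
proof -
  note e = elt_closed[OF assms(1,2)] elt_closed[OF assms(3,4)]
  note m = R.a_closed[OF assms(1,3)] I.a_closed[OF assms(2,4)]
  have "Phi (elt r i \<oplus>\<^bsub>A\<^esub> elt s j) = Phi (elt (r \<oplus> s) (i \<oplus> j))"
    by (simp only: Phi_ops(2)[OF e] Phi_elt[OF assms(1,2)] Phi_elt[OF assms(3,4)] Phi_elt[OF m] quadratic_ring_simps)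
  then show ?thesis by (rule Phi_inj[OF A.a_closed[OF e] elt_closed[OF m]])
qed

lemma elt_mult:
  assumes "r \<in> carrier R" "i \<in> I" "s \<in> carrier R" "j \<in> I"
  shows "elt r i \<otimes>\<^bsub>A\<^esub> elt s j =
    elt (r \<otimes> s \<ominus> b \<otimes> (i \<otimes> j)) (r \<otimes> j \<oplus> i \<otimes> s \<ominus> a \<otimes> (i \<otimes> j))"
proof -
  note e = elt_closed[OF assms(1,2)] elt_closed[OF assms(3,4)]
  have m: "r \<otimes> s \<ominus> b \<otimes> (i \<otimes> j) \<in> carrier R" "r \<otimes> j \<oplus> i \<otimes> s \<ominus> a \<otimes> (i \<otimes> j) \<in> I"
    using assms I.Icarr ab I.I_l_closed I.I_r_closed by (simp_all add: R.minus_eq)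
  have "Phi (elt r i \<otimes>\<^bsub>A\<^esub> elt s j) =
      Phi (elt (r \<otimes> s \<ominus> b \<otimes> (i \<otimes> j)) (r \<otimes> j \<oplus> i \<otimes> s \<ominus> a \<otimes> (i \<otimes> j)))"
    by (simp only: Phi_ops(3)[OF e] Phi_elt[OF assms(1,2)] Phi_elt[OF assms(3,4)] Phi_elt[OF m] quadratic_ring_simps)
  then show ?thesis by (rule Phi_inj[OF A.m_closed[OF e] elt_closed[OF m]])
qed

lemma elt_one: "elt \<one> \<zero> = \<one>\<^bsub>A\<^esub>"
proof -
  have "Phi (elt \<one> \<zero>) = Phi \<one>\<^bsub>A\<^esub>"
    using ring_iso_memE(4)[OF Phi_iso] Phi_elt[OF R.one_closed I.zero_closed] by simp
  then show ?thesis by (rule Phi_inj[OF elt_closed[OF R.one_closed I.zero_closed] A.one_closed])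
qed

lemma elt_zero: "elt \<zero> \<zero> = \<zero>\<^bsub>A\<^esub>"
proof -
  have z: "elt \<zero> \<zero> \<in> carrier A" by (simp add: elt_closed)
  have "elt \<zero> \<zero> \<oplus>\<^bsub>A\<^esub> elt \<zero> \<zero> = elt \<zero> \<zero> \<oplus>\<^bsub>A\<^esub> \<zero>\<^bsub>A\<^esub>"
    unfolding A.r_zero[OF z] by (simp add: elt_add)
  from A.add.l_cancel[OF this z A.zero_closed z] show ?thesis .
qed

end

section \<open>Cohen-Macaulay local rings of dimension one\<close>

lemma (in cring) unitI:
  assumes "x \<in> carrier R" "y \<in> carrier R" "x \<otimes> y = \<one>"
  shows "x \<in> Units R"
  unfolding Units_def using assms m_comm[OF assms(1,2)] by auto

lemma local_unit:
  assumes "noetherian_ring R" "local_ring R \<mm>" "x \<in> carrier R" "x \<notin> \<mm>"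
  shows "x \<in> Units R"
proof -
  interpret R: cring R by (rule local_ringD(1)[OF assms(2)])
  have "PIdl\<^bsub>R\<^esub> x = carrier R"
    using local_ideal_subset[OF assms(1,2) R.cgenideal_ideal[OF assms(3)]] R.cgenideal_self[OF assms(3)] assms(4)
    by blast
  then have "\<one>\<^bsub>R\<^esub> \<in> PIdl\<^bsub>R\<^esub> x" by simp
  then obtain y where "y \<in> carrier R" "\<one>\<^bsub>R\<^esub> = y \<otimes>\<^bsub>R\<^esub> x" by (auto simp: cgenideal_def)
  then show ?thesis using assms(3) R.m_comm by (intro R.unitI[of x y]) simp_all
qed

lemma local_ringI:
  assumes "cring R" "ideal \<mm> R" "\<one>\<^bsub>R\<^esub> \<notin> \<mm>" "\<And>x. x \<in> carrier R \<Longrightarrow> x \<notin> \<mm> \<Longrightarrow> x \<in> Units R"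
  shows "local_ring R \<mm>"
proof -
  interpret R: cring R by fact
  interpret mm: ideal \<mm> R by fact
  have unit: "J = carrier R" if J: "ideal J R" and x: "x \<in> J" "x \<in> Units R" for J x
  proof -
    interpret J: ideal J R by (rule J)
    have "inv\<^bsub>R\<^esub> x \<otimes>\<^bsub>R\<^esub> x \<in> J" using x by (intro J.I_l_closed) auto
    then have "\<one>\<^bsub>R\<^esub> \<in> J" using x(2) by (simp only: R.Units_l_inv)
    then show ?thesis by (rule J.one_imp_carrier)
  qed
  have sub: "J \<subseteq> \<mm>" if J: "ideal J R" "J \<noteq> carrier R" for J
  proof
    fix x assume x: "x \<in> J"
    interpret J: ideal J R by (rule J(1))
    show "x \<in> \<mm>" using unit[OF J(1) x] assms(4)[OF J.Icarr[OF x]] J(2) by blast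
  qed
  have "maximalideal \<mm> R"
  proof (rule maximalidealI[OF assms(2)])
    show "carrier R \<noteq> \<mm>" using assms(3) by (metis R.one_closed)
    fix J assume "ideal J R" "\<mm> \<subseteq> J" "J \<subseteq> carrier R"
    then show "J = \<mm> \<or> J = carrier R" using sub by blast
  qed
  moreover have "J = \<mm>" if J: "maximalideal J R" for J
  proof -
    interpret J: maximalideal J R by (rule J)
    have "J \<subseteq> \<mm>" by (rule sub[OF J.ideal_axioms]) (use J.I_notcarr in metis)
    then show ?thesis
      using J.I_maximal[OF assms(2) _ mm.a_subset] assms(3) R.one_closed by metis
  qed
  ultimately show ?thesis unfolding local_ring_def using assms(1) by iprover
qed

lemma genideal_empty:
  assumes "cring R"
  shows "Idl\<^bsub>R\<^esub> {} = {\<zero>\<^bsub>R\<^esub>}"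
proof -
  interpret R: cring R by fact
  have "Idl\<^bsub>R\<^esub> {} \<subseteq> {\<zero>\<^bsub>R\<^esub>}" by (rule R.genideal_minimal[OF R.zeroideal]) simp
  moreover have "\<zero>\<^bsub>R\<^esub> \<in> Idl\<^bsub>R\<^esub> {}"
    by (rule additive_subgroup.zero_closed[OF ideal.axioms(1)[OF R.genideal_ideal]]) simp
  ultimately show ?thesis by blast
qed

lemma regular_elt_mult:
  assumes "cring R" "regular_elt R u" "regular_elt R v"
  shows "regular_elt R (u \<otimes>\<^bsub>R\<^esub> v)"
proof -
  interpret R: cring R by fact
  have c: "u \<in> carrier R" "v \<in> carrier R" using assms by (simp_all add: regular_elt_def)
  have "x = \<zero>\<^bsub>R\<^esub>" if x: "x \<in> carrier R" "u \<otimes>\<^bsub>R\<^esub> v \<otimes>\<^bsub>R\<^esub> x = \<zero>\<^bsub>R\<^esub>" for x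
  proof -
    have "u \<otimes>\<^bsub>R\<^esub> (v \<otimes>\<^bsub>R\<^esub> x) = \<zero>\<^bsub>R\<^esub>" using c x by (simp add: R.m_assoc)
    then have "v \<otimes>\<^bsub>R\<^esub> x = \<zero>\<^bsub>R\<^esub>" using assms(2) c x(1) unfolding regular_elt_def by (meson R.m_closed)
    then show ?thesis using assms(3) x(1) unfolding regular_elt_def by blast
  qed
  then show ?thesis unfolding regular_elt_def using c by simp
qed

lemma regular_elt_one: "cring R \<Longrightarrow> regular_elt R \<one>\<^bsub>R\<^esub>"
proof -
  assume "cring R"
  then interpret R: cring R .
  show ?thesis unfolding regular_elt_def by simp
qed

lemma regular_elt_power:
  assumes "cring R" "regular_elt R u"
  shows "regular_elt R (u [^]\<^bsub>R\<^esub> (n::nat))"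
proof -
  interpret R: cring R by fact
  show ?thesis
    by (induction n) (simp_all add: regular_elt_mult[OF assms(1) _ assms(2)] regular_elt_one[OF assms(1)])
qed

lemma prime_avoiding_powers:
  assumes "cring R" "noetherian_ring R" "ideal J R" "y \<in> carrier R" "\<And>n::nat. y [^]\<^bsub>R\<^esub> n \<notin> J"
  obtains p where "primeideal p R" "J \<subseteq> p" "y \<notin> p"
proof -
  interpret R: cring R by fact
  let ?S = "range (\<lambda>n::nat. y [^]\<^bsub>R\<^esub> n)"
  have d: "J \<inter> ?S = {}" using assms(5) by blast
  have one: "\<one>\<^bsub>R\<^esub> \<in> ?S" by (rule range_eqI[of _ _ 0]) simp
  have m: "s \<otimes>\<^bsub>R\<^esub> t \<in> ?S" if "s \<in> ?S" "t \<in> ?S" for s t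
  proof -
    from that(1) obtain n :: nat where n: "s = y [^]\<^bsub>R\<^esub> n" by (elim rangeE)
    from that(2) obtain m :: nat where m: "t = y [^]\<^bsub>R\<^esub> m" by (elim rangeE)
    from n m have "s \<otimes>\<^bsub>R\<^esub> t = y [^]\<^bsub>R\<^esub> (n + m)" using R.nat_pow_mult[OF assms(4)] by simp
    then show ?thesis by (rule range_eqI)
  qed
  obtain p where p: "primeideal p R" "J \<subseteq> p" "p \<inter> ?S = {}"
    by (rule prime_avoiding_multiplicative_set[OF assms(1-3) d one m])
  have "y \<in> ?S" by (rule range_eqI[of _ _ 1]) (simp add: R.nat_pow_eone assms(4))
  then have "y \<notin> p" using p(3) by blast
  with p(1,2) show ?thesis by (rule that)
qed

text \<open>The regular element \<open>u\<close> bounds depth and dimension from below. A regular sequence of length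
  two is impossible: modulo its first, regular, element the maximal ideal consists of
  nilpotents, by \<open>dim_one_regular_prime\<close>, so its second element is nilpotent and regular at
  the same time.\<close>

lemma cm_local_ring_dim_oneI:
  assumes N: "noetherian_ring R" and loc: "local_ring R \<mm>" and dim: "krull_dim R \<le> 1"
    and u: "u \<in> \<mm>" "regular_elt R u"
  shows "cm_local_ring R \<mm>" "krull_dim R = 1"
proof -
  note cr = local_ringD(1)[OF loc]
  interpret R: cring R by (rule cr)
  interpret mm: maximalideal \<mm> R by (rule local_ringD(2)[OF loc])
  have one: "\<one>\<^bsub>R\<^esub> \<notin> \<mm>" using mm.one_imp_carrier mm.I_notcarr by metis
  have uc: "u \<in> carrier R" by (rule mm.Icarr[OF u(1)])
  have "\<one>\<^bsub>R\<^esub> \<noteq> \<zero>\<^bsub>R\<^esub>" using one mm.zero_closed by metis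
  then have "u [^]\<^bsub>R\<^esub> n \<notin> {\<zero>\<^bsub>R\<^esub>}" for n :: nat
    using regular_elt_power[OF cr u(2), of n] R.one_closed unfolding regular_elt_def
    by (metis R.r_one R.l_null singletonD)
  then obtain p where p: "primeideal p R" "u \<notin> p"
    using prime_avoiding_powers[OF cr N R.zeroideal uc] by metis
  interpret p: primeideal p R by (rule p(1))
  have "p \<subseteq> \<mm>" by (rule local_ideal_subset[OF N loc p.ideal_axioms]) (use p.I_notcarr in metis)
  then have pm: "p \<subset> \<mm>" using u(1) p(2) by blast
  have "enat 1 \<le> krull_dim R"
    by (rule krull_dim_ge[of 1 "\<lambda>i. if i = 0 then p else \<mm>"])
      (use p(1) pm R.maximalideal_prime[OF mm.is_maximalideal] in auto)
  then show d1: "krull_dim R = 1" using dim by (simp add: one_enat_def)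
  have "depth R \<mm> = 1"
  proof (rule antisym)
    have "enat (length [u]) \<le> depth R \<mm>"
      unfolding depth_def
    proof (rule SUP_upper, intro CollectI conjI)
      show "regular_seq R [u]"
        unfolding regular_seq_def using u(2) by (auto simp: genideal_empty[OF cr] regular_elt_def)
    qed (use u(1) in simp)
    then show "1 \<le> depth R \<mm>" by (simp add: one_enat_def)
    show "depth R \<mm> \<le> 1"
      unfolding depth_def
    proof (rule SUP_least)
      fix xs assume "xs \<in> {xs. set xs \<subseteq> \<mm> \<and> regular_seq R xs}"
      then have xs: "set xs \<subseteq> \<mm>" "regular_seq R xs" by simp_all
      have "length xs \<le> 1"
      proof (rule ccontr)
        assume "\<not> length xs \<le> 1"
        then obtain x y zs where e: "xs = x # y # zs" by (cases xs; cases "tl xs") auto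
        have xy: "x \<in> \<mm>" "y \<in> \<mm>" using xs(1) e by auto
        note xyc = mm.Icarr[OF xy(1)] mm.Icarr[OF xy(2)]
        have "\<forall>z\<in>carrier R. x \<otimes>\<^bsub>R\<^esub> z \<in> Idl\<^bsub>R\<^esub> {} \<longrightarrow> z \<in> Idl\<^bsub>R\<^esub> {}"
          using xs(2)[unfolded regular_seq_def e, rule_format, of 0] by simp
        then have xr: "regular_elt R x" using xyc(1) unfolding genideal_empty[OF cr] regular_elt_def by simp
        have yr: "z \<in> Idl\<^bsub>R\<^esub> {x}" if "z \<in> carrier R" "y \<otimes>\<^bsub>R\<^esub> z \<in> Idl\<^bsub>R\<^esub> {x}" for z
          using xs(2)[unfolded regular_seq_def e, rule_format, of 1 z] that by simp
        have J: "ideal (Idl\<^bsub>R\<^esub> {x}) R" by (rule R.genideal_ideal) (use xyc in simp)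
        have xJ: "x \<in> Idl\<^bsub>R\<^esub> {x}" by (rule R.genideal_self'[OF xyc(1)])
        have "\<exists>n::nat. y [^]\<^bsub>R\<^esub> n \<in> Idl\<^bsub>R\<^esub> {x}"
        proof (rule ccontr)
          assume n: "\<not> ?thesis"
          obtain q where q: "primeideal q R" "Idl\<^bsub>R\<^esub> {x} \<subseteq> q" "y \<notin> q"
            by (rule prime_avoiding_powers[OF cr N J xyc(2)]) (use n in blast)
          have "q = \<mm>" by (rule dim_one_regular_prime[OF N loc dim q(1) subsetD[OF q(2) xJ] xr])
          then show False using q(3) xy(2) by simp
        qed
        then obtain n :: nat where n: "y [^]\<^bsub>R\<^esub> n \<in> Idl\<^bsub>R\<^esub> {x}" by blast
        have "\<one>\<^bsub>R\<^esub> \<in> Idl\<^bsub>R\<^esub> {x}"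
          using n
        proof (induction n)
          case (Suc n)
          have "y \<otimes>\<^bsub>R\<^esub> y [^]\<^bsub>R\<^esub> n \<in> Idl\<^bsub>R\<^esub> {x}" using Suc.prems xyc(2) by (simp add: R.m_comm)
          then have "y [^]\<^bsub>R\<^esub> n \<in> Idl\<^bsub>R\<^esub> {x}" by (rule yr[OF R.nat_pow_closed[OF xyc(2)]])
          then show ?case by (rule Suc.IH)
        qed simp
        moreover have "Idl\<^bsub>R\<^esub> {x} \<subseteq> \<mm>" by (rule R.genideal_minimal[OF mm.ideal_axioms]) (use xy in simp)
        ultimately show False using one by blast
      qed
      then show "enat (length xs) \<le> 1" by (simp add: one_enat_def)
    qed
  qed
  then show "cm_local_ring R \<mm>" unfolding cm_local_ring_def using N loc d1 by simp
qed

lemma cm_local_ring_regular_elt: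
  assumes "cm_local_ring R \<mm>" "krull_dim R = 1"
  obtains u where "u \<in> \<mm>" "regular_elt R u"
proof -
  have loc: "local_ring R \<mm>" and d: "depth R \<mm> = 1" using assms by (simp_all add: cm_local_ring_def)
  note cr = local_ringD(1)[OF loc]
  interpret mm: maximalideal \<mm> R by (rule local_ringD(2)[OF loc])
  have "\<exists>xs. set xs \<subseteq> \<mm> \<and> regular_seq R xs \<and> xs \<noteq> []"
  proof (rule ccontr)
    assume n: "\<not> ?thesis"
    have "depth R \<mm> \<le> 0"
      unfolding depth_def by (rule SUP_least) (use n in \<open>auto simp: zero_enat_def\<close>)
    then show False using d by simp
  qed
  then obtain x xs where xs: "set (x # xs) \<subseteq> \<mm>" "regular_seq R (x # xs)" by (metis list.exhaust)
  have "\<forall>z\<in>carrier R. x \<otimes>\<^bsub>R\<^esub> z \<in> Idl\<^bsub>R\<^esub> {} \<longrightarrow> z \<in> Idl\<^bsub>R\<^esub> {}"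
    using xs(2)[unfolded regular_seq_def, rule_format, of 0] by simp
  moreover have xm: "x \<in> \<mm>" using xs(1) by simp
  ultimately have "regular_elt R x" using mm.Icarr[OF xm] unfolding genideal_empty[OF cr] regular_elt_def by blast
  then show ?thesis by (rule that[OF xm])
qed

section \<open>The quotients of the Rees algebra are Cohen-Macaulay\<close>

text \<open>The conjugate of \<open>r + it\<close> is \<open>r - ai - it\<close>, because the two roots of \<open>t\<^sup>2 + at + b\<close>
  have the sum \<open>-a\<close>.\<close>

lemma (in cring) conjugate_identities:
  assumes "a \<in> carrier R" "b \<in> carrier R" "r \<in> carrier R" "i \<in> carrier R"
  shows "r \<otimes> (r \<ominus> a \<otimes> i) \<ominus> b \<otimes> (i \<otimes> (\<ominus> i)) = r \<otimes> (r \<ominus> a \<otimes> i) \<oplus> b \<otimes> (i \<otimes> i)"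
    and "r \<otimes> (\<ominus> i) \<oplus> i \<otimes> (r \<ominus> a \<otimes> i) \<ominus> a \<otimes> (i \<otimes> (\<ominus> i)) = \<zero>"
    and "(r \<otimes> (r \<ominus> a \<otimes> i) \<oplus> b \<otimes> (i \<otimes> i)) \<oplus> i \<otimes> (a \<otimes> r \<ominus> b \<otimes> i) = r \<otimes> r"
  using assms by algebra+

lemma (in cring) conjugate_cancel:
  assumes "a \<in> carrier R" "s \<in> carrier R" "r \<in> carrier R" "i \<in> carrier R"
  shows "s \<otimes> i = \<ominus> (s \<otimes> (\<ominus> i))" "s \<otimes> r = s \<otimes> (r \<ominus> a \<otimes> i) \<oplus> a \<otimes> (s \<otimes> i)"
  using assms by algebra+

text \<open>The element \<open>v\<close> of \<open>I\<close> witnesses that \<open>I\<close> is regular; it also provides the element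
  \<open>t = vt/v\<close> of the total ring of fractions.\<close>

locale rees_local = rees R I a b
  for R :: "('a, 'k) ring_scheme" (structure) and I a b +
  fixes \<mm> :: "'a set" and v :: 'a
  assumes noeth: "noetherian_ring R" and loc: "local_ring R \<mm>" and dim: "krull_dim R = 1"
    and I_sub: "I \<subseteq> \<mm>" and v: "v \<in> I" "regular_elt R v"
begin

sublocale mm: maximalideal \<mm> R by (rule local_ringD(2)[OF loc])
sublocale N: noetherian_ring R by (rule noeth)

lemma one_notin: "\<one> \<notin> \<mm>" using mm.one_imp_carrier mm.I_notcarr by metis

lemma vc: "v \<in> carrier R" by (rule I.Icarr[OF v(1)])

lemma elt_const_mult:
  assumes "r \<in> carrier R" "s \<in> carrier R" "j \<in> I"
  shows "elt r \<zero> \<otimes>\<^bsub>A\<^esub> elt s j = elt (r \<otimes> s) (r \<otimes> j)"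
  using assms ab I.Icarr by (simp add: elt_mult R.minus_eq)

lemma elt_split: "r \<in> carrier R \<Longrightarrow> i \<in> I \<Longrightarrow> elt r i = elt r \<zero> \<oplus>\<^bsub>A\<^esub> elt \<zero> i"
  using I.Icarr by (simp add: elt_add)

text \<open>The norm of \<open>r + it\<close>, the product with its conjugate.\<close>

definition "qnorm r i = r \<otimes> (r \<ominus> a \<otimes> i) \<oplus> b \<otimes> (i \<otimes> i)"

lemma qnorm_closed: "r \<in> carrier R \<Longrightarrow> i \<in> carrier R \<Longrightarrow> qnorm r i \<in> carrier R"
  using ab by (simp add: qnorm_def)

lemma elt_conj:
  assumes "r \<in> carrier R" "i \<in> I"
  shows "elt r i \<otimes>\<^bsub>A\<^esub> elt (r \<ominus> a \<otimes> i) (\<ominus> i) = elt (qnorm r i) \<zero>"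
proof -
  have i: "i \<in> carrier R" by (rule I.Icarr[OF assms(2)])
  have 1: "r \<otimes> (r \<ominus> a \<otimes> i) \<ominus> b \<otimes> (i \<otimes> (\<ominus> i)) = qnorm r i"
    unfolding qnorm_def by (rule R.conjugate_identities(1)[OF ab assms(1) i])
  have 2: "r \<otimes> (\<ominus> i) \<oplus> i \<otimes> (r \<ominus> a \<otimes> i) \<ominus> a \<otimes> (i \<otimes> (\<ominus> i)) = \<zero>"
    by (rule R.conjugate_identities(2)[OF ab assms(1) i])
  have c: "r \<ominus> a \<otimes> i \<in> carrier R" "\<ominus> i \<in> I" using assms ab i by simp_all
  show ?thesis unfolding elt_mult[OF assms c] 1 2 ..
qed

text \<open>If \<open>r\<close> is a unit, then so is the norm, which differs from \<open>r\<^sup>2\<close> by a multiple of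
  \<open>i \<in> \<mm>\<close>.\<close>

lemma elt_unit:
  assumes "r \<in> carrier R" "i \<in> I" "r \<notin> \<mm>"
  shows "elt r i \<in> Units A"
proof -
  have i: "i \<in> carrier R" by (rule I.Icarr[OF assms(2)])
  have N: "qnorm r i \<in> carrier R" by (rule qnorm_closed[OF assms(1) i])
  have "qnorm r i \<notin> \<mm>"
  proof
    assume n: "qnorm r i \<in> \<mm>"
    have im: "i \<in> \<mm>" using I_sub assms(2) by blast
    have "qnorm r i \<oplus> i \<otimes> (a \<otimes> r \<ominus> b \<otimes> i) = r \<otimes> r"
      unfolding qnorm_def by (rule R.conjugate_identities(3)[OF ab assms(1) i])
    moreover have "qnorm r i \<oplus> i \<otimes> (a \<otimes> r \<ominus> b \<otimes> i) \<in> \<mm>"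
      using n im assms(1) i ab by (intro mm.a_closed mm.I_r_closed) auto
    ultimately have "r \<otimes> r \<in> \<mm>" by simp
    then have "r \<in> \<mm>" using primeideal.I_prime[OF R.maximalideal_prime[OF mm.is_maximalideal] assms(1,1)] by blast
    then show False using assms(3) by simp
  qed
  then have U: "qnorm r i \<in> Units R" by (rule local_unit[OF noeth loc N])
  let ?y = "elt (r \<ominus> a \<otimes> i) (\<ominus> i) \<otimes>\<^bsub>A\<^esub> elt (inv (qnorm r i)) \<zero>"
  have e: "elt r i \<in> carrier A" "elt (r \<ominus> a \<otimes> i) (\<ominus> i) \<in> carrier A" "elt (inv (qnorm r i)) \<zero> \<in> carrier A"
    using assms ab i U by (auto intro!: elt_closed)
  have "elt r i \<otimes>\<^bsub>A\<^esub> ?y = elt (qnorm r i) \<zero> \<otimes>\<^bsub>A\<^esub> elt (inv (qnorm r i)) \<zero>"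
    using e by (simp add: A.m_assoc[symmetric] elt_conj[OF assms(1,2)])
  also have "\<dots> = \<one>\<^bsub>A\<^esub>" using U N by (simp add: elt_const_mult elt_one)
  finally show ?thesis using e by (intro A.unitI[of "elt r i" ?y]) simp_all
qed

definition "nn = {elt r i | r i. r \<in> \<mm> \<and> i \<in> I}"

lemma elt_nn: "r \<in> carrier R \<Longrightarrow> i \<in> I \<Longrightarrow> elt r i \<in> nn \<longleftrightarrow> r \<in> \<mm>"
  unfolding nn_def using elt_eq_iff mm.Icarr by blast

lemma nn_ideal: "ideal nn A"
proof (rule idealI[OF A.ring_axioms])
  note ca = mm.Icarr I.Icarr
  show "subgroup nn (add_monoid A)"
  proof (rule A.add.subgroupI)
    show "nn \<subseteq> carrier A" unfolding nn_def using elt_closed ca by blast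
    show "nn \<noteq> {}" unfolding nn_def using mm.zero_closed I.zero_closed by blast
    fix x y assume "x \<in> nn" "y \<in> nn"
    then obtain r i s j where c: "r \<in> \<mm>" "i \<in> I" "x = elt r i" "s \<in> \<mm>" "j \<in> I" "y = elt s j"
      unfolding nn_def by blast
    have "x \<oplus>\<^bsub>A\<^esub> y = elt (r \<oplus> s) (i \<oplus> j)" unfolding c(3,6) using c ca by (simp add: elt_add)
    then show "x \<oplus>\<^bsub>A\<^esub> y \<in> nn" using c unfolding nn_def by auto
  next
    fix x assume "x \<in> nn"
    then obtain r i where c: "r \<in> \<mm>" "i \<in> I" "x = elt r i" unfolding nn_def by blast
    have "elt (\<ominus> r) (\<ominus> i) \<oplus>\<^bsub>A\<^esub> x = \<zero>\<^bsub>A\<^esub>"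
      unfolding c(3) using c ca by (simp add: elt_add R.l_neg elt_zero)
    moreover have "elt (\<ominus> r) (\<ominus> i) \<in> carrier A" "x \<in> carrier A" using c ca by (auto intro!: elt_closed)
    ultimately have "\<ominus>\<^bsub>A\<^esub> x = elt (\<ominus> r) (\<ominus> i)" using A.minus_equality by metis
    then show "\<ominus>\<^bsub>A\<^esub> x \<in> nn" using c unfolding nn_def by auto
  qed
next
  fix x y assume x: "x \<in> nn" and y: "y \<in> carrier A"
  obtain r i where c: "r \<in> \<mm>" "i \<in> I" "x = elt r i" using x unfolding nn_def by blast
  obtain s j where d: "s \<in> carrier R" "j \<in> I" "y = elt s j" by (rule elt_cases[OF y])
  note ca = mm.Icarr[OF c(1)] I.Icarr[OF c(2)] I.Icarr[OF d(2)]
  have im: "i \<in> \<mm>" using c(2) I_sub by blast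
  have "x \<otimes>\<^bsub>A\<^esub> y = elt (r \<otimes> s \<ominus> b \<otimes> (i \<otimes> j)) (r \<otimes> j \<oplus> i \<otimes> s \<ominus> a \<otimes> (i \<otimes> j))"
    unfolding c(3) d(3) by (rule elt_mult[OF ca(1) c(2) d(1,2)])
  moreover have "r \<otimes> s \<ominus> b \<otimes> (i \<otimes> j) \<in> \<mm>"
    unfolding R.minus_eq using c(1) im ca d(1) ab
    by (intro mm.a_closed mm.a_inv_closed mm.I_r_closed[of r] mm.I_l_closed[of "i \<otimes> j"] mm.I_r_closed[of i]) auto
  moreover have "r \<otimes> j \<oplus> i \<otimes> s \<ominus> a \<otimes> (i \<otimes> j) \<in> I"
    unfolding R.minus_eq using c(2) ca d(1,2) ab
    by (intro I.a_closed I.a_inv_closed I.I_l_closed[of j r] I.I_r_closed[of i s] I.I_l_closed[of "i \<otimes> j" a] I.I_r_closed[of i j]) auto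
  ultimately show "x \<otimes>\<^bsub>A\<^esub> y \<in> nn" unfolding nn_def by blast
  then show "y \<otimes>\<^bsub>A\<^esub> x \<in> nn" using x y c(2,3) ca elt_closed by (simp add: A.m_comm)
qed

lemma A_local: "local_ring A nn"
proof (rule local_ringI[OF A_cring nn_ideal])
  show "\<one>\<^bsub>A\<^esub> \<notin> nn" unfolding elt_one[symmetric] using one_notin by (simp add: elt_nn)
  fix x assume x: "x \<in> carrier A" "x \<notin> nn"
  obtain r i where c: "r \<in> carrier R" "i \<in> I" "x = elt r i" by (rule elt_cases[OF x(1)])
  then show "x \<in> Units A" using x(2) elt_unit by (simp add: elt_nn)
qed

text \<open>For an ideal \<open>J\<close>, the constant coefficients of its elements, and the \<open>i\<close> with \<open>it \<in> J\<close>: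
  the image and the kernel of the projection of \<open>J\<close> to the constant coefficient.\<close>

definition "fst_part J = {r \<in> carrier R. \<exists>i\<in>I. elt r i \<in> J}"
definition "snd_part J = {i \<in> I. elt \<zero> i \<in> J}"

lemma fst_part_ideal:
  assumes "ideal J A"
  shows "ideal (fst_part J) R"
proof -
  interpret J: ideal J A by fact
  interpret SR: module R "scalar_module id R" by (rule self_module[OF R.cring_axioms])
  show ?thesis
    unfolding submodule_iff_ideal[OF R.cring_axioms, symmetric]
  proof (rule SR.submoduleI_linear)
    show "fst_part J \<subseteq> carrier (scalar_module id R)" by (auto simp: fst_part_def)
    show "\<zero>\<^bsub>scalar_module id R\<^esub> \<in> fst_part J"
      unfolding fst_part_def using J.zero_closed elt_zero by (auto intro!: bexI[of _ \<zero>])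
    fix x y assume "x \<in> fst_part J" "y \<in> fst_part J"
    then obtain i j where c: "x \<in> carrier R" "y \<in> carrier R" "i \<in> I" "j \<in> I" "elt x i \<in> J" "elt y j \<in> J"
      unfolding fst_part_def by blast
    have "elt (x \<oplus> y) (i \<oplus> j) \<in> J" using J.a_closed[OF c(5,6)] c by (simp add: elt_add)
    then show "x \<oplus>\<^bsub>scalar_module id R\<^esub> y \<in> fst_part J" using c unfolding fst_part_def by auto
  next
    fix r x assume r: "r \<in> carrier R" and "x \<in> fst_part J"
    then obtain i where c: "x \<in> carrier R" "i \<in> I" "elt x i \<in> J" unfolding fst_part_def by blast
    have "elt (r \<otimes> x) (r \<otimes> i) \<in> J"
      using J.I_l_closed[OF c(3), of "elt r \<zero>"] r c elt_closed by (simp add: elt_const_mult)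
    then show "r \<odot>\<^bsub>scalar_module id R\<^esub> x \<in> fst_part J"
      using c r I.I_l_closed unfolding fst_part_def by auto
  qed
qed

lemma snd_part_ideal:
  assumes "ideal J A"
  shows "ideal (snd_part J) R"
proof -
  interpret J: ideal J A by fact
  interpret SR: module R "scalar_module id R" by (rule self_module[OF R.cring_axioms])
  show ?thesis
    unfolding submodule_iff_ideal[OF R.cring_axioms, symmetric]
  proof (rule SR.submoduleI_linear)
    show "snd_part J \<subseteq> carrier (scalar_module id R)" using I.Icarr by (auto simp: snd_part_def)
    show "\<zero>\<^bsub>scalar_module id R\<^esub> \<in> snd_part J"
      unfolding snd_part_def using J.zero_closed elt_zero by simp
    fix x y assume "x \<in> snd_part J" "y \<in> snd_part J"
    then have c: "x \<in> I" "y \<in> I" "elt \<zero> x \<in> J" "elt \<zero> y \<in> J" unfolding snd_part_def by simp_all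
    have "elt \<zero> (x \<oplus> y) \<in> J" using J.a_closed[OF c(3,4)] c by (simp add: elt_add)
    then show "x \<oplus>\<^bsub>scalar_module id R\<^esub> y \<in> snd_part J" using c unfolding snd_part_def by simp
  next
    fix r x assume r: "r \<in> carrier R" and "x \<in> snd_part J"
    then have c: "x \<in> I" "elt \<zero> x \<in> J" unfolding snd_part_def by simp_all
    have "elt \<zero> (r \<otimes> x) \<in> J"
      using J.I_l_closed[OF c(2), of "elt r \<zero>"] r c elt_closed by (simp add: elt_const_mult)
    then show "r \<odot>\<^bsub>scalar_module id R\<^esub> x \<in> snd_part J"
      using c r I.I_l_closed unfolding snd_part_def by simp
  qed
qed

text \<open>An ideal is generated by lifts of generators of \<open>fst_part\<close> together with generators of
  \<open>snd_part\<close>.\<close>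

lemma A_noetherian: "noetherian_ring A"
proof (rule A.noetherian_ringI)
  fix J assume J: "ideal J A"
  interpret J: ideal J A by (rule J)
  obtain A0 where A0: "A0 \<subseteq> carrier R" "finite A0" "fst_part J = Idl A0"
    using N.finetely_gen[OF fst_part_ideal[OF J]] by (elim exE conjE)
  obtain A1 where A1: "A1 \<subseteq> carrier R" "finite A1" "snd_part J = Idl A1"
    using N.finetely_gen[OF snd_part_ideal[OF J]] by (elim exE conjE)
  have sub0: "A0 \<subseteq> fst_part J" unfolding A0(3) by (rule R.genideal_self[OF A0(1)])
  have sub1: "A1 \<subseteq> snd_part J" unfolding A1(3) by (rule R.genideal_self[OF A1(1)])
  have "\<forall>r\<in>A0. \<exists>i. i \<in> I \<and> elt r i \<in> J" using sub0 unfolding fst_part_def by blast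
  then obtain f where f: "\<And>r. r \<in> A0 \<Longrightarrow> f r \<in> I \<and> elt r (f r) \<in> J" by metis
  let ?G = "(\<lambda>r. elt r (f r)) ` A0 \<union> (\<lambda>i. elt \<zero> i) ` A1"
  have GJ: "?G \<subseteq> J" using f sub1 unfolding snd_part_def by blast
  then have Gc: "?G \<subseteq> carrier A" using J.a_subset by blast
  define K where "K = Idl\<^bsub>A\<^esub> ?G"
  have K: "ideal K A" unfolding K_def by (rule A.genideal_ideal[OF Gc])
  interpret K: ideal K A by (rule K)
  have GK: "?G \<subseteq> K" unfolding K_def by (rule A.genideal_self[OF Gc])
  have "A0 \<subseteq> fst_part K" using GK f A0(1) unfolding fst_part_def by blast
  then have s0: "fst_part J \<subseteq> fst_part K" unfolding A0(3) by (rule R.genideal_minimal[OF fst_part_ideal[OF K]])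
  have "A1 \<subseteq> snd_part K" using GK sub1 unfolding snd_part_def by blast
  then have s1: "snd_part J \<subseteq> snd_part K" unfolding A1(3) by (rule R.genideal_minimal[OF snd_part_ideal[OF K]])
  have KJ: "K \<subseteq> J" unfolding K_def by (rule A.genideal_minimal[OF J GJ])
  have "J \<subseteq> K"
  proof
    fix x assume x: "x \<in> J"
    obtain r i where c: "r \<in> carrier R" "i \<in> I" "x = elt r i" by (rule elt_cases[OF J.Icarr[OF x]])
    then have "r \<in> fst_part K" using s0 x unfolding fst_part_def by blast
    then obtain j where j: "j \<in> I" "elt r j \<in> K" unfolding fst_part_def by blast
    have ij: "i \<oplus> \<ominus> j \<in> I" using c(2) j(1) by simp
    note ca = I.Icarr[OF c(2)] I.Icarr[OF j(1)]
    have "x = elt r j \<oplus>\<^bsub>A\<^esub> elt \<zero> (i \<oplus> \<ominus> j)"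
      unfolding c(3) elt_add[OF c(1) j(1) R.zero_closed ij] using c(1) ca
      by (simp add: R.a_lcomm[of j i] R.r_neg)
    then have eq: "elt \<zero> (i \<oplus> \<ominus> j) = x \<ominus>\<^bsub>A\<^esub> elt r j"
      using elt_closed[OF c(1) j(1)] elt_closed[OF R.zero_closed ij]
      by (simp add: A.minus_eq A.a_comm[of "elt r j"] A.a_assoc A.r_neg)
    have "elt \<zero> (i \<oplus> \<ominus> j) \<in> J" unfolding eq A.minus_eq using x j(2) KJ by (intro J.a_closed J.a_inv_closed) auto
    then have "elt \<zero> (i \<oplus> \<ominus> j) \<in> K" using s1 ij unfolding snd_part_def by blast
    then have "elt r j \<oplus>\<^bsub>A\<^esub> elt \<zero> (i \<oplus> \<ominus> j) \<in> K" using j(2) by (intro K.a_closed)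
    then show "x \<in> K" using \<open>x = elt r j \<oplus>\<^bsub>A\<^esub> elt \<zero> (i \<oplus> \<ominus> j)\<close> by simp
  qed
  then have "J = Idl\<^bsub>A\<^esub> ?G" using KJ unfolding K_def by blast
  moreover have "finite ?G" using A0(2) A1(2) by simp
  ultimately show "\<exists>G\<subseteq>carrier A. finite G \<and> J = Idl\<^bsub>A\<^esub> G" using Gc by blast
qed

lemma regular_const:
  assumes "regular_elt R r"
  shows "regular_elt A (elt r \<zero>)"
proof -
  have r: "r \<in> carrier R" using assms by (simp add: regular_elt_def)
  have "x = \<zero>\<^bsub>A\<^esub>" if x: "x \<in> carrier A" "elt r \<zero> \<otimes>\<^bsub>A\<^esub> x = \<zero>\<^bsub>A\<^esub>" for x
  proof -
    obtain s j where c: "s \<in> carrier R" "j \<in> I" "x = elt s j" by (rule elt_cases[OF x(1)])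
    have jc: "j \<in> carrier R" by (rule I.Icarr[OF c(2)])
    have "elt (r \<otimes> s) (r \<otimes> j) = elt \<zero> \<zero>" using x(2) c r by (simp add: elt_const_mult elt_zero)
    then have "r \<otimes> s = \<zero>" "r \<otimes> j = \<zero>" using elt_eq_iff[of "r \<otimes> s" "r \<otimes> j" \<zero> \<zero>] r c I.I_l_closed by simp_all
    then have "s = \<zero>" "j = \<zero>" using assms c(1) jc unfolding regular_elt_def by blast+
    then show ?thesis using c(3) elt_zero by simp
  qed
  then show ?thesis unfolding regular_elt_def using r elt_closed by simp
qed

text \<open>If \<open>s\<close> kills the norm, then \<open>s\<close> times the conjugate is killed by the regular element
  \<open>r + it\<close>. So \<open>s\<close> kills the conjugate, hence \<open>r\<close> and \<open>i\<close>, hence \<open>r + it\<close>, and therefore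
  vanishes.\<close>

lemma regular_norm:
  assumes "r \<in> carrier R" "i \<in> I" "regular_elt A (elt r i)"
  shows "regular_elt R (qnorm r i)"
proof -
  have i: "i \<in> carrier R" by (rule I.Icarr[OF assms(2)])
  have N: "qnorm r i \<in> carrier R" by (rule qnorm_closed[OF assms(1) i])
  have reg: "y = \<zero>\<^bsub>A\<^esub>" if "y \<in> carrier A" "elt r i \<otimes>\<^bsub>A\<^esub> y = \<zero>\<^bsub>A\<^esub>" for y
    using assms(3) that unfolding regular_elt_def by blast
  have "s = \<zero>" if s: "s \<in> carrier R" "qnorm r i \<otimes> s = \<zero>" for s
  proof -
    have c: "r \<ominus> a \<otimes> i \<in> carrier R" "\<ominus> i \<in> I" using assms ab i by simp_all
    note e = elt_closed[OF assms(1,2)] elt_closed[OF c] elt_closed[OF s(1) I.zero_closed]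
    have 1: "elt (r \<ominus> a \<otimes> i) (\<ominus> i) \<otimes>\<^bsub>A\<^esub> elt s \<zero> = elt (s \<otimes> (r \<ominus> a \<otimes> i)) (s \<otimes> (\<ominus> i))"
      using A.m_comm[OF e(2,3)] elt_const_mult[OF s(1) c] by simp
    have "elt r i \<otimes>\<^bsub>A\<^esub> (elt (r \<ominus> a \<otimes> i) (\<ominus> i) \<otimes>\<^bsub>A\<^esub> elt s \<zero>) = elt (qnorm r i) \<zero> \<otimes>\<^bsub>A\<^esub> elt s \<zero>"
      using A.m_assoc[OF e] elt_conj[OF assms(1,2)] by simp
    also have "\<dots> = \<zero>\<^bsub>A\<^esub>" using s N by (simp add: elt_const_mult elt_zero)
    finally have z0: "elt r i \<otimes>\<^bsub>A\<^esub> (elt (r \<ominus> a \<otimes> i) (\<ominus> i) \<otimes>\<^bsub>A\<^esub> elt s \<zero>) = \<zero>\<^bsub>A\<^esub>" .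
    have "elt (s \<otimes> (r \<ominus> a \<otimes> i)) (s \<otimes> (\<ominus> i)) = elt \<zero> \<zero>"
      unfolding 1[symmetric] elt_zero by (rule reg[OF A.m_closed[OF e(2,3)] z0])
    then have z: "s \<otimes> (r \<ominus> a \<otimes> i) = \<zero>" "s \<otimes> (\<ominus> i) = \<zero>"
      using elt_eq_iff[of "s \<otimes> (r \<ominus> a \<otimes> i)" "s \<otimes> (\<ominus> i)" \<zero> \<zero>] s(1) c I.I_l_closed by simp_all
    have "s \<otimes> i = \<ominus> (s \<otimes> (\<ominus> i))" by (rule R.conjugate_cancel(1)[OF ab(1) s(1) assms(1) i])
    then have si: "s \<otimes> i = \<zero>" using z(2) by simp
    have "s \<otimes> r = s \<otimes> (r \<ominus> a \<otimes> i) \<oplus> a \<otimes> (s \<otimes> i)"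
      by (rule R.conjugate_cancel(2)[OF ab(1) s(1) assms(1) i])
    then have sr: "s \<otimes> r = \<zero>" using z(1) si ab by simp
    have "elt r i \<otimes>\<^bsub>A\<^esub> elt s \<zero> = elt \<zero> \<zero>"
      using A.m_comm[OF e(1,3)] elt_const_mult[OF s(1) assms(1,2)] sr si by simp
    then have "elt s \<zero> = elt \<zero> \<zero>" unfolding elt_zero by (rule reg[OF e(3)])
    then show ?thesis using elt_eq_iff[OF s(1) I.zero_closed R.zero_closed I.zero_closed] by simp
  qed
  then show ?thesis unfolding regular_elt_def using N by blast
qed

lemma contraction_prime:
  assumes "primeideal p A"
  shows "primeideal {r \<in> carrier R. elt r \<zero> \<in> p} R"
proof -
  interpret p: primeideal p A by fact
  interpret SR: module R "scalar_module id R" by (rule self_module[OF R.cring_axioms])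
  have i: "ideal {r \<in> carrier R. elt r \<zero> \<in> p} R"
    unfolding submodule_iff_ideal[OF R.cring_axioms, symmetric]
  proof (rule SR.submoduleI_linear)
    show "\<zero>\<^bsub>scalar_module id R\<^esub> \<in> {r \<in> carrier R. elt r \<zero> \<in> p}" using p.zero_closed elt_zero by simp
    fix x y assume c: "x \<in> {r \<in> carrier R. elt r \<zero> \<in> p}" "y \<in> {r \<in> carrier R. elt r \<zero> \<in> p}"
    then show "x \<oplus>\<^bsub>scalar_module id R\<^esub> y \<in> {r \<in> carrier R. elt r \<zero> \<in> p}"
      using p.a_closed[of "elt x \<zero>" "elt y \<zero>"] by (simp add: elt_add)
  next
    fix r x assume c: "r \<in> carrier R" "x \<in> {r \<in> carrier R. elt r \<zero> \<in> p}"
    then show "r \<odot>\<^bsub>scalar_module id R\<^esub> x \<in> {r \<in> carrier R. elt r \<zero> \<in> p}"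
      using p.I_l_closed[of "elt x \<zero>" "elt r \<zero>"] elt_closed by (simp add: elt_const_mult)
  qed auto
  show ?thesis
  proof (rule primeidealI[OF i R.cring_axioms])
    have "\<one>\<^bsub>A\<^esub> \<notin> p" using p.one_imp_carrier p.I_notcarr by metis
    then have "\<one> \<notin> {r \<in> carrier R. elt r \<zero> \<in> p}" using elt_one by simp
    then show "carrier R \<noteq> {r \<in> carrier R. elt r \<zero> \<in> p}" using R.one_closed by blast
    fix x y assume c: "x \<in> carrier R" "y \<in> carrier R" "x \<otimes> y \<in> {r \<in> carrier R. elt r \<zero> \<in> p}"
    then have "elt x \<zero> \<otimes>\<^bsub>A\<^esub> elt y \<zero> \<in> p" by (simp add: elt_const_mult)
    then have "elt x \<zero> \<in> p \<or> elt y \<zero> \<in> p"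
      by (rule p.I_prime[OF elt_closed[OF c(1) I.zero_closed] elt_closed[OF c(2) I.zero_closed]])
    then show "x \<in> {r \<in> carrier R. elt r \<zero> \<in> p} \<or> y \<in> {r \<in> carrier R. elt r \<zero> \<in> p}" using c by blast
  qed
qed

text \<open>The square of \<open>it\<close> is a combination of the elements \<open>b i\<^sup>2\<close> and \<open>ai\<close> of the maximal
  ideal of \<open>R\<close>, so \<open>it\<close> lies in the prime.\<close>

lemma contraction_maximal:
  assumes "primeideal p A" "\<mm> \<subseteq> {r \<in> carrier R. elt r \<zero> \<in> p}"
  shows "nn \<subseteq> p"
proof
  interpret p: primeideal p A by fact
  fix x assume "x \<in> nn"
  then obtain r i where c: "r \<in> \<mm>" "i \<in> I" "x = elt r i" unfolding nn_def by blast
  note ca = mm.Icarr[OF c(1)] I.Icarr[OF c(2)]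
  have im: "i \<in> \<mm>" using c(2) I_sub by blast
  have mp: "elt s \<zero> \<in> p" if "s \<in> \<mm>" for s using assms(2) that by blast
  have e: "elt \<zero> i \<in> carrier A" by (rule elt_closed[OF R.zero_closed c(2)])
  have c1: "\<ominus> (b \<otimes> (i \<otimes> i)) \<in> \<mm>"
    using im ca ab by (intro mm.a_inv_closed mm.I_l_closed) auto
  have c2: "\<ominus> (a \<otimes> i) \<in> \<mm>" using im ab by (intro mm.a_inv_closed mm.I_l_closed) auto
  have c3: "\<ominus> (a \<otimes> i) \<otimes> i \<in> I" using c(2) ca ab by (intro I.I_l_closed) auto
  have "elt \<zero> i \<otimes>\<^bsub>A\<^esub> elt \<zero> i = elt (\<ominus> (b \<otimes> (i \<otimes> i))) \<zero> \<oplus>\<^bsub>A\<^esub> elt (\<ominus> (a \<otimes> i)) \<zero> \<otimes>\<^bsub>A\<^esub> elt \<zero> i"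
    using c(2) ca ab c3 mm.Icarr[OF c1] by (simp add: elt_mult elt_add R.minus_eq R.l_minus R.m_assoc)
  also have "\<dots> \<in> p" using mp[OF c1] mp[OF c2] e by (intro p.a_closed p.I_r_closed)
  finally have "elt \<zero> i \<in> p" using p.I_prime[OF e e] by blast
  then show "x \<in> p" unfolding c(3) elt_split[OF ca(1) c(2)] using mp[OF c(1)] by (intro p.a_closed)
qed

text \<open>If \<open>x\<close> lies in \<open>q\<close> but not in \<open>p\<close>, consider the conjugate of \<open>x\<close>. The norm lies in \<open>p\<close>,
  being an element of \<open>R\<close> that lies in \<open>q\<close>, so the conjugate lies in \<open>p \<subseteq> q\<close>. The
  trace then lies in \<open>q\<close> and so in \<open>p\<close>, and \<open>x\<close> is the difference of trace and conjugate.\<close>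

lemma incomparable:
  assumes "primeideal p A" "primeideal q A" "p \<subseteq> q"
    and eq: "{r \<in> carrier R. elt r \<zero> \<in> q} \<subseteq> {r \<in> carrier R. elt r \<zero> \<in> p}"
  shows "q \<subseteq> p"
proof
  interpret p: primeideal p A by fact
  interpret q: primeideal q A by fact
  fix x assume x: "x \<in> q"
  obtain r i where c: "r \<in> carrier R" "i \<in> I" "x = elt r i" by (rule elt_cases[OF q.Icarr[OF x]])
  have i: "i \<in> carrier R" by (rule I.Icarr[OF c(2)])
  let ?y = "elt (r \<ominus> a \<otimes> i) (\<ominus> i)"
  have rc: "r \<ominus> a \<otimes> i \<in> carrier R" "\<ominus> i \<in> I" using c i ab by simp_all
  note e = elt_closed[OF c(1,2)] elt_closed[OF rc]
  have down: "elt s \<zero> \<in> p" if "elt s \<zero> \<in> q" "s \<in> carrier R" for s using eq that by blast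
  show "x \<in> p"
  proof (rule ccontr)
    assume xp: "x \<notin> p"
    have xy: "x \<otimes>\<^bsub>A\<^esub> ?y = elt (qnorm r i) \<zero>" unfolding c(3) by (rule elt_conj[OF c(1,2)])
    have "x \<otimes>\<^bsub>A\<^esub> ?y \<in> q" using x e by (intro q.I_r_closed)
    then have "x \<otimes>\<^bsub>A\<^esub> ?y \<in> p" unfolding xy by (rule down) (rule qnorm_closed[OF c(1) i])
    then have yp: "?y \<in> p" using p.I_prime[of x ?y] e xp c(3) by blast
    have t: "x \<oplus>\<^bsub>A\<^esub> ?y = elt (r \<oplus> (r \<ominus> a \<otimes> i)) \<zero>"
      unfolding c(3) elt_add[OF c(1,2) rc] using i by (simp add: R.r_neg)
    have "x \<oplus>\<^bsub>A\<^esub> ?y \<in> q" using x yp assms(3) by (intro q.a_closed) auto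
    then have xyp: "x \<oplus>\<^bsub>A\<^esub> ?y \<in> p" unfolding t by (rule down) (use c rc in simp)
    have "(x \<oplus>\<^bsub>A\<^esub> ?y) \<ominus>\<^bsub>A\<^esub> ?y \<in> p" unfolding A.minus_eq by (rule p.a_closed[OF xyp p.a_inv_closed[OF yp]])
    moreover have "(x \<oplus>\<^bsub>A\<^esub> ?y) \<ominus>\<^bsub>A\<^esub> ?y = x"
      using e unfolding c(3) by (simp add: A.minus_eq A.a_assoc A.r_neg)
    ultimately show False using xp by simp
  qed
qed

lemma A_krull_dim_le: "krull_dim A \<le> 1"
  unfolding krull_dim_def
proof (rule SUP_least)
  fix n assume "n \<in> {n. \<exists>p. (\<forall>i\<le>n. primeideal (p i) A) \<and> (\<forall>i<n. p i \<subset> p (Suc i))}"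
  then obtain p where p: "\<And>i. i \<le> n \<Longrightarrow> primeideal (p i) A" "\<And>i. i < n \<Longrightarrow> p i \<subset> p (Suc i)" by blast
  have "n \<le> 1"
  proof (rule ccontr)
    assume "\<not> n \<le> 1"
    then have pr: "primeideal (p 0) A" "primeideal (p 1) A" "primeideal (p 2) A"
      and lt: "p 0 \<subset> p 1" "p 1 \<subset> p 2" using p(1)[of 0] p(1)[of 1] p(1)[of 2] p(2)[of 0] p(2)[of 1]
      by (simp_all add: numeral_2_eq_2)
    let ?c = "\<lambda>q. {r \<in> carrier R. elt r \<zero> \<in> q}"
    have "p 2 \<subseteq> nn"
      by (rule local_ideal_subset[OF A_noetherian A_local primeideal.axioms(1)[OF pr(3)]])
        (use primeideal.I_notcarr[OF pr(3)] in metis)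
    then have "\<not> nn \<subseteq> p 1" using lt(2) by blast
    then have "\<not> \<mm> \<subseteq> ?c (p 1)" using contraction_maximal[OF pr(2)] by blast
    moreover have "?c (p 1) \<subseteq> \<mm>"
      by (rule local_ideal_subset[OF noeth loc primeideal.axioms(1)[OF contraction_prime[OF pr(2)]]])
        (use primeideal.I_notcarr[OF contraction_prime[OF pr(2)]] in metis)
    ultimately have c1: "?c (p 1) \<subset> \<mm>" by blast
    have "\<not> ?c (p 1) \<subseteq> ?c (p 0)" using incomparable[OF pr(1,2)] lt(1) by blast
    then have c0: "?c (p 0) \<subset> ?c (p 1)" using lt(1) by blast
    define q where "q j = (if j = 0 then ?c (p 0) else if j = 1 then ?c (p 1) else \<mm>)" for j :: nat
    have "enat 2 \<le> krull_dim R"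
    proof (rule krull_dim_ge[of 2 q])
      fix j :: nat assume "j < 2"
      then show "q j \<subset> q (Suc j)" using c0 c1 by (auto simp: q_def less_2_cases_iff)
    next
      fix j :: nat
      show "primeideal (q j) R"
        unfolding q_def using contraction_prime[OF pr(1)] contraction_prime[OF pr(2)]
          R.maximalideal_prime[OF mm.is_maximalideal] by simp
    qed
    then show False using dim by (simp add: one_enat_def)
  qed
  then show "enat n \<le> 1" by (simp add: one_enat_def)
qed

lemma v_nn: "elt v \<zero> \<in> nn" using elt_nn[OF vc I.zero_closed] v(1) I_sub by blast

lemma A_cm: "cm_local_ring A nn" and A_dim: "krull_dim A = 1"
  using cm_local_ring_dim_oneI[OF A_noetherian A_local A_krull_dim_le v_nn regular_const[OF v(2)]] .

end

section \<open>Fractions over the quotients of the Rees algebra\<close>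

lemma (in cring) fraction_identities:
  assumes "x \<in> carrier R" "y \<in> carrier R" "p \<in> carrier R" "q \<in> carrier R"
  shows "(x \<otimes> p) \<otimes> (y \<otimes> q) = (x \<otimes> y) \<otimes> (p \<otimes> q)"
    and "y \<otimes> (x \<otimes> p) \<oplus> x \<otimes> (y \<otimes> q) = (x \<otimes> y) \<otimes> (p \<oplus> q)"
  using assms by algebra+

context fraction_ring
begin

text \<open>The value at a fraction \<open>r/u\<close> has to be \<open>h r\<close> divided by \<open>h u\<close>, and it does not depend on
  the representation. Bringing two fractions to the common denominator \<open>uu'\<close> shows
  compatibility with both operations.\<close>

lemma extend_hom:
  assumes "cring U" "h \<in> ring_hom B U" "\<And>u. regular_elt B u \<Longrightarrow> h u \<in> Units U"
  obtains \<kappa> where "\<kappa> \<in> ring_hom T U" "\<And>r. r \<in> carrier B \<Longrightarrow> \<kappa> (\<iota> r) = h r"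
proof -
  interpret U: cring U by fact
  note hc = ring_hom_closed[OF assms(2)] and hm = ring_hom_mult[OF assms(2)] and ha = ring_hom_add[OF assms(2)]
  have "\<forall>q\<in>carrier T. \<exists>r u. r \<in> carrier B \<and> regular_elt B u \<and> q = \<iota> r \<otimes>\<^bsub>T\<^esub> inv\<^bsub>T\<^esub> (\<iota> u)"
    by (rule ballI) (erule fraction, blast)
  then obtain num den where nd: "\<And>q. q \<in> carrier T \<Longrightarrow> num q \<in> carrier B"
    "\<And>q. q \<in> carrier T \<Longrightarrow> regular_elt B (den q)"
    "\<And>q. q \<in> carrier T \<Longrightarrow> q = \<iota> (num q) \<otimes>\<^bsub>T\<^esub> inv\<^bsub>T\<^esub> (\<iota> (den q))" by metis
  define \<kappa> where "\<kappa> q = h (num q) \<otimes>\<^bsub>U\<^esub> inv\<^bsub>U\<^esub> (h (den q))" for q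
  have \<kappa>c: "\<kappa> q \<in> carrier U" if "q \<in> carrier T" for q
    unfolding \<kappa>_def by (rule U.m_closed[OF hc[OF nd(1)[OF that]] U.Units_inv_closed[OF assms(3)[OF nd(2)[OF that]]]])
  have dq: "\<iota> (den q) \<otimes>\<^bsub>T\<^esub> q = \<iota> (num q)" if q: "q \<in> carrier T" for q
  proof -
    have "\<iota> (den q) \<otimes>\<^bsub>T\<^esub> (inv\<^bsub>T\<^esub> (\<iota> (den q)) \<otimes>\<^bsub>T\<^esub> \<iota> (num q)) = \<iota> (num q)"
      by (rule inv_cancel(2)[OF nd(2)[OF q] iota.hom_closed[OF nd(1)[OF q]]])
    then show ?thesis
      using nd(3)[OF q] T.m_comm[OF iota.hom_closed[OF nd(1)[OF q]] T.Units_inv_closed[OF regular_unit[OF nd(2)[OF q]]]]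
      by simp
  qed
  \<comment> \<open>The value at \<open>q\<close> can be computed from any representation of \<open>q\<close> as a fraction.\<close>
  have char: "h u \<otimes>\<^bsub>U\<^esub> \<kappa> q = h r"
    if q: "q \<in> carrier T" and u: "regular_elt B u" and r: "r \<in> carrier B" and e: "\<iota> u \<otimes>\<^bsub>T\<^esub> q = \<iota> r" for q u r
  proof -
    note uc = regular_closed[OF u] and dc = regular_closed[OF nd(2)[OF q]] and nc = nd(1)[OF q]
    have "\<iota> (u \<otimes>\<^bsub>B\<^esub> num q) = \<iota> (den q \<otimes>\<^bsub>B\<^esub> r)"
      using uc dc nc r q by (simp add: dq[OF q, symmetric] e[symmetric] T.m_lcomm)
    then have "u \<otimes>\<^bsub>B\<^esub> num q = den q \<otimes>\<^bsub>B\<^esub> r" using iota_inj uc dc nc r by (metis B.m_closed)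
    then have 1: "h u \<otimes>\<^bsub>U\<^esub> h (num q) = h (den q) \<otimes>\<^bsub>U\<^esub> h r" using hm uc dc nc r by metis
    have U: "h (den q) \<in> Units U" by (rule assms(3)[OF nd(2)[OF q]])
    have "h u \<otimes>\<^bsub>U\<^esub> \<kappa> q = (h u \<otimes>\<^bsub>U\<^esub> h (num q)) \<otimes>\<^bsub>U\<^esub> inv\<^bsub>U\<^esub> (h (den q))"
      unfolding \<kappa>_def by (rule U.m_assoc[symmetric, OF hc[OF uc] hc[OF nc] U.Units_inv_closed[OF U]])
    also have "\<dots> = h r \<otimes>\<^bsub>U\<^esub> (h (den q) \<otimes>\<^bsub>U\<^esub> inv\<^bsub>U\<^esub> (h (den q)))"
      unfolding 1 using hc[OF r] hc[OF dc] U.Units_inv_closed[OF U] by (simp add: U.m_ac)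
    also have "\<dots> = h r" using U hc[OF r] by simp
    finally show ?thesis .
  qed
  have eqI: "w = w'" if "regular_elt B u" "w \<in> carrier U" "w' \<in> carrier U" "h u \<otimes>\<^bsub>U\<^esub> w = h u \<otimes>\<^bsub>U\<^esub> w'" for u w w'
    using U.Units_l_cancel[OF assms(3)[OF that(1)] that(2,3)] that(4) by blast
  have k0: "\<kappa> (\<iota> r) = h r" if r: "r \<in> carrier B" for r
  proof -
    have "h \<one>\<^bsub>B\<^esub> \<otimes>\<^bsub>U\<^esub> \<kappa> (\<iota> r) = h r"
      by (rule char[OF iota.hom_closed[OF r] regular_elt_one[OF B.cring_axioms] r]) (use r in simp)
    then show ?thesis using ring_hom_one[OF assms(2)] \<kappa>c r by simp
  qed
  have "\<kappa> \<in> ring_hom T U"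
  proof (rule ring_hom_memI)
    fix p q assume pq: "p \<in> carrier T" "q \<in> carrier T"
    let ?u = "den p \<otimes>\<^bsub>B\<^esub> den q"
    note uc = regular_closed[OF nd(2)[OF pq(1)]] regular_closed[OF nd(2)[OF pq(2)]] and nc = nd(1)[OF pq(1)] nd(1)[OF pq(2)]
    have u: "regular_elt B ?u" by (rule regular_elt_mult[OF B.cring_axioms nd(2)[OF pq(1)] nd(2)[OF pq(2)]])
    note c = iota.hom_closed[OF uc(1)] iota.hom_closed[OF uc(2)] hc[OF uc(1)] hc[OF uc(2)] \<kappa>c[OF pq(1)] \<kappa>c[OF pq(2)]
    have hd: "h (num p) = h (den p) \<otimes>\<^bsub>U\<^esub> \<kappa> p" "h (num q) = h (den q) \<otimes>\<^bsub>U\<^esub> \<kappa> q"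
      using char[OF pq(1) nd(2)[OF pq(1)] nc(1) dq[OF pq(1)]] char[OF pq(2) nd(2)[OF pq(2)] nc(2) dq[OF pq(2)]] by simp_all
    have m1: "\<iota> ?u \<otimes>\<^bsub>T\<^esub> (p \<otimes>\<^bsub>T\<^esub> q) = \<iota> (num p \<otimes>\<^bsub>B\<^esub> num q)"
      unfolding iota.hom_mult[OF nc] iota.hom_mult[OF uc] dq[OF pq(1), symmetric] dq[OF pq(2), symmetric]
      by (rule T.fraction_identities(1)[symmetric, OF c(1,2) pq])
    have "h ?u \<otimes>\<^bsub>U\<^esub> \<kappa> (p \<otimes>\<^bsub>T\<^esub> q) = h (num p \<otimes>\<^bsub>B\<^esub> num q)"
      by (rule char[OF _ u _ m1]) (use pq nc in simp_all)
    also have "\<dots> = h ?u \<otimes>\<^bsub>U\<^esub> (\<kappa> p \<otimes>\<^bsub>U\<^esub> \<kappa> q)"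
      unfolding hm[OF nc] hm[OF uc] hd by (rule U.fraction_identities(1)[OF c(3-6)])
    finally show "\<kappa> (p \<otimes>\<^bsub>T\<^esub> q) = \<kappa> p \<otimes>\<^bsub>U\<^esub> \<kappa> q"
      by - (rule eqI[OF u], use pq \<kappa>c in simp_all)
    note nn = B.m_closed[OF uc(2) nc(1)] B.m_closed[OF uc(1) nc(2)]
    have m2: "\<iota> ?u \<otimes>\<^bsub>T\<^esub> (p \<oplus>\<^bsub>T\<^esub> q) = \<iota> (den q \<otimes>\<^bsub>B\<^esub> num p \<oplus>\<^bsub>B\<^esub> den p \<otimes>\<^bsub>B\<^esub> num q)"
      unfolding iota.hom_add[OF nn] iota.hom_mult[OF uc(2) nc(1)] iota.hom_mult[OF uc(1) nc(2)] iota.hom_mult[OF uc]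
        dq[OF pq(1), symmetric] dq[OF pq(2), symmetric]
      by (rule T.fraction_identities(2)[symmetric, OF c(1,2) pq])
    have "h ?u \<otimes>\<^bsub>U\<^esub> \<kappa> (p \<oplus>\<^bsub>T\<^esub> q) = h (den q \<otimes>\<^bsub>B\<^esub> num p \<oplus>\<^bsub>B\<^esub> den p \<otimes>\<^bsub>B\<^esub> num q)"
      by (rule char[OF _ u _ m2]) (use pq nc uc in simp_all)
    also have "\<dots> = h ?u \<otimes>\<^bsub>U\<^esub> (\<kappa> p \<oplus>\<^bsub>U\<^esub> \<kappa> q)"
      unfolding ha[OF nn] hm[OF uc(2) nc(1)] hm[OF uc(1) nc(2)] hm[OF uc] hd
      by (rule U.fraction_identities(2)[OF c(3-6)])
    finally show "\<kappa> (p \<oplus>\<^bsub>T\<^esub> q) = \<kappa> p \<oplus>\<^bsub>U\<^esub> \<kappa> q"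
      by - (rule eqI[OF u], use pq \<kappa>c in simp_all)
  next
    show "\<kappa> \<one>\<^bsub>T\<^esub> = \<one>\<^bsub>U\<^esub>" using k0[of "\<one>\<^bsub>B\<^esub>"] ring_hom_one[OF assms(2)] by simp
  qed (rule \<kappa>c)
  then show ?thesis using k0 by (rule that)
qed

end

lemma (in cring) quadratic_mult:
  assumes "p \<in> carrier R" "q \<in> carrier R" "p' \<in> carrier R" "q' \<in> carrier R" "t \<in> carrier R"
    "a \<in> carrier R" "b \<in> carrier R" "t \<otimes> t = \<ominus> b \<ominus> a \<otimes> t"
  shows "(p \<oplus> q \<otimes> t) \<otimes> (p' \<oplus> q' \<otimes> t) =
    (p \<otimes> p' \<ominus> b \<otimes> q \<otimes> q') \<oplus> (p \<otimes> q' \<oplus> q \<otimes> p' \<ominus> a \<otimes> q \<otimes> q') \<otimes> t"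
proof -
  have "(p \<oplus> q \<otimes> t) \<otimes> (p' \<oplus> q' \<otimes> t) = p \<otimes> p' \<oplus> (p \<otimes> q' \<oplus> q \<otimes> p') \<otimes> t \<oplus> q \<otimes> q' \<otimes> (t \<otimes> t)"
    using assms(1-7) by algebra
  also have "\<dots> = (p \<otimes> p' \<ominus> b \<otimes> q \<otimes> q') \<oplus> (p \<otimes> q' \<oplus> q \<otimes> p' \<ominus> a \<otimes> q \<otimes> q') \<otimes> t"
    unfolding assms(8) using assms(1-7) by algebra
  finally show ?thesis .
qed

lemma (in cring) add_interchange:
  assumes "p \<in> carrier R" "q \<in> carrier R" "p' \<in> carrier R" "q' \<in> carrier R" "t \<in> carrier R"
  shows "(p \<oplus> q \<otimes> t) \<oplus> (p' \<oplus> q' \<otimes> t) = (p \<oplus> p') \<oplus> (q \<oplus> q') \<otimes> t"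
  using assms by algebra

locale rees_fractions = rees_local R I a b \<mm> v + Q: fraction_ring R Q id + AT: fraction_ring "rees_quotient R I a b" T \<iota>
  for R :: "('a, 'k) ring_scheme" (structure) and I a b \<mm> v
    and Q :: "('a, 'l) ring_scheme" and T :: "('t, 'n) ring_scheme" and \<iota>
begin

lemma RQ_closed: "r \<in> carrier R \<Longrightarrow> r \<in> carrier Q"
  using Q.iota.hom_closed[of r] by simp

lemma RQ:
  "r \<in> carrier R \<Longrightarrow> s \<in> carrier R \<Longrightarrow> r \<otimes>\<^bsub>Q\<^esub> s = r \<otimes> s"
  "r \<in> carrier R \<Longrightarrow> s \<in> carrier R \<Longrightarrow> r \<oplus>\<^bsub>Q\<^esub> s = r \<oplus> s"
  "\<zero>\<^bsub>Q\<^esub> = \<zero>" "\<one>\<^bsub>Q\<^esub> = \<one>"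
  "r \<in> carrier R \<Longrightarrow> \<ominus>\<^bsub>Q\<^esub> r = \<ominus> r"
  using Q.iota.hom_mult[of r s] Q.iota.hom_add[of r s] Q.iota.hom_zero Q.iota.hom_one Q.iota.hom_a_inv[of r] by simp_all

definition "con r = \<iota> (elt r \<zero>)"

lemma con_hom: "con \<in> ring_hom R T"
proof (rule ring_hom_memI)
  fix r s assume rs: "r \<in> carrier R" "s \<in> carrier R"
  note e = elt_closed[OF rs(1) I.zero_closed] elt_closed[OF rs(2) I.zero_closed]
  show "con r \<in> carrier T" unfolding con_def by (rule AT.iota.hom_closed[OF e(1)])
  show "con (r \<otimes> s) = con r \<otimes>\<^bsub>T\<^esub> con s"
    unfolding con_def AT.iota.hom_mult[OF e, symmetric] elt_const_mult[OF rs I.zero_closed] using rs by simp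
  show "con (r \<oplus> s) = con r \<oplus>\<^bsub>T\<^esub> con s"
    unfolding con_def AT.iota.hom_add[OF e, symmetric] elt_add[OF rs(1) I.zero_closed rs(2) I.zero_closed] by simp
next
  show "con \<one> = \<one>\<^bsub>T\<^esub>" unfolding con_def elt_one by (rule AT.iota.hom_one)
qed

lemma con_unit: "regular_elt R u \<Longrightarrow> con u \<in> Units T"
  unfolding con_def by (rule AT.regular_unit[OF regular_const])

lemma embedding_exists:
  "\<exists>\<kappa>. \<kappa> \<in> ring_hom Q T \<and> (\<forall>r\<in>carrier R. \<kappa> r = con r)"
  by (rule Q.extend_hom[OF AT.T.cring_axioms con_hom con_unit]) auto

definition "\<kappa> = (SOME \<kappa>. \<kappa> \<in> ring_hom Q T \<and> (\<forall>r\<in>carrier R. \<kappa> r = con r))"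

lemma \<kappa>_hom: "\<kappa> \<in> ring_hom Q T" and \<kappa>_con: "r \<in> carrier R \<Longrightarrow> \<kappa> r = con r"
  using someI_ex[OF embedding_exists] unfolding \<kappa>_def[symmetric] by simp_all

sublocale K: ring_hom_cring Q T \<kappa>
  by unfold_locales (rule \<kappa>_hom)

text \<open>The element \<open>t\<close> of \<open>T\<close>. If \<open>I\<close> is proper, \<open>t\<close> is not an element of the quotient of the Rees
  algebra, but \<open>vt\<close> is.\<close>

definition "\<tau> = inv\<^bsub>T\<^esub> (con v) \<otimes>\<^bsub>T\<^esub> \<iota> (elt \<zero> v)"

lemma con_closed: "r \<in> carrier R \<Longrightarrow> con r \<in> carrier T"
  by (rule ring_hom_closed[OF con_hom])

lemma elt0_closed: "i \<in> I \<Longrightarrow> \<iota> (elt \<zero> i) \<in> carrier T"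
  by (rule AT.iota.hom_closed[OF elt_closed[OF R.zero_closed]])

lemma \<tau>_closed: "\<tau> \<in> carrier T"
  unfolding \<tau>_def by (rule AT.T.m_closed[OF AT.T.Units_inv_closed[OF con_unit[OF v(2)]] elt0_closed[OF v(1)]])

lemma con_cancel:
  assumes "regular_elt R u" "x \<in> carrier T" "y \<in> carrier T" "con u \<otimes>\<^bsub>T\<^esub> x = con u \<otimes>\<^bsub>T\<^esub> y"
  shows "x = y"
  by (rule AT.regular_cancel[OF regular_const[OF assms(1)] assms(2,3) assms(4)[unfolded con_def]])

lemma con_elt:
  assumes "r \<in> carrier R" "s \<in> carrier R" "j \<in> I"
  shows "con r \<otimes>\<^bsub>T\<^esub> \<iota> (elt s j) = \<iota> (elt (r \<otimes> s) (r \<otimes> j))"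
  unfolding con_def AT.iota.hom_mult[OF elt_closed[OF assms(1) I.zero_closed] elt_closed[OF assms(2,3)], symmetric]
  by (simp only: elt_const_mult[OF assms])

lemma \<tau>_v: "con v \<otimes>\<^bsub>T\<^esub> \<tau> = \<iota> (elt \<zero> v)"
  unfolding \<tau>_def con_def by (rule AT.inv_cancel(2)[OF regular_const[OF v(2)] elt0_closed[OF v(1)]])

lemma \<iota>_linear:
  assumes "i \<in> I"
  shows "\<iota> (elt \<zero> i) = con i \<otimes>\<^bsub>T\<^esub> \<tau>"
proof (rule con_cancel[OF v(2)])
  have ic: "i \<in> carrier R" by (rule I.Icarr[OF assms])
  show "\<iota> (elt \<zero> i) \<in> carrier T" by (rule elt0_closed[OF assms])
  show "con i \<otimes>\<^bsub>T\<^esub> \<tau> \<in> carrier T" by (rule AT.T.m_closed[OF con_closed[OF ic] \<tau>_closed])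
  have "con v \<otimes>\<^bsub>T\<^esub> \<iota> (elt \<zero> i) = con i \<otimes>\<^bsub>T\<^esub> \<iota> (elt \<zero> v)"
    unfolding con_elt[OF vc R.zero_closed assms] con_elt[OF ic R.zero_closed v(1)] using vc ic by (simp add: R.m_comm)
  then show "con v \<otimes>\<^bsub>T\<^esub> \<iota> (elt \<zero> i) = con v \<otimes>\<^bsub>T\<^esub> (con i \<otimes>\<^bsub>T\<^esub> \<tau>)"
    unfolding \<tau>_v[symmetric] using con_closed[OF vc] con_closed[OF ic] \<tau>_closed by (simp add: AT.T.m_lcomm)
qed

lemma \<iota>_elt:
  assumes "r \<in> carrier R" "i \<in> I"
  shows "\<iota> (elt r i) = \<kappa> r \<oplus>\<^bsub>T\<^esub> \<kappa> i \<otimes>\<^bsub>T\<^esub> \<tau>"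
  unfolding elt_split[OF assms] AT.iota.hom_add[OF elt_closed[OF assms(1) I.zero_closed] elt_closed[OF R.zero_closed assms(2)]]
  by (simp only: \<iota>_linear[OF assms(2)] \<kappa>_con[OF assms(1)] \<kappa>_con[OF I.Icarr[OF assms(2)]] con_def)

lemma \<tau>_square: "\<tau> \<otimes>\<^bsub>T\<^esub> \<tau> = \<ominus>\<^bsub>T\<^esub> \<kappa> b \<ominus>\<^bsub>T\<^esub> \<kappa> a \<otimes>\<^bsub>T\<^esub> \<tau>"
proof -
  have vv: "v \<otimes> v \<in> I" "v \<otimes> v \<in> carrier R" using v(1) vc by (simp_all add: I.I_l_closed)
  have rvv: "regular_elt R (v \<otimes> v)" by (rule regular_elt_mult[OF R.cring_axioms v(2) v(2)])
  note c = con_closed[OF vc] con_closed[OF ab(1)] con_closed[OF ab(2)] \<tau>_closed con_closed[OF vv(2)]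
  note h = ring_hom_mult[OF con_hom]
  interpret cn: ring_hom_cring R T con by unfold_locales (rule con_hom)
  have cI: "\<ominus> (a \<otimes> (v \<otimes> v)) \<in> I" using vv ab by (simp add: I.I_l_closed)
  have cc: "\<ominus> (b \<otimes> (v \<otimes> v)) \<in> carrier R" using vv ab by simp
  have "con (v \<otimes> v) \<otimes>\<^bsub>T\<^esub> (\<tau> \<otimes>\<^bsub>T\<^esub> \<tau>) = (con v \<otimes>\<^bsub>T\<^esub> \<tau>) \<otimes>\<^bsub>T\<^esub> (con v \<otimes>\<^bsub>T\<^esub> \<tau>)"
    unfolding h[OF vc vc] using c by (simp add: AT.T.m_ac)
  also have "\<dots> = \<iota> (elt \<zero> v \<otimes>\<^bsub>A\<^esub> elt \<zero> v)"
    unfolding \<tau>_v using elt_closed[OF R.zero_closed v(1)] by simp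
  also have "elt \<zero> v \<otimes>\<^bsub>A\<^esub> elt \<zero> v = elt (\<ominus> (b \<otimes> (v \<otimes> v))) (\<ominus> (a \<otimes> (v \<otimes> v)))"
    unfolding elt_mult[OF R.zero_closed v(1) R.zero_closed v(1)] using vc ab by (simp add: R.minus_eq)
  also have "\<iota> \<dots> = con (\<ominus> (b \<otimes> (v \<otimes> v))) \<oplus>\<^bsub>T\<^esub> con (\<ominus> (a \<otimes> (v \<otimes> v))) \<otimes>\<^bsub>T\<^esub> \<tau>"
    unfolding \<iota>_elt[OF cc cI] by (simp only: \<kappa>_con[OF cc] \<kappa>_con[OF I.Icarr[OF cI]])
  also have "\<dots> = \<ominus>\<^bsub>T\<^esub> (con b \<otimes>\<^bsub>T\<^esub> con (v \<otimes> v)) \<oplus>\<^bsub>T\<^esub> \<ominus>\<^bsub>T\<^esub> (con a \<otimes>\<^bsub>T\<^esub> con (v \<otimes> v)) \<otimes>\<^bsub>T\<^esub> \<tau>"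
    using vv(2) vc ab by simp
  also have "\<dots> = con (v \<otimes> v) \<otimes>\<^bsub>T\<^esub> (\<ominus>\<^bsub>T\<^esub> con b \<ominus>\<^bsub>T\<^esub> con a \<otimes>\<^bsub>T\<^esub> \<tau>)"
    using c(2-5) by algebra
  finally have "con (v \<otimes> v) \<otimes>\<^bsub>T\<^esub> (\<tau> \<otimes>\<^bsub>T\<^esub> \<tau>) = con (v \<otimes> v) \<otimes>\<^bsub>T\<^esub> (\<ominus>\<^bsub>T\<^esub> con b \<ominus>\<^bsub>T\<^esub> con a \<otimes>\<^bsub>T\<^esub> \<tau>)" .
  then show ?thesis unfolding \<kappa>_con[OF ab(1)] \<kappa>_con[OF ab(2)]
    by - (rule con_cancel[OF rvv], use c in simp_all)
qed

definition "rfrac p q = \<kappa> p \<oplus>\<^bsub>T\<^esub> \<kappa> q \<otimes>\<^bsub>T\<^esub> \<tau>"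

lemma rfrac_closed: "p \<in> carrier Q \<Longrightarrow> q \<in> carrier Q \<Longrightarrow> rfrac p q \<in> carrier T"
  unfolding rfrac_def using \<tau>_closed by simp

lemma rfrac_add:
  assumes "p \<in> carrier Q" "q \<in> carrier Q" "p' \<in> carrier Q" "q' \<in> carrier Q"
  shows "rfrac p q \<oplus>\<^bsub>T\<^esub> rfrac p' q' = rfrac (p \<oplus>\<^bsub>Q\<^esub> p') (q \<oplus>\<^bsub>Q\<^esub> q')"
  unfolding rfrac_def K.hom_add[OF assms(1,3)] K.hom_add[OF assms(2,4)]
  by (rule AT.T.add_interchange) (use assms \<tau>_closed in simp_all)

lemma rfrac_mult:
  assumes "p \<in> carrier Q" "q \<in> carrier Q" "p' \<in> carrier Q" "q' \<in> carrier Q"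
  shows "rfrac p q \<otimes>\<^bsub>T\<^esub> rfrac p' q' = rfrac (p \<otimes>\<^bsub>Q\<^esub> p' \<ominus>\<^bsub>Q\<^esub> b \<otimes>\<^bsub>Q\<^esub> q \<otimes>\<^bsub>Q\<^esub> q')
    (p \<otimes>\<^bsub>Q\<^esub> q' \<oplus>\<^bsub>Q\<^esub> q \<otimes>\<^bsub>Q\<^esub> p' \<ominus>\<^bsub>Q\<^esub> a \<otimes>\<^bsub>Q\<^esub> q \<otimes>\<^bsub>Q\<^esub> q')"
proof -
  note k = K.hom_closed[OF assms(1)] K.hom_closed[OF assms(2)] K.hom_closed[OF assms(3)] K.hom_closed[OF assms(4)]
  note abQ = RQ_closed[OF ab(1)] RQ_closed[OF ab(2)]
  have "\<kappa> (p \<otimes>\<^bsub>Q\<^esub> p' \<ominus>\<^bsub>Q\<^esub> b \<otimes>\<^bsub>Q\<^esub> q \<otimes>\<^bsub>Q\<^esub> q') = \<kappa> p \<otimes>\<^bsub>T\<^esub> \<kappa> p' \<ominus>\<^bsub>T\<^esub> \<kappa> b \<otimes>\<^bsub>T\<^esub> \<kappa> q \<otimes>\<^bsub>T\<^esub> \<kappa> q'"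
    "\<kappa> (p \<otimes>\<^bsub>Q\<^esub> q' \<oplus>\<^bsub>Q\<^esub> q \<otimes>\<^bsub>Q\<^esub> p' \<ominus>\<^bsub>Q\<^esub> a \<otimes>\<^bsub>Q\<^esub> q \<otimes>\<^bsub>Q\<^esub> q') =
      \<kappa> p \<otimes>\<^bsub>T\<^esub> \<kappa> q' \<oplus>\<^bsub>T\<^esub> \<kappa> q \<otimes>\<^bsub>T\<^esub> \<kappa> p' \<ominus>\<^bsub>T\<^esub> \<kappa> a \<otimes>\<^bsub>T\<^esub> \<kappa> q \<otimes>\<^bsub>T\<^esub> \<kappa> q'"
    using assms abQ by (simp_all add: a_minus_def)
  then show ?thesis unfolding rfrac_def
    using AT.T.quadratic_mult[OF k \<tau>_closed K.hom_closed[OF abQ(1)] K.hom_closed[OF abQ(2)] \<tau>_square] by simp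
qed

lemma common_denominator:
  assumes "p \<in> carrier Q" "q \<in> carrier Q"
  obtains r i u where "r \<in> carrier R" "i \<in> I" "regular_elt R u" "u \<otimes>\<^bsub>Q\<^esub> p = r" "u \<otimes>\<^bsub>Q\<^esub> q = i"
proof -
  have den: "\<exists>r u. r \<in> carrier R \<and> regular_elt R u \<and> u \<otimes>\<^bsub>Q\<^esub> p = r" if pc: "p \<in> carrier Q" for p
  proof -
    obtain r u where ru: "r \<in> carrier R" "regular_elt R u" "p = id r \<otimes>\<^bsub>Q\<^esub> inv\<^bsub>Q\<^esub> (id u)" by (rule Q.fraction[OF pc])
    note rq = RQ_closed[OF ru(1)] and U = Q.regular_unit[OF ru(2)]
    have "u \<otimes>\<^bsub>Q\<^esub> p = r" unfolding ru(3)
      using Q.inv_cancel(2)[OF ru(2) rq] Q.T.m_comm[OF rq Q.T.Units_inv_closed[OF U]] by simp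
    then show ?thesis using ru by blast
  qed
  obtain r u where r: "r \<in> carrier R" "regular_elt R u" "u \<otimes>\<^bsub>Q\<^esub> p = r" using den[OF assms(1)] by (elim exE conjE)
  obtain s w where s: "s \<in> carrier R" "regular_elt R w" "w \<otimes>\<^bsub>Q\<^esub> q = s" using den[OF assms(2)] by (elim exE conjE)
  note uc = Q.regular_closed[OF r(2)] Q.regular_closed[OF s(2)]
  note cq = RQ_closed[OF uc(1)] RQ_closed[OF uc(2)] RQ_closed[OF vc] RQ_closed[OF r(1)] RQ_closed[OF s(1)]
  have reg: "regular_elt R ((w \<otimes> v) \<otimes> u)"
    by (intro regular_elt_mult[OF R.cring_axioms] r(2) s(2) v(2))
  have d: "((w \<otimes> v) \<otimes> u) = ((w \<otimes>\<^bsub>Q\<^esub> v) \<otimes>\<^bsub>Q\<^esub> u)" using uc vc by (simp add: RQ)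
  have e1: "((w \<otimes> v) \<otimes> u) \<otimes>\<^bsub>Q\<^esub> p = (w \<otimes> v) \<otimes> r"
    unfolding d Q.T.m_assoc[OF Q.T.m_closed[OF cq(2,3)] cq(1) assms(1)] r(3)
    using uc vc r(1) by (simp add: RQ)
  have "((w \<otimes> v) \<otimes> u) \<otimes>\<^bsub>Q\<^esub> q = (v \<otimes>\<^bsub>Q\<^esub> u) \<otimes>\<^bsub>Q\<^esub> (w \<otimes>\<^bsub>Q\<^esub> q)"
    unfolding d using cq assms by (simp add: Q.T.m_ac)
  also have "\<dots> = v \<otimes> u \<otimes> s" unfolding s(3) using uc vc s(1) by (simp add: RQ)
  finally have e2: "((w \<otimes> v) \<otimes> u) \<otimes>\<^bsub>Q\<^esub> q = v \<otimes> u \<otimes> s" .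
  have "v \<otimes> u \<otimes> s \<in> I" using v(1) uc s(1) by (intro I.I_r_closed)
  then show ?thesis using that[OF _ _ reg e1 e2] uc vc r(1) by simp
qed

lemma rfrac_fraction:
  assumes "r \<in> carrier R" "i \<in> I" "regular_elt R u"
    and "p \<in> carrier Q" "q \<in> carrier Q" "u \<otimes>\<^bsub>Q\<^esub> p = r" "u \<otimes>\<^bsub>Q\<^esub> q = i"
  shows "con u \<otimes>\<^bsub>T\<^esub> rfrac p q = \<iota> (elt r i)"
proof -
  note u = Q.regular_closed[OF assms(3)]
  have "con u \<otimes>\<^bsub>T\<^esub> rfrac p q = \<kappa> (u \<otimes>\<^bsub>Q\<^esub> p) \<oplus>\<^bsub>T\<^esub> \<kappa> (u \<otimes>\<^bsub>Q\<^esub> q) \<otimes>\<^bsub>T\<^esub> \<tau>"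
    unfolding rfrac_def \<kappa>_con[OF u, symmetric] using RQ_closed[OF u] assms(4,5) \<tau>_closed
    by (simp add: AT.T.r_distr AT.T.m_assoc)
  then show ?thesis unfolding assms(6,7) \<iota>_elt[OF assms(1,2)] .
qed

text \<open>With this, the description by representatives can be replaced by the expression
  \<open>\<kappa> p + \<kappa> q \<tau>\<close>, in which sums and products are computed by ring
  identities.\<close>

lemma rees_frac_eq:
  assumes "p \<in> carrier Q" "q \<in> carrier Q"
  shows "rees_frac R Q I a b T \<iota> p q = rfrac p q"
  unfolding rees_frac_def
proof (rule the_equality)
  have divide: "x = y \<otimes>\<^bsub>Q\<^esub> inv\<^bsub>Q\<^esub> u \<longleftrightarrow> u \<otimes>\<^bsub>Q\<^esub> x = y"
    if "regular_elt R u" "x \<in> carrier Q" "y \<in> carrier Q" for u x y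
    using Q.inv_cancel[OF that(1)] that(2,3) Q.T.m_comm[OF that(3) Q.T.Units_inv_closed[OF Q.regular_unit[OF that(1)]]]
    by (metis id_apply)
  have divide': "x = y \<otimes>\<^bsub>T\<^esub> inv\<^bsub>T\<^esub> (con u) \<longleftrightarrow> con u \<otimes>\<^bsub>T\<^esub> x = y"
    if "regular_elt R u" "x \<in> carrier T" "y \<in> carrier T" for u x y
    using AT.inv_cancel[OF regular_const[OF that(1)]] that(2,3)
      AT.T.m_comm[OF that(3) AT.T.Units_inv_closed[OF con_unit[OF that(1)]]]
    unfolding con_def by metis
  note fc = rfrac_closed[OF assms]
  obtain r i u where c: "r \<in> carrier R" "i \<in> I" "regular_elt R u" "u \<otimes>\<^bsub>Q\<^esub> p = r" "u \<otimes>\<^bsub>Q\<^esub> q = i"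
    by (rule common_denominator[OF assms])
  have f: "rfrac p q = \<iota> (elt r i) \<otimes>\<^bsub>T\<^esub> inv\<^bsub>T\<^esub> (con u)"
    unfolding divide'[OF c(3) fc AT.iota.hom_closed[OF elt_closed[OF c(1,2)]]]
    by (rule rfrac_fraction[OF c(1,2,3) assms c(4,5)])
  have "p = r \<otimes>\<^bsub>Q\<^esub> inv\<^bsub>Q\<^esub> u" unfolding divide[OF c(3) assms(1) RQ_closed[OF c(1)]] by (rule c(4))
  moreover have "q = i \<otimes>\<^bsub>Q\<^esub> inv\<^bsub>Q\<^esub> u"
    unfolding divide[OF c(3) assms(2) RQ_closed[OF I.Icarr[OF c(2)]]] by (rule c(5))
  ultimately show "\<exists>r\<in>carrier R. \<exists>i\<in>I. \<exists>u. regular_elt R u \<and> p = r \<otimes>\<^bsub>Q\<^esub> inv\<^bsub>Q\<^esub> u \<and> q = i \<otimes>\<^bsub>Q\<^esub> inv\<^bsub>Q\<^esub> u \<and>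
    rfrac p q = \<iota> (elt r i) \<otimes>\<^bsub>T\<^esub> inv\<^bsub>T\<^esub> (\<iota> (elt u \<zero>))"
    by (intro bexI[OF _ c(1)] bexI[OF _ c(2)] exI[of _ u] conjI c(3) f[unfolded con_def])
  fix w assume "\<exists>r\<in>carrier R. \<exists>i\<in>I. \<exists>u. regular_elt R u \<and> p = r \<otimes>\<^bsub>Q\<^esub> inv\<^bsub>Q\<^esub> u \<and> q = i \<otimes>\<^bsub>Q\<^esub> inv\<^bsub>Q\<^esub> u \<and>
    w = \<iota> (elt r i) \<otimes>\<^bsub>T\<^esub> inv\<^bsub>T\<^esub> (\<iota> (elt u \<zero>))"
  then obtain r i u where d: "r \<in> carrier R" "i \<in> I" "regular_elt R u" "p = r \<otimes>\<^bsub>Q\<^esub> inv\<^bsub>Q\<^esub> u"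
    "q = i \<otimes>\<^bsub>Q\<^esub> inv\<^bsub>Q\<^esub> u" "w = \<iota> (elt r i) \<otimes>\<^bsub>T\<^esub> inv\<^bsub>T\<^esub> (con u)"
    unfolding con_def[symmetric] by (elim bexE exE conjE)
  have "u \<otimes>\<^bsub>Q\<^esub> p = r" using d(4) unfolding divide[OF d(3) assms(1) RQ_closed[OF d(1)]] .
  moreover have "u \<otimes>\<^bsub>Q\<^esub> q = i" using d(5) unfolding divide[OF d(3) assms(2) RQ_closed[OF I.Icarr[OF d(2)]]] .
  ultimately have "con u \<otimes>\<^bsub>T\<^esub> rfrac p q = \<iota> (elt r i)" by (rule rfrac_fraction[OF d(1,2,3) assms])
  then have "rfrac p q = \<iota> (elt r i) \<otimes>\<^bsub>T\<^esub> inv\<^bsub>T\<^esub> (con u)"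
    unfolding divide'[OF d(3) fc AT.iota.hom_closed[OF elt_closed[OF d(1,2)]]] .
  then show "w = rfrac p q" unfolding d(6) by (rule sym)
qed

lemma rfrac_eq_iff:
  assumes "p \<in> carrier Q" "q \<in> carrier Q" "p' \<in> carrier Q" "q' \<in> carrier Q"
  shows "rfrac p q = rfrac p' q' \<longleftrightarrow> p = p' \<and> q = q'"
proof
  assume e: "rfrac p q = rfrac p' q'"
  obtain r i u where c: "r \<in> carrier R" "i \<in> I" "regular_elt R u" "u \<otimes>\<^bsub>Q\<^esub> p = r" "u \<otimes>\<^bsub>Q\<^esub> q = i"
    by (rule common_denominator[OF assms(1,2)])
  obtain s j w where d: "s \<in> carrier R" "j \<in> I" "regular_elt R w" "w \<otimes>\<^bsub>Q\<^esub> p' = s" "w \<otimes>\<^bsub>Q\<^esub> q' = j"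
    by (rule common_denominator[OF assms(3,4)])
  note uc = Q.regular_closed[OF c(3)] Q.regular_closed[OF d(3)]
  note uq = RQ_closed[OF uc(1)] RQ_closed[OF uc(2)]
  have m: "w \<otimes> r \<in> carrier R" "w \<otimes> i \<in> I" "u \<otimes> s \<in> carrier R" "u \<otimes> j \<in> I"
    using uc c(1,2) d(1,2) by (auto intro: I.I_l_closed)
  have "con w \<otimes>\<^bsub>T\<^esub> (con u \<otimes>\<^bsub>T\<^esub> rfrac p q) = con u \<otimes>\<^bsub>T\<^esub> (con w \<otimes>\<^bsub>T\<^esub> rfrac p' q')"
    unfolding e using uc con_closed rfrac_closed assms by (simp add: AT.T.m_lcomm)
  then have "\<iota> (elt (w \<otimes> r) (w \<otimes> i)) = \<iota> (elt (u \<otimes> s) (u \<otimes> j))"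
    unfolding rfrac_fraction[OF c(1-3) assms(1,2) c(4,5)] rfrac_fraction[OF d(1-3) assms(3,4) d(4,5)]
      con_elt[OF uc(2) c(1,2)] con_elt[OF uc(1) d(1,2)] .
  then have "elt (w \<otimes> r) (w \<otimes> i) = elt (u \<otimes> s) (u \<otimes> j)"
    unfolding AT.iota_inj[OF elt_closed[OF m(1,2)] elt_closed[OF m(3,4)]] .
  then have z: "w \<otimes> r = u \<otimes> s" "w \<otimes> i = u \<otimes> j" unfolding elt_eq_iff[OF m] by simp_all
  have "u \<otimes>\<^bsub>Q\<^esub> (w \<otimes>\<^bsub>Q\<^esub> p) = w \<otimes>\<^bsub>Q\<^esub> r" using uq assms by (simp add: c(4)[symmetric] Q.T.m_lcomm)
  also have "\<dots> = u \<otimes>\<^bsub>Q\<^esub> (w \<otimes>\<^bsub>Q\<^esub> p')" unfolding d(4) using z uc c(1) d(1) by (simp add: RQ)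
  finally have 1: "u \<otimes>\<^bsub>Q\<^esub> (w \<otimes>\<^bsub>Q\<^esub> p) = u \<otimes>\<^bsub>Q\<^esub> (w \<otimes>\<^bsub>Q\<^esub> p')" .
  have "u \<otimes>\<^bsub>Q\<^esub> (w \<otimes>\<^bsub>Q\<^esub> q) = w \<otimes>\<^bsub>Q\<^esub> i" using uq assms by (simp add: c(5)[symmetric] Q.T.m_lcomm)
  also have "\<dots> = u \<otimes>\<^bsub>Q\<^esub> (w \<otimes>\<^bsub>Q\<^esub> q')" unfolding d(5) using z uc I.Icarr[OF c(2)] I.Icarr[OF d(2)] by (simp add: RQ)
  finally have 2: "u \<otimes>\<^bsub>Q\<^esub> (w \<otimes>\<^bsub>Q\<^esub> q) = u \<otimes>\<^bsub>Q\<^esub> (w \<otimes>\<^bsub>Q\<^esub> q')" .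
  have canc: "x = y" if "x \<in> carrier Q" "y \<in> carrier Q" "u \<otimes>\<^bsub>Q\<^esub> (w \<otimes>\<^bsub>Q\<^esub> x) = u \<otimes>\<^bsub>Q\<^esub> (w \<otimes>\<^bsub>Q\<^esub> y)" for x y
    using Q.regular_cancel[OF c(3), of "w \<otimes>\<^bsub>Q\<^esub> x" "w \<otimes>\<^bsub>Q\<^esub> y"] Q.regular_cancel[OF d(3), of x y] that uq by simp
  show "p = p' \<and> q = q'" using canc[OF assms(1,3) 1] canc[OF assms(2,4) 2] by blast
qed simp

lemma \<iota>_rfrac: "r \<in> carrier R \<Longrightarrow> i \<in> I \<Longrightarrow> \<iota> (elt r i) = rfrac r i"
  unfolding rfrac_def by (rule \<iota>_elt)

text \<open>A denominator can be taken from \<open>R\<close>: extend the fraction by the conjugate of its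
  denominator, whose norm is regular by \<open>regular_norm\<close>.\<close>

lemma rfrac_cases:
  assumes "w \<in> carrier T"
  obtains p q where "p \<in> carrier Q" "q \<in> carrier Q" "w = rfrac p q"
proof -
  obtain x y where xy: "x \<in> carrier A" "regular_elt A y" "w = \<iota> x \<otimes>\<^bsub>T\<^esub> inv\<^bsub>T\<^esub> (\<iota> y)" by (rule AT.fraction[OF assms])
  note yc = AT.regular_closed[OF xy(2)]
  obtain s j where s: "s \<in> carrier R" "j \<in> I" "y = elt s j" by (rule elt_cases[OF yc])
  let ?c = "elt (s \<ominus> a \<otimes> j) (\<ominus> j)"
  have j: "j \<in> carrier R" by (rule I.Icarr[OF s(2)])
  have cc: "?c \<in> carrier A" using s j ab by (intro elt_closed) simp_all
  have N: "regular_elt R (qnorm s j)" using regular_norm[OF s(1,2)] xy(2) s(3) by simp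
  obtain r i where r: "r \<in> carrier R" "i \<in> I" "x \<otimes>\<^bsub>A\<^esub> ?c = elt r i" by (rule elt_cases[OF A.m_closed[OF xy(1) cc]])
  have yw: "\<iota> y \<otimes>\<^bsub>T\<^esub> w = \<iota> x"
    unfolding xy(3) using AT.inv_cancel(2)[OF xy(2)] AT.iota.hom_closed[OF xy(1)]
      AT.T.m_comm[OF AT.iota.hom_closed[OF xy(1)] AT.T.Units_inv_closed[OF AT.regular_unit[OF xy(2)]]] by simp
  have "con (qnorm s j) \<otimes>\<^bsub>T\<^esub> w = \<iota> ?c \<otimes>\<^bsub>T\<^esub> (\<iota> y \<otimes>\<^bsub>T\<^esub> w)"
    unfolding con_def elt_conj[OF s(1,2), symmetric] s(3)[symmetric] using yc cc assms
    by (simp add: AT.T.m_ac)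
  also have "\<dots> = \<iota> (elt r i)" unfolding yw r(3)[symmetric] using xy(1) cc by (simp add: AT.T.m_comm)
  finally have 1: "con (qnorm s j) \<otimes>\<^bsub>T\<^esub> w = \<iota> (elt r i)" .
  note NU = Q.regular_unit[OF N]
  note Nc = Q.regular_closed[OF N]
  let ?p = "inv\<^bsub>Q\<^esub> (qnorm s j) \<otimes>\<^bsub>Q\<^esub> r" and ?q = "inv\<^bsub>Q\<^esub> (qnorm s j) \<otimes>\<^bsub>Q\<^esub> i"
  have ri: "r \<in> carrier Q" "i \<in> carrier Q" using RQ_closed r(1) I.Icarr[OF r(2)] by blast+
  have pq: "?p \<in> carrier Q" "?q \<in> carrier Q" using Q.T.Units_inv_closed[OF NU] ri by simp_all
  have "con (qnorm s j) \<otimes>\<^bsub>T\<^esub> rfrac ?p ?q = \<iota> (elt r i)"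
    by (rule rfrac_fraction[OF r(1,2) N pq]) (use Q.inv_cancel(2)[OF N] ri in simp_all)
  then have "w = rfrac ?p ?q" unfolding 1[symmetric] by (rule con_cancel[OF N rfrac_closed[OF pq] assms, symmetric])
  with pq show ?thesis by (rule that)
qed

end

section \<open>Transfer of injectivity and of the socle\<close>

context fraction_ring
begin

lemma submoduleD:
  assumes "submodule H B TM"
  shows "H \<subseteq> carrier T" "\<zero>\<^bsub>T\<^esub> \<in> H" "\<And>x y. x \<in> H \<Longrightarrow> y \<in> H \<Longrightarrow> x \<oplus>\<^bsub>T\<^esub> y \<in> H"
    "\<And>x y. x \<in> H \<Longrightarrow> y \<in> H \<Longrightarrow> x \<ominus>\<^bsub>T\<^esub> y \<in> H" "\<And>r x. r \<in> carrier B \<Longrightarrow> x \<in> H \<Longrightarrow> \<iota> r \<otimes>\<^bsub>T\<^esub> x \<in> H"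
  using TM.submoduleE(1,4,5)[OF assms] submodule_zero[OF TM_module assms] submodule_minus[OF TM_module assms]
  by auto

definition "cong_mod H x y \<longleftrightarrow> x \<in> carrier T \<and> y \<in> carrier T \<and> x \<ominus>\<^bsub>T\<^esub> y \<in> H"

lemma cong_mod_coset:
  assumes "submodule H B TM" "x \<in> carrier T" "y \<in> carrier T"
  shows "H +>\<^bsub>TM\<^esub> x = H +>\<^bsub>TM\<^esub> y \<longleftrightarrow> cong_mod H x y"
  using coset_eq_iff[OF TM_module assms(1), of x y] assms by (simp add: cong_mod_def)

lemma cong_mod_closed: "cong_mod H x y \<Longrightarrow> x \<in> carrier T" "cong_mod H x y \<Longrightarrow> y \<in> carrier T"
  by (simp_all add: cong_mod_def)

lemma cong_mod_refl: "submodule H B TM \<Longrightarrow> x \<in> carrier T \<Longrightarrow> cong_mod H x x"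
  using submoduleD(2) by (simp add: cong_mod_def T.minus_eq T.r_neg)

lemma cong_mod_sym:
  assumes "submodule H B TM" "cong_mod H x y"
  shows "cong_mod H y x"
proof -
  note c = cong_mod_closed[OF assms(2)]
  have "y \<ominus>\<^bsub>T\<^esub> x = \<zero>\<^bsub>T\<^esub> \<ominus>\<^bsub>T\<^esub> (x \<ominus>\<^bsub>T\<^esub> y)" using c by algebra
  then show ?thesis using c submoduleD(2,4)[OF assms(1)] assms(2) by (simp add: cong_mod_def)
qed

lemma cong_mod_trans:
  assumes "submodule H B TM" "cong_mod H x y" "cong_mod H y z"
  shows "cong_mod H x z"
proof -
  note c = cong_mod_closed[OF assms(2)] cong_mod_closed(2)[OF assms(3)]
  have "x \<ominus>\<^bsub>T\<^esub> z = (x \<ominus>\<^bsub>T\<^esub> y) \<oplus>\<^bsub>T\<^esub> (y \<ominus>\<^bsub>T\<^esub> z)" using c by algebra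
  then show ?thesis using c submoduleD(3)[OF assms(1)] assms(2,3) by (simp add: cong_mod_def)
qed

lemma cong_mod_add:
  assumes "submodule H B TM" "cong_mod H x y" "cong_mod H x' y'"
  shows "cong_mod H (x \<oplus>\<^bsub>T\<^esub> x') (y \<oplus>\<^bsub>T\<^esub> y')"
proof -
  note c = cong_mod_closed[OF assms(2)] cong_mod_closed[OF assms(3)]
  have "(x \<oplus>\<^bsub>T\<^esub> x') \<ominus>\<^bsub>T\<^esub> (y \<oplus>\<^bsub>T\<^esub> y') = (x \<ominus>\<^bsub>T\<^esub> y) \<oplus>\<^bsub>T\<^esub> (x' \<ominus>\<^bsub>T\<^esub> y')" using c by algebra
  then show ?thesis using c submoduleD(3)[OF assms(1)] assms(2,3) by (simp add: cong_mod_def)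
qed

lemma cong_mod_zero: "submodule H B TM \<Longrightarrow> x \<in> H \<Longrightarrow> cong_mod H x \<zero>\<^bsub>T\<^esub>"
  using submoduleD(1)[of H] by (auto simp: cong_mod_def T.minus_eq)

text \<open>A homomorphism from \<open>J\<close> to \<open>T/H\<close>, given by representatives of its values in \<open>T\<close>.\<close>

definition linear_mod :: "'t set \<Rightarrow> 'b set \<Rightarrow> ('b \<Rightarrow> 't) \<Rightarrow> bool" where
  "linear_mod H J \<psi> \<longleftrightarrow> (\<forall>x\<in>J. \<psi> x \<in> carrier T) \<and>
     (\<forall>x\<in>J. \<forall>y\<in>J. cong_mod H (\<psi> (x \<oplus>\<^bsub>B\<^esub> y)) (\<psi> x \<oplus>\<^bsub>T\<^esub> \<psi> y)) \<and>
     (\<forall>r\<in>carrier B. \<forall>x\<in>J. cong_mod H (\<psi> (r \<otimes>\<^bsub>B\<^esub> x)) (\<iota> r \<otimes>\<^bsub>T\<^esub> \<psi> x))"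

lemma regular_injective_quot_iff:
  assumes H: "submodule H B TM"
  shows "regular_injective B (quot_module TM H) \<longleftrightarrow>
    (\<forall>J \<psi>. ideal J B \<longrightarrow> (\<exists>u\<in>J. regular_elt B u) \<longrightarrow> linear_mod H J \<psi> \<longrightarrow>
      (\<exists>t\<in>carrier T. \<forall>x\<in>J. cong_mod H (\<psi> x) (\<iota> x \<otimes>\<^bsub>T\<^esub> t)))" (is "?L \<longleftrightarrow> ?R")
proof
  note add = quot_module_add[OF TM_module H] and sm = quot_module_smult[OF TM_module H]
  show ?R if L: ?L
  proof (intro allI impI)
    fix J \<psi> assume J: "ideal J B" and u: "\<exists>u\<in>J. regular_elt B u" and \<psi>: "linear_mod H J \<psi>"
    interpret J: ideal J B by fact
    have c: "\<psi> x \<in> carrier T" if "x \<in> J" for x using \<psi> that unfolding linear_mod_def by blast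
    have a: "cong_mod H (\<psi> (x \<oplus>\<^bsub>B\<^esub> y)) (\<psi> x \<oplus>\<^bsub>T\<^esub> \<psi> y)" if "x \<in> J" "y \<in> J" for x y
      using \<psi> that unfolding linear_mod_def by blast
    have s: "cong_mod H (\<psi> (r \<otimes>\<^bsub>B\<^esub> x)) (\<iota> r \<otimes>\<^bsub>T\<^esub> \<psi> x)" if "r \<in> carrier B" "x \<in> J" for r x
      using \<psi> that unfolding linear_mod_def by blast
    let ?f = "\<lambda>x\<in>J. H +>\<^bsub>TM\<^esub> \<psi> x"
    have f: "?f \<in> mod_hom B ((scalar_module id B)\<lparr>carrier := J\<rparr>) (quot_module TM H)"
    proof (rule mod_homI)
      show "?f \<in> carrier ((scalar_module id B)\<lparr>carrier := J\<rparr>) \<rightarrow>\<^sub>E carrier (quot_module TM H)"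
        unfolding quot_module_carrier using c by auto
      fix x y assume "x \<in> carrier ((scalar_module id B)\<lparr>carrier := J\<rparr>)" "y \<in> carrier ((scalar_module id B)\<lparr>carrier := J\<rparr>)"
      then have xy: "x \<in> J" "y \<in> J" by simp_all
      have "H +>\<^bsub>TM\<^esub> \<psi> (x \<oplus>\<^bsub>B\<^esub> y) = (H +>\<^bsub>TM\<^esub> \<psi> x) \<oplus>\<^bsub>quot_module TM H\<^esub> (H +>\<^bsub>TM\<^esub> \<psi> y)"
        using a[OF xy] cong_mod_coset[OF H, of "\<psi> (x \<oplus>\<^bsub>B\<^esub> y)" "\<psi> x \<oplus>\<^bsub>T\<^esub> \<psi> y"] cong_mod_closed[OF a[OF xy]]
          add[of "\<psi> x" "\<psi> y"] c[OF xy(1)] c[OF xy(2)] by (simp del: a_r_coset_scalar_module)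
      then show "?f (x \<oplus>\<^bsub>(scalar_module id B)\<lparr>carrier := J\<rparr>\<^esub> y) = ?f x \<oplus>\<^bsub>quot_module TM H\<^esub> ?f y"
        using xy by (simp del: a_r_coset_scalar_module)
    next
      fix r x assume "r \<in> carrier B" "x \<in> carrier ((scalar_module id B)\<lparr>carrier := J\<rparr>)"
      then have rx: "r \<in> carrier B" "x \<in> J" by simp_all
      have "H +>\<^bsub>TM\<^esub> \<psi> (r \<otimes>\<^bsub>B\<^esub> x) = r \<odot>\<^bsub>quot_module TM H\<^esub> (H +>\<^bsub>TM\<^esub> \<psi> x)"
        using s[OF rx] cong_mod_coset[OF H, of "\<psi> (r \<otimes>\<^bsub>B\<^esub> x)" "\<iota> r \<otimes>\<^bsub>T\<^esub> \<psi> x"] cong_mod_closed[OF s[OF rx]]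
          sm[of r "\<psi> x"] c[OF rx(2)] rx(1) by (simp del: a_r_coset_scalar_module)
      then show "?f (r \<odot>\<^bsub>(scalar_module id B)\<lparr>carrier := J\<rparr>\<^esub> x) = r \<odot>\<^bsub>quot_module TM H\<^esub> ?f x"
        using rx J.I_l_closed[OF rx(2,1)] by (simp del: a_r_coset_scalar_module)
    qed
    obtain e where e: "e \<in> carrier (quot_module TM H)" "\<And>x. x \<in> J \<Longrightarrow> ?f x = x \<odot>\<^bsub>quot_module TM H\<^esub> e"
      using L[unfolded regular_injective_def, rule_format, OF conjI[OF J conjI[OF u f]]] by (elim bexE) blast
    obtain t where t: "t \<in> carrier T" "e = H +>\<^bsub>TM\<^esub> t" using e(1) unfolding quot_module_carrier by auto
    have "cong_mod H (\<psi> x) (\<iota> x \<otimes>\<^bsub>T\<^esub> t)" if x: "x \<in> J" for x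
      using e(2)[OF x] sm[OF J.Icarr[OF x], of t] t x c[OF x] J.Icarr[OF x] cong_mod_coset[OF H, of "\<psi> x" "\<iota> x \<otimes>\<^bsub>T\<^esub> t"]
      by (simp del: a_r_coset_scalar_module)
    then show "\<exists>t\<in>carrier T. \<forall>x\<in>J. cong_mod H (\<psi> x) (\<iota> x \<otimes>\<^bsub>T\<^esub> t)" using t(1) by blast
  qed
  show ?L if R: ?R
    unfolding regular_injective_def
  proof (intro allI impI, elim conjE)
    fix J f assume J: "ideal J B" and u: "\<exists>u\<in>J. regular_elt B u"
      and f: "f \<in> mod_hom B ((scalar_module id B)\<lparr>carrier := J\<rparr>) (quot_module TM H)"
    interpret J: ideal J B by fact
    have "\<forall>x\<in>J. \<exists>t. t \<in> carrier T \<and> f x = H +>\<^bsub>TM\<^esub> t"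
      using mod_hom_closed[OF f] unfolding quot_module_carrier by auto
    then obtain \<psi> where \<psi>: "\<And>x. x \<in> J \<Longrightarrow> \<psi> x \<in> carrier T" "\<And>x. x \<in> J \<Longrightarrow> f x = H +>\<^bsub>TM\<^esub> \<psi> x" by metis
    have "linear_mod H J \<psi>"
      unfolding linear_mod_def
    proof (intro conjI ballI)
      fix x y assume xy: "x \<in> J" "y \<in> J"
      have "f (x \<oplus>\<^bsub>B\<^esub> y) = f x \<oplus>\<^bsub>quot_module TM H\<^esub> f y" using mod_hom_add[OF f, of x y] xy by simp
      then show "cong_mod H (\<psi> (x \<oplus>\<^bsub>B\<^esub> y)) (\<psi> x \<oplus>\<^bsub>T\<^esub> \<psi> y)"
        using \<psi>(2)[OF xy(1)] \<psi>(2)[OF xy(2)] \<psi>(2)[OF J.a_closed[OF xy]] add[of "\<psi> x" "\<psi> y"] \<psi>(1)[OF xy(1)] \<psi>(1)[OF xy(2)]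
          \<psi>(1)[OF J.a_closed[OF xy]] cong_mod_coset[OF H, of "\<psi> (x \<oplus>\<^bsub>B\<^esub> y)" "\<psi> x \<oplus>\<^bsub>T\<^esub> \<psi> y"]
        by (simp del: a_r_coset_scalar_module)
    next
      fix r x assume rx: "r \<in> carrier B" "x \<in> J"
      have "f (r \<otimes>\<^bsub>B\<^esub> x) = r \<odot>\<^bsub>quot_module TM H\<^esub> f x" using mod_hom_smult[OF f, of r x] rx by simp
      then show "cong_mod H (\<psi> (r \<otimes>\<^bsub>B\<^esub> x)) (\<iota> r \<otimes>\<^bsub>T\<^esub> \<psi> x)"
        using \<psi>(2)[OF rx(2)] \<psi>(2)[OF J.I_l_closed[OF rx(2,1)]] sm[OF rx(1), of "\<psi> x"] \<psi>(1)[OF rx(2)] rx(1)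
          \<psi>(1)[OF J.I_l_closed[OF rx(2,1)]] cong_mod_coset[OF H, of "\<psi> (r \<otimes>\<^bsub>B\<^esub> x)" "\<iota> r \<otimes>\<^bsub>T\<^esub> \<psi> x"]
        by (simp del: a_r_coset_scalar_module)
    qed (rule \<psi>(1))
    from R[rule_format, OF J u this] obtain t where t: "t \<in> carrier T" "\<And>x. x \<in> J \<Longrightarrow> cong_mod H (\<psi> x) (\<iota> x \<otimes>\<^bsub>T\<^esub> t)"
      by (elim bexE) blast
    show "\<exists>e\<in>carrier (quot_module TM H). \<forall>x\<in>J. f x = x \<odot>\<^bsub>quot_module TM H\<^esub> e"
    proof (rule bexI[of _ "H +>\<^bsub>TM\<^esub> t"], rule ballI)
      fix x assume x: "x \<in> J"
      show "f x = x \<odot>\<^bsub>quot_module TM H\<^esub> (H +>\<^bsub>TM\<^esub> t)"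
        using \<psi>(2)[OF x] sm[OF J.Icarr[OF x], of t] t(1) \<psi>(1)[OF x] J.Icarr[OF x] t(2)[OF x]
          cong_mod_coset[OF H, of "\<psi> x" "\<iota> x \<otimes>\<^bsub>T\<^esub> t"] by (simp del: a_r_coset_scalar_module)
    next
      show "H +>\<^bsub>TM\<^esub> t \<in> carrier (quot_module TM H)"
        unfolding quot_module_carrier using t(1) by (simp del: a_r_coset_scalar_module)
    qed
  qed
qed

end

lemma (in cring) cancel_cross_term:
  assumes "x \<in> carrier R" "i \<in> carrier R" "p \<in> carrier R" "a \<in> carrier R" "q \<in> carrier R"
  shows "x \<oplus> i \<otimes> (p \<oplus> a \<otimes> q) \<ominus> a \<otimes> i \<otimes> q = x \<oplus> i \<otimes> p"
  using assms by algebra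

context rees_fractions
begin

lemma rfrac_minus:
  assumes "p \<in> carrier Q" "q \<in> carrier Q" "p' \<in> carrier Q" "q' \<in> carrier Q"
  shows "rfrac p q \<ominus>\<^bsub>T\<^esub> rfrac p' q' = rfrac (p \<ominus>\<^bsub>Q\<^esub> p') (q \<ominus>\<^bsub>Q\<^esub> q')"
proof -
  have c: "p \<ominus>\<^bsub>Q\<^esub> p' \<in> carrier Q" "q \<ominus>\<^bsub>Q\<^esub> q' \<in> carrier Q" using assms by simp_all
  have "(p \<ominus>\<^bsub>Q\<^esub> p') \<oplus>\<^bsub>Q\<^esub> p' = p" "(q \<ominus>\<^bsub>Q\<^esub> q') \<oplus>\<^bsub>Q\<^esub> q' = q" using assms by algebra+
  then have e: "rfrac p q = rfrac (p \<ominus>\<^bsub>Q\<^esub> p') (q \<ominus>\<^bsub>Q\<^esub> q') \<oplus>\<^bsub>T\<^esub> rfrac p' q'"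
    unfolding rfrac_add[OF c assms(3,4)] by simp
  have "(x \<oplus>\<^bsub>T\<^esub> y) \<ominus>\<^bsub>T\<^esub> y = x" if "x \<in> carrier T" "y \<in> carrier T" for x y using that by algebra
  then show ?thesis unfolding e using rfrac_closed[OF c] rfrac_closed[OF assms(3,4)] by blast
qed

lemma rfrac_act:
  assumes "r \<in> carrier R" "i \<in> I" "p \<in> carrier Q" "q \<in> carrier Q"
  shows "\<iota> (elt r i) \<otimes>\<^bsub>T\<^esub> rfrac p q = rfrac (r \<otimes>\<^bsub>Q\<^esub> p \<ominus>\<^bsub>Q\<^esub> b \<otimes>\<^bsub>Q\<^esub> i \<otimes>\<^bsub>Q\<^esub> q)
    (r \<otimes>\<^bsub>Q\<^esub> q \<oplus>\<^bsub>Q\<^esub> i \<otimes>\<^bsub>Q\<^esub> p \<ominus>\<^bsub>Q\<^esub> a \<otimes>\<^bsub>Q\<^esub> i \<otimes>\<^bsub>Q\<^esub> q)"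
  unfolding \<iota>_rfrac[OF assms(1,2)]
  by (rule rfrac_mult[OF RQ_closed[OF assms(1)] RQ_closed[OF I.Icarr[OF assms(2)]] assms(3,4)])

text \<open>The coefficient of \<open>t\<close>; it is determined because of \<open>rfrac_eq_iff\<close> and \<open>rfrac_cases\<close>.\<close>

definition "tcoeff w = (THE q. q \<in> carrier Q \<and> (\<exists>p\<in>carrier Q. w = rfrac p q))"

lemma tcoeff_rfrac [simp]: "p \<in> carrier Q \<Longrightarrow> q \<in> carrier Q \<Longrightarrow> tcoeff (rfrac p q) = q"
  unfolding tcoeff_def by (rule the_equality) (use rfrac_eq_iff in blast)+

lemma tcoeff_closed: "w \<in> carrier T \<Longrightarrow> tcoeff w \<in> carrier Q"
  by (erule rfrac_cases) simp

lemma tcoeff_add: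
  assumes "w \<in> carrier T" "w' \<in> carrier T"
  shows "tcoeff (w \<oplus>\<^bsub>T\<^esub> w') = tcoeff w \<oplus>\<^bsub>Q\<^esub> tcoeff w'"
proof -
  obtain p q p' q' where c: "p \<in> carrier Q" "q \<in> carrier Q" "w = rfrac p q"
    "p' \<in> carrier Q" "q' \<in> carrier Q" "w' = rfrac p' q'" by (metis rfrac_cases assms)
  show ?thesis unfolding c(3,6) rfrac_add[OF c(1,2,4,5)] using c(1,2,4,5) by simp
qed

lemma tcoeff_minus:
  assumes "w \<in> carrier T" "w' \<in> carrier T"
  shows "tcoeff (w \<ominus>\<^bsub>T\<^esub> w') = tcoeff w \<ominus>\<^bsub>Q\<^esub> tcoeff w'"
proof -
  obtain p q p' q' where c: "p \<in> carrier Q" "q \<in> carrier Q" "w = rfrac p q"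
    "p' \<in> carrier Q" "q' \<in> carrier Q" "w' = rfrac p' q'" by (metis rfrac_cases assms)
  show ?thesis unfolding c(3,6) rfrac_minus[OF c(1,2,4,5)] using c(1,2,4,5) by simp
qed

lemma tcoeff_con:
  assumes "r \<in> carrier R" "w \<in> carrier T"
  shows "tcoeff (\<iota> (elt r \<zero>) \<otimes>\<^bsub>T\<^esub> w) = r \<otimes>\<^bsub>Q\<^esub> tcoeff w"
proof -
  obtain p q where c: "p \<in> carrier Q" "q \<in> carrier Q" "w = rfrac p q" by (rule rfrac_cases[OF assms(2)])
  have "\<zero> \<otimes>\<^bsub>Q\<^esub> x = \<zero>" if "x \<in> carrier Q" for x using Q.T.l_null[OF that] RQ(3) by simp
  moreover have "x \<otimes>\<^bsub>Q\<^esub> \<zero> = \<zero>" if "x \<in> carrier Q" for x using Q.T.r_null[OF that] RQ(3) by simp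
  ultimately have z: "\<zero> \<otimes>\<^bsub>Q\<^esub> p = \<zero>" "a \<otimes>\<^bsub>Q\<^esub> \<zero> \<otimes>\<^bsub>Q\<^esub> q = \<zero>" using c RQ_closed[OF ab(1)] by simp_all
  have "x \<oplus>\<^bsub>Q\<^esub> \<zero> \<ominus>\<^bsub>Q\<^esub> \<zero> = x" if "x \<in> carrier Q" for x
    using that unfolding RQ(3)[symmetric] by algebra
  then show ?thesis
    unfolding c(3) rfrac_act[OF assms(1) I.zero_closed c(1,2)] using c(1,2) RQ_closed[OF assms(1)] RQ_closed ab
    by (simp add: z)
qed

text \<open>The set \<open>K\<close> of the theorem, for \<open>W = z\<^sup>-\<^sup>1 \<omega>\<close>.\<close>

definition "canon W = {rfrac p q | p q. p \<in> colon Q W I \<and> q \<in> W}"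

context
  fixes W
  assumes W: "submodule W R Q.TM"
begin

lemmas WD = Q.submoduleD[OF W]

lemma W_smult: "r \<in> carrier R \<Longrightarrow> x \<in> W \<Longrightarrow> r \<otimes>\<^bsub>Q\<^esub> x \<in> W"
  using WD(5)[of r x] by simp

lemma rfrac_canon_iff:
  assumes "p \<in> carrier Q" "q \<in> carrier Q"
  shows "rfrac p q \<in> canon W \<longleftrightarrow> (\<forall>i\<in>I. i \<otimes>\<^bsub>Q\<^esub> p \<in> W) \<and> q \<in> W"
proof -
  have col: "x \<in> colon Q W I \<longleftrightarrow> (\<forall>i\<in>I. i \<otimes>\<^bsub>Q\<^esub> x \<in> W)" if "x \<in> carrier Q" for x
    using that RQ_closed[OF I.Icarr] by (auto simp: colon_def Q.T.m_comm)
  have "rfrac p q \<in> canon W \<longleftrightarrow> p \<in> colon Q W I \<and> q \<in> W"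
  proof
    assume "rfrac p q \<in> canon W"
    then obtain p' q' where "rfrac p q = rfrac p' q'" "p' \<in> colon Q W I" "q' \<in> W"
      unfolding canon_def by blast
    moreover from this have "p' \<in> carrier Q" "q' \<in> carrier Q" using WD(1) by (auto simp: colon_def)
    ultimately show "p \<in> colon Q W I \<and> q \<in> W" using rfrac_eq_iff[OF assms, of p' q'] by simp
  qed (unfold canon_def, blast)
  then show ?thesis using col[OF assms(1)] by simp
qed

text \<open>This identifies \<open>canon W\<close> with the homomorphisms from \<open>A\<close> to \<open>W\<close>: an element \<open>w\<close> corresponds
  to the map that sends \<open>x\<close> to the coefficient of \<open>t\<close> in \<open>xw\<close>.\<close>

lemma canon_iff:
  assumes "w \<in> carrier T"
  shows "w \<in> canon W \<longleftrightarrow> (\<forall>x\<in>carrier A. tcoeff (\<iota> x \<otimes>\<^bsub>T\<^esub> w) \<in> W)"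
proof -
  obtain p q where c: "p \<in> carrier Q" "q \<in> carrier Q" "w = rfrac p q" by (rule rfrac_cases[OF assms])
  have act: "tcoeff (\<iota> (elt r i) \<otimes>\<^bsub>T\<^esub> w) = r \<otimes>\<^bsub>Q\<^esub> q \<oplus>\<^bsub>Q\<^esub> i \<otimes>\<^bsub>Q\<^esub> p \<ominus>\<^bsub>Q\<^esub> (a \<otimes> i) \<otimes>\<^bsub>Q\<^esub> q"
    if "r \<in> carrier R" "i \<in> I" for r i
    unfolding c(3) rfrac_act[OF that c(1,2)]
      RQ(1)[OF ab(1) I.Icarr[OF that(2)], symmetric]
    using c(1,2) RQ_closed[OF that(1)] RQ_closed[OF I.Icarr[OF that(2)]] RQ_closed[OF ab(1)] RQ_closed[OF ab(2)]
    by simp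
  show ?thesis
  proof
    assume "w \<in> canon W"
    then have k: "i \<otimes>\<^bsub>Q\<^esub> p \<in> W" "q \<in> W" if "i \<in> I" for i
      using rfrac_canon_iff[OF c(1,2)] c(3) that by simp_all
    show "\<forall>x\<in>carrier A. tcoeff (\<iota> x \<otimes>\<^bsub>T\<^esub> w) \<in> W"
    proof
      fix x assume x: "x \<in> carrier A"
      obtain r i where e: "r \<in> carrier R" "i \<in> I" "x = elt r i" by (rule elt_cases[OF x])
      have ai: "a \<otimes> i \<in> carrier R" using ab I.Icarr[OF e(2)] by simp
      show "tcoeff (\<iota> x \<otimes>\<^bsub>T\<^esub> w) \<in> W" unfolding e(3) act[OF e(1,2)]
        by (rule WD(4)[OF WD(3)[OF W_smult[OF e(1) k(2)[OF e(2)]] k(1)[OF e(2)]] W_smult[OF ai k(2)[OF e(2)]]])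
    qed
  next
    assume h: "\<forall>x\<in>carrier A. tcoeff (\<iota> x \<otimes>\<^bsub>T\<^esub> w) \<in> W"
    have "tcoeff (\<iota> (elt \<one> \<zero>) \<otimes>\<^bsub>T\<^esub> w) \<in> W" using h elt_closed[OF R.one_closed I.zero_closed] by blast
    then have q: "q \<in> W" unfolding elt_one AT.iota.hom_one using c assms by simp
    have "i \<otimes>\<^bsub>Q\<^esub> p \<in> W" if i: "i \<in> I" for i
    proof -
      have "tcoeff (\<iota> (elt \<zero> i) \<otimes>\<^bsub>T\<^esub> w) \<in> W" using h elt_closed[OF R.zero_closed i] by blast
      then have 1: "\<zero> \<otimes>\<^bsub>Q\<^esub> q \<oplus>\<^bsub>Q\<^esub> i \<otimes>\<^bsub>Q\<^esub> p \<ominus>\<^bsub>Q\<^esub> (a \<otimes> i) \<otimes>\<^bsub>Q\<^esub> q \<in> W" unfolding act[OF R.zero_closed i] .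
      have ai: "a \<otimes> i \<in> carrier R" using ab I.Icarr[OF i] by simp
      have "x = (\<zero>\<^bsub>Q\<^esub> \<otimes>\<^bsub>Q\<^esub> q \<oplus>\<^bsub>Q\<^esub> x \<ominus>\<^bsub>Q\<^esub> y) \<oplus>\<^bsub>Q\<^esub> y" if "x \<in> carrier Q" "y \<in> carrier Q" for x y
        using that c(2) by algebra
      from this[of "i \<otimes>\<^bsub>Q\<^esub> p" "(a \<otimes> i) \<otimes>\<^bsub>Q\<^esub> q"]
      have "i \<otimes>\<^bsub>Q\<^esub> p = (\<zero> \<otimes>\<^bsub>Q\<^esub> q \<oplus>\<^bsub>Q\<^esub> i \<otimes>\<^bsub>Q\<^esub> p \<ominus>\<^bsub>Q\<^esub> (a \<otimes> i) \<otimes>\<^bsub>Q\<^esub> q) \<oplus>\<^bsub>Q\<^esub> (a \<otimes> i) \<otimes>\<^bsub>Q\<^esub> q"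
        unfolding RQ(3) using Q.T.m_closed[OF RQ_closed[OF I.Icarr[OF i]] c(1)] Q.T.m_closed[OF RQ_closed[OF ai] c(2)] by blast
      also have "\<dots> \<in> W" by (rule WD(3)[OF 1 W_smult[OF ai q]])
      finally show ?thesis .
    qed
    then show "w \<in> canon W" unfolding c(3) rfrac_canon_iff[OF c(1,2)] using q by blast
  qed
qed

lemma canon_carrier: "canon W \<subseteq> carrier T"
  using WD(1) by (auto simp: canon_def colon_def intro!: rfrac_closed)

lemma canon_tcoeff: "w \<in> canon W \<Longrightarrow> tcoeff w \<in> W"
  using canon_iff[of w] canon_carrier elt_closed[OF R.one_closed I.zero_closed] elt_one AT.iota.hom_one
  by (metis AT.T.l_one subsetD)

lemma canon_submodule: "submodule (canon W) A AT.TM"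
proof (rule AT.TM.submoduleI_linear)
  show "canon W \<subseteq> carrier AT.TM" using canon_carrier by simp
  have "tcoeff \<zero>\<^bsub>T\<^esub> = \<zero>\<^bsub>Q\<^esub>"
    using tcoeff_minus[OF AT.T.zero_closed AT.T.zero_closed] tcoeff_closed[OF AT.T.zero_closed]
    by (simp add: AT.T.minus_eq Q.T.minus_eq Q.T.r_neg)
  then show "\<zero>\<^bsub>AT.TM\<^esub> \<in> canon W" using WD(2) by (simp add: canon_iff)
  fix w w' assume k: "w \<in> canon W" "w' \<in> canon W"
  note c = subsetD[OF canon_carrier k(1)] subsetD[OF canon_carrier k(2)]
  have "tcoeff (\<iota> x \<otimes>\<^bsub>T\<^esub> (w \<oplus>\<^bsub>T\<^esub> w')) \<in> W" if x: "x \<in> carrier A" for x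
    using k x c unfolding canon_iff[OF c(1)] canon_iff[OF c(2)]
    by (simp add: AT.T.r_distr tcoeff_add WD(3))
  then show "w \<oplus>\<^bsub>AT.TM\<^esub> w' \<in> canon W" using c by (simp add: canon_iff)
next
  fix y w assume k: "y \<in> carrier A" "w \<in> canon W"
  note c = subsetD[OF canon_carrier k(2)]
  have "tcoeff (\<iota> x \<otimes>\<^bsub>T\<^esub> (\<iota> y \<otimes>\<^bsub>T\<^esub> w)) \<in> W" if x: "x \<in> carrier A" for x
  proof -
    have "\<iota> x \<otimes>\<^bsub>T\<^esub> (\<iota> y \<otimes>\<^bsub>T\<^esub> w) = \<iota> (x \<otimes>\<^bsub>A\<^esub> y) \<otimes>\<^bsub>T\<^esub> w" using x k(1) c by (simp add: AT.T.m_assoc)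
    then show ?thesis using k(2) A.m_closed[OF x k(1)] unfolding canon_iff[OF c] by simp
  qed
  then show "y \<odot>\<^bsub>AT.TM\<^esub> w \<in> canon W" using k(1) c by (simp add: canon_iff)
qed

text \<open>The elements that the maximal ideal multiplies into \<open>canon W\<close> are the \<open>p + qt\<close> with
  \<open>pI \<subseteq> W\<close> and \<open>q\<mm> \<subseteq> W\<close>, so \<open>\<sigma>t\<close> generates the socle if
  \<open>\<sigma>\<close> does.\<close>

lemma canon_simple_socle:
  assumes "Q.simple_socle \<mm> W"
  shows "AT.simple_socle nn (canon W)"
proof -
  obtain \<sigma> where \<sigma>: "\<sigma> \<in> carrier Q" "\<And>r. r \<in> \<mm> \<Longrightarrow> r \<otimes>\<^bsub>Q\<^esub> \<sigma> \<in> W" "\<sigma> \<notin> W"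
    "\<And>q. q \<in> carrier Q \<Longrightarrow> \<forall>r\<in>\<mm>. r \<otimes>\<^bsub>Q\<^esub> q \<in> W \<Longrightarrow> \<exists>r\<in>carrier R. q \<ominus>\<^bsub>Q\<^esub> r \<otimes>\<^bsub>Q\<^esub> \<sigma> \<in> W"
    using assms unfolding Q.simple_socle_def id_apply by blast
  have z: "\<zero> \<in> carrier Q" by (rule RQ_closed) simp
  show ?thesis unfolding AT.simple_socle_def
  proof (intro bexI[of _ "rfrac \<zero> \<sigma>"] conjI ballI impI)
    show "rfrac \<zero> \<sigma> \<in> carrier T" by (rule rfrac_closed[OF z \<sigma>(1)])
    show "rfrac \<zero> \<sigma> \<notin> canon W" using rfrac_canon_iff[OF z \<sigma>(1)] \<sigma>(3) by simp
    fix x assume "x \<in> nn"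
    then obtain r i where c: "r \<in> \<mm>" "i \<in> I" "x = elt r i" unfolding nn_def by blast
    note rc = mm.Icarr[OF c(1)] and ic = I.Icarr[OF c(2)]
    note q = RQ_closed[OF rc] RQ_closed[OF ic] RQ_closed[OF ab(1)] RQ_closed[OF ab(2)]
    have im: "i \<in> \<mm>" using c(2) I_sub by blast
    have m: "b \<otimes> i \<in> \<mm>" "a \<otimes> i \<in> \<mm>" using im ab by (auto intro: mm.I_l_closed)
    have e1: "r \<otimes>\<^bsub>Q\<^esub> \<zero> \<ominus>\<^bsub>Q\<^esub> b \<otimes>\<^bsub>Q\<^esub> i \<otimes>\<^bsub>Q\<^esub> \<sigma> = \<zero>\<^bsub>Q\<^esub> \<ominus>\<^bsub>Q\<^esub> (b \<otimes> i) \<otimes>\<^bsub>Q\<^esub> \<sigma>"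
      unfolding RQ(3)[symmetric] RQ(1)[OF ab(2) ic, symmetric] using q \<sigma>(1) by algebra
    have e2: "r \<otimes>\<^bsub>Q\<^esub> \<sigma> \<oplus>\<^bsub>Q\<^esub> i \<otimes>\<^bsub>Q\<^esub> \<zero> \<ominus>\<^bsub>Q\<^esub> a \<otimes>\<^bsub>Q\<^esub> i \<otimes>\<^bsub>Q\<^esub> \<sigma> = r \<otimes>\<^bsub>Q\<^esub> \<sigma> \<ominus>\<^bsub>Q\<^esub> (a \<otimes> i) \<otimes>\<^bsub>Q\<^esub> \<sigma>"
      unfolding RQ(3)[symmetric] RQ(1)[OF ab(1) ic, symmetric] using q \<sigma>(1) by algebra
    have W1: "\<zero>\<^bsub>Q\<^esub> \<ominus>\<^bsub>Q\<^esub> (b \<otimes> i) \<otimes>\<^bsub>Q\<^esub> \<sigma> \<in> W" by (rule WD(4)[OF WD(2) \<sigma>(2)[OF m(1)]])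
    have W2: "r \<otimes>\<^bsub>Q\<^esub> \<sigma> \<ominus>\<^bsub>Q\<^esub> (a \<otimes> i) \<otimes>\<^bsub>Q\<^esub> \<sigma> \<in> W" by (rule WD(4)[OF \<sigma>(2)[OF c(1)] \<sigma>(2)[OF m(2)]])
    show "\<iota> x \<otimes>\<^bsub>T\<^esub> rfrac \<zero> \<sigma> \<in> canon W"
      unfolding c(3) rfrac_act[OF rc c(2) z \<sigma>(1)] e1 e2 rfrac_canon_iff[OF subsetD[OF WD(1) W1] subsetD[OF WD(1) W2]]
      using W1 W2 W_smult I.Icarr by blast
  next
    fix w assume w: "w \<in> carrier T" "\<forall>x\<in>nn. \<iota> x \<otimes>\<^bsub>T\<^esub> w \<in> canon W"
    obtain p q where c: "p \<in> carrier Q" "q \<in> carrier Q" "w = rfrac p q" by (rule rfrac_cases[OF w(1)])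
    have rq: "r \<otimes>\<^bsub>Q\<^esub> q \<in> W" if r: "r \<in> \<mm>" for r
    proof -
      have "\<iota> (elt r \<zero>) \<otimes>\<^bsub>T\<^esub> w \<in> canon W" using w(2) elt_nn[OF mm.Icarr[OF r] I.zero_closed] r by blast
      from canon_tcoeff[OF this] show ?thesis
        using tcoeff_con[OF mm.Icarr[OF r] w(1)] c by simp
    qed
    then obtain s where s: "s \<in> carrier R" "q \<ominus>\<^bsub>Q\<^esub> s \<otimes>\<^bsub>Q\<^esub> \<sigma> \<in> W" using \<sigma>(4)[OF c(2)] by blast
    note sq = RQ_closed[OF s(1)]
    have ip: "i \<otimes>\<^bsub>Q\<^esub> p \<in> W" if i: "i \<in> I" for i
    proof -
      note ic = I.Icarr[OF i]
      note cq = RQ_closed[OF ic] RQ_closed[OF ab(1)] RQ_closed[OF ab(2)] z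
      have ai: "a \<otimes> i \<in> \<mm>" using I_sub i ab by (auto intro: mm.I_l_closed)
      have "\<iota> (elt \<zero> i) \<otimes>\<^bsub>T\<^esub> w \<in> canon W" using w(2) elt_nn[OF R.zero_closed i] mm.zero_closed by blast
      from canon_tcoeff[OF this]
      have 1: "\<zero> \<otimes>\<^bsub>Q\<^esub> q \<oplus>\<^bsub>Q\<^esub> i \<otimes>\<^bsub>Q\<^esub> p \<ominus>\<^bsub>Q\<^esub> a \<otimes>\<^bsub>Q\<^esub> i \<otimes>\<^bsub>Q\<^esub> q \<in> W"
        unfolding c(3) rfrac_act[OF R.zero_closed i c(1,2)] using c(1,2) cq by simp
      have "i \<otimes>\<^bsub>Q\<^esub> p = (\<zero> \<otimes>\<^bsub>Q\<^esub> q \<oplus>\<^bsub>Q\<^esub> i \<otimes>\<^bsub>Q\<^esub> p \<ominus>\<^bsub>Q\<^esub> a \<otimes>\<^bsub>Q\<^esub> i \<otimes>\<^bsub>Q\<^esub> q) \<oplus>\<^bsub>Q\<^esub> (a \<otimes> i) \<otimes>\<^bsub>Q\<^esub> q"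
        unfolding RQ(3)[symmetric] RQ(1)[OF ab(1) ic, symmetric] using c(1,2) cq(1-3) by algebra
      also have "\<dots> \<in> W" by (rule WD(3)[OF 1 rq[OF ai]])
      finally show ?thesis .
    qed
    have e: "\<iota> (elt s \<zero>) \<otimes>\<^bsub>T\<^esub> rfrac \<zero> \<sigma> = rfrac \<zero> (s \<otimes>\<^bsub>Q\<^esub> \<sigma>)"
    proof -
      have "s \<otimes>\<^bsub>Q\<^esub> \<zero> \<ominus>\<^bsub>Q\<^esub> b \<otimes>\<^bsub>Q\<^esub> \<zero> \<otimes>\<^bsub>Q\<^esub> \<sigma> = \<zero>"
        "s \<otimes>\<^bsub>Q\<^esub> \<sigma> \<oplus>\<^bsub>Q\<^esub> \<zero> \<otimes>\<^bsub>Q\<^esub> \<zero> \<ominus>\<^bsub>Q\<^esub> a \<otimes>\<^bsub>Q\<^esub> \<zero> \<otimes>\<^bsub>Q\<^esub> \<sigma> = s \<otimes>\<^bsub>Q\<^esub> \<sigma>"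
        unfolding RQ(3)[symmetric] using sq \<sigma>(1) RQ_closed[OF ab(1)] RQ_closed[OF ab(2)] by algebra+
      then show ?thesis unfolding rfrac_act[OF s(1) I.zero_closed z \<sigma>(1)] by simp
    qed
    have "p \<ominus>\<^bsub>Q\<^esub> \<zero> = p" unfolding RQ(3)[symmetric] using c(1) by algebra
    then have "w \<ominus>\<^bsub>T\<^esub> \<iota> (elt s \<zero>) \<otimes>\<^bsub>T\<^esub> rfrac \<zero> \<sigma> = rfrac p (q \<ominus>\<^bsub>Q\<^esub> s \<otimes>\<^bsub>Q\<^esub> \<sigma>)"
      unfolding e c(3) rfrac_minus[OF c(1,2) z Q.T.m_closed[OF sq \<sigma>(1)]] by simp
    also have "\<dots> \<in> canon W" unfolding rfrac_canon_iff[OF c(1) subsetD[OF WD(1) s(2)]] using s(2) ip by blast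
    finally show "\<exists>x\<in>carrier A. w \<ominus>\<^bsub>T\<^esub> \<iota> x \<otimes>\<^bsub>T\<^esub> rfrac \<zero> \<sigma> \<in> canon W"
      using elt_closed[OF s(1) I.zero_closed] by blast
  qed
qed

text \<open>Composed with the coefficient of \<open>t\<close>, a map to \<open>T/canon W\<close> becomes an \<open>R\<close>-linear map to
  \<open>Q(R)/W\<close>, and by \<open>canon_iff\<close> no information is lost. On \<open>r + it \<in> J\<close> the multiplication
  by \<open>p + qt\<close> has the coefficient \<open>rq + i(p - aq)\<close> of \<open>t\<close>; the two terms are found by applying
  the assumption to the ideals \<open>snd_part J\<close> and \<open>fst_part J\<close> of \<open>R\<close>.\<close>

lemma canon_regular_injective:
  assumes inj: "regular_injective R (quot_module Q.TM W)"
  shows "regular_injective A (quot_module AT.TM (canon W))"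
  unfolding AT.regular_injective_quot_iff[OF canon_submodule]
proof (intro allI impI)
  fix J \<phi> assume J: "ideal J A" and reg: "\<exists>u\<in>J. regular_elt A u" and \<phi>: "AT.linear_mod (canon W) J \<phi>"
  interpret J: ideal J A by (rule J)
  note injW = inj[unfolded Q.regular_injective_quot_iff[OF W], rule_format]
  note tr = Q.cong_mod_trans[OF W] and sy = Q.cong_mod_sym[OF W] and ad = Q.cong_mod_add[OF W]
    and rf = Q.cong_mod_refl[OF W]
  have \<phi>c: "\<phi> x \<in> carrier T" if "x \<in> J" for x using \<phi> that unfolding AT.linear_mod_def by blast
  have \<phi>a: "AT.cong_mod (canon W) (\<phi> (x \<oplus>\<^bsub>A\<^esub> y)) (\<phi> x \<oplus>\<^bsub>T\<^esub> \<phi> y)" if "x \<in> J" "y \<in> J" for x y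
    using \<phi> that unfolding AT.linear_mod_def by blast
  have \<phi>s: "AT.cong_mod (canon W) (\<phi> (y \<otimes>\<^bsub>A\<^esub> x)) (\<iota> y \<otimes>\<^bsub>T\<^esub> \<phi> x)" if "y \<in> carrier A" "x \<in> J" for x y
    using \<phi> that unfolding AT.linear_mod_def by blast
  have down: "Q.cong_mod W (tcoeff x) (tcoeff y)" if "AT.cong_mod (canon W) x y" for x y
  proof -
    note c = AT.cong_mod_closed[OF that]
    have "tcoeff (x \<ominus>\<^bsub>T\<^esub> y) \<in> W" by (rule canon_tcoeff) (use that in \<open>simp add: AT.cong_mod_def\<close>)
    then show ?thesis using c tcoeff_closed by (simp add: Q.cong_mod_def tcoeff_minus)
  qed
  define \<psi> where "\<psi> x = tcoeff (\<phi> x)" for x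
  have \<psi>c: "\<psi> x \<in> carrier Q" if "x \<in> J" for x unfolding \<psi>_def by (rule tcoeff_closed[OF \<phi>c[OF that]])
  have \<psi>a: "Q.cong_mod W (\<psi> (x \<oplus>\<^bsub>A\<^esub> y)) (\<psi> x \<oplus>\<^bsub>Q\<^esub> \<psi> y)" if "x \<in> J" "y \<in> J" for x y
    using down[OF \<phi>a[OF that]] tcoeff_add[OF \<phi>c[OF that(1)] \<phi>c[OF that(2)]] unfolding \<psi>_def by simp
  have \<psi>s: "Q.cong_mod W (\<psi> (elt r \<zero> \<otimes>\<^bsub>A\<^esub> x)) (r \<otimes>\<^bsub>Q\<^esub> \<psi> x)" if "r \<in> carrier R" "x \<in> J" for r x
    using down[OF \<phi>s[OF elt_closed[OF that(1) I.zero_closed] that(2)]] tcoeff_con[OF that(1) \<phi>c[OF that(2)]]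
    unfolding \<psi>_def by simp
  obtain N where N: "regular_elt R N" "elt N \<zero> \<in> J"
  proof -
    obtain x where x: "x \<in> J" "regular_elt A x" using reg by (elim bexE)
    obtain s j where s: "s \<in> carrier R" "j \<in> I" "x = elt s j" by (rule elt_cases[OF J.Icarr[OF x(1)]])
    have "elt (s \<ominus> a \<otimes> j) (\<ominus> j) \<in> carrier A" using s ab I.Icarr by (intro elt_closed) auto
    then have "elt s j \<otimes>\<^bsub>A\<^esub> elt (s \<ominus> a \<otimes> j) (\<ominus> j) \<in> J" using x(1) s(3) by (intro J.I_r_closed) auto
    then show ?thesis using that[OF regular_norm[OF s(1,2)]] x(2) s(3) elt_conj[OF s(1,2)] by simp
  qed
  note Nc = Q.regular_closed[OF N(1)]
  \<comment> \<open>The restriction to the elements \<open>it\<close> of \<open>J\<close> determines the constant coefficient.\<close>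
  have lin1: "Q.linear_mod W (snd_part J) (\<lambda>i. \<psi> (elt \<zero> i))"
    unfolding Q.linear_mod_def
  proof (intro conjI ballI)
    fix i assume "i \<in> snd_part J"
    then show "\<psi> (elt \<zero> i) \<in> carrier Q" using \<psi>c by (simp add: snd_part_def)
  next
    fix i j assume "i \<in> snd_part J" "j \<in> snd_part J"
    then have c: "i \<in> I" "j \<in> I" "elt \<zero> i \<in> J" "elt \<zero> j \<in> J" by (simp_all add: snd_part_def)
    show "Q.cong_mod W (\<psi> (elt \<zero> (i \<oplus> j))) (\<psi> (elt \<zero> i) \<oplus>\<^bsub>Q\<^esub> \<psi> (elt \<zero> j))"
      using \<psi>a[OF c(3,4)] elt_add[OF R.zero_closed c(1) R.zero_closed c(2)] by simp
  next
    fix r i assume r: "r \<in> carrier R" and "i \<in> snd_part J"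
    then have c: "i \<in> I" "elt \<zero> i \<in> J" by (simp_all add: snd_part_def)
    show "Q.cong_mod W (\<psi> (elt \<zero> (r \<otimes> i))) (id r \<otimes>\<^bsub>Q\<^esub> \<psi> (elt \<zero> i))"
      using \<psi>s[OF r c(2)] elt_const_mult[OF r R.zero_closed c(1)] r by simp
  qed
  have reg1: "\<exists>u\<in>snd_part J. regular_elt R u"
  proof (intro bexI[of _ "N \<otimes> v"] regular_elt_mult[OF R.cring_axioms N(1) v(2)])
    have "elt N \<zero> \<otimes>\<^bsub>A\<^esub> elt \<zero> v \<in> J" by (rule J.I_r_closed[OF N(2) elt_closed[OF R.zero_closed v(1)]])
    then show "N \<otimes> v \<in> snd_part J"
      unfolding elt_const_mult[OF Nc R.zero_closed v(1)] snd_part_def using Nc v(1) by (simp add: I.I_l_closed)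
  qed
  from injW[OF snd_part_ideal[OF J] reg1 lin1]
  obtain p' where p'_id: "p' \<in> carrier Q"
    "\<And>i. i \<in> snd_part J \<Longrightarrow> Q.cong_mod W (\<psi> (elt \<zero> i)) (id i \<otimes>\<^bsub>Q\<^esub> p')"
    by (elim bexE) (rule that, assumption, erule bspec)
  note p' = p'_id(1) p'_id(2)[unfolded id_apply]
  define G where "G r i = \<psi> (elt r i) \<ominus>\<^bsub>Q\<^esub> i \<otimes>\<^bsub>Q\<^esub> p'" for r i
  have ip: "i \<otimes>\<^bsub>Q\<^esub> p' \<in> carrier Q" if "i \<in> I" for i
    by (rule Q.T.m_closed[OF RQ_closed[OF I.Icarr[OF that]] p'(1)])
  have Gc: "G r i \<in> carrier Q" if "i \<in> I" "elt r i \<in> J" for r i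
    unfolding G_def using \<psi>c[OF that(2)] ip[OF that(1)] by simp
  have Ga: "Q.cong_mod W (G (r \<oplus> s) (i \<oplus> j)) (G r i \<oplus>\<^bsub>Q\<^esub> G s j)"
    if c: "r \<in> carrier R" "i \<in> I" "s \<in> carrier R" "j \<in> I" and e: "elt r i \<in> J" "elt s j \<in> J" for r i s j
  proof -
    have 1: "Q.cong_mod W (\<psi> (elt (r \<oplus> s) (i \<oplus> j))) (\<psi> (elt r i) \<oplus>\<^bsub>Q\<^esub> \<psi> (elt s j))"
      using \<psi>a[OF e] unfolding elt_add[OF c] .
    note iq = RQ_closed[OF I.Icarr[OF c(2)]] RQ_closed[OF I.Icarr[OF c(4)]]
    have eq: "x \<ominus>\<^bsub>Q\<^esub> (i \<oplus>\<^bsub>Q\<^esub> j) \<otimes>\<^bsub>Q\<^esub> p' \<ominus>\<^bsub>Q\<^esub> ((y \<ominus>\<^bsub>Q\<^esub> i \<otimes>\<^bsub>Q\<^esub> p') \<oplus>\<^bsub>Q\<^esub> (z \<ominus>\<^bsub>Q\<^esub> j \<otimes>\<^bsub>Q\<^esub> p'))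
        = x \<ominus>\<^bsub>Q\<^esub> (y \<oplus>\<^bsub>Q\<^esub> z)" if "x \<in> carrier Q" "y \<in> carrier Q" "z \<in> carrier Q" for x y z
      using that iq p'(1) by algebra
    have ij: "i \<oplus> j = i \<oplus>\<^bsub>Q\<^esub> j" using RQ(2)[OF I.Icarr[OF c(2)] I.Icarr[OF c(4)]] by simp
    have "elt (r \<oplus> s) (i \<oplus> j) \<in> J" using J.a_closed[OF e] unfolding elt_add[OF c] .
    then have cl: "G (r \<oplus> s) (i \<oplus> j) \<in> carrier Q" by (rule Gc[OF I.a_closed[OF c(2,4)]])
    show ?thesis
      unfolding Q.cong_mod_def
    proof (intro conjI cl Q.T.a_closed Gc c e)
      show "G (r \<oplus> s) (i \<oplus> j) \<ominus>\<^bsub>Q\<^esub> (G r i \<oplus>\<^bsub>Q\<^esub> G s j) \<in> W"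
        unfolding G_def ij eq[OF Q.cong_mod_closed(1)[OF 1[unfolded ij]] \<psi>c[OF e(1)] \<psi>c[OF e(2)]]
        using 1[unfolded ij] by (simp add: Q.cong_mod_def)
    qed
  qed
  have Gs: "Q.cong_mod W (G (s \<otimes> r) (s \<otimes> i)) (s \<otimes>\<^bsub>Q\<^esub> G r i)"
    if c: "s \<in> carrier R" "r \<in> carrier R" "i \<in> I" and e: "elt r i \<in> J" for s r i
  proof -
    have 1: "Q.cong_mod W (\<psi> (elt (s \<otimes> r) (s \<otimes> i))) (s \<otimes>\<^bsub>Q\<^esub> \<psi> (elt r i))"
      using \<psi>s[OF c(1) e] unfolding elt_const_mult[OF c] .
    note iq = RQ_closed[OF I.Icarr[OF c(3)]] RQ_closed[OF c(1)]
    have eq: "x \<ominus>\<^bsub>Q\<^esub> (s \<otimes>\<^bsub>Q\<^esub> i) \<otimes>\<^bsub>Q\<^esub> p' \<ominus>\<^bsub>Q\<^esub> (s \<otimes>\<^bsub>Q\<^esub> (y \<ominus>\<^bsub>Q\<^esub> i \<otimes>\<^bsub>Q\<^esub> p'))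
        = x \<ominus>\<^bsub>Q\<^esub> (s \<otimes>\<^bsub>Q\<^esub> y)" if "x \<in> carrier Q" "y \<in> carrier Q" for x y
      using that iq p'(1) by algebra
    have si: "s \<otimes> i = s \<otimes>\<^bsub>Q\<^esub> i" using RQ(1)[OF c(1) I.Icarr[OF c(3)]] by simp
    have "elt (s \<otimes> r) (s \<otimes> i) \<in> J"
      using J.I_l_closed[OF e elt_closed[OF c(1) I.zero_closed]] unfolding elt_const_mult[OF c] .
    then have cl: "G (s \<otimes> r) (s \<otimes> i) \<in> carrier Q" by (rule Gc[OF I.I_l_closed[OF c(3,1)]])
    show ?thesis
      unfolding Q.cong_mod_def
    proof (intro conjI cl Q.T.m_closed iq(2) Gc c e)
      show "G (s \<otimes> r) (s \<otimes> i) \<ominus>\<^bsub>Q\<^esub> (s \<otimes>\<^bsub>Q\<^esub> G r i) \<in> W"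
        unfolding G_def si eq[OF Q.cong_mod_closed(1)[OF 1[unfolded si]] \<psi>c[OF e]]
        using 1[unfolded si] by (simp add: Q.cong_mod_def)
    qed
  qed
  have Gi: "Q.cong_mod W (G r i) (G r j)"
    if c: "r \<in> carrier R" "i \<in> I" "j \<in> I" and e: "elt r i \<in> J" "elt r j \<in> J" for r i j
  proof -
    note ca = I.Icarr[OF c(2)] I.Icarr[OF c(3)]
    have ij: "i \<ominus> j \<in> I" using c by (simp add: R.minus_eq)
    have ijz: "(\<zero> \<oplus> r) = r" "(i \<ominus> j) \<oplus> j = i" using c(1) ca by algebra+
    have split: "elt r i = elt \<zero> (i \<ominus> j) \<oplus>\<^bsub>A\<^esub> elt r j"
      unfolding elt_add[OF R.zero_closed ij c(1,3)] ijz ..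
    have "(x \<oplus>\<^bsub>A\<^esub> y) \<ominus>\<^bsub>A\<^esub> y = x" if "x \<in> carrier A" "y \<in> carrier A" for x y using that by algebra
    from this[OF elt_closed[OF R.zero_closed ij] elt_closed[OF c(1,3)]]
    have "elt \<zero> (i \<ominus> j) = elt r i \<ominus>\<^bsub>A\<^esub> elt r j" unfolding split by simp
    also have "\<dots> \<in> J" unfolding A.minus_eq by (rule J.a_closed[OF e(1) J.a_inv_closed[OF e(2)]])
    finally have z: "elt \<zero> (i \<ominus> j) \<in> J" .
    have "Q.cong_mod W (\<psi> (elt \<zero> (i \<ominus> j))) ((i \<ominus> j) \<otimes>\<^bsub>Q\<^esub> p')"
      by (rule p'(2)) (use z ij in \<open>simp add: snd_part_def\<close>)
    then have "G \<zero> (i \<ominus> j) \<in> W" by (simp add: G_def Q.cong_mod_def)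
    then have 0: "Q.cong_mod W (G \<zero> (i \<ominus> j)) \<zero>\<^bsub>Q\<^esub>" by (rule Q.cong_mod_zero[OF W])
    have "Q.cong_mod W (G r i) (G \<zero> (i \<ominus> j) \<oplus>\<^bsub>Q\<^esub> G r j)"
      using Ga[OF R.zero_closed ij c(1,3) z e(2)] unfolding ijz .
    moreover have "Q.cong_mod W (G \<zero> (i \<ominus> j) \<oplus>\<^bsub>Q\<^esub> G r j) (\<zero>\<^bsub>Q\<^esub> \<oplus>\<^bsub>Q\<^esub> G r j)"
      by (rule ad[OF 0 rf[OF Gc[OF c(3) e(2)]]])
    ultimately show ?thesis using tr Gc[OF c(3) e(2)] by (metis Q.T.l_zero)
  qed
  \<comment> \<open>What remains depends on the constant coefficients of the elements of \<open>J\<close> only.\<close>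
  have "\<forall>r\<in>fst_part J. \<exists>i. i \<in> I \<and> elt r i \<in> J" unfolding fst_part_def by blast
  then obtain \<eta> where \<eta>: "\<And>r. r \<in> fst_part J \<Longrightarrow> \<eta> r \<in> I" "\<And>r. r \<in> fst_part J \<Longrightarrow> elt r (\<eta> r) \<in> J" by metis
  have fc: "r \<in> carrier R" if "r \<in> fst_part J" for r using that by (simp add: fst_part_def)
  interpret F: ideal "fst_part J" R by (rule fst_part_ideal[OF J])
  have lin0: "Q.linear_mod W (fst_part J) (\<lambda>r. G r (\<eta> r))"
    unfolding Q.linear_mod_def
  proof (intro conjI ballI)
    fix r assume "r \<in> fst_part J"
    then show "G r (\<eta> r) \<in> carrier Q" by (intro Gc \<eta>)
  next
    fix r s assume rs: "r \<in> fst_part J" "s \<in> fst_part J"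
    note k = fc[OF rs(1)] \<eta>(1)[OF rs(1)] fc[OF rs(2)] \<eta>(1)[OF rs(2)]
    have m: "elt (r \<oplus> s) (\<eta> r \<oplus> \<eta> s) \<in> J"
      using J.a_closed[OF \<eta>(2)[OF rs(1)] \<eta>(2)[OF rs(2)]] unfolding elt_add[OF k] .
    note rs' = F.a_closed[OF rs]
    show "Q.cong_mod W (G (r \<oplus> s) (\<eta> (r \<oplus> s))) (G r (\<eta> r) \<oplus>\<^bsub>Q\<^esub> G s (\<eta> s))"
      by (rule tr[OF Gi[OF fc[OF rs'] \<eta>(1)[OF rs'] I.a_closed[OF k(2,4)] \<eta>(2)[OF rs'] m]
        Ga[OF k \<eta>(2)[OF rs(1)] \<eta>(2)[OF rs(2)]]])
  next
    fix s r assume s: "s \<in> carrier R" and r: "r \<in> fst_part J"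
    note k = s fc[OF r] \<eta>(1)[OF r]
    have m: "elt (s \<otimes> r) (s \<otimes> \<eta> r) \<in> J"
      using J.I_l_closed[OF \<eta>(2)[OF r] elt_closed[OF s I.zero_closed]] unfolding elt_const_mult[OF k] .
    note r' = F.I_l_closed[OF r s]
    show "Q.cong_mod W (G (s \<otimes> r) (\<eta> (s \<otimes> r))) (id s \<otimes>\<^bsub>Q\<^esub> G r (\<eta> r))"
      unfolding id_apply
      by (rule tr[OF Gi[OF fc[OF r'] \<eta>(1)[OF r'] I.I_l_closed[OF k(3) s] \<eta>(2)[OF r'] m]
        Gs[OF k \<eta>(2)[OF r]]])
  qed
  have reg0: "\<exists>u\<in>fst_part J. regular_elt R u"
    using N Nc I.zero_closed unfolding fst_part_def by blast
  from injW[OF fst_part_ideal[OF J] reg0 lin0]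
  obtain q where q_id: "q \<in> carrier Q"
    "\<And>r. r \<in> fst_part J \<Longrightarrow> Q.cong_mod W (G r (\<eta> r)) (id r \<otimes>\<^bsub>Q\<^esub> q)"
    by (elim bexE) (rule that, assumption, erule bspec)
  note q = q_id(1) q_id(2)[unfolded id_apply]
  define p where "p = p' \<oplus>\<^bsub>Q\<^esub> a \<otimes>\<^bsub>Q\<^esub> q"
  note aQ = RQ_closed[OF ab(1)] RQ_closed[OF ab(2)]
  have p: "p \<in> carrier Q" unfolding p_def using p'(1) q(1) aQ by simp
  have w: "rfrac p q \<in> carrier T" by (rule rfrac_closed[OF p q(1)])
  have main: "Q.cong_mod W (\<psi> x) (tcoeff (\<iota> x \<otimes>\<^bsub>T\<^esub> rfrac p q))" if x: "x \<in> J" for x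
  proof -
    obtain r i where c: "r \<in> carrier R" "i \<in> I" "x = elt r i" by (rule elt_cases[OF J.Icarr[OF x]])
    note rq = RQ_closed[OF c(1)] RQ_closed[OF I.Icarr[OF c(2)]]
    have t: "tcoeff (\<iota> x \<otimes>\<^bsub>T\<^esub> rfrac p q) = r \<otimes>\<^bsub>Q\<^esub> q \<oplus>\<^bsub>Q\<^esub> i \<otimes>\<^bsub>Q\<^esub> p \<ominus>\<^bsub>Q\<^esub> a \<otimes>\<^bsub>Q\<^esub> i \<otimes>\<^bsub>Q\<^esub> q"
      unfolding c(3) rfrac_act[OF c(1,2) p q(1)] using rq p q(1) aQ by simp
    have t': "r \<otimes>\<^bsub>Q\<^esub> q \<oplus>\<^bsub>Q\<^esub> i \<otimes>\<^bsub>Q\<^esub> p \<ominus>\<^bsub>Q\<^esub> a \<otimes>\<^bsub>Q\<^esub> i \<otimes>\<^bsub>Q\<^esub> q = r \<otimes>\<^bsub>Q\<^esub> q \<oplus>\<^bsub>Q\<^esub> i \<otimes>\<^bsub>Q\<^esub> p'"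
      unfolding p_def by (rule Q.T.cancel_cross_term[OF Q.T.m_closed[OF rq(1) q(1)] rq(2) p'(1) aQ(1) q(1)])
    have f: "r \<in> fst_part J"
      unfolding fst_part_def by (intro CollectI conjI c(1) bexI[OF _ c(2)] x[unfolded c(3)])
    have 1: "Q.cong_mod W (G r i) (r \<otimes>\<^bsub>Q\<^esub> q)"
      by (rule tr[OF Gi[OF c(1,2) \<eta>(1)[OF f] x[unfolded c(3)] \<eta>(2)[OF f]] q(2)[OF f]])
    have 2: "Q.cong_mod W (G r i \<oplus>\<^bsub>Q\<^esub> i \<otimes>\<^bsub>Q\<^esub> p') (r \<otimes>\<^bsub>Q\<^esub> q \<oplus>\<^bsub>Q\<^esub> i \<otimes>\<^bsub>Q\<^esub> p')"
      by (rule ad[OF 1 rf[OF ip[OF c(2)]]])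
    have "(y \<ominus>\<^bsub>Q\<^esub> z) \<oplus>\<^bsub>Q\<^esub> z = y" if "y \<in> carrier Q" "z \<in> carrier Q" for y z using that by algebra
    from this[OF \<psi>c[OF x] ip[OF c(2)]]
    have "G r i \<oplus>\<^bsub>Q\<^esub> i \<otimes>\<^bsub>Q\<^esub> p' = \<psi> x" unfolding G_def c(3) .
    then show ?thesis unfolding t t' using 2 by simp
  qed
  show "\<exists>w\<in>carrier T. \<forall>x\<in>J. AT.cong_mod (canon W) (\<phi> x) (\<iota> x \<otimes>\<^bsub>T\<^esub> w)"
  proof (intro bexI[OF _ w] ballI)
    fix x assume x: "x \<in> J"
    have xw: "\<iota> x \<otimes>\<^bsub>T\<^esub> rfrac p q \<in> carrier T" using w J.Icarr[OF x] by simp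
    have dc: "\<phi> x \<ominus>\<^bsub>T\<^esub> \<iota> x \<otimes>\<^bsub>T\<^esub> rfrac p q \<in> carrier T" using \<phi>c[OF x] xw by simp
    have "tcoeff (\<iota> y \<otimes>\<^bsub>T\<^esub> (\<phi> x \<ominus>\<^bsub>T\<^esub> \<iota> x \<otimes>\<^bsub>T\<^esub> rfrac p q)) \<in> W" if y: "y \<in> carrier A" for y
    proof -
      note yx = J.I_l_closed[OF x y] and yc = AT.iota.hom_closed[OF y]
      have "Q.cong_mod W (tcoeff (\<iota> y \<otimes>\<^bsub>T\<^esub> \<phi> x)) (\<psi> (y \<otimes>\<^bsub>A\<^esub> x))"
        unfolding \<psi>_def by (rule sy[OF down[OF \<phi>s[OF y x]]])
      from tr[OF this main[OF yx]]
      have 1: "tcoeff (\<iota> y \<otimes>\<^bsub>T\<^esub> \<phi> x) \<ominus>\<^bsub>Q\<^esub> tcoeff (\<iota> (y \<otimes>\<^bsub>A\<^esub> x) \<otimes>\<^bsub>T\<^esub> rfrac p q) \<in> W"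
        by (simp add: Q.cong_mod_def)
      have d: "z \<otimes>\<^bsub>T\<^esub> (m \<ominus>\<^bsub>T\<^esub> k \<otimes>\<^bsub>T\<^esub> l) = z \<otimes>\<^bsub>T\<^esub> m \<ominus>\<^bsub>T\<^esub> (z \<otimes>\<^bsub>T\<^esub> k) \<otimes>\<^bsub>T\<^esub> l"
        if "z \<in> carrier T" "m \<in> carrier T" "k \<in> carrier T" "l \<in> carrier T" for z m k l
        using that by algebra
      show ?thesis
        unfolding d[OF yc \<phi>c[OF x] AT.iota.hom_closed[OF J.Icarr[OF x]] w] AT.iota.hom_mult[OF y J.Icarr[OF x], symmetric]
          tcoeff_minus[OF AT.T.m_closed[OF yc \<phi>c[OF x]] AT.T.m_closed[OF AT.iota.hom_closed[OF J.Icarr[OF yx]] w]]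
        by (rule 1)
    qed
    then show "AT.cong_mod (canon W) (\<phi> x) (\<iota> x \<otimes>\<^bsub>T\<^esub> rfrac p q)"
      unfolding AT.cong_mod_def using \<phi>c[OF x] xw canon_iff[OF dc] by blast
  qed
qed

end

end

section \<open>Scaling, integrality and reductions\<close>

context fraction_ring
begin

text \<open>The set \<open>z\<^sup>-\<^sup>1 H\<close>. Multiplication by the unit \<open>z\<close> is an isomorphism from it to
  \<open>H\<close>.\<close>

definition "scaled z H = {x \<in> carrier T. z \<otimes>\<^bsub>T\<^esub> x \<in> H}"

context
  fixes z H
  assumes z: "z \<in> Units T" and H: "submodule H B TM"
begin

lemmas HD = submoduleD[OF H]
lemma zc: "z \<in> carrier T" "inv\<^bsub>T\<^esub> z \<in> carrier T" using z by auto

lemma z_inv: "x \<in> carrier T \<Longrightarrow> z \<otimes>\<^bsub>T\<^esub> (inv\<^bsub>T\<^esub> z \<otimes>\<^bsub>T\<^esub> x) = x" "x \<in> carrier T \<Longrightarrow> inv\<^bsub>T\<^esub> z \<otimes>\<^bsub>T\<^esub> (z \<otimes>\<^bsub>T\<^esub> x) = x"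
  using zc z by (simp_all add: T.m_assoc[symmetric])

lemma scaled_submodule: "submodule (scaled z H) B TM"
proof (rule TM.submoduleI_linear)
  fix r x assume r: "r \<in> carrier B" and x: "x \<in> scaled z H"
  then have c: "x \<in> carrier T" "z \<otimes>\<^bsub>T\<^esub> x \<in> H" by (simp_all add: scaled_def)
  have "z \<otimes>\<^bsub>T\<^esub> (\<iota> r \<otimes>\<^bsub>T\<^esub> x) = \<iota> r \<otimes>\<^bsub>T\<^esub> (z \<otimes>\<^bsub>T\<^esub> x)" using zc r c(1) by (simp add: T.m_lcomm)
  then show "r \<odot>\<^bsub>TM\<^esub> x \<in> scaled z H" using HD(5)[OF r c(2)] r c(1) by (simp add: scaled_def)
qed (use zc HD in \<open>auto simp: scaled_def T.r_distr\<close>)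

lemma scaled_cong_mod:
  assumes "x \<in> carrier T" "y \<in> carrier T"
  shows "cong_mod (scaled z H) x y \<longleftrightarrow> cong_mod H (z \<otimes>\<^bsub>T\<^esub> x) (z \<otimes>\<^bsub>T\<^esub> y)"
proof -
  have "z \<otimes>\<^bsub>T\<^esub> (x \<ominus>\<^bsub>T\<^esub> y) = z \<otimes>\<^bsub>T\<^esub> x \<ominus>\<^bsub>T\<^esub> z \<otimes>\<^bsub>T\<^esub> y" using assms zc by algebra
  then show ?thesis using assms zc by (simp add: cong_mod_def scaled_def)
qed

lemma scaled_simple_socle:
  assumes "simple_socle \<nn> H" "\<nn> \<subseteq> carrier B"
  shows "simple_socle \<nn> (scaled z H)"
proof -
  obtain \<sigma> where \<sigma>: "\<sigma> \<in> carrier T" "\<And>r. r \<in> \<nn> \<Longrightarrow> \<iota> r \<otimes>\<^bsub>T\<^esub> \<sigma> \<in> H" "\<sigma> \<notin> H"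
    "\<And>q. q \<in> carrier T \<Longrightarrow> \<forall>r\<in>\<nn>. \<iota> r \<otimes>\<^bsub>T\<^esub> q \<in> H \<Longrightarrow> \<exists>r\<in>carrier B. q \<ominus>\<^bsub>T\<^esub> \<iota> r \<otimes>\<^bsub>T\<^esub> \<sigma> \<in> H"
    using assms(1) unfolding simple_socle_def by blast
  let ?s = "inv\<^bsub>T\<^esub> z \<otimes>\<^bsub>T\<^esub> \<sigma>"
  have s: "?s \<in> carrier T" using zc \<sigma>(1) by simp
  have zs: "z \<otimes>\<^bsub>T\<^esub> (\<iota> r \<otimes>\<^bsub>T\<^esub> x) = \<iota> r \<otimes>\<^bsub>T\<^esub> (z \<otimes>\<^bsub>T\<^esub> x)" if "r \<in> carrier B" "x \<in> carrier T" for r x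
    using zc that by (simp add: T.m_lcomm)
  show ?thesis
    unfolding simple_socle_def
  proof (intro bexI[OF _ s] conjI ballI impI)
    fix r assume r: "r \<in> \<nn>"
    then have rc: "r \<in> carrier B" using assms(2) by blast
    show "\<iota> r \<otimes>\<^bsub>T\<^esub> ?s \<in> scaled z H"
      using zs[OF rc s] z_inv(1)[OF \<sigma>(1)] \<sigma>(2)[OF r] rc s by (simp add: scaled_def)
  next
    show "?s \<notin> scaled z H" using z_inv(1)[OF \<sigma>(1)] \<sigma>(3) by (simp add: scaled_def)
  next
    fix q assume q: "q \<in> carrier T" "\<forall>r\<in>\<nn>. \<iota> r \<otimes>\<^bsub>T\<^esub> q \<in> scaled z H"
    have "\<forall>r\<in>\<nn>. \<iota> r \<otimes>\<^bsub>T\<^esub> (z \<otimes>\<^bsub>T\<^esub> q) \<in> H"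
    proof
      fix r assume r: "r \<in> \<nn>"
      then have "z \<otimes>\<^bsub>T\<^esub> (\<iota> r \<otimes>\<^bsub>T\<^esub> q) \<in> H" using q(2) by (simp add: scaled_def)
      then show "\<iota> r \<otimes>\<^bsub>T\<^esub> (z \<otimes>\<^bsub>T\<^esub> q) \<in> H" using zs[OF subsetD[OF assms(2) r] q(1)] by simp
    qed
    from \<sigma>(4)[OF T.m_closed[OF zc(1) q(1)] this]
    obtain r where r: "r \<in> carrier B" "z \<otimes>\<^bsub>T\<^esub> q \<ominus>\<^bsub>T\<^esub> \<iota> r \<otimes>\<^bsub>T\<^esub> \<sigma> \<in> H"
      by (elim bexE)
    have rs: "\<iota> r \<otimes>\<^bsub>T\<^esub> ?s \<in> carrier T" using r(1) s by simp
    have "z \<otimes>\<^bsub>T\<^esub> (q \<ominus>\<^bsub>T\<^esub> y) = z \<otimes>\<^bsub>T\<^esub> q \<ominus>\<^bsub>T\<^esub> z \<otimes>\<^bsub>T\<^esub> y" if "y \<in> carrier T" for y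
      using zc q(1) that by algebra
    from this[OF rs] have "z \<otimes>\<^bsub>T\<^esub> (q \<ominus>\<^bsub>T\<^esub> \<iota> r \<otimes>\<^bsub>T\<^esub> ?s) \<in> H"
      unfolding zs[OF r(1) s] z_inv(1)[OF \<sigma>(1)] using r(2) by simp
    then have "q \<ominus>\<^bsub>T\<^esub> \<iota> r \<otimes>\<^bsub>T\<^esub> ?s \<in> scaled z H" using q(1) rs by (simp add: scaled_def)
    then show "\<exists>r\<in>carrier B. q \<ominus>\<^bsub>T\<^esub> \<iota> r \<otimes>\<^bsub>T\<^esub> ?s \<in> scaled z H" by (rule bexI[OF _ r(1)])
  qed
qed

lemma scaled_regular_injective:
  assumes "regular_injective B (quot_module TM H)"
  shows "regular_injective B (quot_module TM (scaled z H))"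
  unfolding regular_injective_quot_iff[OF scaled_submodule]
proof (intro allI impI)
  fix J \<psi> assume J: "ideal J B" and u: "\<exists>u\<in>J. regular_elt B u" and \<psi>: "linear_mod (scaled z H) J \<psi>"
  interpret J: ideal J B by (rule J)
  have c: "\<psi> x \<in> carrier T" if "x \<in> J" for x using \<psi> that unfolding linear_mod_def by blast
  have a: "cong_mod (scaled z H) (\<psi> (x \<oplus>\<^bsub>B\<^esub> y)) (\<psi> x \<oplus>\<^bsub>T\<^esub> \<psi> y)" if "x \<in> J" "y \<in> J" for x y
    using \<psi> that unfolding linear_mod_def by blast
  have s: "cong_mod (scaled z H) (\<psi> (r \<otimes>\<^bsub>B\<^esub> x)) (\<iota> r \<otimes>\<^bsub>T\<^esub> \<psi> x)" if "r \<in> carrier B" "x \<in> J" for r x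
    using \<psi> that unfolding linear_mod_def by blast
  have zs: "z \<otimes>\<^bsub>T\<^esub> (\<iota> r \<otimes>\<^bsub>T\<^esub> x) = \<iota> r \<otimes>\<^bsub>T\<^esub> (z \<otimes>\<^bsub>T\<^esub> x)" if "r \<in> carrier B" "x \<in> carrier T" for r x
    using zc that by (simp add: T.m_lcomm)
  have "linear_mod H J (\<lambda>x. z \<otimes>\<^bsub>T\<^esub> \<psi> x)"
    unfolding linear_mod_def
  proof (intro conjI ballI)
    fix x y assume xy: "x \<in> J" "y \<in> J"
    show "cong_mod H (z \<otimes>\<^bsub>T\<^esub> \<psi> (x \<oplus>\<^bsub>B\<^esub> y)) (z \<otimes>\<^bsub>T\<^esub> \<psi> x \<oplus>\<^bsub>T\<^esub> z \<otimes>\<^bsub>T\<^esub> \<psi> y)"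
      using a[OF xy] scaled_cong_mod[OF cong_mod_closed[OF a[OF xy]]]
        T.r_distr[OF c[OF xy(1)] c[OF xy(2)] zc(1)] by simp
  next
    fix r x assume rx: "r \<in> carrier B" "x \<in> J"
    show "cong_mod H (z \<otimes>\<^bsub>T\<^esub> \<psi> (r \<otimes>\<^bsub>B\<^esub> x)) (\<iota> r \<otimes>\<^bsub>T\<^esub> (z \<otimes>\<^bsub>T\<^esub> \<psi> x))"
      using s[OF rx] scaled_cong_mod[OF cong_mod_closed[OF s[OF rx]]] zs[OF rx(1) c[OF rx(2)]] by simp
  qed (use c zc in simp)
  from assms[unfolded regular_injective_quot_iff[OF H], rule_format, OF J u this]
  obtain t where t: "t \<in> carrier T" "\<forall>x\<in>J. cong_mod H (z \<otimes>\<^bsub>T\<^esub> \<psi> x) (\<iota> x \<otimes>\<^bsub>T\<^esub> t)" by (elim bexE)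
  have s: "inv\<^bsub>T\<^esub> z \<otimes>\<^bsub>T\<^esub> t \<in> carrier T" using zc t(1) by simp
  show "\<exists>t\<in>carrier T. \<forall>x\<in>J. cong_mod (scaled z H) (\<psi> x) (\<iota> x \<otimes>\<^bsub>T\<^esub> t)"
  proof (intro bexI[OF _ s] ballI)
    fix x assume x: "x \<in> J"
    note xc = J.Icarr[OF x]
    show "cong_mod (scaled z H) (\<psi> x) (\<iota> x \<otimes>\<^bsub>T\<^esub> (inv\<^bsub>T\<^esub> z \<otimes>\<^bsub>T\<^esub> t))"
      unfolding scaled_cong_mod[OF c[OF x] T.m_closed[OF iota.hom_closed[OF xc] s]] zs[OF xc s] z_inv(1)[OF t(1)]
      using t(2) x by blast
  qed
qed

lemma scaled_fractional_ideal:
  assumes "fractional_ideal B T \<iota> H"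
  shows "fractional_ideal B T \<iota> (scaled z H)"
proof -
  obtain y where y: "regular_elt B y" "\<And>h. h \<in> H \<Longrightarrow> \<iota> y \<otimes>\<^bsub>T\<^esub> h \<in> \<iota> ` carrier B"
    using assms unfolding fractional_ideal_def by blast
  obtain r u where ru: "r \<in> carrier B" "regular_elt B u" "inv\<^bsub>T\<^esub> z = \<iota> r \<otimes>\<^bsub>T\<^esub> inv\<^bsub>T\<^esub> (\<iota> u)" by (rule fraction[OF zc(2)])
  note c = regular_closed[OF y(1)] regular_closed[OF ru(2)] ru(1)
  note ic = iota.hom_closed[OF c(1)] iota.hom_closed[OF c(2)] iota.hom_closed[OF c(3)]
  have "\<iota> (y \<otimes>\<^bsub>B\<^esub> u) \<otimes>\<^bsub>T\<^esub> x \<in> \<iota> ` carrier B" if x: "x \<in> scaled z H" for x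
  proof -
    have xc: "x \<in> carrier T" "z \<otimes>\<^bsub>T\<^esub> x \<in> H" using x by (simp_all add: scaled_def)
    obtain s where s: "s \<in> carrier B" "\<iota> y \<otimes>\<^bsub>T\<^esub> (z \<otimes>\<^bsub>T\<^esub> x) = \<iota> s" using y(2)[OF xc(2)] by blast
    have "\<iota> u \<otimes>\<^bsub>T\<^esub> inv\<^bsub>T\<^esub> z = \<iota> r"
      unfolding ru(3) using T.m_comm[OF ic(3) T.Units_inv_closed[OF regular_unit[OF ru(2)]]]
        inv_cancel(2)[OF ru(2) ic(3)] by simp
    moreover have "\<iota> (y \<otimes>\<^bsub>B\<^esub> u) \<otimes>\<^bsub>T\<^esub> x = (\<iota> u \<otimes>\<^bsub>T\<^esub> inv\<^bsub>T\<^esub> z) \<otimes>\<^bsub>T\<^esub> (\<iota> y \<otimes>\<^bsub>T\<^esub> (z \<otimes>\<^bsub>T\<^esub> x))"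
    proof -
      have "\<iota> (y \<otimes>\<^bsub>B\<^esub> u) \<otimes>\<^bsub>T\<^esub> x = \<iota> y \<otimes>\<^bsub>T\<^esub> \<iota> u \<otimes>\<^bsub>T\<^esub> (inv\<^bsub>T\<^esub> z \<otimes>\<^bsub>T\<^esub> (z \<otimes>\<^bsub>T\<^esub> x))"
        unfolding z_inv(2)[OF xc(1)] using c by simp
      also have "\<dots> = (\<iota> u \<otimes>\<^bsub>T\<^esub> inv\<^bsub>T\<^esub> z) \<otimes>\<^bsub>T\<^esub> (\<iota> y \<otimes>\<^bsub>T\<^esub> (z \<otimes>\<^bsub>T\<^esub> x))"
        using ic(1,2) zc xc(1) by algebra
      finally show ?thesis .
    qed
    ultimately have "\<iota> (y \<otimes>\<^bsub>B\<^esub> u) \<otimes>\<^bsub>T\<^esub> x = \<iota> (r \<otimes>\<^bsub>B\<^esub> s)" using s c by simp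
    then show ?thesis using s(1) c(3) by blast
  qed
  then show ?thesis
    unfolding fractional_ideal_def using scaled_submodule regular_elt_mult[OF B.cring_axioms y(1) ru(2)] by blast
qed

end

text \<open>The ideals \<open>J m\<close> of the elements \<open>c f(w)\<close>, where \<open>f\<close> is a polynomial over \<open>B\<close> of degree less
  than \<open>m\<close>, form an ascending chain. Once it is stationary, \<open>c w\<^sup>m\<close> is \<open>c f(w)\<close> with \<open>f\<close>
  of degree less than \<open>m\<close>, and cancelling \<open>c\<close> gives an equation of integral dependence.\<close>

lemma integral_if_common_denominator:
  assumes N: "noetherian_ring B" and w: "w \<in> carrier T" and c: "regular_elt B c"
    and pow: "\<And>k::nat. \<iota> c \<otimes>\<^bsub>T\<^esub> w [^]\<^bsub>T\<^esub> k \<in> \<iota> ` carrier B"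
  shows "w \<in> integral_closure T (\<iota> ` carrier B)"
proof -
  define span where "span m \<beta> = (\<Oplus>\<^bsub>T\<^esub>k\<in>{..<m}. \<iota> (\<beta> k) \<otimes>\<^bsub>T\<^esub> w [^]\<^bsub>T\<^esub> (k::nat))" for m :: nat and \<beta> :: "nat \<Rightarrow> 'b"
  define J where "J m = {x \<in> carrier B. \<exists>\<beta>\<in>UNIV \<rightarrow> carrier B. \<iota> x = \<iota> c \<otimes>\<^bsub>T\<^esub> span m \<beta>}" for m
  note cc = regular_closed[OF c]
  note ic = iota.hom_closed[OF cc]
  have wk: "w [^]\<^bsub>T\<^esub> k \<in> carrier T" for k :: nat using w by simp
  have tc: "(\<lambda>k. \<iota> (\<beta> k) \<otimes>\<^bsub>T\<^esub> w [^]\<^bsub>T\<^esub> (k::nat)) \<in> A \<rightarrow> carrier T" if "\<beta> \<in> UNIV \<rightarrow> carrier B" for \<beta> A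
    using that wk by auto
  have sc: "span m \<beta> \<in> carrier T" if "\<beta> \<in> UNIV \<rightarrow> carrier B" for m \<beta>
    unfolding span_def by (rule T.finsum_closed[OF tc[OF that]])
  have sa: "span m (\<lambda>k. \<beta> k \<oplus>\<^bsub>B\<^esub> \<gamma> k) = span m \<beta> \<oplus>\<^bsub>T\<^esub> span m \<gamma>"
    if "\<beta> \<in> UNIV \<rightarrow> carrier B" "\<gamma> \<in> UNIV \<rightarrow> carrier B" for m \<beta> \<gamma>
  proof -
    have "span m \<beta> \<oplus>\<^bsub>T\<^esub> span m \<gamma> = (\<Oplus>\<^bsub>T\<^esub>k\<in>{..<m}. \<iota> (\<beta> k) \<otimes>\<^bsub>T\<^esub> w [^]\<^bsub>T\<^esub> k \<oplus>\<^bsub>T\<^esub> \<iota> (\<gamma> k) \<otimes>\<^bsub>T\<^esub> w [^]\<^bsub>T\<^esub> k)"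
      unfolding span_def by (rule T.finsum_addf[symmetric, OF tc[OF that(1)] tc[OF that(2)]])
    also have "\<dots> = span m (\<lambda>k. \<beta> k \<oplus>\<^bsub>B\<^esub> \<gamma> k)"
      unfolding span_def
    proof (rule T.finsum_cong', rule refl)
      show "(\<lambda>k. \<iota> (\<beta> k \<oplus>\<^bsub>B\<^esub> \<gamma> k) \<otimes>\<^bsub>T\<^esub> w [^]\<^bsub>T\<^esub> k) \<in> {..<m} \<rightarrow> carrier T"
        by (rule tc) (use that in auto)
      fix k
      have "\<beta> k \<in> carrier B" "\<gamma> k \<in> carrier B" using that by auto
      then show "\<iota> (\<beta> k) \<otimes>\<^bsub>T\<^esub> w [^]\<^bsub>T\<^esub> k \<oplus>\<^bsub>T\<^esub> \<iota> (\<gamma> k) \<otimes>\<^bsub>T\<^esub> w [^]\<^bsub>T\<^esub> k = \<iota> (\<beta> k \<oplus>\<^bsub>B\<^esub> \<gamma> k) \<otimes>\<^bsub>T\<^esub> w [^]\<^bsub>T\<^esub> k"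
        using wk by (simp add: T.l_distr)
    qed
    finally show ?thesis ..
  qed
  have ss: "span m (\<lambda>k. r \<otimes>\<^bsub>B\<^esub> \<beta> k) = \<iota> r \<otimes>\<^bsub>T\<^esub> span m \<beta>"
    if "r \<in> carrier B" "\<beta> \<in> UNIV \<rightarrow> carrier B" for m r \<beta>
  proof -
    have "\<iota> r \<otimes>\<^bsub>T\<^esub> span m \<beta> = (\<Oplus>\<^bsub>T\<^esub>k\<in>{..<m}. \<iota> r \<otimes>\<^bsub>T\<^esub> (\<iota> (\<beta> k) \<otimes>\<^bsub>T\<^esub> w [^]\<^bsub>T\<^esub> k))"
      unfolding span_def by (rule T.finsum_rdistr[OF _ iota.hom_closed[OF that(1)] tc[OF that(2)]]) simp
    also have "\<dots> = span m (\<lambda>k. r \<otimes>\<^bsub>B\<^esub> \<beta> k)"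
      unfolding span_def
    proof (rule T.finsum_cong', rule refl)
      show "(\<lambda>k. \<iota> (r \<otimes>\<^bsub>B\<^esub> \<beta> k) \<otimes>\<^bsub>T\<^esub> w [^]\<^bsub>T\<^esub> k) \<in> {..<m} \<rightarrow> carrier T"
        by (rule tc) (use that in auto)
      fix k
      have "\<beta> k \<in> carrier B" using that by auto
      then show "\<iota> r \<otimes>\<^bsub>T\<^esub> (\<iota> (\<beta> k) \<otimes>\<^bsub>T\<^esub> w [^]\<^bsub>T\<^esub> k) = \<iota> (r \<otimes>\<^bsub>B\<^esub> \<beta> k) \<otimes>\<^bsub>T\<^esub> w [^]\<^bsub>T\<^esub> k"
        using wk that(1) by (simp add: T.m_assoc)
    qed
    finally show ?thesis ..
  qed
  have sS: "span (Suc m) \<beta> = \<iota> (\<beta> m) \<otimes>\<^bsub>T\<^esub> w [^]\<^bsub>T\<^esub> m \<oplus>\<^bsub>T\<^esub> span m \<beta>" if "\<beta> \<in> UNIV \<rightarrow> carrier B" for m \<beta>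
  proof -
    have "\<beta> m \<in> carrier B" using that by blast
    then show ?thesis unfolding span_def lessThan_Suc using T.finsum_insert[OF _ _ tc[OF that], of "{..<m}" m] wk by simp
  qed
  have cgr: "span m \<beta> = span m \<gamma>" if "\<And>k. k < m \<Longrightarrow> \<beta> k = \<gamma> k" "\<gamma> \<in> UNIV \<rightarrow> carrier B" for m \<beta> \<gamma>
    unfolding span_def by (rule T.finsum_cong'[OF refl tc[OF that(2)]]) (use that(1) in simp)
  have ideal: "ideal (J m) B" for m
  proof -
    interpret SB: module B "scalar_module id B" by (rule self_module[OF B.cring_axioms])
    have s0: "span m (\<lambda>k. \<zero>\<^bsub>B\<^esub>) = \<zero>\<^bsub>T\<^esub>" unfolding span_def using wk by simp
    show ?thesis
      unfolding submodule_iff_ideal[OF B.cring_axioms, symmetric]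
    proof (rule SB.submoduleI_linear)
      show "\<zero>\<^bsub>scalar_module id B\<^esub> \<in> J m" unfolding J_def using s0 ic by (auto intro!: bexI[of _ "\<lambda>k. \<zero>\<^bsub>B\<^esub>"])
      fix x y assume "x \<in> J m" "y \<in> J m"
      then obtain \<beta> \<gamma> where k: "x \<in> carrier B" "y \<in> carrier B" "\<beta> \<in> UNIV \<rightarrow> carrier B" "\<gamma> \<in> UNIV \<rightarrow> carrier B"
        "\<iota> x = \<iota> c \<otimes>\<^bsub>T\<^esub> span m \<beta>" "\<iota> y = \<iota> c \<otimes>\<^bsub>T\<^esub> span m \<gamma>" unfolding J_def by blast
      have "\<iota> (x \<oplus>\<^bsub>B\<^esub> y) = \<iota> c \<otimes>\<^bsub>T\<^esub> span m (\<lambda>k. \<beta> k \<oplus>\<^bsub>B\<^esub> \<gamma> k)"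
        unfolding sa[OF k(3,4)] using k(1,2,5,6) sc[OF k(3)] sc[OF k(4)] ic by (simp add: T.r_distr)
      moreover have "(\<lambda>k. \<beta> k \<oplus>\<^bsub>B\<^esub> \<gamma> k) \<in> UNIV \<rightarrow> carrier B" using k(3,4) by auto
      ultimately show "x \<oplus>\<^bsub>scalar_module id B\<^esub> y \<in> J m" unfolding J_def using k(1,2) by auto
    next
      fix r x assume r: "r \<in> carrier B" and "x \<in> J m"
      then obtain \<beta> where k: "x \<in> carrier B" "\<beta> \<in> UNIV \<rightarrow> carrier B" "\<iota> x = \<iota> c \<otimes>\<^bsub>T\<^esub> span m \<beta>" unfolding J_def by blast
      have "\<iota> (r \<otimes>\<^bsub>B\<^esub> x) = \<iota> c \<otimes>\<^bsub>T\<^esub> span m (\<lambda>k. r \<otimes>\<^bsub>B\<^esub> \<beta> k)"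
        unfolding ss[OF r k(2)] using r k(1,3) sc[OF k(2)] ic by (simp add: T.m_lcomm)
      moreover have "(\<lambda>k. r \<otimes>\<^bsub>B\<^esub> \<beta> k) \<in> UNIV \<rightarrow> carrier B" using k(2) r by auto
      ultimately show "r \<odot>\<^bsub>scalar_module id B\<^esub> x \<in> J m" unfolding J_def using k(1) r by auto
    qed (auto simp: J_def)
  qed
  have "range J \<noteq> {}" by simp
  then obtain M where M: "M \<in> range J" "\<And>K. K \<in> range J \<Longrightarrow> M \<subseteq> K \<Longrightarrow> K = M"
    by (rule noetherian_maximal_element[OF N]) (use ideal in blast)+
  obtain m where m: "M = J m" using M(1) by blast
  have "J m \<subseteq> J (Suc m)"
  proof
    fix x assume "x \<in> J m"
    then obtain \<beta> where k: "x \<in> carrier B" "\<beta> \<in> UNIV \<rightarrow> carrier B" "\<iota> x = \<iota> c \<otimes>\<^bsub>T\<^esub> span m \<beta>" unfolding J_def by blast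
    let ?g = "\<lambda>k. if k = m then \<zero>\<^bsub>B\<^esub> else \<beta> k"
    have g: "?g \<in> UNIV \<rightarrow> carrier B" using k(2) by auto
    have gs: "span (Suc m) ?g = span m \<beta>"
      unfolding sS[OF g] using cgr[of m ?g \<beta>] k(2) sc[OF k(2)] wk by simp
    show "x \<in> J (Suc m)"
      unfolding J_def by (intro CollectI conjI k(1) bexI[OF _ g]) (simp only: gs k(3))
  qed
  then have Jm: "J (Suc m) = J m" using M(2)[of "J (Suc m)"] m by simp
  obtain x where x: "x \<in> carrier B" "\<iota> c \<otimes>\<^bsub>T\<^esub> w [^]\<^bsub>T\<^esub> m = \<iota> x" using pow[of m] by blast
  let ?e = "\<lambda>k. if k = m then \<one>\<^bsub>B\<^esub> else \<zero>\<^bsub>B\<^esub>"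
  have e: "?e \<in> UNIV \<rightarrow> carrier B" by auto
  have "span m ?e = \<zero>\<^bsub>T\<^esub>"
    using cgr[of m ?e "\<lambda>k. \<zero>\<^bsub>B\<^esub>"] wk by (simp add: span_def)
  then have "span (Suc m) ?e = w [^]\<^bsub>T\<^esub> m" unfolding sS[OF e] using wk by simp
  then have "x \<in> J (Suc m)" unfolding J_def using x e by (auto intro!: bexI[of _ ?e])
  then obtain \<beta> where \<beta>: "\<beta> \<in> UNIV \<rightarrow> carrier B" "\<iota> x = \<iota> c \<otimes>\<^bsub>T\<^esub> span m \<beta>" unfolding Jm by (auto simp: J_def)
  have eq: "w [^]\<^bsub>T\<^esub> m = span m \<beta>"
    by (rule regular_cancel[OF c wk sc[OF \<beta>(1)]]) (simp add: x(2) \<beta>(2))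
  let ?d = "\<lambda>k. \<ominus>\<^bsub>B\<^esub> \<one>\<^bsub>B\<^esub> \<otimes>\<^bsub>B\<^esub> \<beta> k"
  have d: "?d \<in> UNIV \<rightarrow> carrier B" using \<beta>(1) by auto
  have "w [^]\<^bsub>T\<^esub> m \<oplus>\<^bsub>T\<^esub> span m ?d = \<zero>\<^bsub>T\<^esub>"
    unfolding ss[OF B.a_inv_closed[OF B.one_closed] \<beta>(1)] eq[symmetric] using wk by (simp add: T.l_minus T.r_neg)
  then show ?thesis
    unfolding integral_closure_def span_def using w d
    by (intro CollectI conjI exI[of _ m] bexI[of _ "\<lambda>k. \<iota> (?d k)"]) auto
qed

end

text \<open>Here \<open>G\<close> is the power \<open>H\<^sup>n\<close> with \<open>x H\<^sup>n = H\<^sup>n\<^sup>+\<^sup>1\<close>. It is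
  multiplied into itself by the fractions \<open>h/x\<close> with \<open>h \<in> H\<close>.\<close>

lemma principal_reduction:
  assumes "cring R" "x \<in> carrier R" "reduction R (PIdl\<^bsub>R\<^esub> x) H"
  obtains G where "ideal G R" "\<And>h g. h \<in> H \<Longrightarrow> g \<in> G \<Longrightarrow> \<exists>g'\<in>G. h \<otimes>\<^bsub>R\<^esub> g = x \<otimes>\<^bsub>R\<^esub> g'"
    "\<And>y. y \<in> H \<Longrightarrow> \<exists>n::nat. y [^]\<^bsub>R\<^esub> n \<in> G"
proof -
  interpret R: cring R by fact
  obtain n :: nat where H: "ideal H R"
    and n: "(PIdl\<^bsub>R\<^esub> x) \<cdot>\<^bsub>R\<^esub> (H [^]\<^bsub>ideals_set R\<^esub> n) = H [^]\<^bsub>ideals_set R\<^esub> Suc n"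
    using assms(3) unfolding reduction_def by blast
  interpret IS: comm_monoid "ideals_set R" by (rule R.ideals_set_is_comm_monoid)
  have Hin: "H \<in> carrier (ideals_set R)" using H by (simp add: ideals_set_def)
  have pi: "ideal (H [^]\<^bsub>ideals_set R\<^esub> (k::nat)) R" for k
    using IS.nat_pow_closed[OF Hin, of k] by (simp add: ideals_set_def)
  let ?G = "H [^]\<^bsub>ideals_set R\<^esub> n"
  interpret G: ideal ?G R by (rule pi)
  interpret H: ideal H R by (rule H)
  have Suc: "H [^]\<^bsub>ideals_set R\<^esub> Suc k = (H [^]\<^bsub>ideals_set R\<^esub> k) \<cdot>\<^bsub>R\<^esub> H" for k :: nat
    by (simp add: ideals_set_def)
  have el: "\<exists>g'\<in>?G. s = x \<otimes>\<^bsub>R\<^esub> g'" if "s \<in> (PIdl\<^bsub>R\<^esub> x) \<cdot>\<^bsub>R\<^esub> ?G" for s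
    using that
  proof (induction rule: ideal_prod.induct)
    case (prod i j)
    obtain r where r: "r \<in> carrier R" "i = r \<otimes>\<^bsub>R\<^esub> x" using prod(1) by (auto simp: cgenideal_def)
    have "i \<otimes>\<^bsub>R\<^esub> j = x \<otimes>\<^bsub>R\<^esub> (r \<otimes>\<^bsub>R\<^esub> j)" unfolding r(2) using r(1) assms(2) G.Icarr[OF prod(2)] by (simp add: R.m_ac)
    then show ?case using G.I_l_closed[OF prod(2) r(1)] by blast
  next
    case (sum s1 s2)
    then obtain g1 g2 where g: "g1 \<in> ?G" "s1 = x \<otimes>\<^bsub>R\<^esub> g1" "g2 \<in> ?G" "s2 = x \<otimes>\<^bsub>R\<^esub> g2" by blast
    then have "s1 \<oplus>\<^bsub>R\<^esub> s2 = x \<otimes>\<^bsub>R\<^esub> (g1 \<oplus>\<^bsub>R\<^esub> g2)" using assms(2) G.Icarr by (simp add: R.r_distr)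
    then show ?case using G.a_closed[OF g(1,3)] by blast
  qed
  have "\<exists>g'\<in>?G. h \<otimes>\<^bsub>R\<^esub> g = x \<otimes>\<^bsub>R\<^esub> g'" if "h \<in> H" "g \<in> ?G" for h g
  proof (rule el)
    have "g \<otimes>\<^bsub>R\<^esub> h \<in> ?G \<cdot>\<^bsub>R\<^esub> H" by (rule ideal_prod.prod[OF that(2,1)])
    then show "h \<otimes>\<^bsub>R\<^esub> g \<in> (PIdl\<^bsub>R\<^esub> x) \<cdot>\<^bsub>R\<^esub> ?G"
      unfolding n Suc using R.m_comm[OF H.Icarr[OF that(1)] G.Icarr[OF that(2)]] by simp
  qed
  moreover have "y [^]\<^bsub>R\<^esub> k \<in> H [^]\<^bsub>ideals_set R\<^esub> k" if y: "y \<in> H" for y and k :: nat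
  proof (induction k)
    case 0
    then show ?case by (simp add: ideals_set_def)
  next
    case (Suc k)
    then show ?case unfolding \<open>\<And>k. H [^]\<^bsub>ideals_set R\<^esub> Suc k = (H [^]\<^bsub>ideals_set R\<^esub> k) \<cdot>\<^bsub>R\<^esub> H\<close> R.nat_pow_Suc
      using y by (rule ideal_prod.prod)
  qed
  ultimately show ?thesis using that[OF pi] by blast
qed

context rees_fractions
begin

lemma rfrac_con:
  assumes "r \<in> carrier R" "p \<in> carrier Q" "q \<in> carrier Q"
  shows "\<iota> (elt r \<zero>) \<otimes>\<^bsub>T\<^esub> rfrac p q = rfrac (r \<otimes>\<^bsub>Q\<^esub> p) (r \<otimes>\<^bsub>Q\<^esub> q)"
  unfolding rfrac_def con_def[symmetric] \<kappa>_con[OF assms(1), symmetric]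
  using assms RQ_closed[OF assms(1)] \<tau>_closed by (simp add: AT.T.r_distr AT.T.m_assoc)

lemma canon_fractional_ideal:
  assumes "fractional_ideal R Q id W"
  shows "fractional_ideal A T \<iota> (canon W)"
proof -
  have W: "submodule W R Q.TM" using assms by (simp add: fractional_ideal_def)
  obtain y where y: "regular_elt R y" "\<And>h. h \<in> W \<Longrightarrow> y \<otimes>\<^bsub>Q\<^esub> h \<in> carrier R"
    using assms unfolding fractional_ideal_def by auto
  note yc = Q.regular_closed[OF y(1)]
  note q = RQ_closed[OF yc] RQ_closed[OF vc]
  have reg: "regular_elt A (elt (y \<otimes> v) \<zero>)"
    by (rule regular_const[OF regular_elt_mult[OF R.cring_axioms y(1) v(2)]])
  have yv: "y \<otimes> v = y \<otimes>\<^bsub>Q\<^esub> v" using RQ(1)[OF yc vc] by simp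
  have "\<iota> (elt (y \<otimes> v) \<zero>) \<otimes>\<^bsub>T\<^esub> w \<in> \<iota> ` carrier A" if wW: "w \<in> canon W" for w
  proof -
    obtain p q where c: "p \<in> carrier Q" "q \<in> carrier Q" "w = rfrac p q"
      by (rule rfrac_cases[OF subsetD[OF canon_carrier[OF W] wW]])
    have pq: "v \<otimes>\<^bsub>Q\<^esub> p \<in> W" "q \<in> W" using wW v(1) unfolding c(3) rfrac_canon_iff[OF W c(1,2)] by blast+
    have 1: "(y \<otimes>\<^bsub>Q\<^esub> v) \<otimes>\<^bsub>Q\<^esub> p \<in> carrier R" using y(2)[OF pq(1)] q c(1) by (simp add: Q.T.m_assoc)
    have "(y \<otimes>\<^bsub>Q\<^esub> v) \<otimes>\<^bsub>Q\<^esub> q = v \<otimes>\<^bsub>Q\<^esub> (y \<otimes>\<^bsub>Q\<^esub> q)" using q c(2) by (simp add: Q.T.m_ac)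
    also have "\<dots> = v \<otimes> (y \<otimes>\<^bsub>Q\<^esub> q)" by (rule RQ(1)[OF vc y(2)[OF pq(2)]])
    finally have 2: "(y \<otimes>\<^bsub>Q\<^esub> v) \<otimes>\<^bsub>Q\<^esub> q \<in> I" using I.I_r_closed[OF v(1) y(2)[OF pq(2)]] by simp
    note pq' = 1[folded yv] 2[folded yv]
    show ?thesis
      unfolding c(3) rfrac_con[OF R.m_closed[OF yc vc] c(1,2)] \<iota>_rfrac[OF pq', symmetric]
      by (rule imageI[OF elt_closed[OF pq']])
  qed
  then show ?thesis unfolding fractional_ideal_def using canon_submodule[OF W] reg by blast
qed

text \<open>The elements of \<open>canon W\<close> map the set \<open>G + Gt\<close> to itself, as \<open>W\<close> and \<open>(W : I)\<close> map \<open>G\<close> to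
  itself. Applied to \<open>y\<close>, this shows that \<open>vy\<close> is a common denominator of all powers of an
  element of \<open>canon W\<close>.\<close>

lemma canon_integral:
  assumes W: "submodule W R Q.TM" and G: "ideal G R" and y: "y \<in> G" "regular_elt R y"
    and stable: "\<And>h g. h \<in> W \<union> colon Q W I \<Longrightarrow> g \<in> G \<Longrightarrow> h \<otimes>\<^bsub>Q\<^esub> g \<in> G"
  shows "canon W \<subseteq> integral_closure T (\<iota> ` carrier A)"
proof
  fix w assume w: "w \<in> canon W"
  interpret G: ideal G R by (rule G)
  have GQ: "g \<in> carrier Q" if "g \<in> G" for g using RQ_closed[OF G.Icarr[OF that]] .
  have Gadd: "g \<oplus>\<^bsub>Q\<^esub> h \<in> G" if "g \<in> G" "h \<in> G" for g h
    unfolding RQ(2)[OF G.Icarr[OF that(1)] G.Icarr[OF that(2)]] by (rule G.a_closed[OF that])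
  have Gminus: "g \<ominus>\<^bsub>Q\<^esub> h \<in> G" if "g \<in> G" "h \<in> G" for g h
    unfolding Q.T.minus_eq RQ(5)[OF G.Icarr[OF that(2)]] by (rule Gadd[OF that(1) G.a_inv_closed[OF that(2)]])
  have Gsm: "r \<otimes>\<^bsub>Q\<^esub> g \<in> G" if "r \<in> carrier R" "g \<in> G" for r g
    unfolding RQ(1)[OF that(1) G.Icarr[OF that(2)]] by (rule G.I_l_closed[OF that(2,1)])
  note wc = subsetD[OF canon_carrier[OF W] w]
  obtain p q where c: "p \<in> carrier Q" "q \<in> carrier Q" "w = rfrac p q" by (rule rfrac_cases[OF wc])
  have ipq: "\<And>i. i \<in> I \<Longrightarrow> i \<otimes>\<^bsub>Q\<^esub> p \<in> W" "q \<in> W"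
    using w unfolding c(3) rfrac_canon_iff[OF W c(1,2)] by blast+
  have pi: "p \<otimes>\<^bsub>Q\<^esub> i \<in> W" if i: "i \<in> I" for i
    unfolding Q.T.m_comm[OF c(1) RQ_closed[OF I.Icarr[OF i]]] by (rule ipq(1)[OF i])
  have "p \<in> colon Q W I" unfolding colon_def by (intro CollectI conjI c(1) ballI pi)
  note pq = this ipq(2)
  define M where "M = {rfrac g h | g h. g \<in> G \<and> h \<in> G}"
  have MI: "rfrac g h \<in> M" if "g \<in> G" "h \<in> G" for g h unfolding M_def using that by blast
  have step: "w \<otimes>\<^bsub>T\<^esub> x \<in> M" if xM: "x \<in> M" for x
  proof -
    obtain g h where gh: "g \<in> G" "h \<in> G" "x = rfrac g h" using xM unfolding M_def by (elim CollectE exE conjE)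
    have pg: "p \<otimes>\<^bsub>Q\<^esub> g \<in> G" "p \<otimes>\<^bsub>Q\<^esub> h \<in> G" "q \<otimes>\<^bsub>Q\<^esub> g \<in> G" "q \<otimes>\<^bsub>Q\<^esub> h \<in> G"
      by (rule stable[OF UnI2[OF pq(1)] gh(1)] stable[OF UnI2[OF pq(1)] gh(2)]
        stable[OF UnI1[OF pq(2)] gh(1)] stable[OF UnI1[OF pq(2)] gh(2)])+
    have a: "b \<otimes>\<^bsub>Q\<^esub> q \<otimes>\<^bsub>Q\<^esub> h = b \<otimes>\<^bsub>Q\<^esub> (q \<otimes>\<^bsub>Q\<^esub> h)" "a \<otimes>\<^bsub>Q\<^esub> q \<otimes>\<^bsub>Q\<^esub> h = a \<otimes>\<^bsub>Q\<^esub> (q \<otimes>\<^bsub>Q\<^esub> h)"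
      using c(2) GQ[OF gh(2)] RQ_closed[OF ab(1)] RQ_closed[OF ab(2)] by (simp_all add: Q.T.m_assoc)
    have 1: "p \<otimes>\<^bsub>Q\<^esub> g \<ominus>\<^bsub>Q\<^esub> b \<otimes>\<^bsub>Q\<^esub> q \<otimes>\<^bsub>Q\<^esub> h \<in> G" unfolding a by (rule Gminus[OF pg(1) Gsm[OF ab(2) pg(4)]])
    have 2: "p \<otimes>\<^bsub>Q\<^esub> h \<oplus>\<^bsub>Q\<^esub> q \<otimes>\<^bsub>Q\<^esub> g \<ominus>\<^bsub>Q\<^esub> a \<otimes>\<^bsub>Q\<^esub> q \<otimes>\<^bsub>Q\<^esub> h \<in> G"
      unfolding a by (rule Gminus[OF Gadd[OF pg(2,3)] Gsm[OF ab(1) pg(4)]])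
    show ?thesis unfolding c(3) gh(3) rfrac_mult[OF c(1,2) GQ[OF gh(1)] GQ[OF gh(2)]] 
      by (rule MI[OF 1 2])
  qed
  note yc = G.Icarr[OF y(1)]
  have z: "\<zero> \<in> carrier Q" by (rule RQ_closed) simp
  have y0: "rfrac y \<zero> \<in> carrier T" by (rule rfrac_closed[OF RQ_closed[OF yc] z])
  have Mk: "w [^]\<^bsub>T\<^esub> k \<otimes>\<^bsub>T\<^esub> rfrac y \<zero> \<in> M" for k :: nat
  proof (induction k)
    case 0
    have "rfrac y \<zero> \<in> M" by (rule MI[OF y(1) G.zero_closed])
    then show ?case using y0 by simp
  next
    case (Suc k)
    have "w [^]\<^bsub>T\<^esub> Suc k \<otimes>\<^bsub>T\<^esub> rfrac y \<zero> = w \<otimes>\<^bsub>T\<^esub> (w [^]\<^bsub>T\<^esub> k \<otimes>\<^bsub>T\<^esub> rfrac y \<zero>)" using wc y0 by (simp add: AT.T.m_ac)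
    then show ?case using step[OF Suc.IH] by simp
  qed
  show "w \<in> integral_closure T (\<iota> ` carrier A)"
  proof (rule AT.integral_if_common_denominator[OF A_noetherian wc regular_const[OF regular_elt_mult[OF R.cring_axioms v(2) y(2)]]])
    fix k :: nat
    obtain g h where gh: "g \<in> G" "h \<in> G" "w [^]\<^bsub>T\<^esub> k \<otimes>\<^bsub>T\<^esub> rfrac y \<zero> = rfrac g h" using Mk[of k] unfolding M_def by (elim CollectE exE conjE)
    note gc = G.Icarr[OF gh(1)] G.Icarr[OF gh(2)]
    have vh: "v \<otimes> g \<in> carrier R" "v \<otimes> h \<in> I" using vc gc v(1) by (auto intro: I.I_r_closed)
    have e: "\<iota> (elt v \<zero>) \<otimes>\<^bsub>T\<^esub> rfrac y \<zero> = \<iota> (elt (v \<otimes> y) \<zero>)"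
      using con_elt[OF vc yc I.zero_closed] vc
      unfolding \<iota>_rfrac[OF yc I.zero_closed, symmetric] con_def by simp
    have "\<iota> (elt (v \<otimes> y) \<zero>) \<otimes>\<^bsub>T\<^esub> w [^]\<^bsub>T\<^esub> k = \<iota> (elt v \<zero>) \<otimes>\<^bsub>T\<^esub> (w [^]\<^bsub>T\<^esub> k \<otimes>\<^bsub>T\<^esub> rfrac y \<zero>)"
      unfolding e[symmetric] using AT.iota.hom_closed[OF elt_closed[OF vc I.zero_closed]] y0 wc by (simp add: AT.T.m_ac)
    also have "\<dots> = \<iota> (elt (v \<otimes> g) (v \<otimes> h))"
      unfolding gh(3) rfrac_con[OF vc GQ[OF gh(1)] GQ[OF gh(2)]] RQ(1)[OF vc gc(1)] RQ(1)[OF vc gc(2)] \<iota>_rfrac[OF vh] ..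
    finally show "\<iota> (elt (v \<otimes> y) \<zero>) \<otimes>\<^bsub>T\<^esub> w [^]\<^bsub>T\<^esub> k \<in> \<iota> ` carrier A" using elt_closed[OF vh] by blast
  qed
qed

end

section \<open>The canonical ideal\<close>

theorem proposition2p1:
  fixes R :: "('a, 'k) ring_scheme" and Q :: "('a, 'l) ring_scheme"
    and T :: "('t, 'n) ring_scheme" and \<iota> :: "(nat \<Rightarrow> 'a) set \<Rightarrow> 't"
    and \<mm> I \<omega> :: "'a set" and a b z :: 'a
  assumes "cm_local_ring R \<mm>"
    and "krull_dim R = 1"
    and "infinite (carrier (R Quot \<mm>))"
    and "total_fraction_ring R Q id"
    and "canonical_ideal R Q id \<omega>"
    and "carrier R \<subseteq> \<omega>"
    and "\<omega> \<subseteq> integral_closure Q (carrier R)"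
    and "m_primary R \<mm> I"
    and "frac_minimal_reduction R Q z (colon Q \<omega> I)"
    and "a \<in> carrier R"
    and "b \<in> carrier R"
    and "total_fraction_ring (rees_quotient R I a b) T \<iota>"
  shows
    \<comment> \<open>the stated module structure on \<open>K\<close> is multiplication in \<open>T\<close>\<close>
    "(\<forall>r\<in>carrier R. \<forall>i\<in>I. \<forall>x\<in>colon Q \<omega> I. \<forall>y\<in>\<omega>.
        rees_elt R I a b r i \<odot>\<^bsub>scalar_module \<iota> T\<^esub>
            rees_frac R Q I a b T \<iota> (x \<otimes>\<^bsub>Q\<^esub> inv\<^bsub>Q\<^esub> z) (y \<otimes>\<^bsub>Q\<^esub> inv\<^bsub>Q\<^esub> z) =
          rees_frac R Q I a b T \<iota>
            ((r \<otimes>\<^bsub>Q\<^esub> x) \<otimes>\<^bsub>Q\<^esub> inv\<^bsub>Q\<^esub> z \<ominus>\<^bsub>Q\<^esub> (b \<otimes>\<^bsub>Q\<^esub> i \<otimes>\<^bsub>Q\<^esub> y) \<otimes>\<^bsub>Q\<^esub> inv\<^bsub>Q\<^esub> z)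
            ((r \<otimes>\<^bsub>Q\<^esub> y) \<otimes>\<^bsub>Q\<^esub> inv\<^bsub>Q\<^esub> z \<oplus>\<^bsub>Q\<^esub> (i \<otimes>\<^bsub>Q\<^esub> x) \<otimes>\<^bsub>Q\<^esub> inv\<^bsub>Q\<^esub> z
              \<ominus>\<^bsub>Q\<^esub> (a \<otimes>\<^bsub>Q\<^esub> i \<otimes>\<^bsub>Q\<^esub> y) \<otimes>\<^bsub>Q\<^esub> inv\<^bsub>Q\<^esub> z))
     \<and> canonical_ideal (rees_quotient R I a b) T \<iota> (rees_canonical R Q I a b T \<iota> \<omega> z)
     \<and> \<iota> ` carrier (rees_quotient R I a b) \<subseteq> rees_canonical R Q I a b T \<iota> \<omega> z
     \<and> rees_canonical R Q I a b T \<iota> \<omega> z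
         \<subseteq> integral_closure T (\<iota> ` carrier (rees_quotient R I a b))"
proof -
  have N: "noetherian_ring R" and loc: "local_ring R \<mm>" using assms(1) by (simp_all add: cm_local_ring_def)
  note cr = local_ringD(1)[OF loc]
  interpret R: cring R by (rule cr)
  interpret mm: maximalideal \<mm> R by (rule local_ringD(2)[OF loc])
  obtain u where u: "u \<in> \<mm>" "regular_elt R u" by (rule cm_local_ring_regular_elt[OF assms(1,2)])
  have I: "ideal I R" and Im: "{x \<in> carrier R. \<exists>n::nat. x [^]\<^bsub>R\<^esub> n \<in> I} = \<mm>"
    using assms(8) by (simp_all add: m_primary_def)
  interpret I: ideal I R by (rule I)
  have "I \<subseteq> \<mm>"
  proof
    fix x assume x: "x \<in> I"
    have "x [^]\<^bsub>R\<^esub> (1::nat) \<in> I" using R.nat_pow_eone[OF I.Icarr[OF x]] x by simp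
    then show "x \<in> \<mm>" unfolding Im[symmetric] using I.Icarr[OF x] by blast
  qed
  \<comment> \<open>Some power of a regular element of the maximal ideal lies in the primary ideal \<open>I\<close>.\<close>
  obtain n :: nat where n: "u [^]\<^bsub>R\<^esub> n \<in> I" using u(1) unfolding Im[symmetric] by blast
  have regv: "regular_elt R (u [^]\<^bsub>R\<^esub> n)" by (rule regular_elt_power[OF cr u(2)])
  interpret rees_fractions R I a b \<mm> "u [^]\<^bsub>R\<^esub> n" Q T \<iota>
    by (intro rees_fractions.intro rees_local.intro rees.intro rees_axioms.intro rees_local_axioms.intro
      fraction_ring.intro cr I assms(2,4,10-12) N loc n regv \<open>I \<subseteq> \<mm>\<close>)
  have fr\<omega>: "fractional_ideal R Q id \<omega>" using assms(5) by (simp add: canonical_ideal_def)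
  have sub\<omega>: "submodule \<omega> R Q.TM" using fr\<omega> by (simp add: fractional_ideal_def)
  note inj\<omega> = Q.canonical_ideal_imp_regular_injective_simple_socle[OF assms(1,2,5) u]
  note \<omega>D = Q.submoduleD[OF sub\<omega>]
  have \<omega>sm: "r \<otimes>\<^bsub>Q\<^esub> x \<in> \<omega>" if "r \<in> carrier R" "x \<in> \<omega>" for r x using \<omega>D(5)[OF that] by simp
  let ?H = "colon Q \<omega> I"
  have HI: "x \<in> ?H \<longleftrightarrow> x \<in> carrier Q \<and> (\<forall>i\<in>I. i \<otimes>\<^bsub>Q\<^esub> x \<in> \<omega>)" for x
    unfolding colon_def mem_Collect_eq using Q.T.m_comm[OF _ RQ_closed[OF I.Icarr]] by (metis (no_types, lifting))
  have Hc: "x \<in> carrier Q" if "x \<in> ?H" for x using that unfolding HI by blast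
  have \<omega>H: "\<omega> \<subseteq> ?H" unfolding subset_iff HI using \<omega>sm[OF I.Icarr] \<omega>D(1) by blast
  have oneH: "\<one>\<^bsub>Q\<^esub> \<in> ?H" using \<omega>H assms(6) R.one_closed RQ(4) by auto
  obtain y x where fy: "regular_elt R y" "(\<lambda>h. y \<otimes>\<^bsub>Q\<^esub> h) ` ?H \<subseteq> carrier R" "x \<in> carrier R"
      "minimal_reduction R (PIdl\<^bsub>R\<^esub> x) ((\<lambda>h. y \<otimes>\<^bsub>Q\<^esub> h) ` ?H)"
      "(\<lambda>r. z \<otimes>\<^bsub>Q\<^esub> r) ` carrier R = (\<lambda>r. (x \<otimes>\<^bsub>Q\<^esub> inv\<^bsub>Q\<^esub> y) \<otimes>\<^bsub>Q\<^esub> r) ` carrier R"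
    and frH: "fractional_ideal R Q id ?H" and zc: "z \<in> carrier Q"
    using assms(9) unfolding frac_minimal_reduction_def by (elim conjE exE)
  let ?yH = "(\<lambda>h. y \<otimes>\<^bsub>Q\<^esub> h) ` ?H"
  have red: "reduction R (PIdl\<^bsub>R\<^esub> x) ?yH" using fy(4) by (simp add: minimal_reduction_def)
  have HD: "r \<otimes>\<^bsub>Q\<^esub> h \<in> ?H" if "r \<in> carrier R" "h \<in> ?H" for r h
    using Q.submoduleD(5)[of ?H r h] frH that by (simp add: fractional_ideal_def)
  obtain G where G: "ideal G R" "\<And>h g. h \<in> ?yH \<Longrightarrow> g \<in> G \<Longrightarrow> \<exists>g'\<in>G. h \<otimes>\<^bsub>R\<^esub> g = x \<otimes>\<^bsub>R\<^esub> g'"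
    "\<And>y. y \<in> ?yH \<Longrightarrow> \<exists>n::nat. y [^]\<^bsub>R\<^esub> n \<in> G" using principal_reduction[OF cr fy(3) red] by metis
  interpret G: ideal G R by (rule G(1))
  note yc = Q.regular_closed[OF fy(1)]
  note yQ = RQ_closed[OF yc] and xQ = RQ_closed[OF fy(3)]
  have yU: "y \<in> Units Q" using Q.regular_unit[OF fy(1)] by simp
  have xH: "x \<in> ?yH"
    using red R.cgenideal_self[OF fy(3)] unfolding reduction_def by blast
  then obtain h0 where h0: "h0 \<in> ?H" "x = y \<otimes>\<^bsub>Q\<^esub> h0" by blast
  note h0c = Hc[OF h0(1)]
  have xy: "x \<otimes>\<^bsub>Q\<^esub> inv\<^bsub>Q\<^esub> y = h0"
    using yU yQ h0c unfolding h0(2) by (simp add: Q.T.m_assoc Q.T.m_comm[of h0] Q.T.m_assoc[symmetric])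
  \<comment> \<open>Both \<open>z\<close> and \<open>x/y\<close> generate the same cyclic submodule of \<open>Q\<close>.\<close>
  have "z \<otimes>\<^bsub>Q\<^esub> \<one>\<^bsub>R\<^esub> \<in> (\<lambda>r. h0 \<otimes>\<^bsub>Q\<^esub> r) ` carrier R" using fy(5) R.one_closed unfolding xy by blast
  then obtain r0 where r0: "r0 \<in> carrier R" "z \<otimes>\<^bsub>Q\<^esub> \<one>\<^bsub>R\<^esub> = h0 \<otimes>\<^bsub>Q\<^esub> r0" by blast
  have "h0 \<otimes>\<^bsub>Q\<^esub> \<one>\<^bsub>R\<^esub> \<in> (\<lambda>r. z \<otimes>\<^bsub>Q\<^esub> r) ` carrier R" using fy(5) R.one_closed unfolding xy by blast
  then obtain s0 where s0: "s0 \<in> carrier R" "h0 \<otimes>\<^bsub>Q\<^esub> \<one>\<^bsub>R\<^esub> = z \<otimes>\<^bsub>Q\<^esub> s0" by blast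
  have r1: "q \<otimes>\<^bsub>Q\<^esub> \<one>\<^bsub>R\<^esub> = q" if "q \<in> carrier Q" for q using Q.T.r_one[OF that] RQ(4) by simp
  have zh: "z = r0 \<otimes>\<^bsub>Q\<^esub> h0" using r0 r1[OF zc] Q.T.m_comm[OF h0c RQ_closed[OF r0(1)]] by simp
  have hz: "h0 = z \<otimes>\<^bsub>Q\<^esub> s0" using s0(2) r1[OF h0c] by simp
  have zH: "z \<in> ?H" unfolding zh by (rule HD[OF r0(1) h0(1)])
  have "y \<otimes>\<^bsub>Q\<^esub> \<one>\<^bsub>Q\<^esub> \<in> ?yH" using oneH by blast
  then have yH: "y \<in> ?yH" using yQ by simp
  obtain k :: nat where k: "y [^]\<^bsub>R\<^esub> k \<in> G" using G(3)[OF yH] by blast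
  obtain g where g: "g \<in> G" "y \<otimes>\<^bsub>R\<^esub> y [^]\<^bsub>R\<^esub> k = x \<otimes>\<^bsub>R\<^esub> g" using G(2)[OF yH k] by blast
  note regyk = regular_elt_power[OF cr fy(1), of k]
  have regxg: "regular_elt R (x \<otimes>\<^bsub>R\<^esub> g)" unfolding g(2)[symmetric] by (rule regular_elt_mult[OF cr fy(1) regyk])
  \<comment> \<open>A power of the regular element \<open>y\<close> is a multiple of \<open>x\<close>.\<close>
  have regx: "regular_elt R x"
    unfolding regular_elt_def
  proof (intro conjI ballI impI fy(3))
    fix t assume t: "t \<in> carrier R" "x \<otimes>\<^bsub>R\<^esub> t = \<zero>\<^bsub>R\<^esub>"
    note gc = G.Icarr[OF g(1)]
    have "(x \<otimes>\<^bsub>R\<^esub> g) \<otimes>\<^bsub>R\<^esub> t = g \<otimes>\<^bsub>R\<^esub> (x \<otimes>\<^bsub>R\<^esub> t)" using fy(3) t(1) gc by (simp add: R.m_ac)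
    then have "(x \<otimes>\<^bsub>R\<^esub> g) \<otimes>\<^bsub>R\<^esub> t = \<zero>\<^bsub>R\<^esub>" unfolding t(2) using gc by simp
    then show "t = \<zero>\<^bsub>R\<^esub>" using regxg t(1) unfolding regular_elt_def by blast
  qed
  have xU: "x \<in> Units Q" using Q.regular_unit[OF regx] by simp
  note s0Q = RQ_closed[OF s0(1)]
  have yz: "y \<otimes>\<^bsub>Q\<^esub> z \<in> carrier Q" using yQ zc by simp
  have x_yz: "x = (y \<otimes>\<^bsub>Q\<^esub> z) \<otimes>\<^bsub>Q\<^esub> s0" unfolding h0(2) hz using yQ zc s0Q by (simp add: Q.T.m_assoc)
  have "z \<otimes>\<^bsub>Q\<^esub> (y \<otimes>\<^bsub>Q\<^esub> s0 \<otimes>\<^bsub>Q\<^esub> inv\<^bsub>Q\<^esub> x) = x \<otimes>\<^bsub>Q\<^esub> inv\<^bsub>Q\<^esub> x"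
  proof -
    have "z \<otimes>\<^bsub>Q\<^esub> (y \<otimes>\<^bsub>Q\<^esub> s0 \<otimes>\<^bsub>Q\<^esub> t) = ((y \<otimes>\<^bsub>Q\<^esub> z) \<otimes>\<^bsub>Q\<^esub> s0) \<otimes>\<^bsub>Q\<^esub> t" if "t \<in> carrier Q" for t
      using that zc yQ s0Q by algebra
    from this[OF Q.T.Units_inv_closed[OF xU]] show ?thesis unfolding x_yz[symmetric] .
  qed
  then have zU: "z \<in> Units Q"
    using zc yQ s0Q xU by (intro Q.T.unitI[of z "y \<otimes>\<^bsub>Q\<^esub> s0 \<otimes>\<^bsub>Q\<^esub> inv\<^bsub>Q\<^esub> x"]) simp_all
  note izc = Q.T.Units_inv_closed[OF zU]
  have zcanc: "z \<otimes>\<^bsub>Q\<^esub> (q \<otimes>\<^bsub>Q\<^esub> inv\<^bsub>Q\<^esub> z) = q" "(z \<otimes>\<^bsub>Q\<^esub> q) \<otimes>\<^bsub>Q\<^esub> inv\<^bsub>Q\<^esub> z = q" if "q \<in> carrier Q" for q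
    using Q.z_inv[OF zU sub\<omega> that] Q.T.m_comm[OF that izc] Q.T.m_comm[OF Q.T.m_closed[OF zc that] izc] by simp_all
  define W where "W = Q.scaled z \<omega>"
  have subW: "submodule W R Q.TM" unfolding W_def by (rule Q.scaled_submodule[OF zU sub\<omega>])
  have Wiff: "q \<in> W \<longleftrightarrow> q \<in> carrier Q \<and> z \<otimes>\<^bsub>Q\<^esub> q \<in> \<omega>" for q unfolding W_def Q.scaled_def by simp
  have Ciff: "q \<in> colon Q W I \<longleftrightarrow> q \<in> carrier Q \<and> z \<otimes>\<^bsub>Q\<^esub> q \<in> ?H" for q
  proof (cases "q \<in> carrier Q")
    case True
    have "q \<otimes>\<^bsub>Q\<^esub> i \<in> W \<longleftrightarrow> (z \<otimes>\<^bsub>Q\<^esub> q) \<otimes>\<^bsub>Q\<^esub> i \<in> \<omega>" if "i \<in> I" for i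
      unfolding Wiff using True zc RQ_closed[OF I.Icarr[OF that]] by (simp add: Q.T.m_assoc)
    then show ?thesis using True zc by (simp add: colon_def)
  qed (simp add: colon_def)
  have K: "rees_canonical R Q I a b T \<iota> \<omega> z = canon W"
  proof
    show "rees_canonical R Q I a b T \<iota> \<omega> z \<subseteq> canon W"
    proof
      fix w assume "w \<in> rees_canonical R Q I a b T \<iota> \<omega> z"
      then obtain p q where c: "w = rees_frac R Q I a b T \<iota> (p \<otimes>\<^bsub>Q\<^esub> inv\<^bsub>Q\<^esub> z) (q \<otimes>\<^bsub>Q\<^esub> inv\<^bsub>Q\<^esub> z)" "p \<in> ?H" "q \<in> \<omega>"
        unfolding rees_canonical_def by (elim CollectE exE conjE)
      have pc: "p \<in> carrier Q" "q \<in> carrier Q" using Hc[OF c(2)] \<omega>D(1) c(3) by blast+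
      have d: "p \<otimes>\<^bsub>Q\<^esub> inv\<^bsub>Q\<^esub> z \<in> carrier Q" "q \<otimes>\<^bsub>Q\<^esub> inv\<^bsub>Q\<^esub> z \<in> carrier Q" using pc izc by simp_all
      have "p \<otimes>\<^bsub>Q\<^esub> inv\<^bsub>Q\<^esub> z \<in> colon Q W I" "q \<otimes>\<^bsub>Q\<^esub> inv\<^bsub>Q\<^esub> z \<in> W"
        unfolding Ciff Wiff zcanc(1)[OF pc(1)] zcanc(1)[OF pc(2)] using d c by blast+
      then show "w \<in> canon W" unfolding c(1) rees_frac_eq[OF d] canon_def by blast
    qed
    show "canon W \<subseteq> rees_canonical R Q I a b T \<iota> \<omega> z"
    proof
      fix w assume "w \<in> canon W"
      then obtain p q where c: "w = rfrac p q" "p \<in> colon Q W I" "q \<in> W"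
        unfolding canon_def by (elim CollectE exE conjE)
      note d = c(2)[unfolded Ciff, THEN conjunct1] c(2)[unfolded Ciff, THEN conjunct2]
        c(3)[unfolded Wiff, THEN conjunct1] c(3)[unfolded Wiff, THEN conjunct2]
      have "w = rees_frac R Q I a b T \<iota> ((z \<otimes>\<^bsub>Q\<^esub> p) \<otimes>\<^bsub>Q\<^esub> inv\<^bsub>Q\<^esub> z) ((z \<otimes>\<^bsub>Q\<^esub> q) \<otimes>\<^bsub>Q\<^esub> inv\<^bsub>Q\<^esub> z)"
        unfolding zcanc(2)[OF d(1)] zcanc(2)[OF d(3)] rees_frac_eq[OF d(1,3)] by (rule c(1))
      then show "w \<in> rees_canonical R Q I a b T \<iota> \<omega> z"
        unfolding rees_canonical_def using d(2,4) by blast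
    qed
  qed
  have struct: "rees_elt R I a b r i \<odot>\<^bsub>scalar_module \<iota> T\<^esub>
            rees_frac R Q I a b T \<iota> (p \<otimes>\<^bsub>Q\<^esub> inv\<^bsub>Q\<^esub> z) (q \<otimes>\<^bsub>Q\<^esub> inv\<^bsub>Q\<^esub> z) =
          rees_frac R Q I a b T \<iota>
            ((r \<otimes>\<^bsub>Q\<^esub> p) \<otimes>\<^bsub>Q\<^esub> inv\<^bsub>Q\<^esub> z \<ominus>\<^bsub>Q\<^esub> (b \<otimes>\<^bsub>Q\<^esub> i \<otimes>\<^bsub>Q\<^esub> q) \<otimes>\<^bsub>Q\<^esub> inv\<^bsub>Q\<^esub> z)
            ((r \<otimes>\<^bsub>Q\<^esub> q) \<otimes>\<^bsub>Q\<^esub> inv\<^bsub>Q\<^esub> z \<oplus>\<^bsub>Q\<^esub> (i \<otimes>\<^bsub>Q\<^esub> p) \<otimes>\<^bsub>Q\<^esub> inv\<^bsub>Q\<^esub> z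
              \<ominus>\<^bsub>Q\<^esub> (a \<otimes>\<^bsub>Q\<^esub> i \<otimes>\<^bsub>Q\<^esub> q) \<otimes>\<^bsub>Q\<^esub> inv\<^bsub>Q\<^esub> z)"
    if ri: "r \<in> carrier R" "i \<in> I" and pq: "p \<in> ?H" "q \<in> \<omega>" for r i p q
  proof -
    note c = RQ_closed[OF ri(1)] RQ_closed[OF I.Icarr[OF ri(2)]] RQ_closed[OF assms(10)] RQ_closed[OF assms(11)]
      Hc[OF pq(1)] subsetD[OF \<omega>D(1) pq(2)] izc
    have d: "p \<otimes>\<^bsub>Q\<^esub> inv\<^bsub>Q\<^esub> z \<in> carrier Q" "q \<otimes>\<^bsub>Q\<^esub> inv\<^bsub>Q\<^esub> z \<in> carrier Q" using c by simp_all
    have e: "(r \<otimes>\<^bsub>Q\<^esub> p) \<otimes>\<^bsub>Q\<^esub> inv\<^bsub>Q\<^esub> z = r \<otimes>\<^bsub>Q\<^esub> (p \<otimes>\<^bsub>Q\<^esub> inv\<^bsub>Q\<^esub> z)"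
      "(r \<otimes>\<^bsub>Q\<^esub> q) \<otimes>\<^bsub>Q\<^esub> inv\<^bsub>Q\<^esub> z = r \<otimes>\<^bsub>Q\<^esub> (q \<otimes>\<^bsub>Q\<^esub> inv\<^bsub>Q\<^esub> z)"
      "(i \<otimes>\<^bsub>Q\<^esub> p) \<otimes>\<^bsub>Q\<^esub> inv\<^bsub>Q\<^esub> z = i \<otimes>\<^bsub>Q\<^esub> (p \<otimes>\<^bsub>Q\<^esub> inv\<^bsub>Q\<^esub> z)"
      "(b \<otimes>\<^bsub>Q\<^esub> i \<otimes>\<^bsub>Q\<^esub> q) \<otimes>\<^bsub>Q\<^esub> inv\<^bsub>Q\<^esub> z = b \<otimes>\<^bsub>Q\<^esub> i \<otimes>\<^bsub>Q\<^esub> (q \<otimes>\<^bsub>Q\<^esub> inv\<^bsub>Q\<^esub> z)"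
      "(a \<otimes>\<^bsub>Q\<^esub> i \<otimes>\<^bsub>Q\<^esub> q) \<otimes>\<^bsub>Q\<^esub> inv\<^bsub>Q\<^esub> z = a \<otimes>\<^bsub>Q\<^esub> i \<otimes>\<^bsub>Q\<^esub> (q \<otimes>\<^bsub>Q\<^esub> inv\<^bsub>Q\<^esub> z)"
      using c by (simp_all add: Q.T.m_assoc)
    have f: "r \<otimes>\<^bsub>Q\<^esub> (p \<otimes>\<^bsub>Q\<^esub> inv\<^bsub>Q\<^esub> z) \<ominus>\<^bsub>Q\<^esub> b \<otimes>\<^bsub>Q\<^esub> i \<otimes>\<^bsub>Q\<^esub> (q \<otimes>\<^bsub>Q\<^esub> inv\<^bsub>Q\<^esub> z) \<in> carrier Q"
      "r \<otimes>\<^bsub>Q\<^esub> (q \<otimes>\<^bsub>Q\<^esub> inv\<^bsub>Q\<^esub> z) \<oplus>\<^bsub>Q\<^esub> i \<otimes>\<^bsub>Q\<^esub> (p \<otimes>\<^bsub>Q\<^esub> inv\<^bsub>Q\<^esub> z) \<ominus>\<^bsub>Q\<^esub> a \<otimes>\<^bsub>Q\<^esub> i \<otimes>\<^bsub>Q\<^esub> (q \<otimes>\<^bsub>Q\<^esub> inv\<^bsub>Q\<^esub> z) \<in> carrier Q"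
      using c d by simp_all
    show ?thesis unfolding scalar_module_simps(4) e rees_frac_eq[OF d] rees_frac_eq[OF f] by (rule rfrac_act[OF ri d])
  qed
  have unitn: "elt (u [^]\<^bsub>R\<^esub> n) \<zero>\<^bsub>R\<^esub> \<in> nn" by (rule v_nn)
  have "regular_injective R (quot_module Q.TM W)"
    unfolding W_def by (rule Q.scaled_regular_injective[OF zU sub\<omega> inj\<omega>(1)])
  note injK = canon_regular_injective[OF subW this]
  have "Q.simple_socle \<mm> W"
    unfolding W_def by (rule Q.scaled_simple_socle[OF zU sub\<omega> inj\<omega>(2)]) (use mm.Icarr in blast)
  note socK = canon_simple_socle[OF subW this]
  have "fractional_ideal R Q id W"
    unfolding W_def by (rule Q.scaled_fractional_ideal[OF zU sub\<omega> fr\<omega>])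
  note frK = canon_fractional_ideal[OF this]
  have can: "canonical_ideal A T \<iota> (canon W)"
    by (rule AT.canonical_idealI[OF A_cm A_dim frK unitn regular_const[OF regv] injK socK])
  have low: "\<iota> ` carrier A \<subseteq> canon W"
  proof
    fix w assume "w \<in> \<iota> ` carrier A"
    then obtain e where e: "e \<in> carrier A" "w = \<iota> e" by (elim imageE)
    obtain r i where c: "r \<in> carrier R" "i \<in> I" "e = elt r i" by (rule elt_cases[OF e(1)])
    have zI: "j \<in> W" if j: "j \<in> I" for j
      unfolding Wiff using zH RQ_closed[OF I.Icarr[OF j]] j unfolding colon_def by blast
    have "j \<otimes>\<^bsub>Q\<^esub> r \<in> W" if j: "j \<in> I" for j
      unfolding RQ(1)[OF I.Icarr[OF j] c(1)] by (rule zI[OF I.I_r_closed[OF j c(1)]])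
    then show "w \<in> canon W"
      unfolding e(2) c(3) \<iota>_rfrac[OF c(1,2)] rfrac_canon_iff[OF subW RQ_closed[OF c(1)] RQ_closed[OF I.Icarr[OF c(2)]]]
      using zI[OF c(2)] by blast
  qed
  \<comment> \<open>If \<open>zh\<close> lies in \<open>(\<omega> : I)\<close>, then \<open>(yzh)t\<close> is a multiple of \<open>x\<close> by an element of \<open>G\<close>, and \<open>x\<close> is a multiple of \<open>yz\<close> by an element of \<open>R\<close>.\<close>
  have stable: "h \<otimes>\<^bsub>Q\<^esub> t \<in> G" if h: "h \<in> W \<union> colon Q W I" and t: "t \<in> G" for h t
  proof -
    have hc: "h \<in> carrier Q" and zhH: "z \<otimes>\<^bsub>Q\<^esub> h \<in> ?H" using h \<omega>H unfolding Un_iff Wiff Ciff by blast+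
    have yzh: "y \<otimes>\<^bsub>Q\<^esub> (z \<otimes>\<^bsub>Q\<^esub> h) \<in> ?yH" using zhH by blast
    obtain t' where t': "t' \<in> G" "y \<otimes>\<^bsub>Q\<^esub> (z \<otimes>\<^bsub>Q\<^esub> h) \<otimes>\<^bsub>R\<^esub> t = x \<otimes>\<^bsub>R\<^esub> t'" using G(2)[OF yzh t] by (elim bexE)
    have c: "t \<in> carrier R" "t' \<in> carrier R" "y \<otimes>\<^bsub>Q\<^esub> (z \<otimes>\<^bsub>Q\<^esub> h) \<in> carrier R"
      using G.Icarr[OF t] G.Icarr[OF t'(1)] fy(2) yzh by blast+
    have eq: "y \<otimes>\<^bsub>Q\<^esub> (z \<otimes>\<^bsub>Q\<^esub> h) \<otimes>\<^bsub>Q\<^esub> t = x \<otimes>\<^bsub>Q\<^esub> t'"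
      using t'(2) RQ(1)[OF c(3,1)] RQ(1)[OF fy(3) c(2)] by simp
    note q = RQ_closed[OF c(1)] RQ_closed[OF c(2)]
    have yzU: "y \<otimes>\<^bsub>Q\<^esub> z \<in> Units Q" by (rule Q.T.Units_m_closed[OF yU zU])
    have "(y \<otimes>\<^bsub>Q\<^esub> z) \<otimes>\<^bsub>Q\<^esub> (h \<otimes>\<^bsub>Q\<^esub> t) = y \<otimes>\<^bsub>Q\<^esub> (z \<otimes>\<^bsub>Q\<^esub> h) \<otimes>\<^bsub>Q\<^esub> t"
      using yQ zc hc q by (simp add: Q.T.m_assoc)
    also have "\<dots> = (y \<otimes>\<^bsub>Q\<^esub> z) \<otimes>\<^bsub>Q\<^esub> (s0 \<otimes>\<^bsub>Q\<^esub> t')"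
      unfolding eq x_yz by (rule Q.T.m_assoc[OF yz s0Q q(2)])
    finally have "h \<otimes>\<^bsub>Q\<^esub> t = s0 \<otimes>\<^bsub>Q\<^esub> t'"
      using Q.T.Units_l_cancel[OF yzU Q.T.m_closed[OF hc q(1)] Q.T.m_closed[OF s0Q q(2)]] by blast
    then show ?thesis using RQ(1)[OF s0(1) c(2)] G.I_l_closed[OF t'(1) s0(1)] by simp
  qed
  have up: "canon W \<subseteq> integral_closure T (\<iota> ` carrier A)"
    by (rule canon_integral[OF subW G(1) k regyk stable])
  show ?thesis unfolding K using struct can low up by blast
qed

end
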